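(* Let $A,C,G,W_1,W_2$ satisfy the standing assumptions (S1)-(S4) of the context. For any $\lambda\ge0$, the objective $\mathcal L_\lambda(\mathsf K)$ admits a DCL $(f_{\mathrm{cvx}},f_{\mathrm{lft}},\Phi)$ in which the lifted parameter is a pair $(\mathsf K,\Sigma)$ with $\Sigma$ symmetric $2n\times 2n$, such that for every $\mathsf K\in\mathcal K_{\mathrm{info}}$ the lifted parameter $(\mathsf K,\Sigma_{\mathsf K})$ lies in $\mathcal K_{\mathrm{info}}\times\{\Sigma\succ0\}$, $$\mathcal L_\lambda(\mathsf K)=f_{\mathrm{lft}}(\mathsf K,\Sigma_{\mathsf K})=\min_{\Sigma\succeq0}f_{\mathrm{lft}}(\mathsf K,\Sigma),$$ and $$\sigma_{d_z}\big(\nabla\Phi(\mathsf K,\Sigma_{\mathsf K})\big)\ \ge\ 1\big/\mathrm{poly}_{\mathrm{op}}\big(A,C,W_2^{-1},\Sigma_{\mathsf K},\Sigma_{\mathsf K}^{-1},Z_{\mathsf K}^{-1},\mathcal L_{\mathrm{OE}}(\mathsf K)\big),$$ $$\|\Phi(\mathsf K,\Sigma_{\mathsf K})\|_{\ell_2}\ \le\ \big(\max\{n,\sqrt{mn}\}+\sqrt{\mathcal L_{\mathrm{OE}}(\mathsf K)}\big)\cdot\mathrm{poly}_{\mathrm{op}}\big(A,C,W_2^{-1},\Sigma_{\mathsf K},\Sigma_{\mathsf K}^{-1},Z_{\mathsf K}^{-1}\big).$$ Furthermore, for $\mathsf K\in\mathcal K_{\mathrm{info}}$ the parameters satisfy $$\max\{\|A_{\mathsf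 K}\|,\|B_{\mathsf K}\|\}\le\mathrm{poly}_{\mathrm{op}}\big(A,C,W_2^{-1},Z_{\mathsf K}^{-1},\Sigma_{\mathsf K},\Sigma_{\mathsf K}^{-1}\big),\qquad \|C_{\mathsf K}\|_F\le\sqrt{\mathcal L_{\mathrm{OE}}(\mathsf K)\,\|\Sigma_{\mathsf K}^{-1}\|}.$$
   Context: Output estimation (OE) problem. Let $n,m,p\ge 1$, $A\in\mathbb R^{n\times n}$, $C\in\mathbb R^{m\times n}$, $G\in\mathbb R^{p\times n}$, $W_1\in\mathbb R^{n\times n}$ and $W_2\in\mathbb R^{m\times m}$ symmetric. The true system is $\dot x(t)=Ax(t)+w(t)$, $y(t)=Cx(t)+v(t)$, $z(t)=Gx(t)$, $x(0)=0$, where $w,v$ are independent white Gaussian noises with intensities $W_1,W_2$. A filter is a triple $\mathsf K=(A_{\mathsf K},B_{\mathsf K},C_{\mathsf K})\in\mathbb R^{n\times n}\times\mathbb R^{n\times m}\times\mathbb R^{p\times n}$, with dynamics $\dot{\hat x}(t)=A_{\mathsf K}\hat x(t)+B_{\mathsf K}y(t)$, $\hat z(t)=C_{\mathsf K}\hat x(t)$. Its loss is $\mathcal L_{\mathrm{OE}}(\mathsf K)=\lim_{t\to\infty}\mathbb E\|z(t)-\hat z(t)\|^2$. $\mathcal K_{\mathrm{stab}}$ is the set of $\mathsf K$ with $A_{\mathsf K}$ Hurwitz stable. For $\mathsf K\in\mathcal K_{\mathrm{stab}}$, $\Sigma_{\mathsf K}\in\mathbb R^{2n\times 2n}$ is the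 unique solution of $$A_{\mathrm{cl},\mathsf K}\Sigma+\Sigma A_{\mathrm{cl},\mathsf K}^\top+W_{\mathrm{cl},\mathsf K}=0,\quad A_{\mathrm{cl},\mathsf K}=\begin{bmatrix}A&0\\ B_{\mathsf K}C&A_{\mathsf K}\end{bmatrix},\quad W_{\mathrm{cl},\mathsf K}=\begin{bmatrix}W_1&0\\0&B_{\mathsf K}W_2B_{\mathsf K}^\top\end{bmatrix},$$ partitioned into $n\times n$ blocks $\Sigma_{\mathsf K}=\begin{bmatrix}\Sigma_{11,\mathrm{sys}}&\Sigma_{12,\mathsf K}\\ \Sigma_{12,\mathsf K}^\top&\Sigma_{22,\mathsf K}\end{bmatrix}$. Then $\mathcal L_{\mathrm{OE}}(\mathsf K)=\mathrm{tr}\big([G\ \ {-C_{\mathsf K}}]\,\Sigma_{\mathsf K}\,[G\ \ {-C_{\mathsf K}}]^\top\big)$. Put $\mathcal K_{\mathrm{info}}=\{\mathsf K\in\mathcal K_{\mathrm{stab}}:\mathrm{rank}(\Sigma_{12,\mathsf K})=n\}$; on this set $\Sigma_{\mathsf K}\succ0$ and $Z_{\mathsf K}:=\Sigma_{12,\mathsf K}\Sigma_{22,\mathsf K}^{-1}\Sigma_{12,\mathsf K}^\top\succ0$. Set $\mathcal L_\lambda(\mathsf K)=\mathcal L_{\mathrm{OE}}(\mathsf K)+\lambda\,\mathrm{tr}[Z_{\mathsf K}^{-1}]$ for $\mathsf K\in\mathcal K_{\mathrm{info}}$, and $\mathcal L_\lambda(\mathsf K)=+\infty$ otherwise (also when $\lambda=0$).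 Let $P_\star$ be the (positive semidefinite, stabilizing) solution of $AP_\star+P_\star A^\top-P_\star C^\top W_2^{-1}CP_\star+W_1=0$, $L_\star=P_\star C^\top W_2^{-1}$, and $\mathcal K_{\mathrm{opt}}=\{(S(A-L_\star C)S^{-1},SL_\star,GS^{-1}): S\in\mathbb R^{n\times n} \text{ invertible}\}$. Standing assumptions: (S1) $A$ is Hurwitz stable. (S2) $(A,C)$ is observable, i.e. $\int_0^\infty e^{sA^\top}C^\top Ce^{sA}\,ds\succ0$. (S3) $W_1\succ0$ and $W_2\succ0$. (S4) For every $\mathsf K\in\mathcal K_{\mathrm{opt}}$, the pair $(A_{\mathsf K},B_{\mathsf K})$ is controllable. Notation: $\|\cdot\|$ operator norm, $\|\cdot\|_F$ Frobenius norm, $\|\cdot\|_{\ell_2}$ Euclidean norm of parameters, $\sigma_j$ the $j$-th largest singular value, $\nabla\Phi$ the Jacobian. $\mathrm{poly}_{\mathrm{op}}(X_1,X_2,\dots,\kappa)$ denotes a term bounded by a universal polynomial in the operator norms $\|X_1\|,\|X_2\|,\dots$ of the matrix arguments and in the scalar argument $\kappa$ (different occurrences may be different polynomials). Functions take values in $\mathbb R\cup\{\infty\}$ and $\mathrm{dom}(f)=\{f\ne\infty\}$. A triplet $(f_{\mathrm{cvx}},f_{\mathrm{lft}},\Phi)$ is a DCL (differentiable convex lifting) of a proper $f:\mathbb R^d\to\mathbb R\cup\{\infty\}$ if: (1) $f_{\mathrm{cvx}}:\mathbb R^{d_z}\to\mathbb R\cup\{\infty\}$ is a proper convex function whose minimum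 is finite and attained; (2) for some $d_\xi\ge0$, $f_{\mathrm{lft}}:\mathbb R^{d+d_\xi}\to\mathbb R\cup\{\infty\}$ satisfies $f(\boldsymbol x)=\min_{\boldsymbol\xi}f_{\mathrm{lft}}(\boldsymbol x,\boldsymbol\xi)$; (3) there is an open set $\mathcal Y\supseteq\mathrm{dom}(f_{\mathrm{lft}})$ and a continuously differentiable $\Phi:\mathcal Y\to\mathbb R^{d_z}$ with $f_{\mathrm{lft}}=f_{\mathrm{cvx}}\circ\Phi$ on $\mathcal Y$. *)

theory Defs
  imports
    "HOL-Analysis.Analysis"
    "Jordan_Normal_Form.Matrix"
    "Jordan_Normal_Form.Char_Poly"
    "Jordan_Normal_Form.Gauss_Jordan_Elimination"
    "Jordan_Normal_Form.DL_Rank"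
begin

text \<open>
  The polynomials in the main estimate are universal: they may not depend on the dimensions
  \<open>n\<close>, \<open>m\<close>, \<open>p\<close>. The dimensions are therefore quantified inside the statement, and vectors and
  matrices are the carrier-based ones of \<open>Jordan_Normal_Form\<close>; \<open>carrier_vec d\<close> is
  \<open>d\<close>-dimensional Euclidean space.
\<close>

unbundle no vec_syntax

section \<open>Vectors and matrices\<close>

definition vnorm :: "real vec \<Rightarrow> real" where
  "vnorm v = sqrt (v \<bullet> v)"

definition op_norm :: "real mat \<Rightarrow> real" where
  "op_norm A = Sup {vnorm (A *\<^sub>v v) | v. v \<in> carrier_vec (dim_col A) \<and> vnorm v \<le> 1}"

definition frob_norm :: "real mat \<Rightarrow> real" where
  "frob_norm A = sqrt (\<Sum>i<dim_row A. \<Sum>j<dim_col A. (A $$ (i,j))\<^sup>2)"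

definition tr :: "real mat \<Rightarrow> real" where
  "tr A = sum_list (diag_mat A)"

text \<open>The inverse; unspecified if the matrix is not invertible.\<close>

definition minv :: "real mat \<Rightarrow> real mat" where
  "minv A = the (mat_inverse A)"

definition sym_mat :: "nat \<Rightarrow> real mat \<Rightarrow> bool" where
  "sym_mat n A \<longleftrightarrow> A \<in> carrier_mat n n \<and> A\<^sup>T = A"

definition pos_semidef :: "nat \<Rightarrow> real mat \<Rightarrow> bool" where
  "pos_semidef n A \<longleftrightarrow> sym_mat n A \<and> (\<forall>v\<in>carrier_vec n. 0 \<le> v \<bullet> (A *\<^sub>v v))"

definition pos_def :: "nat \<Rightarrow> real mat \<Rightarrow> bool" where
  "pos_def n A \<longleftrightarrow> sym_mat n A \<and> (\<forall>v\<in>carrier_vec n. v \<noteq> 0\<^sub>v n \<longrightarrow> 0 < v \<bullet> (A *\<^sub>v v))"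

definition hurwitz :: "real mat \<Rightarrow> bool" where
  "hurwitz A \<longleftrightarrow> (\<forall>\<mu>. eigenvalue (map_mat complex_of_real A) \<mu> \<longrightarrow> Re \<mu> < 0)"

text \<open>
  The \<open>j\<close>-th largest singular value (counted from 1, with multiplicity) of an \<open>r \<times> c\<close> matrix, for
  \<open>1 \<le> j \<le> min r c\<close>: the square root of the \<open>j\<close>-th largest eigenvalue of \<open>J J\<^sup>T\<close>. For all other
  \<open>j\<close> it is 0, as usual.
\<close>

definition sing_val :: "nat \<Rightarrow> real mat \<Rightarrow> real" where
  "sing_val j J =
    (if 1 \<le> j \<and> j \<le> min (dim_row J) (dim_col J)
     then rev (sorted_list_of_multiset (image_mset sqrt (proots (char_poly (J * J\<^sup>T))))) ! (j - 1)
     else 0)"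

definition mat_exp :: "real mat \<Rightarrow> real mat" where
  "mat_exp A = mat (dim_row A) (dim_row A) (\<lambda>ij. \<Sum>k. (A ^\<^sub>m k) $$ ij / fact k)"

text \<open>The infinite-horizon observability Gramian, integrated entrywise.\<close>

definition obs_gramian :: "real mat \<Rightarrow> real mat \<Rightarrow> real mat" where
  "obs_gramian A C = mat (dim_row A) (dim_row A) (\<lambda>ij.
     integral {0..} (\<lambda>s. (mat_exp (s \<cdot>\<^sub>m A\<^sup>T) * C\<^sup>T * C * mat_exp (s \<cdot>\<^sub>m A)) $$ ij))"

definition observable :: "real mat \<Rightarrow> real mat \<Rightarrow> bool" where
  "observable A C \<longleftrightarrow> pos_def (dim_row A) (obs_gramian A C)"

text \<open>The Kalman matrix \<open>[B, A B, \<dots>, A\<^sup>n\<^sup>-\<^sup>1 B]\<close>.\<close>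

definition ctrb_mat :: "real mat \<Rightarrow> real mat \<Rightarrow> real mat" where
  "ctrb_mat A B = mat_of_cols (dim_row A) (concat (map (\<lambda>k. cols (A ^\<^sub>m k * B)) [0..<dim_row A]))"

definition controllable :: "real mat \<Rightarrow> real mat \<Rightarrow> bool" where
  "controllable A B \<longleftrightarrow> vec_space.rank (dim_row A) (ctrb_mat A B) = dim_row A"

section \<open>Differentiable convex liftings\<close>

text \<open>Functions with values in the reals extended by \<open>\<infinity>\<close> are \<open>ereal\<close>-valued functions that avoid \<open>-\<infinity>\<close>.\<close>

definition ext_dom :: "nat \<Rightarrow> (real vec \<Rightarrow> ereal) \<Rightarrow> real vec set" where
  "ext_dom d f = {x \<in> carrier_vec d. f x \<noteq> \<infinity>}"

definition ext_valued :: "nat \<Rightarrow> (real vec \<Rightarrow> ereal) \<Rightarrow> bool" where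
  "ext_valued d f \<longleftrightarrow> (\<forall>x\<in>carrier_vec d. f x \<noteq> -\<infinity>)"

definition ext_proper :: "nat \<Rightarrow> (real vec \<Rightarrow> ereal) \<Rightarrow> bool" where
  "ext_proper d f \<longleftrightarrow> ext_valued d f \<and> ext_dom d f \<noteq> {}"

definition ext_convex :: "nat \<Rightarrow> (real vec \<Rightarrow> ereal) \<Rightarrow> bool" where
  "ext_convex d f \<longleftrightarrow>
    (\<forall>x\<in>carrier_vec d. \<forall>y\<in>carrier_vec d. \<forall>t. 0 < t \<and> t < 1 \<longrightarrow>
       f (t \<cdot>\<^sub>v x + (1 - t) \<cdot>\<^sub>v y) \<le> ereal t * f x + ereal (1 - t) * f y)"

definition vopen :: "nat \<Rightarrow> real vec set \<Rightarrow> bool" where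
  "vopen d Y \<longleftrightarrow> Y \<subseteq> carrier_vec d \<and>
    (\<forall>x\<in>Y. \<exists>e>0. \<forall>y\<in>carrier_vec d. vnorm (y - x) < e \<longrightarrow> y \<in> Y)"

text \<open>Frechet differentiability of a map between \<open>carrier_vec d\<close> and \<open>carrier_vec k\<close>.\<close>

definition has_jacobian :: "nat \<Rightarrow> nat \<Rightarrow> (real vec \<Rightarrow> real vec) \<Rightarrow> real vec \<Rightarrow> real mat \<Rightarrow> bool" where
  "has_jacobian d k F x J \<longleftrightarrow> J \<in> carrier_mat k d \<and>
    (\<forall>e>0. \<exists>\<delta>>0. \<forall>h\<in>carrier_vec d. vnorm h < \<delta> \<longrightarrow>
       vnorm (F (x + h) - F x - J *\<^sub>v h) \<le> e * vnorm h)"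

definition jacobian_mat :: "nat \<Rightarrow> nat \<Rightarrow> (real vec \<Rightarrow> real vec) \<Rightarrow> real vec \<Rightarrow> real mat" where
  "jacobian_mat d k F x = (THE J. has_jacobian d k F x J)"

definition C1_on :: "nat \<Rightarrow> nat \<Rightarrow> real vec set \<Rightarrow> (real vec \<Rightarrow> real vec) \<Rightarrow> bool" where
  "C1_on d k Y F \<longleftrightarrow>
    (\<forall>x\<in>Y. F x \<in> carrier_vec k) \<and>
    (\<exists>J. (\<forall>x\<in>Y. has_jacobian d k F x (J x)) \<and>
         (\<forall>i<k. \<forall>j<d. \<forall>x\<in>Y. \<forall>e>0. \<exists>\<delta>>0. \<forall>y\<in>Y. vnorm (y - x) < \<delta> \<longrightarrow>
            \<bar>J y $$ (i,j) - J x $$ (i,j)\<bar> < e))"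

text \<open>
  \<open>(f\<^sub>c, f\<^sub>l, \<Phi>)\<close> is a DCL of the proper function \<open>f\<close>. Here \<open>d\<close>, \<open>dx\<close>, \<open>dz\<close> are the dimensions of
  the parameter, of the lifting variable and of the convex parameter.
\<close>

definition is_DCL ::
  "nat \<Rightarrow> nat \<Rightarrow> nat \<Rightarrow> (real vec \<Rightarrow> ereal) \<Rightarrow>
   (real vec \<Rightarrow> ereal) \<Rightarrow> (real vec \<Rightarrow> ereal) \<Rightarrow> (real vec \<Rightarrow> real vec) \<Rightarrow> bool" where
  "is_DCL d dx dz f fcvx flft \<Phi> \<longleftrightarrow>
    ext_proper d f \<and>
    ext_proper dz fcvx \<and> ext_convex dz fcvx \<and>
    (\<exists>z\<in>carrier_vec dz. \<bar>fcvx z\<bar> \<noteq> \<infinity> \<and> (\<forall>z'\<in>carrier_vec dz. fcvx z \<le> fcvx z')) \<and>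
    ext_valued (d + dx) flft \<and>
    (\<forall>x\<in>carrier_vec d. \<exists>\<xi>\<in>carrier_vec dx. f x = flft (x @\<^sub>v \<xi>) \<and>
       (\<forall>\<xi>'\<in>carrier_vec dx. flft (x @\<^sub>v \<xi>) \<le> flft (x @\<^sub>v \<xi>'))) \<and>
    (\<exists>Y. vopen (d + dx) Y \<and> ext_dom (d + dx) flft \<subseteq> Y \<and> C1_on (d + dx) dz Y \<Phi> \<and>
         (\<forall>y\<in>Y. flft y = fcvx (\<Phi> y)))"

section \<open>The output estimation problem\<close>

type_synonym filt = "real mat \<times> real mat \<times> real mat"

definition filters :: "nat \<Rightarrow> nat \<Rightarrow> nat \<Rightarrow> filt set" where
  "filters n m p = carrier_mat n n \<times> carrier_mat n m \<times> carrier_mat p n"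

definition K_stab :: "nat \<Rightarrow> nat \<Rightarrow> nat \<Rightarrow> filt set" where
  "K_stab n m p = {(A\<^sub>K, B\<^sub>K, C\<^sub>K). (A\<^sub>K, B\<^sub>K, C\<^sub>K) \<in> filters n m p \<and> hurwitz A\<^sub>K}"

fun A_cl :: "real mat \<Rightarrow> real mat \<Rightarrow> filt \<Rightarrow> real mat" where
  "A_cl A C (A\<^sub>K, B\<^sub>K, C\<^sub>K) =
    four_block_mat A (0\<^sub>m (dim_row A) (dim_row A)) (B\<^sub>K * C) A\<^sub>K"

fun W_cl :: "real mat \<Rightarrow> real mat \<Rightarrow> filt \<Rightarrow> real mat" where
  "W_cl W\<^sub>1 W\<^sub>2 (A\<^sub>K, B\<^sub>K, C\<^sub>K) =
    four_block_mat W\<^sub>1 (0\<^sub>m (dim_row W\<^sub>1) (dim_row W\<^sub>1)) (0\<^sub>m (dim_row W\<^sub>1) (dim_row W\<^sub>1)) (B\<^sub>K * W\<^sub>2 * B\<^sub>K\<^sup>T)"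

definition Sigma_K :: "real mat \<Rightarrow> real mat \<Rightarrow> real mat \<Rightarrow> real mat \<Rightarrow> filt \<Rightarrow> real mat" where
  "Sigma_K A C W\<^sub>1 W\<^sub>2 K = (let N = 2 * dim_row A in
    THE S. S \<in> carrier_mat N N \<and>
      A_cl A C K * S + S * (A_cl A C K)\<^sup>T + W_cl W\<^sub>1 W\<^sub>2 K = 0\<^sub>m N N)"

text \<open>The upper right and the lower right \<open>n \<times> n\<close> block of a \<open>2n \<times> 2n\<close> matrix.\<close>

definition block12 :: "nat \<Rightarrow> real mat \<Rightarrow> real mat" where
  "block12 n S = mat n n (\<lambda>(i,j). S $$ (i, n + j))"

definition block22 :: "nat \<Rightarrow> real mat \<Rightarrow> real mat" where
  "block22 n S = mat n n (\<lambda>(i,j). S $$ (n + i, n + j))"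

definition Z_K :: "real mat \<Rightarrow> real mat \<Rightarrow> real mat \<Rightarrow> real mat \<Rightarrow> filt \<Rightarrow> real mat" where
  "Z_K A C W\<^sub>1 W\<^sub>2 K =
    (let n = dim_row A; S = Sigma_K A C W\<^sub>1 W\<^sub>2 K
     in block12 n S * minv (block22 n S) * (block12 n S)\<^sup>T)"

text \<open>
  For a stable filter, the steady-state mean squared estimation error is
  \<open>tr ([G, -C\<^sub>K] \<Sigma>\<^sub>K [G, -C\<^sub>K]\<^sup>T)\<close>, where \<open>\<Sigma>\<^sub>K\<close> is the stationary covariance of the joint state of
  the system and the filter. \<open>err_out\<close> is the row block \<open>[G, -C\<^sub>K]\<close>.
\<close>

fun err_out :: "real mat \<Rightarrow> filt \<Rightarrow> real mat" where
  "err_out G (A\<^sub>K, B\<^sub>K, C\<^sub>K) = four_block_mat G (- C\<^sub>K) (0\<^sub>m 0 (dim_col G)) (0\<^sub>m 0 (dim_col C\<^sub>K))"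

definition L_OE :: "real mat \<Rightarrow> real mat \<Rightarrow> real mat \<Rightarrow> real mat \<Rightarrow> real mat \<Rightarrow> filt \<Rightarrow> real" where
  "L_OE A C G W\<^sub>1 W\<^sub>2 K = tr (err_out G K * Sigma_K A C W\<^sub>1 W\<^sub>2 K * (err_out G K)\<^sup>T)"

definition K_info :: "nat \<Rightarrow> nat \<Rightarrow> nat \<Rightarrow> real mat \<Rightarrow> real mat \<Rightarrow> real mat \<Rightarrow> real mat \<Rightarrow> filt set" where
  "K_info n m p A C W\<^sub>1 W\<^sub>2 =
    {K \<in> K_stab n m p. vec_space.rank n (block12 n (Sigma_K A C W\<^sub>1 W\<^sub>2 K)) = n}"

definition L_reg ::
  "nat \<Rightarrow> nat \<Rightarrow> nat \<Rightarrow> real mat \<Rightarrow> real mat \<Rightarrow> real mat \<Rightarrow> real mat \<Rightarrow> real mat \<Rightarrow> real \<Rightarrow> filt \<Rightarrow> ereal" where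
  "L_reg n m p A C G W\<^sub>1 W\<^sub>2 reg K =
    (if K \<in> K_info n m p A C W\<^sub>1 W\<^sub>2
     then ereal (L_OE A C G W\<^sub>1 W\<^sub>2 K + reg * tr (minv (Z_K A C W\<^sub>1 W\<^sub>2 K)))
     else \<infinity>)"

definition kalman_gain :: "real mat \<Rightarrow> real mat \<Rightarrow> real mat \<Rightarrow> real mat" where
  "kalman_gain C W\<^sub>2 P = P * C\<^sup>T * minv W\<^sub>2"

text \<open>\<open>P\<close> is the positive semidefinite, stabilizing solution of the filter Riccati equation.\<close>

definition is_riccati_sol ::
  "nat \<Rightarrow> real mat \<Rightarrow> real mat \<Rightarrow> real mat \<Rightarrow> real mat \<Rightarrow> real mat \<Rightarrow> bool" where
  "is_riccati_sol n A C W\<^sub>1 W\<^sub>2 P \<longleftrightarrow>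
    pos_semidef n P \<and>
    A * P + P * A\<^sup>T - P * C\<^sup>T * minv W\<^sub>2 * C * P + W\<^sub>1 = 0\<^sub>m n n \<and>
    hurwitz (A - kalman_gain C W\<^sub>2 P * C)"

definition K_opt :: "nat \<Rightarrow> real mat \<Rightarrow> real mat \<Rightarrow> real mat \<Rightarrow> real mat \<Rightarrow> real mat \<Rightarrow> filt set" where
  "K_opt n A C G W\<^sub>2 P =
    (let L = kalman_gain C W\<^sub>2 P
     in {(S * (A - L * C) * minv S, S * L, G * minv S) | S. S \<in> carrier_mat n n \<and> invertible_mat S})"

definition standing_assumptions ::
  "nat \<Rightarrow> nat \<Rightarrow> nat \<Rightarrow> real mat \<Rightarrow> real mat \<Rightarrow> real mat \<Rightarrow> real mat \<Rightarrow> real mat \<Rightarrow> real mat \<Rightarrow> bool" where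
  "standing_assumptions n m p A C G W\<^sub>1 W\<^sub>2 P \<longleftrightarrow>
    1 \<le> n \<and> 1 \<le> m \<and> 1 \<le> p \<and>
    A \<in> carrier_mat n n \<and> C \<in> carrier_mat m n \<and> G \<in> carrier_mat p n \<and>
    hurwitz A \<and>
    observable A C \<and>
    pos_def n W\<^sub>1 \<and> pos_def m W\<^sub>2 \<and>
    is_riccati_sol n A C W\<^sub>1 W\<^sub>2 P \<and>
    (\<forall>(A\<^sub>K, B\<^sub>K, C\<^sub>K)\<in>K_opt n A C G W\<^sub>2 P. controllable A\<^sub>K B\<^sub>K)"

section \<open>Filters and symmetric matrices as Euclidean parameters\<close>

text \<open>Row-major enumeration of the entries of a matrix, and its inverse.\<close>

definition vec_of_mat :: "real mat \<Rightarrow> real vec" where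
  "vec_of_mat A = vec (dim_row A * dim_col A) (\<lambda>k. A $$ (k div dim_col A, k mod dim_col A))"

definition mat_of_vec :: "nat \<Rightarrow> nat \<Rightarrow> real vec \<Rightarrow> real mat" where
  "mat_of_vec r c v = mat r c (\<lambda>(i,j). v $ (i * c + j))"

fun vec_of_filt :: "filt \<Rightarrow> real vec" where
  "vec_of_filt (A\<^sub>K, B\<^sub>K, C\<^sub>K) = vec_of_mat A\<^sub>K @\<^sub>v (vec_of_mat B\<^sub>K @\<^sub>v vec_of_mat C\<^sub>K)"

definition filt_of_vec :: "nat \<Rightarrow> nat \<Rightarrow> nat \<Rightarrow> real vec \<Rightarrow> filt" where
  "filt_of_vec n m p x =
    (mat_of_vec n n (vec_first x (n * n)),
     mat_of_vec n m (vec_first (vec_last x (n * m + p * n)) (n * m)),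
     mat_of_vec p n (vec_last x (p * n)))"

definition dim_filt :: "nat \<Rightarrow> nat \<Rightarrow> nat \<Rightarrow> nat" where
  "dim_filt n m p = n * n + (n * m + p * n)"

text \<open>
  The coordinates of a symmetric \<open>N \<times> N\<close> matrix are its \<open>N (N + 1) / 2\<close> entries on and above the
  diagonal. The factor \<open>sqrt 2\<close> makes the Euclidean norm of the coordinates the Frobenius norm of
  the matrix.
\<close>

definition svec :: "real mat \<Rightarrow> real vec" where
  "svec S = vec_of_list
    [if i = j then S $$ (i,j) else sqrt 2 * S $$ (i,j). i \<leftarrow> [0..<dim_row S], j \<leftarrow> [i..<dim_row S]]"

definition dim_sym :: "nat \<Rightarrow> nat" where
  "dim_sym N = N * (N + 1) div 2"

definition lift_param :: "filt \<Rightarrow> real mat \<Rightarrow> real vec" where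
  "lift_param K S = vec_of_filt K @\<^sub>v svec S"

end

theory Submission
  imports Defs "Jordan_Normal_Form.Spectral_Radius"
begin

unbundle no inner_syntax

text \<open>
  Write \<open>X\<close>, \<open>U\<close>, \<open>V\<close> for the blocks of \<open>\<Sigma>\<close>, where \<open>X = \<Sigma>\<^sub>1\<^sub>1\<close> is fixed by the system, and
  \<open>\<Delta> = V - U\<^sup>T X\<^sup>-\<^sup>1 U\<close>. The new variables are \<open>\<Theta> = U \<Delta>\<^sup>-\<^sup>1 U\<^sup>T\<close>, \<open>\<Psi> = U \<Delta>\<^sup>-\<^sup>1 B\<^sub>K\<close>, \<open>H = C\<^sub>K U\<^sup>T\<close> and the residual
  \<open>E = A U + X C\<^sup>T B\<^sub>K\<^sup>T + U A\<^sub>K\<^sup>T\<close> of the off-diagonal block of the Lyapunov equation. On \<open>E = 0\<close> the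
  remaining block of the Lyapunov equation, relaxed to an inequality, becomes a convex quadratic
  matrix inequality in \<open>(\<Theta>, \<Psi>)\<close>, and since \<open>X\<^sup>-\<^sup>1 + \<Theta>\<^sup>-\<^sup>1 = U\<^sup>-\<^sup>T V U\<^sup>-\<^sup>1\<close>, which is \<open>Z\<^sup>-\<^sup>1\<close>, the objective is a sum
  of matrix fractional functions of \<open>(H, \<Theta>)\<close>. The relaxation costs nothing, because \<open>U\<close> is determined
  by \<open>E = 0\<close> and the inequality only enlarges \<open>V\<close>. Every feasible \<open>\<Theta>\<close> satisfies
  \<open>X\<^sup>-\<^sup>1 + \<Theta>\<^sup>-\<^sup>1 \<ge> (X - P)\<^sup>-\<^sup>1\<close>, so that the minimum is attained at the Kalman filter. The derivative of
  the change of variables is triangular: a right inverse is obtained by solving for the variations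
  of \<open>V\<close>, \<open>B\<^sub>K\<close>, \<open>C\<^sub>K\<close>, \<open>A\<^sub>K\<close> in turn, and its norm bounds the smallest singular value from below.
\<close>

section \<open>Linear algebra with dimension side conditions\<close>

text \<open>\<open>\<Phi>\<close> must be differentiable on an open set, whereas the covariances
  solve a matrix equation. Keeping the residual \<open>E\<close> as a coordinate moves that equation
  into the domain of the convex function, where it is linear. The coordinates
  \<open>\<Theta>\<close>, \<open>\<Psi>\<close>, \<open>H\<close>, \<open>E\<close> are exactly as
  many as the entries of \<open>V\<close>, \<open>B_K\<close>, \<open>C_K\<close>,
  \<open>A_K\<close>, so \<open>U\<close> can be frozen in the Jacobian argument and a square
  triangular system is left. Convexity of the quadratic term in \<open>\<Theta>\<close> rests on the
  Lyapunov equation of \<open>X\<close>, which trades \<open>A X + X A^T\<close> for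
  \<open>- W1\<close>. Yet the polynomials may not involve \<open>W1\<close>: it could enter only
  through the bound on \<open>\<Psi>\<close>, where its contribution has a favourable sign and is
  discarded. They may not involve the dimensions either, so in the right inverse each product has
  one factor in the Frobenius norm and all others in the operator norm. Assumption (S4) enters as
  definiteness of \<open>X - P\<close>: it places the Kalman filter, the candidate minimizer, inside
  the domain of the objective.\<close>

text \<open>The side conditions are equations between dimensions, which the simplifier can discharge
  without guessing intermediate dimensions.\<close>

lemma mvec_add:
  fixes A :: "real mat"
  assumes "dim_vec v = dim_col A" "dim_vec w = dim_col A"
  shows "A *\<^sub>v (v + w) = A *\<^sub>v v + A *\<^sub>v w"
  using assms by (intro mult_add_distrib_mat_vec[of _ "dim_row A" "dim_col A"]) (auto simp: carrier_vec_def simp del: carrier_vecD)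

lemma mvec_minus:
  fixes A :: "real mat"
  assumes "dim_vec v = dim_col A" "dim_vec w = dim_col A"
  shows "A *\<^sub>v (v - w) = A *\<^sub>v v - A *\<^sub>v w"
  using assms by (intro mult_minus_distrib_mat_vec[of _ "dim_row A" "dim_col A"]) (auto simp: carrier_vec_def simp del: carrier_vecD)

lemma mvec_smult:
  fixes A :: "real mat"
  assumes "dim_vec v = dim_col A"
  shows "A *\<^sub>v (k \<cdot>\<^sub>v v) = k \<cdot>\<^sub>v (A *\<^sub>v v)"
  using assms by (intro mult_mat_vec[of _ "dim_row A" "dim_col A"]) (auto simp: carrier_vec_def simp del: carrier_vecD)

lemma mvec_uminus:
  fixes A :: "real mat"
  assumes "dim_vec v = dim_col A"
  shows "A *\<^sub>v (- v) = - (A *\<^sub>v v)"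
  using assms by (intro eq_vecI) auto

lemma mvec_zero:
  fixes A :: "real mat"
  assumes "dim_col A = n"
  shows "A *\<^sub>v 0\<^sub>v n = 0\<^sub>v (dim_row A)"
  using assms by (intro eq_vecI) (auto simp: scalar_prod_def)

lemma add_mvec:
  fixes A :: "real mat"
  assumes "dim_row A = dim_row B" "dim_col A = dim_col B" "dim_vec v = dim_col B"
  shows "(A + B) *\<^sub>v v = A *\<^sub>v v + B *\<^sub>v v"
  using assms by (intro add_mult_distrib_mat_vec[of _ "dim_row A" "dim_col A"]) (auto simp: carrier_vec_def simp del: carrier_vecD)

lemma minus_mvec:
  fixes A :: "real mat"
  assumes "dim_row A = dim_row B" "dim_col A = dim_col B" "dim_vec v = dim_col B"
  shows "(A - B) *\<^sub>v v = A *\<^sub>v v - B *\<^sub>v v"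
  using assms by (intro minus_mult_distrib_mat_vec[of _ "dim_row A" "dim_col A"]) (auto simp: carrier_vec_def simp del: carrier_vecD)

lemma smult_mvec:
  fixes A :: "real mat"
  assumes "dim_vec v = dim_col A"
  shows "(k \<cdot>\<^sub>m A) *\<^sub>v v = k \<cdot>\<^sub>v (A *\<^sub>v v)"
  using assms by (intro eq_vecI) (auto simp: scalar_prod_def sum_distrib_left mult.assoc)

lemma mult_mvec:
  fixes A :: "real mat"
  assumes "dim_col A = dim_row B" "dim_vec v = dim_col B"
  shows "(A * B) *\<^sub>v v = A *\<^sub>v (B *\<^sub>v v)"
  using assms by (intro assoc_mult_mat_vec[of _ "dim_row A" "dim_col A" _ "dim_col B"]) (auto simp: carrier_vec_def simp del: carrier_vecD)

lemma sp_add: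
  fixes u :: "real vec"
  assumes "dim_vec u = dim_vec w" "dim_vec v = dim_vec w"
  shows "(u + v) \<bullet> w = u \<bullet> w + v \<bullet> w" "w \<bullet> (u + v) = w \<bullet> u + w \<bullet> v"
  using assms by (auto intro!: add_scalar_prod_distrib[of _ "dim_vec w"] scalar_prod_add_distrib[of _ "dim_vec w"]
      simp: carrier_vec_def simp del: carrier_vecD)

lemma sp_minus:
  fixes u :: "real vec"
  assumes "dim_vec u = dim_vec w" "dim_vec v = dim_vec w"
  shows "(u - v) \<bullet> w = u \<bullet> w - v \<bullet> w" "w \<bullet> (u - v) = w \<bullet> u - w \<bullet> v"
  using assms by (auto intro!: minus_scalar_prod_distrib[of _ "dim_vec w"] scalar_prod_minus_distrib[of _ "dim_vec w"]
      simp: carrier_vec_def simp del: carrier_vecD)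

lemma sp_comm:
  fixes v :: "real vec"
  assumes "dim_vec v = dim_vec w"
  shows "v \<bullet> w = w \<bullet> v"
  using assms by (intro comm_scalar_prod[of _ "dim_vec w"]) (auto simp: carrier_vec_def simp del: carrier_vecD)

lemma sp_mvec_left:
  fixes A :: "real mat"
  assumes "dim_vec v = dim_col A" "dim_vec w = dim_row A"
  shows "(A *\<^sub>v v) \<bullet> w = v \<bullet> (A\<^sup>T *\<^sub>v w)"
  using transpose_vec_mult_scalar[of "A\<^sup>T" "dim_col A" "dim_row A" w v] assms
  by (auto simp: carrier_vec_def simp del: carrier_vecD)

lemma sp_mvec_swap:
  fixes A :: "real mat"
  assumes "dim_vec v = dim_row A" "dim_vec w = dim_col A"
  shows "v \<bullet> (A *\<^sub>v w) = w \<bullet> (A\<^sup>T *\<^sub>v v)"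
  using assms sp_mvec_left[of w A v] by (simp add: sp_comm)

lemmas mvec_simps = mvec_add mvec_minus mvec_smult mvec_uminus add_mvec minus_mvec smult_mvec mult_mvec
lemmas sp_simps = sp_add sp_minus

lemma mmult_assoc:
  fixes A :: "real mat"
  assumes "dim_col A = dim_row B" "dim_col B = dim_row C"
  shows "(A * B) * C = A * (B * C)"
  using assms by (intro assoc_mult_mat[of _ "dim_row A" "dim_col A" _ "dim_col B" _ "dim_col C"]) auto

lemma mmult_add:
  fixes A :: "real mat"
  assumes BC: "dim_row B = dim_row C" "dim_col B = dim_col C"
  shows "dim_col A = dim_row C \<Longrightarrow> A * (B + C) = A * B + A * C"
    "dim_row A = dim_col C \<Longrightarrow> (B + C) * A = B * A + C * A"
  by (rule mult_add_distrib_mat add_mult_distrib_mat carrier_matI refl BC | assumption | simp only:)+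

lemma mmult_minus:
  fixes A :: "real mat"
  assumes BC: "dim_row B = dim_row C" "dim_col B = dim_col C"
  shows "dim_col A = dim_row C \<Longrightarrow> A * (B - C) = A * B - A * C"
    "dim_row A = dim_col C \<Longrightarrow> (B - C) * A = B * A - C * A"
  by (rule mult_minus_distrib_mat minus_mult_distrib_mat carrier_matI refl BC | assumption | simp only:)+

lemma mmult_uminus:
  fixes A :: "real mat"
  assumes "dim_col A = dim_row B"
  shows "A * (- B) = - (A * B)" "(- A) * B = - (A * B)"
  using assms by (auto intro!: eq_matI)

lemma mmult_one:
  fixes A :: "real mat"
  shows "dim_col A = n \<Longrightarrow> A * 1\<^sub>m n = A" "dim_row A = n \<Longrightarrow> 1\<^sub>m n * A = A"
  by (auto intro!: eq_matI)

lemma mtrans: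
  fixes A :: "real mat"
  shows "dim_col A = dim_row B \<Longrightarrow> (A * B)\<^sup>T = B\<^sup>T * A\<^sup>T"
    "dim_row A = dim_row B \<Longrightarrow> dim_col A = dim_col B \<Longrightarrow> (A + B)\<^sup>T = A\<^sup>T + B\<^sup>T"
    "dim_row A = dim_row B \<Longrightarrow> dim_col A = dim_col B \<Longrightarrow> (A - B)\<^sup>T = A\<^sup>T - B\<^sup>T"
    "(- A)\<^sup>T = - A\<^sup>T"
proof -
  show "dim_col A = dim_row B \<Longrightarrow> (A * B)\<^sup>T = B\<^sup>T * A\<^sup>T"
    by (rule transpose_mult[of _ "dim_row A" "dim_col A" _ "dim_col B"]) (auto simp: carrier_vec_def simp del: carrier_vecD)
qed (auto intro!: eq_matI)

text \<open>Several matrix identities below are verified on a generic vector, where products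
  associate to the right by themselves; this rule lifts the result back.\<close>

lemma eq_mat_by_mvec:
  fixes A :: "real mat"
  assumes A: "A \<in> carrier_mat r c" and B: "B \<in> carrier_mat r c"
    and eq: "\<And>v. v \<in> carrier_vec c \<Longrightarrow> A *\<^sub>v v = B *\<^sub>v v"
  shows "A = B"
proof (rule eq_matI)
  fix i j assume ij: "i < dim_row B" "j < dim_col B"
  have "(A *\<^sub>v unit_vec c j) $ i = (B *\<^sub>v unit_vec c j) $ i" by (simp add: eq)
  then show "A $$ (i,j) = B $$ (i,j)" using ij A B by (auto simp: row_def)
qed (use A B in auto)

lemma eq_vec_by_sp:
  fixes v :: "real vec"
  assumes v: "v \<in> carrier_vec n" and w: "w \<in> carrier_vec n"
    and eq: "\<And>u. u \<in> carrier_vec n \<Longrightarrow> u \<bullet> v = u \<bullet> w"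
  shows "v = w"
proof (rule eq_vecI)
  fix i assume i: "i < dim_vec w"
  then have "unit_vec n i \<bullet> v = unit_vec n i \<bullet> w" by (simp add: eq)
  then show "v $ i = w $ i" using i v w by auto
qed (use v w in auto)

section \<open>Norms\<close>

lemma sp_self: "(v :: real vec) \<bullet> v = (\<Sum>i<dim_vec v. (v $ i)\<^sup>2)"
  by (simp add: scalar_prod_def power2_eq_square atLeast0LessThan)

lemma sp_self_ge_0: "(v :: real vec) \<bullet> v \<ge> 0"
  by (auto simp: sp_self intro: sum_nonneg)

lemma sp_self_eq_0: "v \<in> carrier_vec n \<Longrightarrow> (v :: real vec) \<bullet> v = 0 \<longleftrightarrow> v = 0\<^sub>v n"
  by (auto simp: sp_self sum_nonneg_eq_0_iff intro!: eq_vecI)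

lemma vnorm_sq: "(vnorm v)\<^sup>2 = v \<bullet> v"
  by (simp add: vnorm_def sp_self_ge_0)

lemma vnorm_ge_0 [simp]: "vnorm v \<ge> 0"
  by (simp add: vnorm_def sp_self_ge_0)

lemma vnorm_zero [simp]: "vnorm (0\<^sub>v n) = 0"
  by (simp add: vnorm_def)

lemma vnorm_eq_0: "v \<in> carrier_vec n \<Longrightarrow> vnorm v = 0 \<longleftrightarrow> v = 0\<^sub>v n"
  by (simp add: vnorm_def sp_self_eq_0 del: carrier_vec_dim_vec)

lemma vnorm_pos: "v \<in> carrier_vec n \<Longrightarrow> v \<noteq> 0\<^sub>v n \<Longrightarrow> vnorm v > 0"
  using vnorm_eq_0[of v n] vnorm_ge_0[of v] by linarith

lemma vnorm_le: "c \<ge> 0 \<Longrightarrow> v \<bullet> v \<le> c\<^sup>2 \<Longrightarrow> vnorm v \<le> c"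
  by (simp add: vnorm_def real_le_lsqrt sp_self_ge_0)

lemma vnorm_smult: "vnorm (k \<cdot>\<^sub>v v) = \<bar>k\<bar> * vnorm v"
proof -
  have "(k \<cdot>\<^sub>v v) \<bullet> (k \<cdot>\<^sub>v v) = k\<^sup>2 * (v \<bullet> v)" by (simp add: power2_eq_square)
  then show ?thesis by (simp add: vnorm_def real_sqrt_mult)
qed

lemma vnorm_uminus: "vnorm (- v) = vnorm v"
  by (simp add: vnorm_def)

lemma vec_Cauchy_Schwarz:
  assumes "dim_vec v = dim_vec w"
  shows "\<bar>v \<bullet> w\<bar> \<le> vnorm v * vnorm w"
proof -
  have "(v \<bullet> w)\<^sup>2 \<le> (v \<bullet> v) * (w \<bullet> w)"
    using Cauchy_Schwarz_ineq_sum[of "\<lambda>i. v $ i" "\<lambda>i. w $ i" "{..<dim_vec w}"] assms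
    by (simp add: scalar_prod_def power2_eq_square atLeast0LessThan)
  then have "(v \<bullet> w)\<^sup>2 \<le> (vnorm v * vnorm w)\<^sup>2"
    by (simp add: power_mult_distrib vnorm_sq)
  then show ?thesis
    by (metis abs_le_square_iff abs_of_nonneg mult_nonneg_nonneg vnorm_ge_0)
qed

lemma vec_Cauchy_Schwarz': "dim_vec v = dim_vec w \<Longrightarrow> v \<bullet> w \<le> vnorm v * vnorm w"
  using vec_Cauchy_Schwarz[of v w] by linarith

lemma vnorm_triangle:
  assumes "dim_vec v = dim_vec w"
  shows "vnorm (v + w) \<le> vnorm v + vnorm w"
proof (rule vnorm_le)
  have "(v + w) \<bullet> (v + w) = v \<bullet> v + 2 * (v \<bullet> w) + w \<bullet> w"
    using assms by (simp add: sp_simps sp_comm)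
  also have "\<dots> \<le> (vnorm v)\<^sup>2 + 2 * (vnorm v * vnorm w) + (vnorm w)\<^sup>2"
    using vec_Cauchy_Schwarz'[OF assms] by (simp add: vnorm_sq)
  finally show "(v + w) \<bullet> (v + w) \<le> (vnorm v + vnorm w)\<^sup>2"
    by (simp add: power2_sum)
qed simp

lemma abs_index_le_vnorm: "i < dim_vec v \<Longrightarrow> \<bar>v $ i\<bar> \<le> vnorm v"
proof -
  assume i: "i < dim_vec v"
  have "(v $ i)\<^sup>2 \<le> v \<bullet> v" unfolding sp_self by (rule member_le_sum) (use i in auto)
  then show ?thesis unfolding vnorm_def by (intro real_le_rsqrt) simp
qed

lemma vnorm_le_sum: "vnorm v \<le> (\<Sum>i<dim_vec v. \<bar>v $ i\<bar>)"
  unfolding vnorm_def sp_self using L2_set_le_sum_abs[of "\<lambda>i. v $ i" "{..<dim_vec v}"]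
  by (simp add: L2_set_def)

lemma vnorm_append_sq: "(vnorm (v @\<^sub>v w))\<^sup>2 = (vnorm v)\<^sup>2 + (vnorm w)\<^sup>2"
  by (simp add: vnorm_sq scalar_prod_append[of v "dim_vec v" w "dim_vec w"])

lemma vnorm_append_le: "vnorm (v @\<^sub>v w) \<le> vnorm v + vnorm w"
  by (rule power2_le_imp_le) (auto simp: vnorm_append_sq power2_sum)

lemma vnorm_le_append: "vnorm v \<le> vnorm (v @\<^sub>v w)" "vnorm w \<le> vnorm (v @\<^sub>v w)"
  by (rule power2_le_imp_le; simp add: vnorm_append_sq)+

lemma frob_norm_ge_0 [simp]: "frob_norm A \<ge> 0"
  unfolding frob_norm_def by (intro real_sqrt_ge_zero sum_nonneg) auto

lemma frob_norm_sq: "(frob_norm A)\<^sup>2 = (\<Sum>i<dim_row A. \<Sum>j<dim_col A. (A $$ (i,j))\<^sup>2)"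
  unfolding frob_norm_def by (intro real_sqrt_pow2 sum_nonneg) auto

lemma frob_norm_sq_rows: "(frob_norm A)\<^sup>2 = (\<Sum>i<dim_row A. (vnorm (row A i))\<^sup>2)"
  unfolding frob_norm_sq vnorm_sq by (intro sum.cong) (auto simp: sp_self)

lemma frob_norm_sq_cols: "(frob_norm A)\<^sup>2 = (\<Sum>j<dim_col A. (vnorm (col A j))\<^sup>2)"
  unfolding frob_norm_sq vnorm_sq by (subst sum.swap) (auto intro!: sum.cong simp: sp_self)

lemma frob_norm_transpose: "frob_norm A\<^sup>T = frob_norm A"
  unfolding frob_norm_def by (subst sum.swap) simp

text \<open>Cauchy-Schwarz row by row. The crude constant serves to make the supremum in
  \<open>op_norm\<close> finite.\<close>

lemma vnorm_mvec_le_frob: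
  assumes "dim_vec v = dim_col A"
  shows "vnorm (A *\<^sub>v v) \<le> frob_norm A * vnorm v"
proof (rule power2_le_imp_le)
  have "(vnorm (A *\<^sub>v v))\<^sup>2 = (\<Sum>i<dim_row A. (row A i \<bullet> v)\<^sup>2)"
    unfolding vnorm_sq sp_self by simp
  also have "\<dots> \<le> (\<Sum>i<dim_row A. (vnorm (row A i) * vnorm v)\<^sup>2)"
  proof (rule sum_mono)
    fix i
    have "\<bar>row A i \<bullet> v\<bar> \<le> vnorm (row A i) * vnorm v" using assms by (intro vec_Cauchy_Schwarz) simp
    then show "(row A i \<bullet> v)\<^sup>2 \<le> (vnorm (row A i) * vnorm v)\<^sup>2" 
      by (metis abs_le_square_iff abs_of_nonneg mult_nonneg_nonneg vnorm_ge_0)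
  qed
  also have "\<dots> = (frob_norm A * vnorm v)\<^sup>2"
    by (simp add: power_mult_distrib frob_norm_sq_rows sum_distrib_right)
  finally show "(vnorm (A *\<^sub>v v))\<^sup>2 \<le> (frob_norm A * vnorm v)\<^sup>2" .
qed simp

lemma op_norm_bdd:
  "bdd_above {vnorm (A *\<^sub>v v) | v. v \<in> carrier_vec (dim_col A) \<and> vnorm v \<le> 1}"
proof (rule bdd_aboveI, clarify)
  fix v :: "real vec" assume v: "v \<in> carrier_vec (dim_col A)" "vnorm v \<le> 1"
  have "vnorm (A *\<^sub>v v) \<le> frob_norm A * vnorm v" by (rule vnorm_mvec_le_frob) (use v in auto)
  also have "\<dots> \<le> frob_norm A * 1" by (rule mult_left_mono) (use v in auto)
  finally show "vnorm (A *\<^sub>v v) \<le> frob_norm A" by simp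
qed

lemma op_norm_ge_0 [simp]: "op_norm A \<ge> 0"
proof -
  have "vnorm (A *\<^sub>v 0\<^sub>v (dim_col A)) \<le> op_norm A"
    unfolding op_norm_def by (rule cSup_upper[OF _ op_norm_bdd]) (auto intro!: exI[of _ "0\<^sub>v (dim_col A)"])
  then show ?thesis using vnorm_ge_0 order_trans by blast
qed

lemma vnorm_mvec_le_op:
  assumes "dim_vec v = dim_col A"
  shows "vnorm (A *\<^sub>v v) \<le> op_norm A * vnorm v"
proof (cases "vnorm v = 0")
  case True
  then have "v = 0\<^sub>v (dim_col A)" using vnorm_eq_0[of v "dim_col A"] assms by (auto simp: carrier_vec_def simp del: carrier_vecD)
  then show ?thesis by (simp add: mvec_zero)
next
  case False
  then have pos: "vnorm v > 0" by (simp add: less_le)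
  let ?u = "(1 / vnorm v) \<cdot>\<^sub>v v"
  have "vnorm (A *\<^sub>v ?u) \<le> op_norm A"
    unfolding op_norm_def
    by (rule cSup_upper[OF _ op_norm_bdd], rule CollectI, rule exI[of _ ?u])
      (use assms pos in \<open>auto simp: vnorm_smult carrier_vec_def simp del: carrier_vecD\<close>)
  then have "vnorm (A *\<^sub>v v) / vnorm v \<le> op_norm A"
    using assms pos by (simp add: mvec_smult vnorm_smult)
  then show ?thesis using pos by (simp add: divide_le_eq)
qed

lemma op_norm_le:
  assumes "\<And>v. v \<in> carrier_vec (dim_col A) \<Longrightarrow> vnorm (A *\<^sub>v v) \<le> c * vnorm v" and "c \<ge> 0"
  shows "op_norm A \<le> c"
  unfolding op_norm_def
proof (rule cSup_least)
  show "{vnorm (A *\<^sub>v v) | v. v \<in> carrier_vec (dim_col A) \<and> vnorm v \<le> 1} \<noteq> {}"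
    by (auto intro!: exI[of _ "0\<^sub>v (dim_col A)"])
  fix x assume "x \<in> {vnorm (A *\<^sub>v v) | v. v \<in> carrier_vec (dim_col A) \<and> vnorm v \<le> 1}"
  then obtain v where v: "x = vnorm (A *\<^sub>v v)" "v \<in> carrier_vec (dim_col A)" "vnorm v \<le> 1" by auto
  have "x \<le> c * vnorm v" using v assms by simp
  also have "\<dots> \<le> c * 1" by (rule mult_left_mono) (use v assms in auto)
  finally show "x \<le> c" by simp
qed

lemma op_norm_mult:
  assumes "dim_col A = dim_row B"
  shows "op_norm (A * B) \<le> op_norm A * op_norm B"
proof (rule op_norm_le)
  fix v :: "real vec" assume v: "v \<in> carrier_vec (dim_col (A * B))"
  have "vnorm ((A * B) *\<^sub>v v) = vnorm (A *\<^sub>v (B *\<^sub>v v))" using assms v by (simp add: mult_mvec)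
  also have "\<dots> \<le> op_norm A * vnorm (B *\<^sub>v v)" by (rule vnorm_mvec_le_op) (simp add: assms)
  also have "\<dots> \<le> op_norm A * (op_norm B * vnorm v)"
    by (intro mult_left_mono vnorm_mvec_le_op) (use v in auto)
  finally show "vnorm ((A * B) *\<^sub>v v) \<le> op_norm A * op_norm B * vnorm v" by (simp add: mult.assoc)
qed simp

lemma op_norm_add:
  assumes "dim_row A = dim_row B" "dim_col A = dim_col B"
  shows "op_norm (A + B) \<le> op_norm A + op_norm B"
proof (rule op_norm_le)
  fix v :: "real vec" assume v: "v \<in> carrier_vec (dim_col (A + B))"
  have "vnorm ((A + B) *\<^sub>v v) \<le> vnorm (A *\<^sub>v v) + vnorm (B *\<^sub>v v)"
    using assms v by (simp add: add_mvec vnorm_triangle)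
  also have "\<dots> \<le> op_norm A * vnorm v + op_norm B * vnorm v"
    by (intro add_mono vnorm_mvec_le_op) (use v assms in auto)
  finally show "vnorm ((A + B) *\<^sub>v v) \<le> (op_norm A + op_norm B) * vnorm v" by (simp add: distrib_right)
qed simp

lemma op_norm_uminus: "op_norm (- A) = op_norm A"
proof -
  have "op_norm (- B) \<le> op_norm B" for B
  proof (rule op_norm_le)
    fix v :: "real vec" assume "v \<in> carrier_vec (dim_col (- B))"
    then show "vnorm (- B *\<^sub>v v) \<le> op_norm B * vnorm v"
      using vnorm_mvec_le_op[of v B] by (simp add: vnorm_uminus)
  qed simp
  from this[of A] this[of "- A"] show ?thesis by simp
qed

lemma op_norm_minus:
  assumes "dim_row A = dim_row B" "dim_col A = dim_col B"
  shows "op_norm (A - B) \<le> op_norm A + op_norm B"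
proof -
  have "A - B = A + - B" using assms by (auto intro!: eq_matI)
  then show ?thesis using op_norm_add[of A "- B"] assms by (simp add: op_norm_uminus)
qed

text \<open>From \<open>|B^T v|^2 = v . B B^T v <= |v| |B| |B^T v|\<close> one factor
  \<open>|B^T v|\<close> cancels; the reverse bound is the same with \<open>A^T\<close> for
  \<open>B\<close>.\<close>

lemma op_norm_transpose: "op_norm A\<^sup>T = op_norm A"
proof -
  have "op_norm B\<^sup>T \<le> op_norm B" for B
  proof (rule op_norm_le)
    fix v :: "real vec" assume v: "v \<in> carrier_vec (dim_col B\<^sup>T)"
    let ?w = "B\<^sup>T *\<^sub>v v"
    have "(vnorm ?w)\<^sup>2 = v \<bullet> (B *\<^sub>v ?w)"
      unfolding vnorm_sq using v by (subst sp_mvec_left) auto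
    also have "\<dots> \<le> vnorm v * vnorm (B *\<^sub>v ?w)" by (rule vec_Cauchy_Schwarz') (use v in auto)
    also have "\<dots> \<le> vnorm v * (op_norm B * vnorm ?w)"
      by (intro mult_left_mono vnorm_mvec_le_op) auto
    finally have "vnorm ?w * vnorm ?w \<le> op_norm B * vnorm v * vnorm ?w"
      by (simp add: power2_eq_square ac_simps)
    then show "vnorm ?w \<le> op_norm B * vnorm v"
      by (cases "vnorm ?w = 0") (auto simp: less_le)
  qed simp
  from this[of A] this[of "A\<^sup>T"] show ?thesis by simp
qed

text \<open>Applied column by column. Only one factor is measured in the Frobenius norm, so no power
  of the dimension appears.\<close>

lemma frob_norm_mult_left:
  assumes "dim_col A = dim_row B"
  shows "frob_norm (A * B) \<le> op_norm A * frob_norm B"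
proof (rule power2_le_imp_le)
  have "(frob_norm (A * B))\<^sup>2 = (\<Sum>j<dim_col B. (vnorm (A *\<^sub>v col B j))\<^sup>2)"
    unfolding frob_norm_sq_cols by (intro sum.cong) (use assms in \<open>auto intro!: arg_cong[of _ _ vnorm]\<close>)
  also have "\<dots> \<le> (\<Sum>j<dim_col B. (op_norm A * vnorm (col B j))\<^sup>2)"
    by (intro sum_mono power_mono vnorm_mvec_le_op) (use assms in auto)
  also have "\<dots> = (op_norm A * frob_norm B)\<^sup>2"
    by (simp add: power_mult_distrib frob_norm_sq_cols sum_distrib_left)
  finally show "(frob_norm (A * B))\<^sup>2 \<le> (op_norm A * frob_norm B)\<^sup>2" .
qed simp

lemma frob_norm_mult_right:
  assumes "dim_col A = dim_row B"
  shows "frob_norm (A * B) \<le> frob_norm A * op_norm B"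
  using frob_norm_mult_left[of "B\<^sup>T" "A\<^sup>T"] assms
  by (simp add: mtrans(1)[symmetric] frob_norm_transpose op_norm_transpose mult.commute)

text \<open>The columns are images of unit vectors. This is the source of the dimension factor in
  the bound on \<open>Phi\<close>.\<close>

lemma frob_norm_le_op: "frob_norm A \<le> sqrt (real (dim_col A)) * op_norm A"
proof (rule power2_le_imp_le)
  have "(frob_norm A)\<^sup>2 = (\<Sum>j<dim_col A. (vnorm (A *\<^sub>v unit_vec (dim_col A) j))\<^sup>2)"
    unfolding frob_norm_sq_cols
    by (intro sum.cong refl arg_cong[where f = "\<lambda>v. (vnorm v)\<^sup>2"] eq_vecI) auto
  also have "\<dots> \<le> (\<Sum>j<dim_col A. (op_norm A)\<^sup>2)"
  proof (intro sum_mono power_mono)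
    fix j assume "j \<in> {..<dim_col A}"
    then have "vnorm (unit_vec (dim_col A) j) = 1" by (simp add: vnorm_def)
    then show "vnorm (A *\<^sub>v unit_vec (dim_col A) j) \<le> op_norm A"
      using vnorm_mvec_le_op[of "unit_vec (dim_col A) j" A] by simp
  qed simp
  finally show "(frob_norm A)\<^sup>2 \<le> (sqrt (real (dim_col A)) * op_norm A)\<^sup>2"
    by (simp add: power_mult_distrib)
qed simp

section \<open>Row-major vectorization of matrices\<close>

lemma index_lt_mult:
  assumes "i < r" "j < c"
  shows "i * c + j < r * (c::nat)"
proof -
  have "i * c + j < Suc i * c" using assms by simp
  also have "\<dots> \<le> r * c" using assms by (intro mult_le_mono1) simp
  finally show ?thesis .
qed

lemma vec_of_mat_carrier [simp]: "A \<in> carrier_mat r c \<Longrightarrow> vec_of_mat A \<in> carrier_vec (r * c)"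
  by (auto simp: vec_of_mat_def)

lemma vnorm_vec_of_mat: "vnorm (vec_of_mat A) = frob_norm A"
proof -
  let ?r = "dim_row A" and ?c = "dim_col A"
  have "(\<Sum>k<?r * ?c. (A $$ (k div ?c, k mod ?c))\<^sup>2) = (\<Sum>i<?r. \<Sum>j<?c. (A $$ (i, j))\<^sup>2)"
    (is "?L = ?R")
  proof (cases "?c = 0")
    case False
    have "?R = (\<Sum>(i,j)\<in>{..<?r} \<times> {..<?c}. (A $$ (i, j))\<^sup>2)" by (simp add: sum.cartesian_product)
    also have "\<dots> = ?L"
      by (rule sum.reindex_bij_witness[where i = "\<lambda>k. (k div ?c, k mod ?c)" and j = "\<lambda>(i,j). i * ?c + j"])
        (use False in \<open>auto simp: less_mult_imp_div_less index_lt_mult\<close>)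
    finally show ?thesis ..
  qed simp
  then show ?thesis
    by (simp add: vnorm_def sp_self frob_norm_def vec_of_mat_def)
qed

lemma frob_norm_add:
  assumes "dim_row A = dim_row B" "dim_col A = dim_col B"
  shows "frob_norm (A + B) \<le> frob_norm A + frob_norm B"
proof -
  have "vec_of_mat (A + B) = vec_of_mat A + vec_of_mat B"
  proof (rule eq_vecI)
    fix i assume "i < dim_vec (vec_of_mat A + vec_of_mat B)"
    then have i: "i < dim_row B * dim_col B" by (simp add: vec_of_mat_def)
    then have "dim_col B > 0" by (intro Nat.gr0I) simp
    then show "vec_of_mat (A + B) $ i = (vec_of_mat A + vec_of_mat B) $ i"
      using i assms by (simp add: vec_of_mat_def less_mult_imp_div_less)
  qed (use assms in \<open>simp add: vec_of_mat_def\<close>)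
  then show ?thesis
    using vnorm_triangle[of "vec_of_mat A" "vec_of_mat B"] assms
    by (simp add: vnorm_vec_of_mat[symmetric]) (simp add: vec_of_mat_def)
qed

lemma frob_norm_uminus: "frob_norm (- A) = frob_norm A"
  unfolding frob_norm_def by simp

lemma frob_norm_minus:
  assumes "dim_row A = dim_row B" "dim_col A = dim_col B"
  shows "frob_norm (A - B) \<le> frob_norm A + frob_norm B"
proof -
  have "A - B = A + - B" using assms by (auto intro!: eq_matI)
  then show ?thesis using frob_norm_add[of A "- B"] assms by (simp add: frob_norm_uminus)
qed

section \<open>Inverses and definite matrices\<close>

lemma det_nz_iff_kernel:
  fixes A :: "real mat"
  assumes "A \<in> carrier_mat n n"
  shows "Determinant.det A \<noteq> 0 \<longleftrightarrow> (\<forall>v\<in>carrier_vec n. A *\<^sub>v v = 0\<^sub>v n \<longrightarrow> v = 0\<^sub>v n)"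
  using det_0_iff_vec_prod_zero[OF assms] by blast

lemma
  assumes A: "A \<in> carrier_mat n n" and det: "Determinant.det A \<noteq> 0"
  shows minv_carrier: "minv A \<in> carrier_mat n n"
    and minv_right: "A * minv A = 1\<^sub>m n"
    and minv_left: "minv A * A = 1\<^sub>m n"
proof -
  have "mat_inverse A \<noteq> None"
    using mat_inverse(1)[OF A, of "()"] det_non_zero_imp_unit[OF A det, of "()"] by blast
  then obtain B where B: "mat_inverse A = Some B" by auto
  then show "minv A \<in> carrier_mat n n" "A * minv A = 1\<^sub>m n" "minv A * A = 1\<^sub>m n"
    using mat_inverse(2)[OF A B] by (auto simp: minv_def)
qed

lemma minv_cancel:
  assumes A: "A \<in> carrier_mat n n" "Determinant.det A \<noteq> 0" and v: "v \<in> carrier_vec n"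
  shows "A *\<^sub>v (minv A *\<^sub>v v) = v" "minv A *\<^sub>v (A *\<^sub>v v) = v"
  using minv_carrier[OF A] minv_right[OF A] minv_left[OF A] A v
  by (simp_all add: mult_mvec[symmetric])

lemma det_nz_of_right_inverse:
  fixes A :: "real mat"
  assumes A: "A \<in> carrier_mat n n" and B: "B \<in> carrier_mat n n" and AB: "A * B = 1\<^sub>m n"
  shows "Determinant.det A \<noteq> 0" "Determinant.det B \<noteq> 0"
  using det_mult[OF A B] AB by auto

lemma minv_unique:
  assumes A: "A \<in> carrier_mat n n" and B: "B \<in> carrier_mat n n" and AB: "A * B = 1\<^sub>m n"
  shows "minv A = B"
proof -
  note d = det_nz_of_right_inverse(1)[OF A B AB]
  have "minv A = minv A * (A * B)" using minv_carrier[OF A d] by (simp add: AB mmult_one)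
  also have "\<dots> = (minv A * A) * B" using minv_carrier[OF A d] A B by (simp add: mmult_assoc)
  also have "\<dots> = B" using B by (simp add: minv_left[OF A d] mmult_one)
  finally show ?thesis .
qed

lemma det_minv_nz:
  assumes "A \<in> carrier_mat n n" "Determinant.det A \<noteq> 0"
  shows "Determinant.det (minv A) \<noteq> 0"
  using det_nz_of_right_inverse(2)[OF assms(1) minv_carrier[OF assms] minv_right[OF assms]] .

lemma det_mult_nz:
  fixes A :: "real mat"
  assumes "A \<in> carrier_mat n n" "B \<in> carrier_mat n n" "Determinant.det A \<noteq> 0" "Determinant.det B \<noteq> 0"
  shows "Determinant.det (A * B) \<noteq> 0"
  using det_mult[OF assms(1,2)] assms by simp

lemma det_trans_nz:
  fixes A :: "real mat"
  assumes "A \<in> carrier_mat n n" "Determinant.det A \<noteq> 0"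
  shows "Determinant.det A\<^sup>T \<noteq> 0"
  using det_transpose[OF assms(1)] assms by simp

lemma minv_minv:
  assumes "A \<in> carrier_mat n n" "Determinant.det A \<noteq> 0"
  shows "minv (minv A) = A"
  by (rule minv_unique[OF minv_carrier[OF assms] assms(1) minv_left[OF assms]])

lemma minv_mult:
  assumes A: "A \<in> carrier_mat n n" "Determinant.det A \<noteq> 0" and B: "B \<in> carrier_mat n n" "Determinant.det B \<noteq> 0"
  shows "minv (A * B) = minv B * minv A"
proof (rule minv_unique)
  note i = minv_carrier[OF A] minv_carrier[OF B]
  have "A * B * (minv B * minv A) = A * ((B * minv B) * minv A)" using A B i by (simp add: mmult_assoc)
  also have "\<dots> = A * minv A" using i by (simp add: minv_right[OF B] mmult_one)
  finally show "A * B * (minv B * minv A) = 1\<^sub>m n" by (simp add: minv_right[OF A])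
qed (use A B minv_carrier[OF A] minv_carrier[OF B] in auto)

lemma minv_transpose:
  assumes A: "A \<in> carrier_mat n n" "Determinant.det A \<noteq> 0"
  shows "minv A\<^sup>T = (minv A)\<^sup>T"
proof (rule minv_unique)
  show "A\<^sup>T * (minv A)\<^sup>T = 1\<^sub>m n"
    using minv_left[OF A] minv_carrier[OF A] A by (metis carrier_matD mtrans(1) transpose_one)
qed (use A minv_carrier[OF A] in auto)

lemma sym_mat_swap:
  assumes "sym_mat n A" "v \<in> carrier_vec n" "w \<in> carrier_vec n"
  shows "v \<bullet> (A *\<^sub>v w) = w \<bullet> (A *\<^sub>v v)"
proof -
  have "dim_vec v = dim_row A" "dim_vec w = dim_col A" "A\<^sup>T = A" using assms by (auto simp: sym_mat_def)
  then show ?thesis using sp_mvec_swap[of v A w] by simp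
qed

lemma pos_def_det_nz:
  assumes "pos_def n A"
  shows "Determinant.det A \<noteq> 0"
proof -
  have A: "A \<in> carrier_mat n n" using assms by (simp add: pos_def_def sym_mat_def)
  show ?thesis
    unfolding det_nz_iff_kernel[OF A] using assms by (force simp: pos_def_def)
qed

lemma pos_defD:
  assumes "pos_def n A"
  shows "A \<in> carrier_mat n n" "A\<^sup>T = A" "sym_mat n A" "Determinant.det A \<noteq> 0"
    "\<And>v. v \<in> carrier_vec n \<Longrightarrow> v \<noteq> 0\<^sub>v n \<Longrightarrow> 0 < v \<bullet> (A *\<^sub>v v)"
  using assms pos_def_det_nz[OF assms] by (auto simp: pos_def_def sym_mat_def)

lemma pos_def_ge_0:
  assumes "pos_def n A" "v \<in> carrier_vec n"
  shows "0 \<le> v \<bullet> (A *\<^sub>v v)"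
  using pos_defD(1,5)[OF assms(1)] assms(2)
  by (cases "v = 0\<^sub>v n") (auto simp: mvec_zero intro: less_imp_le)

lemma sym_mat_minv:
  assumes "sym_mat n A" "Determinant.det A \<noteq> 0"
  shows "sym_mat n (minv A)"
  using assms minv_carrier[of A n] minv_transpose[of A n] by (simp add: sym_mat_def)

lemma pos_def_minv:
  assumes "pos_def n A"
  shows "pos_def n (minv A)"
  unfolding pos_def_def
proof (intro conjI ballI impI)
  note D = pos_defD[OF assms]
  show "sym_mat n (minv A)" by (rule sym_mat_minv) (use D in auto)
  fix v :: "real vec" assume v: "v \<in> carrier_vec n" "v \<noteq> 0\<^sub>v n"
  let ?w = "minv A *\<^sub>v v"
  have w: "?w \<in> carrier_vec n" using minv_carrier[OF D(1,4)] v by simp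
  have Aw: "A *\<^sub>v ?w = v" by (rule minv_cancel[OF D(1,4) v(1)])
  have "?w \<noteq> 0\<^sub>v n" using Aw v D(1) by (auto simp: mvec_zero)
  then have "0 < ?w \<bullet> (A *\<^sub>v ?w)" using D(5) w by blast
  then show "0 < v \<bullet> (minv A *\<^sub>v v)" using Aw comm_scalar_prod[OF w v(1)] by simp
qed

lemma pos_def_congruence:
  assumes A: "pos_def n A" and N: "N \<in> carrier_mat n n" "Determinant.det N \<noteq> 0"
  shows "pos_def n (N * A * N\<^sup>T)"
  unfolding pos_def_def
proof (intro conjI ballI impI)
  note D = pos_defD[OF A]
  show "sym_mat n (N * A * N\<^sup>T)"
    using D(1,2) N(1) by (simp add: sym_mat_def mtrans mmult_assoc)
  fix v :: "real vec" assume v: "v \<in> carrier_vec n" "v \<noteq> 0\<^sub>v n"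
  let ?w = "N\<^sup>T *\<^sub>v v"
  have NT: "N\<^sup>T \<in> carrier_mat n n" using N by simp
  have w: "?w \<in> carrier_vec n" by (rule mult_mat_vec_carrier[OF NT v(1)])
  have w0: "?w \<noteq> 0\<^sub>v n"
    using iffD1[OF det_nz_iff_kernel[OF NT] det_trans_nz[OF N]] v by blast
  have "v \<bullet> (N * A * N\<^sup>T *\<^sub>v v) = ?w \<bullet> (A *\<^sub>v ?w)"
    using D(1) N(1) v(1) by (simp add: mult_mvec sp_mvec_left)
  then show "0 < v \<bullet> (N * A * N\<^sup>T *\<^sub>v v)" using D(5)[OF w w0] by simp
qed

text \<open>Along the line \<open>v + t A v\<close> the form equals
  \<open>2 t |A v|^2 + t^2 c\<close> with \<open>c >= 0\<close>; it would become negative for small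
  negative \<open>t\<close> unless \<open>A v = 0\<close>.\<close>

lemma pos_semidef_kernel:
  assumes A: "pos_semidef n A" and v: "v \<in> carrier_vec n" and 0: "v \<bullet> (A *\<^sub>v v) = 0"
  shows "A *\<^sub>v v = 0\<^sub>v n"
proof -
  have Ac: "A \<in> carrier_mat n n" and sym: "sym_mat n A" using A by (auto simp: pos_semidef_def sym_mat_def)
  let ?w = "A *\<^sub>v v"
  have w: "?w \<in> carrier_vec n" using Ac v by simp
  define a where "a = ?w \<bullet> ?w"
  define c where "c = ?w \<bullet> (A *\<^sub>v ?w)"
  have c: "c \<ge> 0" using A w by (auto simp: c_def pos_semidef_def)
  have "0 \<le> (v + t \<cdot>\<^sub>v ?w) \<bullet> (A *\<^sub>v (v + t \<cdot>\<^sub>v ?w))" for t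
    using A v w by (auto simp: pos_semidef_def)
  also have "(v + t \<cdot>\<^sub>v ?w) \<bullet> (A *\<^sub>v (v + t \<cdot>\<^sub>v ?w)) = 2 * t * a + t\<^sup>2 * c" for t
    using Ac v w 0 sym_mat_swap[OF sym v w]
    by (simp add: mvec_simps sp_simps a_def c_def power2_eq_square algebra_simps)
  finally have "0 \<le> 2 * t * a + t\<^sup>2 * c" for t .
  note quad = this
  \<comment> \<open>The value \<open>t = - a / (c + 1)\<close> nearly minimizes the quadratic; the
    added 1 covers \<open>c = 0\<close>.\<close>
  have "2 * (- a / (c + 1)) * a + (- a / (c + 1))\<^sup>2 * c = (- 2 * a * a * (c + 1) + a\<^sup>2 * c) / (c + 1)\<^sup>2"
    using c by (simp add: divide_simps) (simp add: power2_eq_square algebra_simps)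
  then have "0 \<le> (- 2 * a * a * (c + 1) + a\<^sup>2 * c) / (c + 1)\<^sup>2"
    using quad[of "- a / (c + 1)"] by simp
  then have "0 \<le> - 2 * a * a * (c + 1) + a\<^sup>2 * c" using c by (simp add: zero_le_divide_iff)
  then have "a\<^sup>2 * (c + 2) \<le> 0" by (simp add: power2_eq_square algebra_simps)
  then have "a = 0" using c by (simp add: mult_le_0_iff)
  then show ?thesis using sp_self_eq_0[OF w] by (simp add: a_def)
qed

section \<open>Hurwitz matrices and Lyapunov equations\<close>

text \<open>Eigenvectors of a real matrix for a complex eigenvalue are handled through their real and
  imaginary parts.\<close>

definition real_eigenpair :: "nat \<Rightarrow> real mat \<Rightarrow> real \<Rightarrow> real \<Rightarrow> real vec \<Rightarrow> real vec \<Rightarrow> bool" where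
  "real_eigenpair n M \<alpha> \<beta> a b \<longleftrightarrow> a \<in> carrier_vec n \<and> b \<in> carrier_vec n \<and> (a \<noteq> 0\<^sub>v n \<or> b \<noteq> 0\<^sub>v n) \<and>
     M *\<^sub>v a = \<alpha> \<cdot>\<^sub>v a - \<beta> \<cdot>\<^sub>v b \<and> M *\<^sub>v b = \<beta> \<cdot>\<^sub>v a + \<alpha> \<cdot>\<^sub>v b"

lemma eigenvalue_iff_real_eigenpair:
  assumes M: "M \<in> carrier_mat n n"
  shows "eigenvalue (map_mat complex_of_real M) \<mu> \<longleftrightarrow> (\<exists>a b. real_eigenpair n M (Re \<mu>) (Im \<mu>) a b)"
proof
  assume "eigenvalue (map_mat complex_of_real M) \<mu>"
  then obtain v where v: "v \<in> carrier_vec n" "v \<noteq> 0\<^sub>v n"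
    and ev: "map_mat complex_of_real M *\<^sub>v v = \<mu> \<cdot>\<^sub>v v"
    using M by (auto simp: eigenvalue_def eigenvector_def)
  have idx: "(\<Sum>j<n. complex_of_real (M $$ (i,j)) * v $ j) = \<mu> * v $ i" if "i < n" for i
    using arg_cong[OF ev, of "\<lambda>w. w $ i"] that M v
    by (simp add: scalar_prod_def atLeast0LessThan)
  have re: "(\<Sum>j<n. M $$ (i,j) * Re (v $ j)) = Re \<mu> * Re (v $ i) - Im \<mu> * Im (v $ i)"
    and im: "(\<Sum>j<n. M $$ (i,j) * Im (v $ j)) = Re \<mu> * Im (v $ i) + Im \<mu> * Re (v $ i)" if "i < n" for i
    using arg_cong[OF idx[OF that], of Re] arg_cong[OF idx[OF that], of Im] by auto
  have nz: "map_vec Re v \<noteq> 0\<^sub>v n \<or> map_vec Im v \<noteq> 0\<^sub>v n"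
  proof (rule ccontr)
    assume "\<not> ?thesis"
    then have "Re (v $ i) = 0 \<and> Im (v $ i) = 0" if "i < n" for i
      using v that by (metis carrier_vecD index_map_vec(1) index_zero_vec(1))
    then have "v = 0\<^sub>v n" using v by (intro eq_vecI) (auto simp: complex_eq_iff)
    then show False using v by simp
  qed
  have "real_eigenpair n M (Re \<mu>) (Im \<mu>) (map_vec Re v) (map_vec Im v)"
    unfolding real_eigenpair_def using v M nz
    by (auto intro!: eq_vecI simp: scalar_prod_def atLeast0LessThan re im)
  then show "\<exists>a b. real_eigenpair n M (Re \<mu>) (Im \<mu>) a b" by blast
next
  assume "\<exists>a b. real_eigenpair n M (Re \<mu>) (Im \<mu>) a b"
  then obtain a b where ab: "real_eigenpair n M (Re \<mu>) (Im \<mu>) a b" by blast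
  then have c: "a \<in> carrier_vec n" "b \<in> carrier_vec n" by (auto simp: real_eigenpair_def)
  define v where "v = vec n (\<lambda>i. Complex (a $ i) (b $ i))"
  have 1: "(\<Sum>j<n. M $$ (i,j) * a $ j) = Re \<mu> * a $ i - Im \<mu> * b $ i"
    and 2: "(\<Sum>j<n. M $$ (i,j) * b $ j) = Im \<mu> * a $ i + Re \<mu> * b $ i" if "i < n" for i
  proof -
    have "M *\<^sub>v a = Re \<mu> \<cdot>\<^sub>v a - Im \<mu> \<cdot>\<^sub>v b" "M *\<^sub>v b = Im \<mu> \<cdot>\<^sub>v a + Re \<mu> \<cdot>\<^sub>v b"
      using ab by (auto simp: real_eigenpair_def)
    from this[THEN arg_cong[of _ _ "\<lambda>w. w $ i"]]
    show "(\<Sum>j<n. M $$ (i,j) * a $ j) = Re \<mu> * a $ i - Im \<mu> * b $ i"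
      "(\<Sum>j<n. M $$ (i,j) * b $ j) = Im \<mu> * a $ i + Re \<mu> * b $ i"
      using that M c by (simp_all add: scalar_prod_def atLeast0LessThan)
  qed
  have "v \<noteq> 0\<^sub>v n"
  proof
    assume "v = 0\<^sub>v n"
    then have "Complex (a $ i) (b $ i) = 0" if "i < n" for i
      using that by (metis v_def index_vec index_zero_vec(1))
    then have "a = 0\<^sub>v n" "b = 0\<^sub>v n" using c by (auto intro!: eq_vecI simp: complex_eq_iff)
    then show False using ab by (simp add: real_eigenpair_def)
  qed
  moreover have "map_mat complex_of_real M *\<^sub>v v = \<mu> \<cdot>\<^sub>v v"
    using M by (intro eq_vecI)
      (auto simp: v_def scalar_prod_def atLeast0LessThan complex_eq_iff 1 2)
  ultimately show "eigenvalue (map_mat complex_of_real M) \<mu>"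
    using M unfolding eigenvalue_def eigenvector_def by (intro exI[of _ v]) (auto simp: v_def)
qed

lemma hurwitz_real_eigenpair:
  assumes "hurwitz M" "M \<in> carrier_mat n n" "real_eigenpair n M \<alpha> \<beta> a b"
  shows "\<alpha> < 0"
  using eigenvalue_iff_real_eigenpair[OF assms(2), of "Complex \<alpha> \<beta>"] assms
  by (auto simp: hurwitz_def)

lemma eigenvalue_transpose:
  assumes "M \<in> carrier_mat n n"
  shows "eigenvalue (map_mat complex_of_real M\<^sup>T) \<mu> \<longleftrightarrow> eigenvalue (map_mat complex_of_real M) \<mu>"
proof -
  have "char_poly (map_mat complex_of_real M)\<^sup>T = char_poly (map_mat complex_of_real M)"
    by (rule char_poly_transpose_mat) (use assms in simp)
  then show ?thesis
    using eigenvalue_root_char_poly[of "map_mat complex_of_real M" n \<mu>]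
      eigenvalue_root_char_poly[of "map_mat complex_of_real M\<^sup>T" n \<mu>] assms
    by (simp add: map_mat_transpose)
qed

lemma hurwitz_transpose: "M \<in> carrier_mat n n \<Longrightarrow> hurwitz M\<^sup>T \<longleftrightarrow> hurwitz M"
  by (simp add: hurwitz_def eigenvalue_transpose)

lemma hurwitzI_transpose:
  assumes M: "M \<in> carrier_mat n n"
    and neg: "\<And>\<alpha> \<beta> a b. real_eigenpair n M\<^sup>T \<alpha> \<beta> a b \<Longrightarrow> \<alpha> < 0"
  shows "hurwitz M"
  unfolding hurwitz_def
proof (intro allI impI)
  fix \<mu> assume "eigenvalue (map_mat complex_of_real M) \<mu>"
  then have "eigenvalue (map_mat complex_of_real M\<^sup>T) \<mu>" using eigenvalue_transpose[OF M] by simp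
  then show "Re \<mu> < 0" using eigenvalue_iff_real_eigenpair[of "M\<^sup>T" n \<mu>] M neg by auto
qed

text \<open>Each summand is \<open>2 (M^T v) . S v\<close>; after inserting the eigenvector
  equations the terms with \<open>\<beta>\<close> cancel because
  \<open>a . S b = b . S a\<close>.\<close>

lemma real_eigenpair_form:
  assumes S: "sym_mat n S" and M: "M \<in> carrier_mat n n" and ab: "real_eigenpair n M\<^sup>T \<alpha> \<beta> a b"
  shows "a \<bullet> ((M * S + S * M\<^sup>T) *\<^sub>v a) + b \<bullet> ((M * S + S * M\<^sup>T) *\<^sub>v b) =
    2 * \<alpha> * (a \<bullet> (S *\<^sub>v a) + b \<bullet> (S *\<^sub>v b))"
proof -
  have c: "a \<in> carrier_vec n" "b \<in> carrier_vec n" "S \<in> carrier_mat n n"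
    and e: "M\<^sup>T *\<^sub>v a = \<alpha> \<cdot>\<^sub>v a - \<beta> \<cdot>\<^sub>v b" "M\<^sup>T *\<^sub>v b = \<beta> \<cdot>\<^sub>v a + \<alpha> \<cdot>\<^sub>v b"
    using ab S by (auto simp: real_eigenpair_def sym_mat_def)
  have q: "v \<bullet> ((M * S + S * M\<^sup>T) *\<^sub>v v) = 2 * ((M\<^sup>T *\<^sub>v v) \<bullet> (S *\<^sub>v v))" if v: "v \<in> carrier_vec n" for v
    using c M v sym_mat_swap[OF S v, of "M\<^sup>T *\<^sub>v v"] sp_mvec_left[of v "M\<^sup>T" "S *\<^sub>v v"]
    by (simp add: mvec_simps sp_simps)
  show ?thesis
    unfolding q[OF c(1)] q[OF c(2)] e
    using c sym_mat_swap[OF S c(1,2)] by (simp add: sp_simps algebra_simps)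
qed

text \<open>Lyapunov's criterion: on an eigenpair of \<open>M^T\<close> the two forms add up to a
  negative number that equals \<open>2 \<alpha>\<close> times a nonnegative one.\<close>

lemma hurwitzI_lyapunov:
  assumes S: "pos_def n S" and M: "M \<in> carrier_mat n n"
    and neg: "\<And>v. v \<in> carrier_vec n \<Longrightarrow> v \<noteq> 0\<^sub>v n \<Longrightarrow> v \<bullet> ((M * S + S * M\<^sup>T) *\<^sub>v v) < 0"
  shows "hurwitz M"
proof (rule hurwitzI_transpose[OF M])
  fix \<alpha> \<beta> a b assume ab: "real_eigenpair n M\<^sup>T \<alpha> \<beta> a b"
  note D = pos_defD[OF S]
  let ?q = "\<lambda>v. v \<bullet> ((M * S + S * M\<^sup>T) *\<^sub>v v)"
  have c: "a \<in> carrier_vec n" "b \<in> carrier_vec n" "a \<noteq> 0\<^sub>v n \<or> b \<noteq> 0\<^sub>v n"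
    using ab by (auto simp: real_eigenpair_def)
  have le: "?q v \<le> 0" if "v \<in> carrier_vec n" for v
    using neg[OF that] D(1) M that by (cases "v = 0\<^sub>v n") (auto simp: mvec_zero intro: less_imp_le)
  have "?q a + ?q b < 0" using c neg le[of a] le[of b] by (meson add_neg_nonpos add_nonpos_neg)
  then have "2 * \<alpha> * (a \<bullet> (S *\<^sub>v a) + b \<bullet> (S *\<^sub>v b)) < 0"
    unfolding real_eigenpair_form[OF D(3) M ab] .
  moreover have "a \<bullet> (S *\<^sub>v a) + b \<bullet> (S *\<^sub>v b) \<ge> 0"
    using pos_def_ge_0[OF S] c by (simp add: add_nonneg_nonneg)
  ultimately show "\<alpha> < 0" by (smt (verit) mult_nonneg_nonneg)
qed

section \<open>Decay of matrix powers and the Cayley transform\<close>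

lemmas carrier_intros = mult_carrier_mat add_carrier_mat minus_carrier_mat one_carrier_mat zero_carrier_mat
  transpose_carrier_mat[THEN iffD2] mult_mat_vec_carrier pow_carrier_mat

lemma zero_mvec: "v \<in> carrier_vec c \<Longrightarrow> 0\<^sub>m r c *\<^sub>v v = (0\<^sub>v r :: real vec)"
  by (intro eq_vecI) (auto simp: scalar_prod_def)

lemma pow_mat_smult:
  fixes A :: "real mat"
  assumes A: "A \<in> carrier_mat n n"
  shows "(c \<cdot>\<^sub>m A) ^\<^sub>m k = c ^ k \<cdot>\<^sub>m (A ^\<^sub>m k)"
proof (induction k)
  case 0
  then show ?case by (auto intro!: eq_matI)
next
  case (Suc k)
  have "A ^\<^sub>m k \<in> carrier_mat n n" using A by simp
  then show ?case using A
    by (auto simp: Suc mult_smult_assoc_mat[of _ n n _ n] mult_smult_distrib[of _ n n _ n] intro!: eq_matI)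
qed

text \<open>With \<open>r\<close> strictly between the spectral radius and 1, the powers of
  \<open>A / r\<close> stay bounded, so those of \<open>A\<close> are \<open>O(r^k)\<close>. The
  rescaling turns boundedness into decay.\<close>

lemma spectral_decay:
  fixes A :: "real mat"
  assumes A: "A \<in> carrier_mat n n"
    and ev: "\<And>\<mu>. eigenvalue (map_mat complex_of_real A) \<mu> \<Longrightarrow> cmod \<mu> < 1"
    and ij: "i < n" "j < n"
  shows "(\<lambda>k. (A ^\<^sub>m k) $$ (i,j)) \<longlonglongrightarrow> 0"
proof -
  let ?c = "map_mat complex_of_real"
  have n: "n > 0" using ij by simp
  define \<rho> where "\<rho> = spectral_radius (?c A)"
  have \<rho>: "0 \<le> \<rho>" "\<rho> < 1"
    using spectral_radius_mem_max(1)[of "?c A" n] A n ev by (auto simp: \<rho>_def spectrum_def)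
  define r where "r = (1 + \<rho>) / 2"
  have r: "0 < r" "r < 1" "\<rho> < r" using \<rho> by (auto simp: r_def)
  let ?B = "(1 / r) \<cdot>\<^sub>m A"
  have B: "?B \<in> carrier_mat n n" using A by simp
  \<comment> \<open>An eigenvalue \<open>\<mu>\<close> of \<open>A / r\<close> gives the eigenvalue
    \<open>r \<mu>\<close> of \<open>A\<close>, whence
    \<open>r |\<mu>| <= \<rho> < r\<close>.\<close>
  have "spectral_radius (?c ?B) < 1"
  proof -
    have "spectral_radius (?c ?B) \<in> cmod ` spectrum (?c ?B)"
      by (rule spectral_radius_mem_max(1)[of _ n]) (use B n in auto)
    then obtain \<mu> where \<mu>: "eigenvalue (?c ?B) \<mu>" "spectral_radius (?c ?B) = cmod \<mu>"
      by (auto simp: spectrum_def)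
    then obtain v where v: "v \<in> carrier_vec n" "v \<noteq> 0\<^sub>v n" "?c ?B *\<^sub>v v = \<mu> \<cdot>\<^sub>v v"
      using A by (auto simp: eigenvalue_def eigenvector_def)
    have "?c A *\<^sub>v v = (of_real r * \<mu>) \<cdot>\<^sub>v v"
    proof (rule eq_vecI)
      fix l assume l: "l < dim_vec ((of_real r * \<mu>) \<cdot>\<^sub>v v)"
      have "(\<Sum>q<n. complex_of_real (A $$ (l,q) / r) * v $ q) = \<mu> * v $ l"
        using arg_cong[OF v(3), of "\<lambda>w. w $ l"] l v(1) A by (simp add: scalar_prod_def atLeast0LessThan)
      then have "of_real r * (\<Sum>q<n. complex_of_real (A $$ (l,q) / r) * v $ q) = of_real r * (\<mu> * v $ l)"
        by simp
      then have "(\<Sum>q<n. complex_of_real (A $$ (l,q)) * v $ q) = of_real r * (\<mu> * v $ l)"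
        using r by (simp add: sum_distrib_left)
      then show "(?c A *\<^sub>v v) $ l = ((of_real r * \<mu>) \<cdot>\<^sub>v v) $ l"
        using l v(1) A by (simp add: scalar_prod_def atLeast0LessThan)
    qed (use A v in auto)
    then have "eigenvalue (?c A) (of_real r * \<mu>)"
      unfolding eigenvalue_def eigenvector_def using v A by auto
    then have "cmod (of_real r * \<mu>) \<le> \<rho>"
      unfolding \<rho>_def by (intro spectral_radius_mem_max(2)[of _ n]) (use A n in \<open>auto simp: spectrum_def\<close>)
    then have "r * cmod \<mu> < r * 1" using r by (simp only: norm_mult norm_of_real)
    then show ?thesis using \<mu>(2) r(1) mult_less_cancel_left_pos[OF r(1)] by metis
  qed
  then obtain c where c: "norm_bound (?c ?B ^\<^sub>m k) c" for k
    using spectral_radius_jnf_norm_bound_less_1_upper_triangular[of "?c ?B" n] B by auto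
  have bnd: "\<bar>(A ^\<^sub>m k) $$ (i,j)\<bar> \<le> c * r ^ k" for k
  proof -
    have Ak: "A ^\<^sub>m k \<in> carrier_mat n n" using A by simp
    have "?c ?B ^\<^sub>m k = ?c (?B ^\<^sub>m k)" by (rule of_real_hom.mat_hom_pow[OF B, symmetric])
    then have "norm_bound (?c (?B ^\<^sub>m k)) c" using c[of k] by simp
    then have "\<bar>(?B ^\<^sub>m k) $$ (i,j)\<bar> \<le> c"
      using ij pow_carrier_mat[OF B, of k] unfolding norm_bound_def
      by (metis carrier_matD index_map_mat norm_of_real real_norm_def)
    moreover have "(?B ^\<^sub>m k) $$ (i,j) = (1 / r) ^ k * (A ^\<^sub>m k) $$ (i,j)"
      unfolding pow_mat_smult[OF A] using ij Ak by (metis carrier_matD index_smult_mat(1))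
    ultimately have "\<bar>(A ^\<^sub>m k) $$ (i,j)\<bar> / r ^ k \<le> c"
      using r by (simp add: power_one_over abs_mult field_simps)
    then show ?thesis using r by (simp add: divide_le_eq)
  qed
  have "(\<lambda>k. c * r ^ k) \<longlonglongrightarrow> c * 0"
    by (intro tendsto_mult tendsto_const LIMSEQ_realpow_zero) (use r in auto)
  then show ?thesis
    by (intro Lim_null_comparison[OF _ \<open>(\<lambda>k. c * r ^ k) \<longlonglongrightarrow> c * 0\<close>[simplified]]) (use bnd in auto)
qed

text \<open>The map \<open>x -> (1 + x) / (1 - x)\<close> takes the open left half plane into the
  open unit disc, so the Cayley transform \<open>T\<close> of a Hurwitz matrix has only eigenvalues
  of modulus below 1.\<close>

lemma cayley_decay:
  fixes M :: "real mat"
  assumes M: "M \<in> carrier_mat n n" and H: "hurwitz M"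
  obtains T where "T \<in> carrier_mat n n" "Determinant.det (1\<^sub>m n - M) \<noteq> 0"
    "T = (1\<^sub>m n + M) * minv (1\<^sub>m n - M)"
    "\<And>i j. i < n \<Longrightarrow> j < n \<Longrightarrow> (\<lambda>k. (T ^\<^sub>m k) $$ (i,j)) \<longlonglongrightarrow> 0"
proof -
  have N: "1\<^sub>m n - M \<in> carrier_mat n n" by (intro carrier_intros M)
  have det: "Determinant.det (1\<^sub>m n - M) \<noteq> 0"
    unfolding det_nz_iff_kernel[OF N]
  proof (intro ballI impI)
    fix v assume v: "v \<in> carrier_vec n" "(1\<^sub>m n - M) *\<^sub>v v = 0\<^sub>v n"
    have eq: "v - M *\<^sub>v v = 0\<^sub>v n" using v M by (simp add: minus_mvec)
    have "M *\<^sub>v v = 1 \<cdot>\<^sub>v v - 0 \<cdot>\<^sub>v 0\<^sub>v n"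
    proof (rule eq_vecI)
      fix i assume "i < dim_vec (1 \<cdot>\<^sub>v v - 0 \<cdot>\<^sub>v 0\<^sub>v n)"
      then show "(M *\<^sub>v v) $ i = (1 \<cdot>\<^sub>v v - 0 \<cdot>\<^sub>v 0\<^sub>v n) $ i"
        using arg_cong[OF eq, of "\<lambda>w. w $ i"] v M by simp
    qed (use M v in auto)
    moreover have "M *\<^sub>v 0\<^sub>v n = 0 \<cdot>\<^sub>v v + 1 \<cdot>\<^sub>v 0\<^sub>v n"
      using M v by (auto simp: mvec_zero intro!: eq_vecI)
    ultimately show "v = 0\<^sub>v n"
      using hurwitz_real_eigenpair[OF H M, of 1 0 v "0\<^sub>v n"] v by (auto simp: real_eigenpair_def)
  qed
  note I = minv_carrier[OF N det]
  define T where "T = (1\<^sub>m n + M) * minv (1\<^sub>m n - M)"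
  have T: "T \<in> carrier_mat n n" unfolding T_def by (rule carrier_intros I M)+
  have "cmod \<mu> < 1" if \<mu>: "eigenvalue (map_mat complex_of_real T) \<mu>" for \<mu>
  proof -
    let ?c = "map_mat complex_of_real"
    obtain x where x: "x \<in> carrier_vec n" "x \<noteq> 0\<^sub>v n" "?c T *\<^sub>v x = \<mu> \<cdot>\<^sub>v x"
      using \<mu> T by (auto simp: eigenvalue_def eigenvector_def)
    define y where "y = ?c (minv (1\<^sub>m n - M)) *\<^sub>v x"
    have y: "y \<in> carrier_vec n" using I x by (simp add: y_def)
    have cM: "?c M \<in> carrier_mat n n" using M by simp
    have cN: "?c (1\<^sub>m n - M) = 1\<^sub>m n - ?c M" using M by (auto intro!: eq_matI)
    have cP: "?c (1\<^sub>m n + M) = 1\<^sub>m n + ?c M" using M by (auto intro!: eq_matI)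
    have "(1\<^sub>m n - ?c M) *\<^sub>v y = (?c (1\<^sub>m n - M) * ?c (minv (1\<^sub>m n - M))) *\<^sub>v x"
      unfolding y_def cN[symmetric] by (rule assoc_mult_mat_vec[symmetric]) (use N I x in auto)
    also have "?c (1\<^sub>m n - M) * ?c (minv (1\<^sub>m n - M)) = ?c (1\<^sub>m n)"
      unfolding of_real_hom.mat_hom_mult[OF N I, symmetric] minv_right[OF N det] ..
    also have "?c (1\<^sub>m n) *\<^sub>v x = x" using x by (simp add: of_real_hom.mat_hom_one)
    finally have yx: "(1\<^sub>m n - ?c M) *\<^sub>v y = x" .
    have "?c T *\<^sub>v x = (?c (1\<^sub>m n + M) * ?c (minv (1\<^sub>m n - M))) *\<^sub>v x"
      unfolding T_def by (subst of_real_hom.mat_hom_mult[of _ n n]) (use I M in auto)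
    also have "\<dots> = (1\<^sub>m n + ?c M) *\<^sub>v y"
      unfolding y_def cP[symmetric] by (rule assoc_mult_mat_vec) (use M I x in auto)
    finally have e: "(1\<^sub>m n + ?c M) *\<^sub>v y = \<mu> \<cdot>\<^sub>v x" using x by simp
    have y0: "y \<noteq> 0\<^sub>v n"
    proof
      assume "y = 0\<^sub>v n"
      then have "x = 0\<^sub>v n" using yx cM by (auto intro!: eq_vecI simp: scalar_prod_def)
      then show False using x by simp
    qed
    \<comment> \<open>Multiplied out instead of divided by \<open>1 + \<mu>\<close>, so that the
      same identity can exclude \<open>\<mu> = - 1\<close>: that value would force
      \<open>y = 0\<close>.\<close>
    have comp: "(1 + \<mu>) * (?c M *\<^sub>v y) $ i = (\<mu> - 1) * y $ i" if i: "i < n" for i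
    proof -
      have "((1\<^sub>m n + ?c M) *\<^sub>v y) $ i = y $ i + (?c M *\<^sub>v y) $ i"
        using cM y i by (subst add_mult_distrib_mat_vec[of _ n n]) auto
      moreover have "((1\<^sub>m n - ?c M) *\<^sub>v y) $ i = y $ i - (?c M *\<^sub>v y) $ i"
        using cM y i by (subst minus_mult_distrib_mat_vec[of _ n n]) auto
      moreover have "((1\<^sub>m n + ?c M) *\<^sub>v y) $ i = \<mu> * ((1\<^sub>m n - ?c M) *\<^sub>v y) $ i"
        unfolding e yx using x i by simp
      ultimately have "y $ i + (?c M *\<^sub>v y) $ i = \<mu> * (y $ i - (?c M *\<^sub>v y) $ i)" by simp
      then show ?thesis by (simp add: algebra_simps)
    qed
    have \<mu>1: "1 + \<mu> \<noteq> 0"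
    proof
      assume "1 + \<mu> = 0"
      then have "\<mu> = - 1" by (simp add: add_eq_0_iff)
      then have "y $ i = 0" if "i < n" for i using comp[OF that] by simp
      then have "y = 0\<^sub>v n" using y by (intro eq_vecI) auto
      then show False using y0 by simp
    qed
    let ?l = "(\<mu> - 1) / (1 + \<mu>)"
    have "?c M *\<^sub>v y = ?l \<cdot>\<^sub>v y"
    proof (rule eq_vecI)
      fix i assume "i < dim_vec (?l \<cdot>\<^sub>v y)"
      then show "(?c M *\<^sub>v y) $ i = (?l \<cdot>\<^sub>v y) $ i"
        using comp[of i] y \<mu>1 cM by (simp add: field_simps del: index_mult_mat_vec)
    qed (use cM y in auto)
    then have "eigenvalue (?c M) ?l"
      unfolding eigenvalue_def eigenvector_def using y y0 cM by auto
    then have "Re ?l < 0" using H by (auto simp: hurwitz_def)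
    \<comment> \<open>The numerator of \<open>Re ((\<mu> - 1) / (1 + \<mu>))\<close>; it equals
      \<open>|\<mu>|^2 - 1\<close>.\<close>
    then have "Re (\<mu> - 1) * Re (1 + \<mu>) + Im (\<mu> - 1) * Im (1 + \<mu>) < 0"
      by (simp add: Re_divide divide_less_0_iff not_sum_power2_lt_zero)
    then have "(cmod \<mu>)\<^sup>2 < 1" unfolding cmod_power2 by (simp add: algebra_simps power2_eq_square)
    then show ?thesis by (simp add: power_less_one_iff abs_square_less_1)
  qed
  from spectral_decay[OF T this] show ?thesis
    using that[OF T det T_def] by blast
qed

lemma mvec_tendsto_0:
  fixes T :: "nat \<Rightarrow> real mat"
  assumes T: "\<And>k. T k \<in> carrier_mat n n" and lim: "\<And>i j. i < n \<Longrightarrow> j < n \<Longrightarrow> (\<lambda>k. T k $$ (i,j)) \<longlonglongrightarrow> 0"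
    and v: "v \<in> carrier_vec n" and i: "i < n"
  shows "(\<lambda>k. (T k *\<^sub>v v) $ i) \<longlonglongrightarrow> 0"
proof -
  have "(\<lambda>k. \<Sum>j<n. T k $$ (i,j) * v $ j) \<longlonglongrightarrow> (\<Sum>j<n. 0 * v $ j)"
    by (intro tendsto_sum tendsto_mult lim tendsto_const i) auto
  moreover have "(T k *\<^sub>v v) $ i = (\<Sum>j<n. T k $$ (i,j) * v $ j)" for k
    using T[of k] v i by (simp add: scalar_prod_def atLeast0LessThan)
  ultimately show ?thesis by simp
qed

text \<open>The orbit of the Cayley transform of \<open>M\<^sup>T\<close> plays the role of the trajectory
  \<open>exp (t M\<^sup>T) v\<close> in the usual proof, so that no integrals of matrix exponentials are needed.\<close>

lemma hurwitz_orbit: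
  assumes M: "M \<in> carrier_mat n n" and H: "hurwitz M" and S: "S \<in> carrier_mat n n"
  obtains T where "T \<in> carrier_mat n n"
    "\<And>v w. v \<in> carrier_vec n \<Longrightarrow> w \<in> carrier_vec n \<Longrightarrow> (\<lambda>k. (T ^\<^sub>m k *\<^sub>v v) \<bullet> (S *\<^sub>v (T ^\<^sub>m k *\<^sub>v w))) \<longlonglongrightarrow> 0"
    "\<And>v w. v \<in> carrier_vec n \<Longrightarrow> w \<in> carrier_vec n \<Longrightarrow> \<exists>y\<in>carrier_vec n. \<exists>z\<in>carrier_vec n. (v = w \<longrightarrow> y = z) \<and>
       (T *\<^sub>v v) \<bullet> (S *\<^sub>v (T *\<^sub>v w)) = v \<bullet> (S *\<^sub>v w) + 2 * (y \<bullet> ((M * S + S * M\<^sup>T) *\<^sub>v z))"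
proof -
  have MT: "M\<^sup>T \<in> carrier_mat n n" "hurwitz M\<^sup>T" using M H hurwitz_transpose[OF M] by auto
  obtain T where T: "T \<in> carrier_mat n n" and det: "Determinant.det (1\<^sub>m n - M\<^sup>T) \<noteq> 0"
    and Td: "T = (1\<^sub>m n + M\<^sup>T) * minv (1\<^sub>m n - M\<^sup>T)"
    and lim: "\<And>i j. i < n \<Longrightarrow> j < n \<Longrightarrow> (\<lambda>k. (T ^\<^sub>m k) $$ (i,j)) \<longlonglongrightarrow> 0"
    using cayley_decay[OF MT] by blast
  have N: "1\<^sub>m n - M\<^sup>T \<in> carrier_mat n n" by (intro carrier_intros M)
  note I = minv_carrier[OF N det]
  show ?thesis
  proof (rule that[OF T])
    fix v w :: "real vec" assume v: "v \<in> carrier_vec n" and w: "w \<in> carrier_vec n"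
    have Tk: "T ^\<^sub>m k \<in> carrier_mat n n" for k using T by simp
    have lv: "(\<lambda>k. (T ^\<^sub>m k *\<^sub>v u) $ i) \<longlonglongrightarrow> 0" if "i < n" "u \<in> carrier_vec n" for i u
      by (rule mvec_tendsto_0[OF Tk lim that(2,1)])
    have "(\<lambda>k. \<Sum>i<n. (T ^\<^sub>m k *\<^sub>v v) $ i * (\<Sum>j<n. S $$ (i,j) * (T ^\<^sub>m k *\<^sub>v w) $ j)) \<longlonglongrightarrow>
      (\<Sum>i<n. 0 * (\<Sum>j<n. S $$ (i,j) * 0))"
      by (intro tendsto_sum tendsto_mult lv tendsto_const v w) auto
    moreover have "(T ^\<^sub>m k *\<^sub>v v) \<bullet> (S *\<^sub>v (T ^\<^sub>m k *\<^sub>v w)) =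
        (\<Sum>i<n. (T ^\<^sub>m k *\<^sub>v v) $ i * (\<Sum>j<n. S $$ (i,j) * (T ^\<^sub>m k *\<^sub>v w) $ j))" for k
      using Tk[of k] S v w by (auto simp: scalar_prod_def atLeast0LessThan simp del: pow_mat_dim_square intro!: sum.cong)
    ultimately show "(\<lambda>k. (T ^\<^sub>m k *\<^sub>v v) \<bullet> (S *\<^sub>v (T ^\<^sub>m k *\<^sub>v w))) \<longlonglongrightarrow> 0" by simp
  next
    fix v w :: "real vec" assume v: "v \<in> carrier_vec n" and w: "w \<in> carrier_vec n"
    let ?y = "minv (1\<^sub>m n - M\<^sup>T) *\<^sub>v v" and ?z = "minv (1\<^sub>m n - M\<^sup>T) *\<^sub>v w"
    have yz: "?y \<in> carrier_vec n" "?z \<in> carrier_vec n" using I v w by auto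
    have T1: "T *\<^sub>v v = ?y + M\<^sup>T *\<^sub>v ?y" "T *\<^sub>v w = ?z + M\<^sup>T *\<^sub>v ?z"
      unfolding Td using I MT v w yz by (simp_all add: mult_mvec add_mvec)
    have "?y - M\<^sup>T *\<^sub>v ?y = (1\<^sub>m n - M\<^sup>T) *\<^sub>v ?y" using I MT v yz by (simp add: minus_mvec)
    then have v1: "v = ?y - M\<^sup>T *\<^sub>v ?y" using minv_cancel(1)[OF N det v] by simp
    have "?z - M\<^sup>T *\<^sub>v ?z = (1\<^sub>m n - M\<^sup>T) *\<^sub>v ?z" using I MT w yz by (simp add: minus_mvec)
    then have w1: "w = ?z - M\<^sup>T *\<^sub>v ?z" using minv_cancel(1)[OF N det w] by simp
    \<comment> \<open>For \<open>v = y - M^T y\<close> one has \<open>T v = y + M^T y\<close>;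
      expanding both sides leaves twice the two mixed terms, which make up the Lyapunov operator. It
      is the discrete counterpart of differentiating the form along the flow.\<close>
    have main: "(y + M\<^sup>T *\<^sub>v y) \<bullet> (S *\<^sub>v (z + M\<^sup>T *\<^sub>v z)) =
      (y - M\<^sup>T *\<^sub>v y) \<bullet> (S *\<^sub>v (z - M\<^sup>T *\<^sub>v z)) + 2 * (y \<bullet> ((M * S + S * M\<^sup>T) *\<^sub>v z))"
      if "y \<in> carrier_vec n" "z \<in> carrier_vec n" for y z
      using that S M MT sp_mvec_left[of y "M\<^sup>T" "S *\<^sub>v z"] by (simp add: mvec_simps sp_simps)
    show "\<exists>y\<in>carrier_vec n. \<exists>z\<in>carrier_vec n. (v = w \<longrightarrow> y = z) \<and>
       (T *\<^sub>v v) \<bullet> (S *\<^sub>v (T *\<^sub>v w)) = v \<bullet> (S *\<^sub>v w) + 2 * (y \<bullet> ((M * S + S * M\<^sup>T) *\<^sub>v z))"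
      by (rule bexI[OF _ yz(1)], rule bexI[OF _ yz(2)])
        (use main[OF yz] in \<open>simp add: T1 v1[symmetric] w1[symmetric]\<close>)
  qed
qed

text \<open>The recursion of \<open>^\<^sub>m\<close> appends its factor on the right; orbits need
  it on the left.\<close>

lemma pow_mvec_Suc:
  fixes T :: "real mat"
  assumes "T \<in> carrier_mat n n" "v \<in> carrier_vec n"
  shows "T ^\<^sub>m (Suc k) *\<^sub>v v = T *\<^sub>v (T ^\<^sub>m k *\<^sub>v v)"
proof -
  have c: "T ^\<^sub>m k \<in> carrier_mat n n" for k by (intro carrier_intros assms)
  have "T ^\<^sub>m (Suc k) = T * T ^\<^sub>m k"
  proof (induction k)
    case (Suc k)
    have "T ^\<^sub>m Suc (Suc k) = (T * T ^\<^sub>m k) * T" using Suc by simp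
    also have "\<dots> = T * T ^\<^sub>m (Suc k)" using assms c[of k] by (simp add: mmult_assoc)
    finally show ?case .
  qed (use assms in simp)
  then show ?thesis using assms by (simp add: mult_mvec)
qed

text \<open>The form of \<open>S\<close> does not increase along the orbit of \<open>v\<close> and
  tends to 0, so it must start nonnegative.\<close>

lemma lyapunov_nonneg:
  assumes M: "M \<in> carrier_mat n n" and H: "hurwitz M" and S: "S \<in> carrier_mat n n"
    and neg: "\<And>v. v \<in> carrier_vec n \<Longrightarrow> v \<bullet> ((M * S + S * M\<^sup>T) *\<^sub>v v) \<le> 0"
    and v: "v \<in> carrier_vec n"
  shows "0 \<le> v \<bullet> (S *\<^sub>v v)"
proof -
  obtain T where T: "T \<in> carrier_mat n n" and
    lim: "\<And>v w. v \<in> carrier_vec n \<Longrightarrow> w \<in> carrier_vec n \<Longrightarrow> (\<lambda>k. (T ^\<^sub>m k *\<^sub>v v) \<bullet> (S *\<^sub>v (T ^\<^sub>m k *\<^sub>v w))) \<longlonglongrightarrow> 0" and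
    step: "\<And>v w. v \<in> carrier_vec n \<Longrightarrow> w \<in> carrier_vec n \<Longrightarrow> \<exists>y\<in>carrier_vec n. \<exists>z\<in>carrier_vec n. (v = w \<longrightarrow> y = z) \<and>
       (T *\<^sub>v v) \<bullet> (S *\<^sub>v (T *\<^sub>v w)) = v \<bullet> (S *\<^sub>v w) + 2 * (y \<bullet> ((M * S + S * M\<^sup>T) *\<^sub>v z))"
    using hurwitz_orbit[OF M H S] by blast
  let ?x = "\<lambda>k. T ^\<^sub>m k *\<^sub>v v"
  have x: "?x k \<in> carrier_vec n" for k by (rule carrier_intros T v)+
  have dec: "?x (Suc k) \<bullet> (S *\<^sub>v ?x (Suc k)) \<le> ?x k \<bullet> (S *\<^sub>v ?x k)" for k
  proof -
    obtain y where "y \<in> carrier_vec n"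
      "?x (Suc k) \<bullet> (S *\<^sub>v ?x (Suc k)) = ?x k \<bullet> (S *\<^sub>v ?x k) + 2 * (y \<bullet> ((M * S + S * M\<^sup>T) *\<^sub>v y))"
      using step[OF x[of k] x[of k]] unfolding pow_mvec_Suc[OF T v] by auto
    then show ?thesis using neg[of y] by simp
  qed
  have "?x k \<bullet> (S *\<^sub>v ?x k) \<le> v \<bullet> (S *\<^sub>v v)" for k
  proof (induction k)
    case 0
    show ?case using T v by simp
  next
    case (Suc k)
    then show ?case using dec[of k] by linarith
  qed
  then show ?thesis by (intro LIMSEQ_le_const2[OF lim[OF v v]]) auto
qed

text \<open>Here the bilinear form is constant along a pair of orbits and tends to 0, hence it
  vanishes for all pairs; working with two vectors covers nonsymmetric \<open>S\<close>.\<close>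

lemma lyapunov_unique:
  assumes M: "M \<in> carrier_mat n n" and H: "hurwitz M" and S: "S \<in> carrier_mat n n"
    and 0: "M * S + S * M\<^sup>T = 0\<^sub>m n n"
  shows "S = 0\<^sub>m n n"
proof (rule eq_mat_by_mvec[OF S])
  obtain T where T: "T \<in> carrier_mat n n" and
    lim: "\<And>v w. v \<in> carrier_vec n \<Longrightarrow> w \<in> carrier_vec n \<Longrightarrow> (\<lambda>k. (T ^\<^sub>m k *\<^sub>v v) \<bullet> (S *\<^sub>v (T ^\<^sub>m k *\<^sub>v w))) \<longlonglongrightarrow> 0" and
    step: "\<And>v w. v \<in> carrier_vec n \<Longrightarrow> w \<in> carrier_vec n \<Longrightarrow> \<exists>y\<in>carrier_vec n. \<exists>z\<in>carrier_vec n. (v = w \<longrightarrow> y = z) \<and>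
       (T *\<^sub>v v) \<bullet> (S *\<^sub>v (T *\<^sub>v w)) = v \<bullet> (S *\<^sub>v w) + 2 * (y \<bullet> ((M * S + S * M\<^sup>T) *\<^sub>v z))"
    using hurwitz_orbit[OF M H S] by blast
  fix w :: "real vec" assume w: "w \<in> carrier_vec n"
  have "v \<bullet> (S *\<^sub>v w) = 0" if v: "v \<in> carrier_vec n" for v
  proof -
    have x: "T ^\<^sub>m k *\<^sub>v u \<in> carrier_vec n" if "u \<in> carrier_vec n" for k u by (rule carrier_intros T that)+
    have dec: "(T ^\<^sub>m (Suc k) *\<^sub>v v) \<bullet> (S *\<^sub>v (T ^\<^sub>m (Suc k) *\<^sub>v w)) = (T ^\<^sub>m k *\<^sub>v v) \<bullet> (S *\<^sub>v (T ^\<^sub>m k *\<^sub>v w))" for k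
      using step[OF x[OF v, of k] x[OF w, of k]] unfolding pow_mvec_Suc[OF T v] pow_mvec_Suc[OF T w] 0
      by (auto simp: zero_mvec)
    have "(T ^\<^sub>m k *\<^sub>v v) \<bullet> (S *\<^sub>v (T ^\<^sub>m k *\<^sub>v w)) = v \<bullet> (S *\<^sub>v w)" for k
      by (induction k) (use dec T v w in \<open>auto simp del: pow_mat.simps(2)\<close>)
    then have "(\<lambda>k. v \<bullet> (S *\<^sub>v w)) \<longlonglongrightarrow> 0" using lim[OF v w] by simp
    then show ?thesis by (simp add: LIMSEQ_const_iff)
  qed
  then show "S *\<^sub>v w = 0\<^sub>m n n *\<^sub>v w"
    using S w by (intro eq_vec_by_sp[of _ n]) (auto simp: zero_mvec)
qed simp

section \<open>Linear maps on carriers and solvability of the Lyapunov equation\<close>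

lemma linear_vec_expand:
  fixes g :: "real vec \<Rightarrow> real vec"
  assumes car: "\<And>v. v \<in> carrier_vec d \<Longrightarrow> g v \<in> carrier_vec k"
    and add: "\<And>v w. v \<in> carrier_vec d \<Longrightarrow> w \<in> carrier_vec d \<Longrightarrow> g (v + w) = g v + g w"
    and smult: "\<And>c v. v \<in> carrier_vec d \<Longrightarrow> g (c \<cdot>\<^sub>v v) = c \<cdot>\<^sub>v g v"
    and v: "v \<in> carrier_vec d"
  shows "g v = mat k d (\<lambda>(i,j). g (unit_vec d j) $ i) *\<^sub>v v"
proof -
  \<comment> \<open>\<open>p q\<close> keeps the first \<open>q\<close> entries of \<open>v\<close>;
    the expansion is built up by adding one unit vector at a time.\<close>
  define p where "p q = vec d (\<lambda>i. if i < q then v $ i else 0)" for q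
  have "i < k \<Longrightarrow> q \<le> d \<Longrightarrow> g (p q) $ i = (\<Sum>j<q. g (unit_vec d j) $ i * v $ j)" for i q
  proof (induction q)
    case 0
    have "p 0 = 0 \<cdot>\<^sub>v p 0" by (auto simp: p_def)
    then have "g (p 0) = 0 \<cdot>\<^sub>v g (p 0)" using smult[of "p 0" 0] by (simp add: p_def)
    moreover have "g (p 0) \<in> carrier_vec k" by (rule car) (simp add: p_def)
    ultimately have "g (p 0) $ i = 0 * g (p 0) $ i" using 0 by (metis carrier_vecD index_smult_vec(1))
    then show ?case by simp
  next
    case (Suc q)
    have c: "p q \<in> carrier_vec d" "unit_vec d q \<in> carrier_vec d" by (auto simp: p_def)
    have "p (Suc q) = p q + v $ q \<cdot>\<^sub>v unit_vec d q"
      using Suc.prems by (auto simp: p_def unit_vec_def less_Suc_eq intro!: eq_vecI)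
    then have "g (p (Suc q)) = g (p q) + v $ q \<cdot>\<^sub>v g (unit_vec d q)"
      using add[of "p q" "v $ q \<cdot>\<^sub>v unit_vec d q"] smult c by simp
    then show ?case using Suc car[OF c(1)] car[OF c(2)] by (simp add: mult.commute)
  qed
  from this[of _ d] have "g v $ i = (\<Sum>j<d. g (unit_vec d j) $ i * v $ j)" if "i < k" for i
  proof -
    have "p d = v" using v by (auto simp: p_def intro!: eq_vecI)
    then show ?thesis using \<open>\<And>i. i < k \<Longrightarrow> d \<le> d \<Longrightarrow> g (p d) $ i = _ i\<close> that by simp
  qed
  then show ?thesis
    using car[OF v] v by (intro eq_vecI) (auto simp: scalar_prod_def atLeast0LessThan)
qed

text \<open>An injective linear map of a carrier to itself is given by a square matrix with trivial
  kernel, hence by an invertible one.\<close>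

lemma linear_vec_surj:
  fixes g :: "real vec \<Rightarrow> real vec"
  assumes car: "\<And>v. v \<in> carrier_vec d \<Longrightarrow> g v \<in> carrier_vec d"
    and add: "\<And>v w. v \<in> carrier_vec d \<Longrightarrow> w \<in> carrier_vec d \<Longrightarrow> g (v + w) = g v + g w"
    and smult: "\<And>c v. v \<in> carrier_vec d \<Longrightarrow> g (c \<cdot>\<^sub>v v) = c \<cdot>\<^sub>v g v"
    and inj: "\<And>v. v \<in> carrier_vec d \<Longrightarrow> g v = 0\<^sub>v d \<Longrightarrow> v = 0\<^sub>v d"
    and w: "w \<in> carrier_vec d"
  obtains v where "v \<in> carrier_vec d" "g v = w"
proof -
  define J where "J = mat d d (\<lambda>(i,j). g (unit_vec d j) $ i)"
  have J: "J \<in> carrier_mat d d" by (simp add: J_def)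
  have gJ: "g v = J *\<^sub>v v" if "v \<in> carrier_vec d" for v
    unfolding J_def by (rule linear_vec_expand[OF car add smult that])
  have det: "Determinant.det J \<noteq> 0"
    unfolding det_nz_iff_kernel[OF J] using inj gJ by metis
  show ?thesis
    by (rule that[of "minv J *\<^sub>v w"]) (use minv_carrier[OF J det] minv_cancel[OF J det w] w gJ in auto)
qed

lemma mat_of_vec_carrier [simp]: "mat_of_vec r c v \<in> carrier_mat r c"
  by (simp add: mat_of_vec_def)

lemma mat_of_vec_of_mat: "A \<in> carrier_mat r c \<Longrightarrow> mat_of_vec r c (vec_of_mat A) = A"
  by (rule eq_matI) (auto simp: mat_of_vec_def vec_of_mat_def index_lt_mult)

lemma vec_of_mat_of_vec: "v \<in> carrier_vec (r * c) \<Longrightarrow> vec_of_mat (mat_of_vec r c v) = v"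
proof (rule eq_vecI)
  fix i assume v: "v \<in> carrier_vec (r * c)" and i: "i < dim_vec v"
  then have "c > 0" by (intro Nat.gr0I) simp
  then show "vec_of_mat (mat_of_vec r c v) $ i = v $ i"
    using v i by (simp add: vec_of_mat_def mat_of_vec_def less_mult_imp_div_less)
qed (simp add: vec_of_mat_def mat_of_vec_def)

lemma mat_of_vec_linear:
  assumes "v \<in> carrier_vec (r * c)" "w \<in> carrier_vec (r * c)"
  shows "mat_of_vec r c (v + w) = mat_of_vec r c v + mat_of_vec r c w"
    "mat_of_vec r c (k \<cdot>\<^sub>v v) = k \<cdot>\<^sub>m mat_of_vec r c v"
  using assms by (auto simp: mat_of_vec_def index_lt_mult intro!: eq_matI)

lemma vec_of_mat_linear:
  assumes A: "A \<in> carrier_mat r c" and B: "B \<in> carrier_mat r c"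
  shows "vec_of_mat (A + B) = vec_of_mat A + vec_of_mat B" "vec_of_mat (k \<cdot>\<^sub>m A) = k \<cdot>\<^sub>v vec_of_mat A"
proof -
  have *: "i mod c < c" if "i < r * c" for i :: nat
    using that by (cases "c = 0") auto
  show "vec_of_mat (A + B) = vec_of_mat A + vec_of_mat B" "vec_of_mat (k \<cdot>\<^sub>m A) = k \<cdot>\<^sub>v vec_of_mat A"
    using A B by (auto simp: vec_of_mat_def less_mult_imp_div_less * intro!: eq_vecI)
qed

lemma vec_of_mat_zero: "vec_of_mat (0\<^sub>m r c) = 0\<^sub>v (r * c)"
proof (rule eq_vecI)
  fix i assume i: "i < dim_vec (0\<^sub>v (r * c) :: real vec)"
  then have "c > 0" by (intro Nat.gr0I) simp
  then show "vec_of_mat (0\<^sub>m r c) $ i = 0\<^sub>v (r * c) $ i"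
    using i by (simp add: vec_of_mat_def less_mult_imp_div_less)
qed (simp add: vec_of_mat_def)

text \<open>Uniqueness already makes \<open>S -> M S + S M^T\<close> injective on vectorized
  matrices; existence follows by counting dimensions, without the integral formula for the
  solution.\<close>

lemma lyapunov_solvable:
  assumes M: "M \<in> carrier_mat n n" and H: "hurwitz M" and W: "W \<in> carrier_mat n n"
  shows "\<exists>!S. S \<in> carrier_mat n n \<and> M * S + S * M\<^sup>T + W = 0\<^sub>m n n"
proof -
  let ?f = "\<lambda>S. M * S + S * M\<^sup>T"
  let ?g = "\<lambda>v. vec_of_mat (?f (mat_of_vec n n v))"
  have fc: "?f S \<in> carrier_mat n n" if "S \<in> carrier_mat n n" for S using M that by simp
  have fadd: "?f (S + R) = ?f S + ?f R" if S: "S \<in> carrier_mat n n" and R: "R \<in> carrier_mat n n" for S R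
  proof -
    have MT: "M\<^sup>T \<in> carrier_mat n n" using M by simp
    show ?thesis
      unfolding mult_add_distrib_mat[OF M S R] add_mult_distrib_mat[OF S R MT]
      by (rule eq_matI) (use M S R in simp_all)
  qed
  have fsm: "?f (k \<cdot>\<^sub>m S) = k \<cdot>\<^sub>m ?f S" if S: "S \<in> carrier_mat n n" for S k
  proof -
    have MT: "M\<^sup>T \<in> carrier_mat n n" using M by simp
    show ?thesis
      unfolding mult_smult_distrib[OF M S] mult_smult_assoc_mat[OF S MT]
      by (rule eq_matI) (use M S in \<open>simp_all add: distrib_left\<close>)
  qed
  obtain v where v: "v \<in> carrier_vec (n * n)" "?g v = vec_of_mat (- W)"
  proof (rule linear_vec_surj[of "n * n" ?g "vec_of_mat (- W)"])
    fix v :: "real vec" assume v: "v \<in> carrier_vec (n * n)"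
    show "?g v \<in> carrier_vec (n * n)" by (rule vec_of_mat_carrier[OF fc]) simp
    { fix w :: "real vec" assume w: "w \<in> carrier_vec (n * n)"
      show "?g (v + w) = ?g v + ?g w"
        unfolding mat_of_vec_linear(1)[OF v w] fadd[OF mat_of_vec_carrier mat_of_vec_carrier]
        by (rule vec_of_mat_linear[OF fc fc]) auto }
    show "?g (k \<cdot>\<^sub>v v) = k \<cdot>\<^sub>v ?g v" for k
      unfolding mat_of_vec_linear(2)[OF v v] fsm[OF mat_of_vec_carrier]
      by (rule vec_of_mat_linear[OF fc fc]) auto
    assume "?g v = 0\<^sub>v (n * n)"
    then have "?f (mat_of_vec n n v) = mat_of_vec n n (0\<^sub>v (n * n))"
      using mat_of_vec_of_mat[OF fc[OF mat_of_vec_carrier[of n n v]]] by simp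
    also have "\<dots> = 0\<^sub>m n n" by (auto simp: mat_of_vec_def index_lt_mult)
    finally have "mat_of_vec n n v = 0\<^sub>m n n" by (rule lyapunov_unique[OF M H mat_of_vec_carrier])
    then have "v = vec_of_mat (0\<^sub>m n n)" using vec_of_mat_of_vec[OF v] by metis
    also have "\<dots> = 0\<^sub>v (n * n)" by (rule vec_of_mat_zero)
    finally show "v = 0\<^sub>v (n * n)" .
  qed (use W in auto)
  let ?S = "mat_of_vec n n v"
  have "?f ?S = mat_of_vec n n (vec_of_mat (?f ?S))"
    by (rule mat_of_vec_of_mat[OF fc[OF mat_of_vec_carrier], symmetric])
  also have "\<dots> = - W" unfolding v(2) by (rule mat_of_vec_of_mat) (use W in simp)
  finally have "?f ?S = - W" .
  then have ex: "?S \<in> carrier_mat n n \<and> M * ?S + ?S * M\<^sup>T + W = 0\<^sub>m n n" using W by auto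
  have "S = R" if S: "S \<in> carrier_mat n n" "M * S + S * M\<^sup>T + W = 0\<^sub>m n n"
    and R: "R \<in> carrier_mat n n" "M * R + R * M\<^sup>T + W = 0\<^sub>m n n" for S R
  proof -
    have "?f (S - R) = (?f S + W) - (?f R + W)"
    proof -
      have MT: "M\<^sup>T \<in> carrier_mat n n" using M by simp
      show ?thesis
        unfolding mult_minus_distrib_mat[OF M S(1) R(1)] minus_mult_distrib_mat[OF S(1) R(1) MT]
        by (rule eq_matI) (use M S(1) R(1) W in simp_all)
    qed
    also have "\<dots> = 0\<^sub>m n n" unfolding S(2) R(2) by auto
    finally have d: "S - R = 0\<^sub>m n n" by (rule lyapunov_unique[OF M H minus_carrier_mat[OF R(1)]])
    show ?thesis
    proof (rule eq_matI)
      fix i j assume "i < dim_row R" "j < dim_col R"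
      then show "S $$ (i,j) = R $$ (i,j)" using arg_cong[OF d, of "\<lambda>X. X $$ (i,j)"] S(1) R(1) by simp
    qed (use S(1) R(1) in auto)
  qed
  then show ?thesis using ex by blast
qed

section \<open>Block matrices and traces\<close>

definition blk :: "real mat \<Rightarrow> real mat \<Rightarrow> real mat \<Rightarrow> real mat" where
  "blk X U V = four_block_mat X U U\<^sup>T V"

lemma blk_carrier [simp]:
  "X \<in> carrier_mat n n \<Longrightarrow> V \<in> carrier_mat n n \<Longrightarrow> blk X U V \<in> carrier_mat (2 * n) (2 * n)"
  unfolding blk_def mult_2 by (rule four_block_carrier_mat)

lemma blk_mvec:
  assumes "X \<in> carrier_mat n n" "U \<in> carrier_mat n n" "V \<in> carrier_mat n n" "y \<in> carrier_vec n" "v \<in> carrier_vec n"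
  shows "blk X U V *\<^sub>v (y @\<^sub>v v) = (X *\<^sub>v y + U *\<^sub>v v) @\<^sub>v (U\<^sup>T *\<^sub>v y + V *\<^sub>v v)"
  unfolding blk_def by (rule four_block_mat_mult_vec) (use assms in auto)

lemma blk_form:
  assumes "X \<in> carrier_mat n n" "U \<in> carrier_mat n n" "V \<in> carrier_mat n n" "y \<in> carrier_vec n" "v \<in> carrier_vec n"
  shows "(y @\<^sub>v v) \<bullet> (blk X U V *\<^sub>v (y @\<^sub>v v)) = y \<bullet> (X *\<^sub>v y) + 2 * (y \<bullet> (U *\<^sub>v v)) + v \<bullet> (V *\<^sub>v v)"
proof -
  have "(y @\<^sub>v v) \<bullet> (blk X U V *\<^sub>v (y @\<^sub>v v)) = y \<bullet> (X *\<^sub>v y + U *\<^sub>v v) + v \<bullet> (U\<^sup>T *\<^sub>v y + V *\<^sub>v v)"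
    unfolding blk_mvec[OF assms]
    by (rule scalar_prod_append[of _ n _ n]) (use assms in auto)
  moreover have "v \<bullet> (U\<^sup>T *\<^sub>v y) = y \<bullet> (U *\<^sub>v v)"
    using assms sp_mvec_swap[of y U v] by simp
  ultimately show ?thesis using assms by (simp add: sp_simps)
qed

lemma four_block_cases:
  fixes S :: "'a::zero mat"
  assumes S: "S \<in> carrier_mat (n + n) (n + n)"
  obtains S11 S12 S21 S22 where "S = four_block_mat S11 S12 S21 S22"
    "S11 \<in> carrier_mat n n" "S12 \<in> carrier_mat n n" "S21 \<in> carrier_mat n n" "S22 \<in> carrier_mat n n"
proof -
  obtain a b c d where s: "split_block S n n = (a, b, c, d)" by (metis prod_cases4)
  show ?thesis using split_block[OF s, of n n] S that by auto
qed

lemma four_block_inj: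
  assumes "four_block_mat a b c d = four_block_mat a' b' c' d'"
    "a \<in> carrier_mat n n" "b \<in> carrier_mat n n" "c \<in> carrier_mat n n" "d \<in> carrier_mat n n"
    "a' \<in> carrier_mat n n" "b' \<in> carrier_mat n n" "c' \<in> carrier_mat n n" "d' \<in> carrier_mat n n"
  shows "a = a'" "b = b'" "c = c'" "d = d'"
proof -
  have *: "four_block_mat a b c d $$ (i,j) = four_block_mat a' b' c' d' $$ (i,j)" for i j
    using assms(1) by simp
  have "a $$ (i,j) = a' $$ (i,j)" "b $$ (i,j) = b' $$ (i,j)" "c $$ (i,j) = c' $$ (i,j)" "d $$ (i,j) = d' $$ (i,j)"
    if "i < n" "j < n" for i j
    using *[of i j] *[of i "n + j"] *[of "n + i" j] *[of "n + i" "n + j"] that assms(2-) by auto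
  then show "a = a'" "b = b'" "c = c'" "d = d'" using assms(2-) by (auto intro!: eq_matI)
qed

lemma block12_blk [simp]:
  assumes "X \<in> carrier_mat n n" "U \<in> carrier_mat n n" "V \<in> carrier_mat n n"
  shows "block12 n (blk X U V) = U" "block22 n (blk X U V) = V"
  using assms by (auto simp: block12_def block22_def blk_def intro!: eq_matI)

lemma tr_sum: "tr M = (\<Sum>i<dim_row M. M $$ (i,i))"
  by (simp add: tr_def diag_mat_def interv_sum_list_conv_sum_set_nat atLeast0LessThan)

lemma tr_congruence:
  assumes H: "H \<in> carrier_mat r c" and M: "M \<in> carrier_mat c c"
  shows "tr (H * M * H\<^sup>T) = (\<Sum>i<r. row H i \<bullet> (M *\<^sub>v row H i))"
proof -
  have "(H * M * H\<^sup>T) $$ (i,i) = row H i \<bullet> (M *\<^sub>v row H i)" if i: "i < r" for i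
  proof -
    have "(H * M * H\<^sup>T) $$ (i,i) = (H * (M * H\<^sup>T)) $$ (i,i)" using H M by (simp add: mmult_assoc)
    also have "\<dots> = row H i \<bullet> col (M * H\<^sup>T) i" using H M i by simp
    also have "col (M * H\<^sup>T) i = M *\<^sub>v row H i" using H M i by (intro eq_vecI) auto
    finally show ?thesis .
  qed
  then show ?thesis using H by (simp add: tr_sum)
qed

text \<open>Writes the trace through quadratic forms, so that monotonicity and convexity of the
  forms carry over to it.\<close>

lemma tr_form:
  assumes "M \<in> carrier_mat n n"
  shows "tr M = (\<Sum>i<n. unit_vec n i \<bullet> (M *\<^sub>v unit_vec n i))"
  unfolding tr_sum using assms by (auto simp: row_def intro!: sum.cong)

section \<open>The output estimation problem\<close>

locale oe =
  fixes n m p :: nat and A C G W1 W2 P :: "real mat" and reg :: real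
  assumes std: "standing_assumptions n m p A C G W1 W2 P" and reg: "reg \<ge> 0"
begin

lemma n_pos: "1 \<le> n" and m_pos: "1 \<le> m"
  and A: "A \<in> carrier_mat n n" and C: "C \<in> carrier_mat m n" and G: "G \<in> carrier_mat p n"
  and hA: "hurwitz A" and W1: "pos_def n W1" and W2: "pos_def m W2"
  and ric: "is_riccati_sol n A C W1 W2 P"
  using std by (auto simp: standing_assumptions_def)

lemmas W1c = pos_defD(1)[OF W1]
lemmas W2c = pos_defD(1)[OF W2]

definition X :: "real mat" where
  "X = (THE S. S \<in> carrier_mat n n \<and> A * S + S * A\<^sup>T + W1 = 0\<^sub>m n n)"

definition Xi :: "real mat" where "Xi = minv X"

lemma X_ex1: "\<exists>!S. S \<in> carrier_mat n n \<and> A * S + S * A\<^sup>T + W1 = 0\<^sub>m n n"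
  by (rule lyapunov_solvable[OF A hA W1c])

lemma X: "X \<in> carrier_mat n n" and X_eq: "A * X + X * A\<^sup>T + W1 = 0\<^sub>m n n"
  using theI'[OF X_ex1] by (auto simp: X_def)

lemma X_unique: "S \<in> carrier_mat n n \<Longrightarrow> A * S + S * A\<^sup>T + W1 = 0\<^sub>m n n \<Longrightarrow> S = X"
  using X_ex1 X X_eq by blast

lemma X_mvec:
  assumes v: "v \<in> carrier_vec n"
  shows "A *\<^sub>v (X *\<^sub>v v) + X *\<^sub>v (A\<^sup>T *\<^sub>v v) + W1 *\<^sub>v v = 0\<^sub>v n"
  using arg_cong[OF X_eq, of "\<lambda>M. M *\<^sub>v v"] v A X W1c by (simp add: mvec_simps zero_mvec)

lemma X_sym: "X\<^sup>T = X"
proof (rule X_unique)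
  have "(A * X + X * A\<^sup>T + W1)\<^sup>T = 0\<^sub>m n n" using X_eq by simp
  moreover have "(A * X + X * A\<^sup>T + W1)\<^sup>T = A * X\<^sup>T + X\<^sup>T * A\<^sup>T + W1"
    using A X W1c pos_defD(2)[OF W1] by (auto simp: mtrans intro!: comm_add_mat[of _ n n])
  ultimately show "A * X\<^sup>T + X\<^sup>T * A\<^sup>T + W1 = 0\<^sub>m n n" by simp
qed (use X in simp)

lemma sym_X: "sym_mat n X" using X X_sym by (simp add: sym_mat_def)

text \<open>The Lyapunov equation of \<open>X\<close> tested at \<open>r\<close>. It translates
  between \<open>W1\<close> and the pair \<open>A\<close>, \<open>X\<close>, and is what makes the
  quadratic term of \<open>lmi\<close> carry the weight \<open>W1\<close>.\<close>

lemma W1_form: "r \<in> carrier_vec n \<Longrightarrow> r \<bullet> (W1 *\<^sub>v r) = - 2 * ((X *\<^sub>v r) \<bullet> (A\<^sup>T *\<^sub>v r))"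
proof -
  assume r: "r \<in> carrier_vec n"
  have "r \<bullet> (A *\<^sub>v (X *\<^sub>v r) + X *\<^sub>v (A\<^sup>T *\<^sub>v r) + W1 *\<^sub>v r) = 0"
    unfolding X_mvec[OF r] using r by simp
  then have "r \<bullet> (A *\<^sub>v (X *\<^sub>v r)) + r \<bullet> (X *\<^sub>v (A\<^sup>T *\<^sub>v r)) + r \<bullet> (W1 *\<^sub>v r) = 0"
    using r A X W1c by (simp add: sp_simps)
  moreover have "r \<bullet> (A *\<^sub>v (X *\<^sub>v r)) = (X *\<^sub>v r) \<bullet> (A\<^sup>T *\<^sub>v r)"
    using r A X by (intro sp_mvec_swap) auto
  moreover have "r \<bullet> (X *\<^sub>v (A\<^sup>T *\<^sub>v r)) = (X *\<^sub>v r) \<bullet> (A\<^sup>T *\<^sub>v r)"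
    using r A X X_sym sp_mvec_left[of r X "A\<^sup>T *\<^sub>v r"] by simp
  ultimately show ?thesis by simp
qed

text \<open>Semidefiniteness is the Lyapunov comparison. A null vector of \<open>X\<close> would by
  \<open>W1_form\<close> annihilate the form of \<open>W1\<close>, which is definite.\<close>

lemma pos_def_X: "pos_def n X"
proof -
  have psd: "pos_semidef n X"
    unfolding pos_semidef_def
  proof (intro conjI ballI sym_X)
    fix v :: "real vec" assume v: "v \<in> carrier_vec n"
    show "0 \<le> v \<bullet> (X *\<^sub>v v)"
    proof (rule lyapunov_nonneg[OF A hA X _ v])
      fix r :: "real vec" assume r: "r \<in> carrier_vec n"
      have "(A * X + X * A\<^sup>T) *\<^sub>v r + W1 *\<^sub>v r = 0\<^sub>v n"
        using X_mvec[OF r] r A X by (simp add: mvec_simps)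
      then have "r \<bullet> ((A * X + X * A\<^sup>T) *\<^sub>v r + W1 *\<^sub>v r) = 0" using r by simp
      then have "r \<bullet> ((A * X + X * A\<^sup>T) *\<^sub>v r) + r \<bullet> (W1 *\<^sub>v r) = 0"
        using r A X W1c by (simp add: sp_simps)
      then show "r \<bullet> ((A * X + X * A\<^sup>T) *\<^sub>v r) \<le> 0" using pos_def_ge_0[OF W1 r] by simp
    qed
  qed
  show ?thesis
    unfolding pos_def_def
  proof (intro conjI ballI impI sym_X)
    fix v :: "real vec" assume v: "v \<in> carrier_vec n" "v \<noteq> 0\<^sub>v n"
    have "v \<bullet> (X *\<^sub>v v) \<noteq> 0"
    proof
      assume "v \<bullet> (X *\<^sub>v v) = 0"
      then have "X *\<^sub>v v = 0\<^sub>v n" by (rule pos_semidef_kernel[OF psd v(1)])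
      then have "v \<bullet> (W1 *\<^sub>v v) = 0" using W1_form[OF v(1)] v A by simp
      then show False using pos_defD(5)[OF W1 v] by simp
    qed
    moreover have "0 \<le> v \<bullet> (X *\<^sub>v v)" using psd v by (simp add: pos_semidef_def)
    ultimately show "0 < v \<bullet> (X *\<^sub>v v)" by simp
  qed
qed

lemmas detX = pos_defD(4)[OF pos_def_X]

lemma pos_def_Xi: "pos_def n Xi"
  unfolding Xi_def by (rule pos_def_minv[OF pos_def_X])

lemmas Xi = pos_defD(1)[OF pos_def_Xi]
lemmas Xi_sym = pos_defD(2)[OF pos_def_Xi]

lemma Xi_mvec: "v \<in> carrier_vec n \<Longrightarrow> X *\<^sub>v (Xi *\<^sub>v v) = v" "v \<in> carrier_vec n \<Longrightarrow> Xi *\<^sub>v (X *\<^sub>v v) = v"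
  unfolding Xi_def using minv_cancel[OF X detX] by auto

text \<open>
  For \<open>\<Sigma> = blk X U V\<close>, \<open>res12\<close> is the upper right block of the residual of the Lyapunov equation, and
  \<open>res22\<close> is the quadratic form of its lower right block. If \<open>res12\<close> vanishes, then \<open>lmi\<close> at the pair
  \<open>(\<Theta>, \<Psi>)\<close> is \<open>res22\<close> in the variable \<open>u = \<Delta>\<^sup>-\<^sup>1 U\<^sup>T v\<close>.
\<close>

definition schur :: "real mat \<Rightarrow> real mat \<Rightarrow> real mat" where
  "schur U V = V - U\<^sup>T * Xi * U"

definition res12 :: "real mat \<Rightarrow> real mat \<Rightarrow> real mat \<Rightarrow> real mat" where
  "res12 U Ak B = A * U + X * C\<^sup>T * B\<^sup>T + U * Ak\<^sup>T"

definition res22 :: "real mat \<Rightarrow> real mat \<Rightarrow> real mat \<Rightarrow> real mat \<Rightarrow> real vec \<Rightarrow> real" where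
  "res22 U V Ak B u = 2 * (u \<bullet> (Ak *\<^sub>v (V *\<^sub>v u))) + 2 * (u \<bullet> (B *\<^sub>v (C *\<^sub>v (U *\<^sub>v u)))) +
     (B\<^sup>T *\<^sub>v u) \<bullet> (W2 *\<^sub>v (B\<^sup>T *\<^sub>v u))"

definition lmi :: "real mat \<Rightarrow> real mat \<Rightarrow> real vec \<Rightarrow> real" where
  "lmi Th Ps v = - 2 * (v \<bullet> (Th *\<^sub>v (A\<^sup>T *\<^sub>v v))) - 2 * (v \<bullet> (Ps *\<^sub>v (C *\<^sub>v (X *\<^sub>v v)))) +
     (Xi *\<^sub>v (Th *\<^sub>v v)) \<bullet> (W1 *\<^sub>v (Xi *\<^sub>v (Th *\<^sub>v v))) + (Ps\<^sup>T *\<^sub>v v) \<bullet> (W2 *\<^sub>v (Ps\<^sup>T *\<^sub>v v))"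

text \<open>For \<open>T = Z^{-1}\<close> and \<open>H = C_K U^T\<close> the sum over rows is
  \<open>tr(G X G^T) - 2 tr(G H^T) + tr(H T H^T)\<close>, the estimation loss with \<open>V\<close>
  and \<open>C_K\<close> eliminated.\<close>

definition cost :: "real mat \<Rightarrow> real mat \<Rightarrow> real" where
  "cost T H = (\<Sum>i<p. row G i \<bullet> (X *\<^sub>v row G i) - 2 * (row G i \<bullet> row H i) + row H i \<bullet> (T *\<^sub>v row H i)) + reg * tr T"

lemma schur_carrier: "U \<in> carrier_mat n n \<Longrightarrow> V \<in> carrier_mat n n \<Longrightarrow> schur U V \<in> carrier_mat n n"
  unfolding schur_def by (rule carrier_intros Xi | assumption)+

lemma schur_sym: "U \<in> carrier_mat n n \<Longrightarrow> sym_mat n V \<Longrightarrow> sym_mat n (schur U V)"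
proof -
  assume U: "U \<in> carrier_mat n n" and V: "sym_mat n V"
  have Vc: "V \<in> carrier_mat n n" "V\<^sup>T = V" using V by (auto simp: sym_mat_def)
  have "(schur U V)\<^sup>T = schur U V"
    unfolding schur_def using U Vc Xi Xi_sym by (simp add: mtrans mmult_assoc)
  then show ?thesis using schur_carrier[OF U Vc(1)] by (simp add: sym_mat_def)
qed

lemma schur_mvec:
  assumes "U \<in> carrier_mat n n" "V \<in> carrier_mat n n" "v \<in> carrier_vec n"
  shows "V *\<^sub>v v = schur U V *\<^sub>v v + U\<^sup>T *\<^sub>v (Xi *\<^sub>v (U *\<^sub>v v))"
  using assms Xi by (auto simp: schur_def mvec_simps intro!: eq_vecI)

text \<open>Completion of the square in \<open>y\<close>. The first term vanishes at
  \<open>y = - X^{-1} U v\<close>, which is how the Schur complement inherits properties of the full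
  matrix.\<close>

lemma blk_form_schur:
  assumes U: "U \<in> carrier_mat n n" and V: "V \<in> carrier_mat n n" and y: "y \<in> carrier_vec n" and v: "v \<in> carrier_vec n"
  shows "(y @\<^sub>v v) \<bullet> (blk X U V *\<^sub>v (y @\<^sub>v v)) =
    (y + Xi *\<^sub>v (U *\<^sub>v v)) \<bullet> (X *\<^sub>v (y + Xi *\<^sub>v (U *\<^sub>v v))) + v \<bullet> (schur U V *\<^sub>v v)"
proof -
  let ?r = "Xi *\<^sub>v (U *\<^sub>v v)"
  have r: "?r \<in> carrier_vec n" using U v Xi by simp
  have Xr: "X *\<^sub>v ?r = U *\<^sub>v v" using Xi_mvec(1)[of "U *\<^sub>v v"] U v by simp
  have 1: "?r \<bullet> (X *\<^sub>v y) = y \<bullet> (U *\<^sub>v v)"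
    using sym_mat_swap[OF sym_X r y] by (simp add: Xr)
  have 2: "?r \<bullet> (U *\<^sub>v v) = v \<bullet> (U\<^sup>T *\<^sub>v ?r)" using U v r Xi by (intro sp_mvec_swap) auto
  show ?thesis
    unfolding blk_form[OF X U V y v] schur_mvec[OF U V v]
    using U V X Xi y v schur_carrier[OF U V] Xr 1 2 by (simp add: mvec_simps sp_simps)
qed

lemma pos_def_blk:
  assumes U: "U \<in> carrier_mat n n" and V: "sym_mat n V" and D: "pos_def n (schur U V)"
  shows "pos_def (2 * n) (blk X U V)"
  unfolding pos_def_def
proof (intro conjI ballI impI)
  have Vc: "V \<in> carrier_mat n n" "V\<^sup>T = V" using V by (auto simp: sym_mat_def)
  show "sym_mat (2 * n) (blk X U V)"
    unfolding sym_mat_def using X U Vc X_sym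
    by (simp add: blk_def transpose_four_block_mat[of _ n n _ n _ n] mult_2)
  fix w :: "real vec" assume w: "w \<in> carrier_vec (2 * n)" "w \<noteq> 0\<^sub>v (2 * n)"
  define y where "y = vec_first w n"
  define v where "v = vec_last w n"
  have yv: "y \<in> carrier_vec n" "v \<in> carrier_vec n" "w = y @\<^sub>v v"
    using w(1) by (auto simp: y_def v_def mult_2)
  let ?r = "Xi *\<^sub>v (U *\<^sub>v v)"
  have r: "y + ?r \<in> carrier_vec n" using U yv Xi by simp
  show "0 < w \<bullet> (blk X U V *\<^sub>v w)"
  proof (cases "v = 0\<^sub>v n")
    case True
    then have "y \<noteq> 0\<^sub>v n" using w(2) yv by (auto simp: mult_2)
    moreover have "y + ?r = y" using True U Xi yv by (simp add: mvec_zero)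
    ultimately show ?thesis
      unfolding yv(3) blk_form_schur[OF U Vc(1) yv(1,2)]
      using pos_defD(5)[OF pos_def_X yv(1)] pos_def_ge_0[OF D yv(2)] by simp
  next
    case False
    then show ?thesis
      unfolding yv(3) blk_form_schur[OF U Vc(1) yv(1,2)]
      using pos_defD(5)[OF D yv(2)] pos_def_ge_0[OF pos_def_X r] by simp
  qed
qed

lemma pos_def_schur:
  assumes U: "U \<in> carrier_mat n n" and V: "sym_mat n V" and S: "pos_def (2 * n) (blk X U V)"
  shows "pos_def n (schur U V)"
  unfolding pos_def_def
proof (intro conjI ballI impI schur_sym U V)
  have Vc: "V \<in> carrier_mat n n" using V by (auto simp: sym_mat_def)
  fix v :: "real vec" assume v: "v \<in> carrier_vec n" "v \<noteq> 0\<^sub>v n"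
  let ?r = "Xi *\<^sub>v (U *\<^sub>v v)"
  have r: "?r \<in> carrier_vec n" using U v Xi by simp
  have "(- ?r) @\<^sub>v v \<in> carrier_vec (2 * n)" using r v by (simp add: mult_2)
  moreover have "(- ?r) @\<^sub>v v \<noteq> 0\<^sub>v (2 * n)"
  proof
    assume "(- ?r) @\<^sub>v v = 0\<^sub>v (2 * n)"
    also have "0\<^sub>v (2 * n) = 0\<^sub>v n @\<^sub>v (0\<^sub>v n :: real vec)" by (auto simp: mult_2)
    finally show False using r v append_vec_eq[of "- ?r" n "0\<^sub>v n" v "0\<^sub>v n"] by simp
  qed
  ultimately have "0 < ((- ?r) @\<^sub>v v) \<bullet> (blk X U V *\<^sub>v ((- ?r) @\<^sub>v v))" using S by (auto simp: pos_def_def)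
  also have "\<dots> = v \<bullet> (schur U V *\<^sub>v v)"
    using blk_form_schur[OF U Vc, of "- ?r" v] r v X by (simp add: mvec_zero)
  finally show "0 < v \<bullet> (schur U V *\<^sub>v v)" .
qed

end

lemma hurwitzI:
  assumes M: "M \<in> carrier_mat n n"
    and neg: "\<And>\<alpha> \<beta> a b. real_eigenpair n M \<alpha> \<beta> a b \<Longrightarrow> \<alpha> < 0"
  shows "hurwitz M"
  unfolding hurwitz_def using eigenvalue_iff_real_eigenpair[OF M] neg by blast

lemma append_vec_zero: "0\<^sub>v n @\<^sub>v 0\<^sub>v m = (0\<^sub>v (n + m) :: real vec)"
  by (auto intro!: eq_vecI)

lemma append_vec_smult: "k \<cdot>\<^sub>v (v @\<^sub>v w) = (k \<cdot>\<^sub>v v) @\<^sub>v (k \<cdot>\<^sub>v w)"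
  by (auto intro!: eq_vecI)

lemma append_vec_minus:
  assumes "dim_vec v = dim_vec v'" "dim_vec w = dim_vec w'"
  shows "(v @\<^sub>v w) - (v' @\<^sub>v w') = (v - v') @\<^sub>v (w - (w' :: real vec))"
  using assms by (auto intro!: eq_vecI)

context oe begin

definition Th :: "real mat \<Rightarrow> real mat \<Rightarrow> real mat" where
  "Th U V = U * minv (schur U V) * U\<^sup>T"

definition Ps :: "real mat \<Rightarrow> real mat \<Rightarrow> real mat \<Rightarrow> real mat" where
  "Ps U V B = U * minv (schur U V) * B"

lemma res12_carrier: "U \<in> carrier_mat n n \<Longrightarrow> Ak \<in> carrier_mat n n \<Longrightarrow> B \<in> carrier_mat n m \<Longrightarrow> res12 U Ak B \<in> carrier_mat n n"
  unfolding res12_def by (rule carrier_intros A X C | assumption)+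

text \<open>The vanishing residual and its transpose, each solved for the term that contains
  \<open>Ak\<close>.\<close>

lemma res12_mvec:
  assumes U: "U \<in> carrier_mat n n" and Ak: "Ak \<in> carrier_mat n n" and B: "B \<in> carrier_mat n m"
    and 0: "res12 U Ak B = 0\<^sub>m n n" and v: "v \<in> carrier_vec n"
  shows "U *\<^sub>v (Ak\<^sup>T *\<^sub>v v) = - (A *\<^sub>v (U *\<^sub>v v)) - X *\<^sub>v (C\<^sup>T *\<^sub>v (B\<^sup>T *\<^sub>v v))"
    "Ak *\<^sub>v (U\<^sup>T *\<^sub>v v) = - (U\<^sup>T *\<^sub>v (A\<^sup>T *\<^sub>v v)) - B *\<^sub>v (C *\<^sub>v (X *\<^sub>v v))"
proof -
  have e: "A *\<^sub>v (U *\<^sub>v v) + X *\<^sub>v (C\<^sup>T *\<^sub>v (B\<^sup>T *\<^sub>v v)) + U *\<^sub>v (Ak\<^sup>T *\<^sub>v v) = 0\<^sub>v n"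
    using arg_cong[OF 0, of "\<lambda>M. M *\<^sub>v v"] U Ak B A X C v by (simp add: res12_def mvec_simps zero_mvec)
  show "U *\<^sub>v (Ak\<^sup>T *\<^sub>v v) = - (A *\<^sub>v (U *\<^sub>v v)) - X *\<^sub>v (C\<^sup>T *\<^sub>v (B\<^sup>T *\<^sub>v v))"
  proof (rule eq_vecI)
    fix i assume "i < dim_vec (- (A *\<^sub>v (U *\<^sub>v v)) - X *\<^sub>v (C\<^sup>T *\<^sub>v (B\<^sup>T *\<^sub>v v)))"
    then show "(U *\<^sub>v (Ak\<^sup>T *\<^sub>v v)) $ i = (- (A *\<^sub>v (U *\<^sub>v v)) - X *\<^sub>v (C\<^sup>T *\<^sub>v (B\<^sup>T *\<^sub>v v))) $ i"
      using arg_cong[OF e, of "\<lambda>w. w $ i"] U A X by (simp del: index_mult_mat_vec)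
  qed (use U X in simp)
  have "(res12 U Ak B)\<^sup>T = 0\<^sub>m n n" using 0 by simp
  moreover have "(res12 U Ak B)\<^sup>T = U\<^sup>T * A\<^sup>T + B * (C * X) + Ak * U\<^sup>T"
    unfolding res12_def using U Ak B A X C X_sym by (simp add: mtrans mmult_assoc)
  ultimately have "(U\<^sup>T * A\<^sup>T + B * (C * X) + Ak * U\<^sup>T) *\<^sub>v v = 0\<^sub>v n" using v by (simp add: zero_mvec)
  then have e: "U\<^sup>T *\<^sub>v (A\<^sup>T *\<^sub>v v) + B *\<^sub>v (C *\<^sub>v (X *\<^sub>v v)) + Ak *\<^sub>v (U\<^sup>T *\<^sub>v v) = 0\<^sub>v n"
    using U Ak B A X C v by (simp add: mvec_simps)
  show "Ak *\<^sub>v (U\<^sup>T *\<^sub>v v) = - (U\<^sup>T *\<^sub>v (A\<^sup>T *\<^sub>v v)) - B *\<^sub>v (C *\<^sub>v (X *\<^sub>v v))"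
  proof (rule eq_vecI)
    fix i assume "i < dim_vec (- (U\<^sup>T *\<^sub>v (A\<^sup>T *\<^sub>v v)) - B *\<^sub>v (C *\<^sub>v (X *\<^sub>v v)))"
    then show "(Ak *\<^sub>v (U\<^sup>T *\<^sub>v v)) $ i = (- (U\<^sup>T *\<^sub>v (A\<^sup>T *\<^sub>v v)) - B *\<^sub>v (C *\<^sub>v (X *\<^sub>v v))) $ i"
      using arg_cong[OF e, of "\<lambda>w. w $ i"] U Ak B by (simp del: index_mult_mat_vec)
  qed (use Ak B in simp)
qed

text \<open>Put \<open>s = U u\<close> and \<open>r = X^{-1} s\<close>, so that
  \<open>V u = U^T (v + r)\<close>. The transposed residual equation replaces \<open>Ak V u\<close>
  by terms in \<open>A\<close>, \<open>B\<close>, \<open>C\<close>, \<open>X\<close>; the terms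
  \<open>(B^T u) . C s\<close> cancel, and \<open>- 2 s . A^T r\<close> is the form of
  \<open>W1\<close> at \<open>r\<close>. What remains sees \<open>U\<close>, \<open>V\<close>,
  \<open>B\<close> only through \<open>\<Theta>\<close> and \<open>\<Psi>\<close>.\<close>

lemma lmi_eq_res22:
  assumes U: "U \<in> carrier_mat n n" and V: "sym_mat n V" and Ak: "Ak \<in> carrier_mat n n" and B: "B \<in> carrier_mat n m"
    and det: "Determinant.det (schur U V) \<noteq> 0" and 0: "res12 U Ak B = 0\<^sub>m n n" and v: "v \<in> carrier_vec n"
  shows "lmi (Th U V) (Ps U V B) v = res22 U V Ak B (minv (schur U V) *\<^sub>v (U\<^sup>T *\<^sub>v v))"
proof -
  have Vc: "V \<in> carrier_mat n n" using V by (simp add: sym_mat_def)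
  note Dc = schur_carrier[OF U Vc]
  define N where "N = minv (schur U V)"
  have N: "N \<in> carrier_mat n n" "N\<^sup>T = N"
    using sym_mat_minv[OF schur_sym[OF U V] det] by (auto simp: sym_mat_def N_def)
  define u where "u = N *\<^sub>v (U\<^sup>T *\<^sub>v v)"
  define s where "s = U *\<^sub>v u"
  define r where "r = Xi *\<^sub>v s"
  have UTv: "U\<^sup>T *\<^sub>v v \<in> carrier_vec n" using U v by simp
  have u: "u \<in> carrier_vec n" using N U v by (simp add: u_def)
  have s: "s \<in> carrier_vec n" using U u by (simp add: s_def)
  have r: "r \<in> carrier_vec n" using Xi s by (simp add: r_def)
  have Xr: "X *\<^sub>v r = s" using Xi_mvec(1)[OF s] by (simp add: r_def)
  have Thv: "Th U V *\<^sub>v v = s" unfolding Th_def N_def[symmetric] s_def u_def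
    using U N(1) v by (simp add: mult_mvec)
  have ThT: "(Th U V)\<^sup>T = Th U V" unfolding Th_def N_def[symmetric] using U N by (simp add: mtrans mmult_assoc)
  have Thc: "Th U V \<in> carrier_mat n n" unfolding Th_def N_def[symmetric] by (rule carrier_intros U N)+
  have Psc: "Ps U V B \<in> carrier_mat n m" unfolding Ps_def N_def[symmetric] by (rule carrier_intros U N B)+
  have Psv: "(Ps U V B)\<^sup>T *\<^sub>v v = B\<^sup>T *\<^sub>v u" unfolding Ps_def N_def[symmetric] u_def
    using U N B v by (simp add: mtrans mmult_assoc mult_mvec)
  have 1: "v \<bullet> (Th U V *\<^sub>v (A\<^sup>T *\<^sub>v v)) = s \<bullet> (A\<^sup>T *\<^sub>v v)"
    using sp_mvec_left[of v "Th U V" "A\<^sup>T *\<^sub>v v"] Thc v A by (simp add: ThT Thv)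
  have 2: "v \<bullet> (Ps U V B *\<^sub>v (C *\<^sub>v (X *\<^sub>v v))) = (B\<^sup>T *\<^sub>v u) \<bullet> (C *\<^sub>v (X *\<^sub>v v))"
    using sp_mvec_left[of v "(Ps U V B)\<^sup>T" "C *\<^sub>v (X *\<^sub>v v)"] Psc v C X by (simp add: Psv)
  have 3: "r \<bullet> (W1 *\<^sub>v r) = - 2 * (s \<bullet> (A\<^sup>T *\<^sub>v r))" using W1_form[OF r] by (simp add: Xr)
  have "schur U V *\<^sub>v u = U\<^sup>T *\<^sub>v v"
    unfolding u_def N_def by (rule minv_cancel(1)[OF Dc det UTv])
  then have "V *\<^sub>v u = U\<^sup>T *\<^sub>v v + U\<^sup>T *\<^sub>v r"
    using schur_mvec[OF U Vc u] by (simp add: s_def[symmetric] r_def[symmetric])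
  then have Vu: "V *\<^sub>v u = U\<^sup>T *\<^sub>v (v + r)" using U v r by (simp add: mvec_add)
  have "Ak *\<^sub>v (V *\<^sub>v u) = - (U\<^sup>T *\<^sub>v (A\<^sup>T *\<^sub>v (v + r))) - B *\<^sub>v (C *\<^sub>v (X *\<^sub>v (v + r)))"
    unfolding Vu by (rule res12_mvec(2)[OF U Ak B 0]) (use v r in simp)
  then have "u \<bullet> (Ak *\<^sub>v (V *\<^sub>v u)) =
    - (u \<bullet> (U\<^sup>T *\<^sub>v (A\<^sup>T *\<^sub>v (v + r)))) - u \<bullet> (B *\<^sub>v (C *\<^sub>v (X *\<^sub>v (v + r))))"
    using u U B by (simp add: sp_simps)
  also have "u \<bullet> (U\<^sup>T *\<^sub>v (A\<^sup>T *\<^sub>v (v + r))) = s \<bullet> (A\<^sup>T *\<^sub>v v) + s \<bullet> (A\<^sup>T *\<^sub>v r)"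
    unfolding s_def using sp_mvec_left[of u U "A\<^sup>T *\<^sub>v (v + r)"] u U A v r by (simp add: mvec_add sp_simps)
  also have "u \<bullet> (B *\<^sub>v (C *\<^sub>v (X *\<^sub>v (v + r)))) = (B\<^sup>T *\<^sub>v u) \<bullet> (C *\<^sub>v (X *\<^sub>v v)) + (B\<^sup>T *\<^sub>v u) \<bullet> (C *\<^sub>v s)"
    using sp_mvec_left[of u "B\<^sup>T" "C *\<^sub>v (X *\<^sub>v (v + r))"] u B C X v r s by (simp add: mvec_add sp_simps Xr)
  finally have 4: "u \<bullet> (Ak *\<^sub>v (V *\<^sub>v u)) = - (s \<bullet> (A\<^sup>T *\<^sub>v v)) - s \<bullet> (A\<^sup>T *\<^sub>v r)
    - (B\<^sup>T *\<^sub>v u) \<bullet> (C *\<^sub>v (X *\<^sub>v v)) - (B\<^sup>T *\<^sub>v u) \<bullet> (C *\<^sub>v s)" by simp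
  have 5: "u \<bullet> (B *\<^sub>v (C *\<^sub>v (U *\<^sub>v u))) = (B\<^sup>T *\<^sub>v u) \<bullet> (C *\<^sub>v s)"
    using sp_mvec_left[of u "B\<^sup>T" "C *\<^sub>v s"] u B C s by (simp add: s_def)
  show ?thesis
    unfolding lmi_def res22_def N_def[symmetric] u_def[symmetric] Psv Thv r_def[symmetric] 1 2 3 4 5 by simp
qed

section \<open>The closed loop Lyapunov equation by blocks\<close>

definition acl :: "real mat \<Rightarrow> real mat \<Rightarrow> real mat" where
  "acl Ak B = four_block_mat A (0\<^sub>m n n) (B * C) Ak"

definition wcl :: "real mat \<Rightarrow> real mat" where
  "wcl B = four_block_mat W1 (0\<^sub>m n n) (0\<^sub>m n n) (B * W2 * B\<^sup>T)"

lemma A_cl_eq: "A_cl A C (Ak, B, Ck) = acl Ak B" and W_cl_eq: "W_cl W1 W2 (Ak, B, Ck) = wcl B"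
  using A W1c by (auto simp: acl_def wcl_def)

lemma acl_carrier: "Ak \<in> carrier_mat n n \<Longrightarrow> acl Ak B \<in> carrier_mat (2 * n) (2 * n)"
  unfolding acl_def mult_2 using A by (rule four_block_carrier_mat)

lemma wcl_carrier: "B \<in> carrier_mat n m \<Longrightarrow> wcl B \<in> carrier_mat (2 * n) (2 * n)"
  unfolding wcl_def mult_2 by (rule four_block_carrier_mat[OF W1c] carrier_intros W2c | assumption)+

lemma acl_mvec:
  assumes Ak: "Ak \<in> carrier_mat n n" and B: "B \<in> carrier_mat n m" and y: "y \<in> carrier_vec n" and v: "v \<in> carrier_vec n"
  shows "acl Ak B *\<^sub>v (y @\<^sub>v v) = (A *\<^sub>v y) @\<^sub>v (B *\<^sub>v (C *\<^sub>v y) + Ak *\<^sub>v v)"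
    "(acl Ak B)\<^sup>T *\<^sub>v (y @\<^sub>v v) = (A\<^sup>T *\<^sub>v y + C\<^sup>T *\<^sub>v (B\<^sup>T *\<^sub>v v)) @\<^sub>v (Ak\<^sup>T *\<^sub>v v)"
    "(y @\<^sub>v v) \<bullet> (wcl B *\<^sub>v (y @\<^sub>v v)) = y \<bullet> (W1 *\<^sub>v y) + (B\<^sup>T *\<^sub>v v) \<bullet> (W2 *\<^sub>v (B\<^sup>T *\<^sub>v v))"
proof -
  have BC: "B * C \<in> carrier_mat n n" using B C by simp
  have "acl Ak B *\<^sub>v (y @\<^sub>v v) = (A *\<^sub>v y + 0\<^sub>m n n *\<^sub>v v) @\<^sub>v ((B * C) *\<^sub>v y + Ak *\<^sub>v v)"
    unfolding acl_def by (rule four_block_mat_mult_vec) (use A BC Ak y v in auto)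
  then show "acl Ak B *\<^sub>v (y @\<^sub>v v) = (A *\<^sub>v y) @\<^sub>v (B *\<^sub>v (C *\<^sub>v y) + Ak *\<^sub>v v)"
    using A B C Ak y v by (simp add: zero_mvec mult_mvec)
  have T: "(acl Ak B)\<^sup>T = four_block_mat A\<^sup>T (B * C)\<^sup>T (0\<^sub>m n n) Ak\<^sup>T"
    unfolding acl_def using transpose_four_block_mat[of A n n "0\<^sub>m n n" n "B * C" n Ak] A BC Ak by simp
  have "(acl Ak B)\<^sup>T *\<^sub>v (y @\<^sub>v v) = (A\<^sup>T *\<^sub>v y + (B * C)\<^sup>T *\<^sub>v v) @\<^sub>v (0\<^sub>m n n *\<^sub>v y + Ak\<^sup>T *\<^sub>v v)"
    unfolding T by (rule four_block_mat_mult_vec) (use A BC Ak y v in auto)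
  then show "(acl Ak B)\<^sup>T *\<^sub>v (y @\<^sub>v v) = (A\<^sup>T *\<^sub>v y + C\<^sup>T *\<^sub>v (B\<^sup>T *\<^sub>v v)) @\<^sub>v (Ak\<^sup>T *\<^sub>v v)"
    using A B C Ak y v by (simp add: zero_mvec mult_mvec mtrans)
  have BWB: "B * W2 * B\<^sup>T \<in> carrier_mat n n" by (rule carrier_intros B W2c)+
  have "wcl B *\<^sub>v (y @\<^sub>v v) = (W1 *\<^sub>v y + 0\<^sub>m n n *\<^sub>v v) @\<^sub>v (0\<^sub>m n n *\<^sub>v y + (B * W2 * B\<^sup>T) *\<^sub>v v)"
    unfolding wcl_def by (rule four_block_mat_mult_vec) (use W1c BWB y v in auto)
  also have "\<dots> = (W1 *\<^sub>v y) @\<^sub>v (B *\<^sub>v (W2 *\<^sub>v (B\<^sup>T *\<^sub>v v)))"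
    using W1c W2c B y v by (simp add: zero_mvec mult_mvec)
  finally have "(y @\<^sub>v v) \<bullet> (wcl B *\<^sub>v (y @\<^sub>v v)) = y \<bullet> (W1 *\<^sub>v y) + v \<bullet> (B *\<^sub>v (W2 *\<^sub>v (B\<^sup>T *\<^sub>v v)))"
    using W1c W2c B y v by (simp add: scalar_prod_append[of _ n _ n])
  moreover have "v \<bullet> (B *\<^sub>v (W2 *\<^sub>v (B\<^sup>T *\<^sub>v v))) = (B\<^sup>T *\<^sub>v v) \<bullet> (W2 *\<^sub>v (B\<^sup>T *\<^sub>v v))"
    using sp_mvec_left[of v "B\<^sup>T" "W2 *\<^sub>v (B\<^sup>T *\<^sub>v v)"] v B W2c by simp
  ultimately show "(y @\<^sub>v v) \<bullet> (wcl B *\<^sub>v (y @\<^sub>v v)) = y \<bullet> (W1 *\<^sub>v y) + (B\<^sup>T *\<^sub>v v) \<bullet> (W2 *\<^sub>v (B\<^sup>T *\<^sub>v v))"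
    by simp
qed

text \<open>The second part is the rigidity used on null vectors and on the imaginary axis: where
  the noise form vanishes, the system component is zero and the filter component is invisible to
  \<open>B^T\<close>.\<close>

lemma wcl_form_ge_0:
  assumes B: "B \<in> carrier_mat n m" and y: "y \<in> carrier_vec n" and v: "v \<in> carrier_vec n"
  shows "y \<bullet> (W1 *\<^sub>v y) + (B\<^sup>T *\<^sub>v v) \<bullet> (W2 *\<^sub>v (B\<^sup>T *\<^sub>v v)) \<ge> 0"
    "y \<bullet> (W1 *\<^sub>v y) + (B\<^sup>T *\<^sub>v v) \<bullet> (W2 *\<^sub>v (B\<^sup>T *\<^sub>v v)) = 0 \<Longrightarrow> y = 0\<^sub>v n \<and> B\<^sup>T *\<^sub>v v = 0\<^sub>v m"
proof -
  have Bv: "B\<^sup>T *\<^sub>v v \<in> carrier_vec m" using B v by simp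
  note a = pos_def_ge_0[OF W1 y] and b = pos_def_ge_0[OF W2 Bv]
  show "y \<bullet> (W1 *\<^sub>v y) + (B\<^sup>T *\<^sub>v v) \<bullet> (W2 *\<^sub>v (B\<^sup>T *\<^sub>v v)) \<ge> 0" using a b by simp
  assume "y \<bullet> (W1 *\<^sub>v y) + (B\<^sup>T *\<^sub>v v) \<bullet> (W2 *\<^sub>v (B\<^sup>T *\<^sub>v v)) = 0"
  then have "y \<bullet> (W1 *\<^sub>v y) = 0" "(B\<^sup>T *\<^sub>v v) \<bullet> (W2 *\<^sub>v (B\<^sup>T *\<^sub>v v)) = 0" using a b by linarith+
  then show "y = 0\<^sub>v n \<and> B\<^sup>T *\<^sub>v v = 0\<^sub>v m"
    using pos_defD(5)[OF W1 y] pos_defD(5)[OF W2 Bv] by fastforce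
qed

lemma lyap_blk:
  assumes Ak: "Ak \<in> carrier_mat n n" and B: "B \<in> carrier_mat n m"
    and S: "S \<in> carrier_mat n n" "U \<in> carrier_mat n n" "V \<in> carrier_mat n n" and ST: "S\<^sup>T = S"
  shows "acl Ak B * blk S U V + blk S U V * (acl Ak B)\<^sup>T + wcl B =
    four_block_mat (A * S + S * A\<^sup>T + W1) (A * U + S * C\<^sup>T * B\<^sup>T + U * Ak\<^sup>T) (A * U + S * C\<^sup>T * B\<^sup>T + U * Ak\<^sup>T)\<^sup>T
      ((B * C) * U + Ak * V + (U\<^sup>T * (B * C)\<^sup>T + V * Ak\<^sup>T) + B * W2 * B\<^sup>T)"
proof -
  have BC: "B * C \<in> carrier_mat n n" using B C by simp
  have BWB: "B * W2 * B\<^sup>T \<in> carrier_mat n n" by (rule carrier_intros B W2c)+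
  have T: "(acl Ak B)\<^sup>T = four_block_mat A\<^sup>T (B * C)\<^sup>T (0\<^sub>m n n) Ak\<^sup>T"
    unfolding acl_def using transpose_four_block_mat[of A n n "0\<^sub>m n n" n "B * C" n Ak] A BC Ak by simp
  have Z: "(0\<^sub>m n n :: real mat) \<in> carrier_mat n n" by simp
  have 1: "acl Ak B * blk S U V = four_block_mat (A * S + 0\<^sub>m n n * U\<^sup>T) (A * U + 0\<^sub>m n n * V)
     (B * C * S + Ak * U\<^sup>T) (B * C * U + Ak * V)"
    unfolding acl_def blk_def by (rule mult_four_block_mat[OF A Z BC Ak]) (use S in auto)
  have 2: "blk S U V * (acl Ak B)\<^sup>T = four_block_mat (S * A\<^sup>T + U * 0\<^sub>m n n) (S * (B * C)\<^sup>T + U * Ak\<^sup>T)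
     (U\<^sup>T * A\<^sup>T + V * 0\<^sub>m n n) (U\<^sup>T * (B * C)\<^sup>T + V * Ak\<^sup>T)"
    unfolding T blk_def by (rule mult_four_block_mat[of _ n n _ n _ n]) (use S A BC Ak in auto)
  have c: "A * S + 0\<^sub>m n n * U\<^sup>T \<in> carrier_mat n n" "A * U + 0\<^sub>m n n * V \<in> carrier_mat n n"
     "B * C * S + Ak * U\<^sup>T \<in> carrier_mat n n" "B * C * U + Ak * V \<in> carrier_mat n n"
     "S * A\<^sup>T + U * 0\<^sub>m n n \<in> carrier_mat n n" "S * (B * C)\<^sup>T + U * Ak\<^sup>T \<in> carrier_mat n n"
     "U\<^sup>T * A\<^sup>T + V * 0\<^sub>m n n \<in> carrier_mat n n" "U\<^sup>T * (B * C)\<^sup>T + V * Ak\<^sup>T \<in> carrier_mat n n"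
    by (rule carrier_intros A S BC Ak C B)+
  show ?thesis
    unfolding 1 2 wcl_def
    apply (subst add_four_block_mat[OF c])
    apply (subst add_four_block_mat[of _ n n _ n _ n])
    apply (use c W1c BWB in \<open>simp_all\<close>)[8]
    apply (rule cong_four_block_mat)
    using A S BC B C Ak W1c BWB ST
    by (auto simp: mtrans mmult_assoc intro!: eq_matI)
qed

lemma res22_form:
  assumes Ak: "Ak \<in> carrier_mat n n" and B: "B \<in> carrier_mat n m"
    and U: "U \<in> carrier_mat n n" and V: "sym_mat n V" and u: "u \<in> carrier_vec n"
  shows "u \<bullet> (((B * C) * U + Ak * V + (U\<^sup>T * (B * C)\<^sup>T + V * Ak\<^sup>T) + B * W2 * B\<^sup>T) *\<^sub>v u) = res22 U V Ak B u"
proof -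
  have Vc: "V \<in> carrier_mat n n" "V\<^sup>T = V" using V by (auto simp: sym_mat_def)
  have "u \<bullet> (((B * C) * U + Ak * V + (U\<^sup>T * (B * C)\<^sup>T + V * Ak\<^sup>T) + B * W2 * B\<^sup>T) *\<^sub>v u) =
    u \<bullet> (B *\<^sub>v (C *\<^sub>v (U *\<^sub>v u))) + u \<bullet> (Ak *\<^sub>v (V *\<^sub>v u)) + (u \<bullet> (U\<^sup>T *\<^sub>v (C\<^sup>T *\<^sub>v (B\<^sup>T *\<^sub>v u))) + u \<bullet> (V *\<^sub>v (Ak\<^sup>T *\<^sub>v u)))
      + u \<bullet> (B *\<^sub>v (W2 *\<^sub>v (B\<^sup>T *\<^sub>v u)))"
    using Ak B U Vc(1) u C W2c by (simp add: mvec_simps mtrans sp_simps)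
  moreover have "u \<bullet> (B *\<^sub>v (C *\<^sub>v (U *\<^sub>v u))) = u \<bullet> (U\<^sup>T *\<^sub>v (C\<^sup>T *\<^sub>v (B\<^sup>T *\<^sub>v u)))"
    using sp_mvec_swap[of u "B * (C * U)" u] B C U u by (simp add: mtrans mult_mvec mmult_assoc)
  moreover have "u \<bullet> (Ak *\<^sub>v (V *\<^sub>v u)) = u \<bullet> (V *\<^sub>v (Ak\<^sup>T *\<^sub>v u))"
    using sp_mvec_swap[of u "Ak * V" u] Ak Vc u by (simp add: mtrans mult_mvec)
  moreover have "u \<bullet> (B *\<^sub>v (W2 *\<^sub>v (B\<^sup>T *\<^sub>v u))) = (B\<^sup>T *\<^sub>v u) \<bullet> (W2 *\<^sub>v (B\<^sup>T *\<^sub>v u))"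
    using sp_mvec_left[of u "B\<^sup>T" "W2 *\<^sub>v (B\<^sup>T *\<^sub>v u)"] u B W2c by simp
  ultimately show ?thesis by (simp add: res22_def)
qed

text \<open>With \<open>X\<close> in the upper left corner and vanishing \<open>res12\<close>, three
  of the four blocks of the residual are zero, so the form sees only the lower component.\<close>

lemma lyap_blk_form:
  assumes Ak: "Ak \<in> carrier_mat n n" and B: "B \<in> carrier_mat n m"
    and U: "U \<in> carrier_mat n n" and V: "sym_mat n V" and 0: "res12 U Ak B = 0\<^sub>m n n"
    and y: "y \<in> carrier_vec n" and v: "v \<in> carrier_vec n"
  shows "(y @\<^sub>v v) \<bullet> ((acl Ak B * blk X U V + blk X U V * (acl Ak B)\<^sup>T + wcl B) *\<^sub>v (y @\<^sub>v v)) = res22 U V Ak B v"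
proof -
  have Vc: "V \<in> carrier_mat n n" using V by (auto simp: sym_mat_def)
  let ?R = "(B * C) * U + Ak * V + (U\<^sup>T * (B * C)\<^sup>T + V * Ak\<^sup>T) + B * W2 * B\<^sup>T"
  have R: "?R \<in> carrier_mat n n" by (rule carrier_intros B C U Ak Vc W2c)+
  have eq: "acl Ak B * blk X U V + blk X U V * (acl Ak B)\<^sup>T + wcl B = blk (0\<^sub>m n n) (0\<^sub>m n n) ?R"
    using lyap_blk[OF Ak B X U Vc X_sym] unfolding X_eq res12_def[symmetric] 0
    by (simp only: blk_def)
  show ?thesis
    unfolding eq using blk_form[OF _ _ R y v, of "0\<^sub>m n n" "0\<^sub>m n n"] res22_form[OF Ak B U V v] y v
    by (simp add: zero_mvec)
qed

text \<open>Block triangularity: an eigenvector with nonzero upper part yields one of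
  \<open>A\<close>, otherwise its lower part is one of \<open>Ak\<close>.\<close>

lemma hurwitz_acl:
  assumes Ak: "Ak \<in> carrier_mat n n" and B: "B \<in> carrier_mat n m" and H: "hurwitz Ak"
  shows "hurwitz (acl Ak B)"
proof (rule hurwitzI[OF acl_carrier[OF Ak]])
  fix \<alpha> \<beta> a b assume ab: "real_eigenpair (2 * n) (acl Ak B) \<alpha> \<beta> a b"
  define a1 a2 b1 b2 where d: "a1 = vec_first a n" "a2 = vec_last a n" "b1 = vec_first b n" "b2 = vec_last b n"
  have c: "a1 \<in> carrier_vec n" "a2 \<in> carrier_vec n" "b1 \<in> carrier_vec n" "b2 \<in> carrier_vec n" by (auto simp: d)
  have e: "a = a1 @\<^sub>v a2" "b = b1 @\<^sub>v b2" using ab by (auto simp: d real_eigenpair_def mult_2)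
  have BCa: "B *\<^sub>v (C *\<^sub>v a1) + Ak *\<^sub>v a2 \<in> carrier_vec n" "A *\<^sub>v a1 \<in> carrier_vec n"
      "B *\<^sub>v (C *\<^sub>v b1) + Ak *\<^sub>v b2 \<in> carrier_vec n" "A *\<^sub>v b1 \<in> carrier_vec n" using A B Ak C c by auto
  have "(A *\<^sub>v a1) @\<^sub>v (B *\<^sub>v (C *\<^sub>v a1) + Ak *\<^sub>v a2) = (\<alpha> \<cdot>\<^sub>v a1 - \<beta> \<cdot>\<^sub>v b1) @\<^sub>v (\<alpha> \<cdot>\<^sub>v a2 - \<beta> \<cdot>\<^sub>v b2)"
    "(A *\<^sub>v b1) @\<^sub>v (B *\<^sub>v (C *\<^sub>v b1) + Ak *\<^sub>v b2) = (\<beta> \<cdot>\<^sub>v a1 + \<alpha> \<cdot>\<^sub>v b1) @\<^sub>v (\<beta> \<cdot>\<^sub>v a2 + \<alpha> \<cdot>\<^sub>v b2)"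
    using ab c unfolding real_eigenpair_def e acl_mvec(1)[OF Ak B c(1,2)] acl_mvec(1)[OF Ak B c(3,4)]
    by (simp_all add: append_vec_smult append_vec_minus append_vec_add[of _ n _ _ n])
  then have 1: "A *\<^sub>v a1 = \<alpha> \<cdot>\<^sub>v a1 - \<beta> \<cdot>\<^sub>v b1" "A *\<^sub>v b1 = \<beta> \<cdot>\<^sub>v a1 + \<alpha> \<cdot>\<^sub>v b1"
    and 2: "B *\<^sub>v (C *\<^sub>v a1) + Ak *\<^sub>v a2 = \<alpha> \<cdot>\<^sub>v a2 - \<beta> \<cdot>\<^sub>v b2" "B *\<^sub>v (C *\<^sub>v b1) + Ak *\<^sub>v b2 = \<beta> \<cdot>\<^sub>v a2 + \<alpha> \<cdot>\<^sub>v b2"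
    using c BCa append_vec_eq[of "A *\<^sub>v a1" n] append_vec_eq[of "A *\<^sub>v b1" n] by auto
  show "\<alpha> < 0"
  proof (cases "a1 = 0\<^sub>v n \<and> b1 = 0\<^sub>v n")
    case False
    then have "real_eigenpair n A \<alpha> \<beta> a1 b1" using c 1 by (auto simp: real_eigenpair_def)
    then show ?thesis by (rule hurwitz_real_eigenpair[OF hA A])
  next
    case True
    have "a2 \<noteq> 0\<^sub>v n \<or> b2 \<noteq> 0\<^sub>v n"
      using ab True unfolding real_eigenpair_def e by (auto simp: append_vec_zero mult_2)
    moreover have "Ak *\<^sub>v a2 = \<alpha> \<cdot>\<^sub>v a2 - \<beta> \<cdot>\<^sub>v b2" "Ak *\<^sub>v b2 = \<beta> \<cdot>\<^sub>v a2 + \<alpha> \<cdot>\<^sub>v b2"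
      using 2 True B C Ak c by (auto simp: mvec_zero)
    ultimately have "real_eigenpair n Ak \<alpha> \<beta> a2 b2" using c by (auto simp: real_eigenpair_def)
    then show ?thesis by (rule hurwitz_real_eigenpair[OF H Ak])
  qed
qed

end

lemma linear_plus_nonneg_imp_zero:
  fixes a c :: real
  assumes "\<And>t. 0 \<le> t * a + c"
  shows "a = 0"
proof (rule ccontr)
  assume "a \<noteq> 0"
  then show False using assms[of "(- \<bar>c\<bar> - 1) / a"] by simp
qed

lemma form_add:
  fixes M :: "real mat"
  assumes "M \<in> carrier_mat n n" "N \<in> carrier_mat n n" "w \<in> carrier_vec n"
  shows "w \<bullet> ((M + N) *\<^sub>v w) = w \<bullet> (M *\<^sub>v w) + w \<bullet> (N *\<^sub>v w)"
    "w \<bullet> ((M - N) *\<^sub>v w) = w \<bullet> (M *\<^sub>v w) - w \<bullet> (N *\<^sub>v w)"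
  using assms by (simp_all add: mvec_simps sp_simps)

context oe begin

abbreviation SigK :: "filt \<Rightarrow> real mat" where "SigK K \<equiv> Sigma_K A C W1 W2 K"

lemma wcl_sym: "B \<in> carrier_mat n m \<Longrightarrow> (wcl B)\<^sup>T = wcl B"
proof -
  assume B: "B \<in> carrier_mat n m"
  have BWB: "B * W2 * B\<^sup>T \<in> carrier_mat n n" by (rule carrier_intros B W2c)+
  have "(B * W2 * B\<^sup>T)\<^sup>T = B * W2 * B\<^sup>T" using B W2c pos_defD(2)[OF W2] by (simp add: mtrans mmult_assoc)
  then show ?thesis
    unfolding wcl_def using transpose_four_block_mat[of W1 n n "0\<^sub>m n n" n "0\<^sub>m n n" n "B * W2 * B\<^sup>T"] W1c BWB pos_defD(2)[OF W1]
    by simp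
qed

lemma SigK_lyap:
  assumes Ak: "Ak \<in> carrier_mat n n" and B: "B \<in> carrier_mat n m" and H: "hurwitz Ak"
  shows "SigK (Ak, B, Ck) \<in> carrier_mat (2 * n) (2 * n)"
    "acl Ak B * SigK (Ak, B, Ck) + SigK (Ak, B, Ck) * (acl Ak B)\<^sup>T + wcl B = 0\<^sub>m (2 * n) (2 * n)"
    "\<And>S. S \<in> carrier_mat (2 * n) (2 * n) \<Longrightarrow> acl Ak B * S + S * (acl Ak B)\<^sup>T + wcl B = 0\<^sub>m (2 * n) (2 * n) \<Longrightarrow> S = SigK (Ak, B, Ck)"
proof -
  have n: "dim_row A = n" using A by simp
  note ex = lyapunov_solvable[OF acl_carrier[OF Ak] hurwitz_acl[OF Ak B H] wcl_carrier[OF B]]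
  have eq: "SigK (Ak, B, Ck) = (THE S. S \<in> carrier_mat (2 * n) (2 * n) \<and> acl Ak B * S + S * (acl Ak B)\<^sup>T + wcl B = 0\<^sub>m (2 * n) (2 * n))"
    unfolding Sigma_K_def Let_def n A_cl_eq W_cl_eq ..
  show 1: "SigK (Ak, B, Ck) \<in> carrier_mat (2 * n) (2 * n)"
    and 2: "acl Ak B * SigK (Ak, B, Ck) + SigK (Ak, B, Ck) * (acl Ak B)\<^sup>T + wcl B = 0\<^sub>m (2 * n) (2 * n)"
    using theI'[OF ex] unfolding eq by auto
  show "S = SigK (Ak, B, Ck)" if "S \<in> carrier_mat (2 * n) (2 * n)" "acl Ak B * S + S * (acl Ak B)\<^sup>T + wcl B = 0\<^sub>m (2 * n) (2 * n)" for S
    using ex 1 2 that by blast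
qed

text \<open>Symmetry comes from uniqueness, since the transpose solves the same equation; the upper
  left block solves the equation that defines \<open>X\<close>.\<close>

lemma SigK_blk:
  assumes Ak: "Ak \<in> carrier_mat n n" and B: "B \<in> carrier_mat n m" and H: "hurwitz Ak"
  obtains U V where "SigK (Ak, B, Ck) = blk X U V" "U \<in> carrier_mat n n" "sym_mat n V"
    "res12 U Ak B = 0\<^sub>m n n" "\<And>u. u \<in> carrier_vec n \<Longrightarrow> res22 U V Ak B u = 0"
proof -
  let ?S = "SigK (Ak, B, Ck)"
  note S = SigK_lyap(1)[OF Ak B H, of Ck] and e = SigK_lyap(2)[OF Ak B H, of Ck]
  note M = acl_carrier[OF Ak, of B] and W = wcl_carrier[OF B]
  have ST: "?S\<^sup>T = ?S"
  proof (rule SigK_lyap(3)[OF Ak B H])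
    have "(acl Ak B * ?S + ?S * (acl Ak B)\<^sup>T + wcl B)\<^sup>T = 0\<^sub>m (2 * n) (2 * n)" unfolding e by simp
    moreover have "(acl Ak B * ?S + ?S * (acl Ak B)\<^sup>T + wcl B)\<^sup>T = acl Ak B * ?S\<^sup>T + ?S\<^sup>T * (acl Ak B)\<^sup>T + wcl B"
      using S M W wcl_sym[OF B] by (auto simp: mtrans intro!: comm_add_mat[of _ "2 * n" "2 * n"])
    ultimately show "acl Ak B * ?S\<^sup>T + ?S\<^sup>T * (acl Ak B)\<^sup>T + wcl B = 0\<^sub>m (2 * n) (2 * n)" by simp
  qed (use S in simp)
  obtain S11 U S21 V where d: "?S = four_block_mat S11 U S21 V"
    and c: "S11 \<in> carrier_mat n n" "U \<in> carrier_mat n n" "S21 \<in> carrier_mat n n" "V \<in> carrier_mat n n"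
    by (rule four_block_cases[OF S[unfolded mult_2]])
  have "four_block_mat S11\<^sup>T S21\<^sup>T U\<^sup>T V\<^sup>T = four_block_mat S11 U S21 V"
    using ST unfolding d transpose_four_block_mat[OF c] .
  then have t: "S11\<^sup>T = S11" "S21\<^sup>T = U" "U\<^sup>T = S21" "V\<^sup>T = V"
    using four_block_inj[of "S11\<^sup>T" "S21\<^sup>T" "U\<^sup>T" "V\<^sup>T" S11 U S21 V n] c by auto
  have Sb: "?S = blk S11 U V" unfolding d blk_def t ..
  let ?R = "(B * C) * U + Ak * V + (U\<^sup>T * (B * C)\<^sup>T + V * Ak\<^sup>T) + B * W2 * B\<^sup>T"
  let ?Q = "A * U + S11 * C\<^sup>T * B\<^sup>T + U * Ak\<^sup>T"
  have fb: "four_block_mat (A * S11 + S11 * A\<^sup>T + W1) ?Q ?Q\<^sup>T ?R = four_block_mat (0\<^sub>m n n) (0\<^sub>m n n) (0\<^sub>m n n) (0\<^sub>m n n)"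
    using e unfolding Sb lyap_blk[OF Ak B c(1,2,4) t(1)] by (simp add: mult_2)
  have Qc: "?Q \<in> carrier_mat n n" by (rule carrier_intros A c C B Ak)+
  have cc: "A * S11 + S11 * A\<^sup>T + W1 \<in> carrier_mat n n" "?Q\<^sup>T \<in> carrier_mat n n" "?R \<in> carrier_mat n n"
    by (rule carrier_intros A c C B Ak W1c W2c Qc)+
  note z = four_block_inj[OF fb cc(1) Qc cc(2,3) zero_carrier_mat zero_carrier_mat zero_carrier_mat zero_carrier_mat]
  have S11: "S11 = X" by (rule X_unique[OF c(1) z(1)])
  have V: "sym_mat n V" using c t by (simp add: sym_mat_def)
  show ?thesis
  proof (rule that[OF Sb[unfolded S11] c(2) V])
    show "res12 U Ak B = 0\<^sub>m n n" using z(2) unfolding res12_def S11 .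
    show "res22 U V Ak B u = 0" if u: "u \<in> carrier_vec n" for u
      using res22_form[OF Ak B c(2) V u] unfolding z(4) using u by (simp add: zero_mvec)
  qed
qed

lemma SigK_form_ge_0:
  assumes Ak: "Ak \<in> carrier_mat n n" and B: "B \<in> carrier_mat n m" and H: "hurwitz Ak" and w: "w \<in> carrier_vec (2 * n)"
  shows "0 \<le> w \<bullet> (SigK (Ak, B, Ck) *\<^sub>v w)"
proof (rule lyapunov_nonneg[OF acl_carrier[OF Ak] hurwitz_acl[OF Ak B H] SigK_lyap(1)[OF Ak B H] _ w])
  fix w :: "real vec" assume w: "w \<in> carrier_vec (2 * n)"
  let ?S = "SigK (Ak, B, Ck)"
  let ?L = "acl Ak B * ?S + ?S * (acl Ak B)\<^sup>T"
  note S = SigK_lyap(1)[OF Ak B H, of Ck] and M = acl_carrier[OF Ak, of B] and W = wcl_carrier[OF B]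
  have L: "?L \<in> carrier_mat (2 * n) (2 * n)" by (rule carrier_intros S M)+
  define y where "y = vec_first w n"
  define v where "v = vec_last w n"
  have yv: "y \<in> carrier_vec n" "v \<in> carrier_vec n" "w = y @\<^sub>v v"
    using w by (auto simp: y_def v_def mult_2)
  have "w \<bullet> ((?L + wcl B) *\<^sub>v w) = 0"
    unfolding SigK_lyap(2)[OF Ak B H] using w by (simp add: zero_mvec)
  then have "w \<bullet> (?L *\<^sub>v w) + w \<bullet> (wcl B *\<^sub>v w) = 0"
    by (simp only: form_add[OF L W w])
  moreover have "w \<bullet> (wcl B *\<^sub>v w) \<ge> 0"
    unfolding yv(3) acl_mvec(3)[OF Ak B yv(1,2)] by (rule wcl_form_ge_0(1)[OF B yv(1,2)])
  ultimately show "w \<bullet> (?L *\<^sub>v w) \<le> 0" by simp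
qed

text \<open>On a null vector \<open>(y, v)\<close> of \<open>\<Sigma>\<close> the Lyapunov equation
  leaves only the noise form, so \<open>y = 0\<close> as \<open>W1\<close> is definite; the upper
  half of \<open>\<Sigma> (0, v) = 0\<close> then reads \<open>U v = 0\<close>.\<close>

lemma pos_def_SigK:
  assumes Ak: "Ak \<in> carrier_mat n n" and B: "B \<in> carrier_mat n m" and H: "hurwitz Ak"
    and S: "SigK (Ak, B, Ck) = blk X U V" and U: "U \<in> carrier_mat n n" and V: "sym_mat n V" and det: "Determinant.det U \<noteq> 0"
  shows "pos_def (2 * n) (blk X U V)"
proof -
  have Vc: "V \<in> carrier_mat n n" "V\<^sup>T = V" using V by (auto simp: sym_mat_def)
  note M = acl_carrier[OF Ak, of B] and W = wcl_carrier[OF B]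
  have Sc: "blk X U V \<in> carrier_mat (2 * n) (2 * n)" using X Vc by simp
  have sym: "sym_mat (2 * n) (blk X U V)"
    unfolding sym_mat_def using X U Vc X_sym
    by (simp add: blk_def transpose_four_block_mat[of _ n n _ n _ n] mult_2)
  have psd: "pos_semidef (2 * n) (blk X U V)"
    using sym SigK_form_ge_0[OF Ak B H, of _ Ck] unfolding S pos_semidef_def by blast
  show ?thesis
    unfolding pos_def_def
  proof (intro conjI ballI impI sym)
    fix w :: "real vec" assume w: "w \<in> carrier_vec (2 * n)" "w \<noteq> 0\<^sub>v (2 * n)"
    define y where "y = vec_first w n"
    define v where "v = vec_last w n"
    have yv: "y \<in> carrier_vec n" "v \<in> carrier_vec n" "w = y @\<^sub>v v"
      using w(1) by (auto simp: y_def v_def mult_2)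
    have "w \<bullet> (blk X U V *\<^sub>v w) \<noteq> 0"
    proof
      assume "w \<bullet> (blk X U V *\<^sub>v w) = 0"
      then have k: "blk X U V *\<^sub>v w = 0\<^sub>v (2 * n)" by (rule pos_semidef_kernel[OF psd w(1)])
      have "w \<bullet> ((acl Ak B * blk X U V + blk X U V * (acl Ak B)\<^sup>T + wcl B) *\<^sub>v w) = 0"
        using SigK_lyap(2)[OF Ak B H, of Ck] w unfolding S by (simp add: zero_mvec)
      moreover have "w \<bullet> ((acl Ak B * blk X U V + blk X U V * (acl Ak B)\<^sup>T + wcl B) *\<^sub>v w) =
        w \<bullet> (acl Ak B *\<^sub>v (blk X U V *\<^sub>v w)) + w \<bullet> (blk X U V *\<^sub>v ((acl Ak B)\<^sup>T *\<^sub>v w)) + w \<bullet> (wcl B *\<^sub>v w)"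
        using M W Sc w by (simp add: mvec_simps sp_simps)
      moreover have "w \<bullet> (blk X U V *\<^sub>v ((acl Ak B)\<^sup>T *\<^sub>v w)) = ((acl Ak B)\<^sup>T *\<^sub>v w) \<bullet> (blk X U V *\<^sub>v w)"
        by (rule sym_mat_swap[OF sym]) (use w M in auto)
      ultimately have "w \<bullet> (wcl B *\<^sub>v w) = 0"
        unfolding k using M w by (simp add: mvec_zero)
      then have y0: "y = 0\<^sub>v n" unfolding yv(3) acl_mvec(3)[OF Ak B yv(1,2)]
        using wcl_form_ge_0(2)[OF B yv(1,2)] by blast
      have "(X *\<^sub>v y + U *\<^sub>v v) @\<^sub>v (U\<^sup>T *\<^sub>v y + V *\<^sub>v v) = 0\<^sub>v n @\<^sub>v 0\<^sub>v n"
        using k unfolding yv(3) blk_mvec[OF X U Vc(1) yv(1,2)] by (simp add: append_vec_zero mult_2)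
      then have "X *\<^sub>v y + U *\<^sub>v v = 0\<^sub>v n"
        using append_vec_eq[of "X *\<^sub>v y + U *\<^sub>v v" n "0\<^sub>v n"] X U yv by simp
      then have "U *\<^sub>v v = 0\<^sub>v n" using y0 X U yv by (simp add: mvec_zero)
      then have "v = 0\<^sub>v n" using det yv(2) unfolding det_nz_iff_kernel[OF U] by blast
      then show False using w(2) y0 yv(3) by (simp add: append_vec_zero mult_2)
    qed
    moreover have "0 \<le> w \<bullet> (blk X U V *\<^sub>v w)" using psd w by (simp add: pos_semidef_def)
    ultimately show "0 < w \<bullet> (blk X U V *\<^sub>v w)" by simp
  qed
qed

section \<open>The feasible set of the convex problem and its preimage under the lifting\<close>

definition feas :: "real mat \<Rightarrow> real mat \<Rightarrow> real mat \<Rightarrow> bool" where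
  "feas T Q E \<longleftrightarrow> pos_def n T \<and> E = 0\<^sub>m n n \<and> (\<forall>v\<in>carrier_vec n. lmi T Q v \<le> 0)"

lemma Th_carrier:
  assumes "U \<in> carrier_mat n n" "V \<in> carrier_mat n n" "Determinant.det (schur U V) \<noteq> 0"
  shows "Th U V \<in> carrier_mat n n" "B \<in> carrier_mat n k \<Longrightarrow> Ps U V B \<in> carrier_mat n k"
  unfolding Th_def Ps_def
  by (rule carrier_intros assms minv_carrier[OF schur_carrier[OF assms(1,2)] assms(3)] | assumption)+

lemma feasI:
  assumes Ak: "Ak \<in> carrier_mat n n" and B: "B \<in> carrier_mat n m"
    and U: "U \<in> carrier_mat n n" and V: "sym_mat n V" and det: "Determinant.det U \<noteq> 0"
    and D: "pos_def n (schur U V)" and 0: "res12 U Ak B = 0\<^sub>m n n"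
    and r: "\<And>u. u \<in> carrier_vec n \<Longrightarrow> res22 U V Ak B u \<le> 0"
  shows "feas (Th U V) (Ps U V B) (res12 U Ak B)"
  unfolding feas_def
proof (intro conjI ballI 0)
  show "pos_def n (Th U V)" unfolding Th_def by (rule pos_def_congruence[OF pos_def_minv[OF D] U det])
  fix v :: "real vec" assume v: "v \<in> carrier_vec n"
  show "lmi (Th U V) (Ps U V B) v \<le> 0"
    unfolding lmi_eq_res22[OF U V Ak B pos_defD(4)[OF D] 0 v]
    by (rule r) (use minv_carrier[OF pos_defD(1,4)[OF D]] U v in simp)
qed

text \<open>Definiteness of \<open>\<Theta> = U \<Delta>^{-1} U^T\<close> forces \<open>U\<close> to
  be invertible through its determinant, and congruence with \<open>U^{-1}\<close> passes
  definiteness on to \<open>\<Delta>\<close>. The choice \<open>v = U^{-T} \<Delta> u\<close> then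
  reaches every \<open>u\<close>, so the inequality in \<open>lmi\<close> transfers back to
  \<open>res22\<close>.\<close>

lemma feasD:
  assumes Ak: "Ak \<in> carrier_mat n n" and B: "B \<in> carrier_mat n m"
    and U: "U \<in> carrier_mat n n" and V: "sym_mat n V" and det: "Determinant.det (schur U V) \<noteq> 0"
    and f: "feas (Th U V) (Ps U V B) (res12 U Ak B)"
  shows "Determinant.det U \<noteq> 0" "pos_def n (schur U V)" "res12 U Ak B = 0\<^sub>m n n"
    "\<And>u. u \<in> carrier_vec n \<Longrightarrow> res22 U V Ak B u \<le> 0"
proof -
  have Vc: "V \<in> carrier_mat n n" using V by (simp add: sym_mat_def)
  note Dc = schur_carrier[OF U Vc]
  note N = minv_carrier[OF Dc det]
  have Tpd: "pos_def n (U * minv (schur U V) * U\<^sup>T)" using f by (simp add: feas_def Th_def)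
  show 0: "res12 U Ak B = 0\<^sub>m n n" using f by (simp add: feas_def)
  have "Determinant.det (U * (minv (schur U V) * U\<^sup>T)) \<noteq> 0"
    using pos_defD(4)[OF Tpd] U N by (simp add: mmult_assoc)
  moreover have "Determinant.det (U * (minv (schur U V) * U\<^sup>T)) = Determinant.det U * Determinant.det (minv (schur U V) * U\<^sup>T)"
    by (rule det_mult) (rule carrier_intros U N)+
  ultimately show dU: "Determinant.det U \<noteq> 0" by auto
  let ?L = "minv U"
  note L = minv_carrier[OF U dU]
  have dL: "Determinant.det ?L \<noteq> 0" by (rule det_minv_nz[OF U dU])
  have "?L * (U * minv (schur U V) * U\<^sup>T) * ?L\<^sup>T = (?L * U) * minv (schur U V) * (?L * U)\<^sup>T"
    using L U N by (simp add: mmult_assoc mtrans del: assoc_mult_mat)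
  also have "\<dots> = minv (schur U V)" using N by (simp add: minv_left[OF U dU] mmult_one)
  finally have "pos_def n (minv (schur U V))"
    using pos_def_congruence[OF Tpd L dL] by simp
  then show D: "pos_def n (schur U V)"
    using pos_def_minv[of n "minv (schur U V)"] minv_minv[OF Dc det] by simp
  fix u :: "real vec" assume u: "u \<in> carrier_vec n"
  have UT: "U\<^sup>T \<in> carrier_mat n n" "Determinant.det U\<^sup>T \<noteq> 0" using U det_trans_nz[OF U dU] by auto
  let ?v = "minv U\<^sup>T *\<^sub>v (schur U V *\<^sub>v u)"
  have Du: "schur U V *\<^sub>v u \<in> carrier_vec n" using Dc u by simp
  have v: "?v \<in> carrier_vec n" using minv_carrier[OF UT] Du by simp
  have "minv (schur U V) *\<^sub>v (U\<^sup>T *\<^sub>v ?v) = u"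
    unfolding minv_cancel(1)[OF UT Du] by (rule minv_cancel(2)[OF Dc det u])
  then have "lmi (Th U V) (Ps U V B) ?v = res22 U V Ak B u"
    using lmi_eq_res22[OF U V Ak B det 0 v] by simp
  then show "res22 U V Ak B u \<le> 0" using f v by (auto simp: feas_def)
qed

text \<open>An eigenvector of \<open>Ak\<close> for an eigenvalue \<open>\<mu>\<close> yields a left eigenvector of the closed loop matrix.
  The Lyapunov inequality forces \<open>Re \<mu> \<le> 0\<close>, and on the imaginary axis the vanishing of \<open>res12\<close>
  turns the lower part of the left eigenvector into an eigenvector of \<open>A\<close> for \<open>- \<mu>\<close>.\<close>

lemma feas_hurwitz:
  assumes Ak: "Ak \<in> carrier_mat n n" and B: "B \<in> carrier_mat n m"
    and U: "U \<in> carrier_mat n n" and V: "sym_mat n V" and det: "Determinant.det U \<noteq> 0"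
    and D: "pos_def n (schur U V)" and 0: "res12 U Ak B = 0\<^sub>m n n"
    and r: "\<And>u. u \<in> carrier_vec n \<Longrightarrow> res22 U V Ak B u \<le> 0"
  shows "hurwitz Ak"
  unfolding hurwitz_def
proof (intro allI impI)
  fix \<mu> assume "eigenvalue (map_mat complex_of_real Ak) \<mu>"
  then obtain a b where ab: "real_eigenpair n Ak (Re \<mu>) (Im \<mu>) a b"
    using eigenvalue_iff_real_eigenpair[OF Ak] by blast
  define \<alpha> \<beta> where "\<alpha> = Re \<mu>" "\<beta> = Im \<mu>"
  have Vc: "V \<in> carrier_mat n n" using V by (simp add: sym_mat_def)
  note M = acl_carrier[OF Ak, of B] and W = wcl_carrier[OF B]
  have abc: "a \<in> carrier_vec n" "b \<in> carrier_vec n" using ab by (auto simp: real_eigenpair_def)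
  have z: "(0\<^sub>v n :: real vec) \<in> carrier_vec n" by simp
  have zs: "\<alpha> \<cdot>\<^sub>v 0\<^sub>v n - \<beta> \<cdot>\<^sub>v 0\<^sub>v n = (0\<^sub>v n :: real vec)" "\<beta> \<cdot>\<^sub>v 0\<^sub>v n + \<alpha> \<cdot>\<^sub>v 0\<^sub>v n = (0\<^sub>v n :: real vec)"
    by (auto intro!: eq_vecI)
  \<comment> \<open>Eigenvectors of the lower right block of a block lower triangular matrix extend
    by zero. The left eigenvector for the same eigenvalue is obtained from the characteristic
    polynomial and has no such explicit form.\<close>
  have "real_eigenpair (2 * n) (acl Ak B) \<alpha> \<beta> (0\<^sub>v n @\<^sub>v a) (0\<^sub>v n @\<^sub>v b)"
    unfolding real_eigenpair_def acl_mvec(1)[OF Ak B z abc(1)] acl_mvec(1)[OF Ak B z abc(2)]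
    using ab abc A B C Ak append_vec_eq[of "0\<^sub>v n" n "0\<^sub>v n" a "0\<^sub>v n"] append_vec_eq[of "0\<^sub>v n" n "0\<^sub>v n" b "0\<^sub>v n"]
    by (auto simp: real_eigenpair_def append_vec_smult append_vec_minus append_vec_add[of _ n _ _ n] mvec_zero zs
        \<alpha>_\<beta>_def mult_2 append_vec_zero[symmetric])
  then have "\<exists>a b. real_eigenpair (2 * n) (acl Ak B) (Re \<mu>) (Im \<mu>) a b" unfolding \<alpha>_\<beta>_def by blast
  then have "eigenvalue (map_mat complex_of_real (acl Ak B)\<^sup>T) \<mu>"
    using eigenvalue_iff_real_eigenpair[OF M] eigenvalue_transpose[OF M] by blast
  then obtain w1 w2 where w: "real_eigenpair (2 * n) (acl Ak B)\<^sup>T \<alpha> \<beta> w1 w2"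
    using eigenvalue_iff_real_eigenpair[of "(acl Ak B)\<^sup>T"] M unfolding \<alpha>_\<beta>_def by auto
  define y1 v1 y2 v2 where d: "y1 = vec_first w1 n" "v1 = vec_last w1 n" "y2 = vec_first w2 n" "v2 = vec_last w2 n"
  have c: "y1 \<in> carrier_vec n" "v1 \<in> carrier_vec n" "y2 \<in> carrier_vec n" "v2 \<in> carrier_vec n" by (auto simp: d)
  have e: "w1 = y1 @\<^sub>v v1" "w2 = y2 @\<^sub>v v2" using w by (auto simp: d real_eigenpair_def mult_2)
  have wc: "w1 \<in> carrier_vec (2 * n)" "w2 \<in> carrier_vec (2 * n)" using w by (auto simp: real_eigenpair_def)
  note S = pos_def_blk[OF U V D]
  let ?S = "blk X U V"
  let ?L = "acl Ak B * ?S + ?S * (acl Ak B)\<^sup>T"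
  have L: "?L \<in> carrier_mat (2 * n) (2 * n)" by (rule carrier_intros pos_defD(1)[OF S] M)+
  have q: "w \<bullet> (?L *\<^sub>v w) = res22 U V Ak B v - (y \<bullet> (W1 *\<^sub>v y) + (B\<^sup>T *\<^sub>v v) \<bullet> (W2 *\<^sub>v (B\<^sup>T *\<^sub>v v)))"
    if "w = y @\<^sub>v v" "y \<in> carrier_vec n" "v \<in> carrier_vec n" for w y v
  proof -
    have "w \<in> carrier_vec (2 * n)" using that by (simp add: mult_2)
    then have "w \<bullet> ((?L + wcl B) *\<^sub>v w) = w \<bullet> (?L *\<^sub>v w) + w \<bullet> (wcl B *\<^sub>v w)"
      by (rule form_add[OF L W])
    then show ?thesis
      using lyap_blk_form[OF Ak B U V 0 that(2,3)] acl_mvec(3)[OF Ak B that(2,3)] that(1) by simp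
  qed
  let ?s = "w1 \<bullet> (?S *\<^sub>v w1) + w2 \<bullet> (?S *\<^sub>v w2)"
  have s: "?s > 0"
    using w pos_defD(5)[OF S wc(1)] pos_defD(5)[OF S wc(2)] pos_def_ge_0[OF S wc(1)] pos_def_ge_0[OF S wc(2)]
    unfolding real_eigenpair_def by linarith
  let ?p = "\<lambda>y v. y \<bullet> (W1 *\<^sub>v y) + (B\<^sup>T *\<^sub>v v) \<bullet> (W2 *\<^sub>v (B\<^sup>T *\<^sub>v v))"
  have main: "2 * \<alpha> * ?s = res22 U V Ak B v1 - ?p y1 v1 + (res22 U V Ak B v2 - ?p y2 v2)"
    using real_eigenpair_form[OF pos_defD(3)[OF S] M w] q[OF e(1) c(1,2)] q[OF e(2) c(3,4)] by simp
  note p = wcl_form_ge_0[OF B c(1,2)] wcl_form_ge_0[OF B c(3,4)]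
  show "Re \<mu> < 0"
  proof (rule ccontr)
    assume "\<not> Re \<mu> < 0"
    then have \<alpha>: "\<alpha> \<ge> 0" by (simp add: \<alpha>_\<beta>_def)
    then have "2 * \<alpha> * ?s \<ge> 0" using s by simp
    \<comment> \<open>In \<open>main\<close> the left side is nonnegative and the right side is a
      sum of nonpositive terms, so every term vanishes.\<close>
    then have "?p y1 v1 = 0" "?p y2 v2 = 0" "2 * \<alpha> * ?s = 0"
      using main r[OF c(2)] r[OF c(4)] p(1) p(3) by linarith+
    then have y: "y1 = 0\<^sub>v n" "B\<^sup>T *\<^sub>v v1 = 0\<^sub>v m" "y2 = 0\<^sub>v n" "B\<^sup>T *\<^sub>v v2 = 0\<^sub>v m" and \<alpha>0: "\<alpha> = 0"
      using p(2,4) s by auto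
    have "(A\<^sup>T *\<^sub>v y1 + C\<^sup>T *\<^sub>v (B\<^sup>T *\<^sub>v v1)) @\<^sub>v (Ak\<^sup>T *\<^sub>v v1) = (\<alpha> \<cdot>\<^sub>v y1 - \<beta> \<cdot>\<^sub>v y2) @\<^sub>v (\<alpha> \<cdot>\<^sub>v v1 - \<beta> \<cdot>\<^sub>v v2)"
      "(A\<^sup>T *\<^sub>v y2 + C\<^sup>T *\<^sub>v (B\<^sup>T *\<^sub>v v2)) @\<^sub>v (Ak\<^sup>T *\<^sub>v v2) = (\<beta> \<cdot>\<^sub>v y1 + \<alpha> \<cdot>\<^sub>v y2) @\<^sub>v (\<beta> \<cdot>\<^sub>v v1 + \<alpha> \<cdot>\<^sub>v v2)"
      using w c unfolding real_eigenpair_def e acl_mvec(2)[OF Ak B c(1,2)] acl_mvec(2)[OF Ak B c(3,4)]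
      by (simp_all add: append_vec_smult append_vec_minus append_vec_add[of _ n _ _ n])
    moreover have "A\<^sup>T *\<^sub>v y1 + C\<^sup>T *\<^sub>v (B\<^sup>T *\<^sub>v v1) \<in> carrier_vec n" "A\<^sup>T *\<^sub>v y2 + C\<^sup>T *\<^sub>v (B\<^sup>T *\<^sub>v v2) \<in> carrier_vec n"
      using A B C c by auto
    ultimately have ev: "Ak\<^sup>T *\<^sub>v v1 = \<alpha> \<cdot>\<^sub>v v1 - \<beta> \<cdot>\<^sub>v v2" "Ak\<^sup>T *\<^sub>v v2 = \<beta> \<cdot>\<^sub>v v1 + \<alpha> \<cdot>\<^sub>v v2"
      using c append_vec_eq[of "A\<^sup>T *\<^sub>v y1 + C\<^sup>T *\<^sub>v (B\<^sup>T *\<^sub>v v1)" n] append_vec_eq[of "A\<^sup>T *\<^sub>v y2 + C\<^sup>T *\<^sub>v (B\<^sup>T *\<^sub>v v2)" n] by auto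
    have Uc: "U *\<^sub>v v1 \<in> carrier_vec n" "U *\<^sub>v v2 \<in> carrier_vec n" using U c by auto
    have AU: "A *\<^sub>v (U *\<^sub>v v) = - (U *\<^sub>v (Ak\<^sup>T *\<^sub>v v))" if v: "v \<in> carrier_vec n" and "B\<^sup>T *\<^sub>v v = 0\<^sub>v m" for v
      using res12_mvec(1)[OF U Ak B 0 v] that U A X C by (simp add: mvec_zero)
    \<comment> \<open>Where \<open>B^T v = 0\<close>, the residual equation reads
      \<open>A U v = - U Ak^T v\<close>: \<open>U\<close> carries the pair to an eigenpair of
      \<open>A\<close> with real part 0.\<close>
    have "A *\<^sub>v (U *\<^sub>v v1) = 0 \<cdot>\<^sub>v (U *\<^sub>v v1) - (- \<beta>) \<cdot>\<^sub>v (U *\<^sub>v v2)"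
      "A *\<^sub>v (U *\<^sub>v v2) = (- \<beta>) \<cdot>\<^sub>v (U *\<^sub>v v1) + 0 \<cdot>\<^sub>v (U *\<^sub>v v2)"
      unfolding AU[OF c(2) y(2)] AU[OF c(4) y(4)] ev \<alpha>0
      using U c Uc by (auto simp: mvec_simps simp del: index_mult_mat_vec intro!: eq_vecI)
    moreover have "U *\<^sub>v v1 \<noteq> 0\<^sub>v n \<or> U *\<^sub>v v2 \<noteq> 0\<^sub>v n"
    proof -
      have "v1 \<noteq> 0\<^sub>v n \<or> v2 \<noteq> 0\<^sub>v n"
        using w unfolding real_eigenpair_def e y by (auto simp: append_vec_zero mult_2)
      then show ?thesis using det c unfolding det_nz_iff_kernel[OF U] by blast
    qed
    ultimately have "real_eigenpair n A 0 (- \<beta>) (U *\<^sub>v v1) (U *\<^sub>v v2)"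
      using Uc by (simp add: real_eigenpair_def)
    then show False using hurwitz_real_eigenpair[OF hA A] by fastforce
  qed
qed

text \<open>The difference of the two block matrices satisfies a Lyapunov inequality for the stable
  closed loop, so its form is nonnegative. Its upper left block is zero because both carry
  \<open>X\<close>; this forces the off-diagonal block to vanish too and leaves
  \<open>V' <= V\<close>.\<close>

lemma feas_compare:
  assumes Ak: "Ak \<in> carrier_mat n n" and B: "B \<in> carrier_mat n m" and H: "hurwitz Ak"
    and S: "SigK (Ak, B, Ck) = blk X U' V'" and U': "U' \<in> carrier_mat n n" and V': "sym_mat n V'"
    and U: "U \<in> carrier_mat n n" and V: "sym_mat n V" and 0: "res12 U Ak B = 0\<^sub>m n n"
    and r: "\<And>u. u \<in> carrier_vec n \<Longrightarrow> res22 U V Ak B u \<le> 0"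
  shows "U' = U" "\<And>v. v \<in> carrier_vec n \<Longrightarrow> v \<bullet> (V' *\<^sub>v v) \<le> v \<bullet> (V *\<^sub>v v)"
proof -
  have Vc: "V \<in> carrier_mat n n" "V' \<in> carrier_mat n n" using V V' by (auto simp: sym_mat_def)
  note M = acl_carrier[OF Ak, of B] and W = wcl_carrier[OF B]
  have c: "blk X U V \<in> carrier_mat (2 * n) (2 * n)" "blk X U' V' \<in> carrier_mat (2 * n) (2 * n)" using X Vc by auto
  have D: "blk X U V - blk X U' V' \<in> carrier_mat (2 * n) (2 * n)" by (rule minus_carrier_mat[OF c(2)])
  let ?L = "\<lambda>S. acl Ak B * S + S * (acl Ak B)\<^sup>T"
  have nn: "0 \<le> w \<bullet> ((blk X U V - blk X U' V') *\<^sub>v w)" if w: "w \<in> carrier_vec (2 * n)" for w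
  proof (rule lyapunov_nonneg[OF M hurwitz_acl[OF Ak B H] D _ w])
    fix w :: "real vec" assume w: "w \<in> carrier_vec (2 * n)"
    define y where "y = vec_first w n"
    define v where "v = vec_last w n"
    have yv: "y \<in> carrier_vec n" "v \<in> carrier_vec n" "w = y @\<^sub>v v"
      using w by (auto simp: y_def v_def mult_2)
    have "w \<bullet> (?L (blk X U V - blk X U' V') *\<^sub>v w) = w \<bullet> ((?L (blk X U V) + wcl B) *\<^sub>v w) - w \<bullet> ((?L (blk X U' V') + wcl B) *\<^sub>v w)"
      using M W w c by (simp add: mvec_simps sp_simps)
    also have "w \<bullet> ((?L (blk X U' V') + wcl B) *\<^sub>v w) = 0"
      using SigK_lyap(2)[OF Ak B H, of Ck] w unfolding S by (simp add: zero_mvec)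
    also have "w \<bullet> ((?L (blk X U V) + wcl B) *\<^sub>v w) = res22 U V Ak B v"
      unfolding yv(3) by (rule lyap_blk_form[OF Ak B U V 0 yv(1,2)])
    finally show "w \<bullet> (?L (blk X U V - blk X U' V') *\<^sub>v w) \<le> 0" using r[OF yv(2)] by simp
  qed
  have form: "0 \<le> 2 * (y \<bullet> (U *\<^sub>v v) - y \<bullet> (U' *\<^sub>v v)) + (v \<bullet> (V *\<^sub>v v) - v \<bullet> (V' *\<^sub>v v))"
    if y: "y \<in> carrier_vec n" and v: "v \<in> carrier_vec n" for y v
  proof -
    have w: "y @\<^sub>v v \<in> carrier_vec (2 * n)" using y v by (simp add: mult_2)
    show ?thesis
      using nn[OF w] unfolding form_add(2)[OF c w] blk_form[OF X U Vc(1) y v] blk_form[OF X U' Vc(2) y v]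
      by simp
  qed
  show "U' = U"
  proof (rule eq_mat_by_mvec[OF U' U])
    fix v :: "real vec" assume v: "v \<in> carrier_vec n"
    show "U' *\<^sub>v v = U *\<^sub>v v"
    proof (rule eq_vec_by_sp[of _ n])
      fix y :: "real vec" assume y: "y \<in> carrier_vec n"
      \<comment> \<open>Scaling \<open>y\<close> by \<open>t\<close> turns the nonnegative form into
        an affine function of \<open>t\<close> on the whole line, whose slope must be zero.\<close>
      have "2 * (y \<bullet> (U *\<^sub>v v) - y \<bullet> (U' *\<^sub>v v)) = 0"
      proof (rule linear_plus_nonneg_imp_zero)
        fix t :: real
        show "0 \<le> t * (2 * (y \<bullet> (U *\<^sub>v v) - y \<bullet> (U' *\<^sub>v v))) + (v \<bullet> (V *\<^sub>v v) - v \<bullet> (V' *\<^sub>v v))"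
          using form[of "t \<cdot>\<^sub>v y" v] y v U U' by (simp add: algebra_simps)
      qed
      then show "y \<bullet> (U' *\<^sub>v v) = y \<bullet> (U *\<^sub>v v)" by simp
    qed (use U U' v in auto)
  qed
  then show "v \<bullet> (V' *\<^sub>v v) \<le> v \<bullet> (V *\<^sub>v v)" if "v \<in> carrier_vec n" for v
    using form[of "0\<^sub>v n" v] that U by simp
qed

end

section \<open>The objective in the new variables\<close>

lemma minv_congruence:
  assumes U: "U \<in> carrier_mat n n" "Determinant.det U \<noteq> 0" and D: "D \<in> carrier_mat n n" "Determinant.det D \<noteq> 0"
  shows "minv (U * minv D * U\<^sup>T) = (minv U)\<^sup>T * D * minv U"
proof -
  note N = minv_carrier[OF U] and I = minv_carrier[OF D]
  have UT: "U\<^sup>T \<in> carrier_mat n n" "Determinant.det U\<^sup>T \<noteq> 0" using U(1) det_trans_nz[OF U] by auto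
  have "minv (U * minv D * U\<^sup>T) = minv U\<^sup>T * (minv (minv D) * minv U)"
    using minv_mult[of "U * minv D" n "U\<^sup>T"] minv_mult[of U n "minv D"] U I UT det_minv_nz[OF D]
      det_mult_nz[OF U(1) I U(2) det_minv_nz[OF D]] by simp
  then show ?thesis
    using N D(1) by (simp add: minv_minv[OF D] minv_transpose[OF U] mmult_assoc)
qed

lemma mat_rank_n_iff:
  fixes M :: "real mat"
  assumes "M \<in> carrier_mat n n"
  shows "vec_space.rank n M = n \<longleftrightarrow> Determinant.det M \<noteq> 0"
  using vec_space.det_rank_iff[OF assms] by simp

lemma row_mult_transpose:
  fixes H :: "real mat"
  assumes "H \<in> carrier_mat r n" "U \<in> carrier_mat n n" "i < r"
  shows "row (H * U\<^sup>T) i = U *\<^sub>v row H i"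
proof (rule eq_vecI)
  fix j assume "j < dim_vec (U *\<^sub>v row H i)"
  then show "row (H * U\<^sup>T) i $ j = (U *\<^sub>v row H i) $ j"
    using assms comm_scalar_prod[of "row H i" n "row U j"] by auto
qed (use assms in auto)

context oe begin

text \<open>This is \<open>Z^{-1}\<close> for \<open>Z = U V^{-1} U^T\<close>. It is linear in
  \<open>V\<close>, so filters sharing \<open>U\<close> are compared through their \<open>V\<close>
  alone.\<close>

definition Tm :: "real mat \<Rightarrow> real mat \<Rightarrow> real mat" where
  "Tm U V = (minv U)\<^sup>T * V * minv U"

lemma Tm_carrier: "U \<in> carrier_mat n n \<Longrightarrow> Determinant.det U \<noteq> 0 \<Longrightarrow> V \<in> carrier_mat n n \<Longrightarrow> Tm U V \<in> carrier_mat n n"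
  unfolding Tm_def by (rule carrier_intros minv_carrier | assumption)+

lemma Tm_form:
  assumes U: "U \<in> carrier_mat n n" "Determinant.det U \<noteq> 0" and V: "V \<in> carrier_mat n n" and v: "v \<in> carrier_vec n"
  shows "v \<bullet> (Tm U V *\<^sub>v v) = (minv U *\<^sub>v v) \<bullet> (V *\<^sub>v (minv U *\<^sub>v v))"
  using minv_carrier[OF U] V v sp_mvec_left[of v "minv U" "V *\<^sub>v (minv U *\<^sub>v v)"]
  by (simp add: Tm_def mult_mvec)

text \<open>\<open>\<Theta>^{-1} = U^{-T} (V - U^T X^{-1} U) U^{-1}\<close>, where the subtracted
  part collapses to \<open>X^{-1}\<close>.\<close>

lemma Tm_eq:
  assumes U: "U \<in> carrier_mat n n" "Determinant.det U \<noteq> 0" and V: "V \<in> carrier_mat n n" and D: "Determinant.det (schur U V) \<noteq> 0"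
  shows "Xi + minv (Th U V) = Tm U V"
proof -
  let ?N = "minv U"
  note N = minv_carrier[OF U] and Dc = schur_carrier[OF U(1) V]
  have "minv (Th U V) = ?N\<^sup>T * schur U V * ?N"
    unfolding Th_def by (rule minv_congruence[OF U Dc D])
  also have "\<dots> = ?N\<^sup>T * V * ?N - (U * ?N)\<^sup>T * Xi * (U * ?N)"
    unfolding schur_def using U(1) V N Xi
    by (simp add: mmult_minus mmult_assoc mtrans del: assoc_mult_mat)
  also have "\<dots> = Tm U V - Xi" using Xi by (simp add: minv_right[OF U] mmult_one Tm_def)
  finally show ?thesis using Tm_carrier[OF U V] Xi by (auto intro!: eq_matI)
qed

text \<open>With \<open>H = C_K U^T\<close> the factors \<open>U^{-1}\<close> in \<open>Tm\<close>
  cancel against \<open>U\<close>, row by row.\<close>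

lemma cost_Tm:
  assumes U: "U \<in> carrier_mat n n" "Determinant.det U \<noteq> 0" and V: "V \<in> carrier_mat n n" and Ck: "Ck \<in> carrier_mat p n"
  shows "cost (Tm U V) (Ck * U\<^sup>T) = (\<Sum>i<p. row G i \<bullet> (X *\<^sub>v row G i) - 2 * (row G i \<bullet> (U *\<^sub>v row Ck i)) + row Ck i \<bullet> (V *\<^sub>v row Ck i))
    + reg * tr (Tm U V)"
proof -
  have "row (Ck * U\<^sup>T) i \<bullet> (Tm U V *\<^sub>v row (Ck * U\<^sup>T) i) = row Ck i \<bullet> (V *\<^sub>v row Ck i)" if i: "i < p" for i
  proof -
    have r: "row Ck i \<in> carrier_vec n" "U *\<^sub>v row Ck i \<in> carrier_vec n" using Ck U by auto
    show ?thesis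
      unfolding row_mult_transpose[OF Ck U(1) i] Tm_form[OF U V r(2)] minv_cancel(2)[OF U r(1)] ..
  qed
  then show ?thesis unfolding cost_def by (simp add: row_mult_transpose[OF Ck U(1)])
qed

lemma L_OE_eq:
  assumes S: "SigK (Ak, B, Ck) = blk X U V" and U: "U \<in> carrier_mat n n" and V: "V \<in> carrier_mat n n" and Ck: "Ck \<in> carrier_mat p n"
  shows "L_OE A C G W1 W2 (Ak, B, Ck) =
    (\<Sum>i<p. row G i \<bullet> (X *\<^sub>v row G i) - 2 * (row G i \<bullet> (U *\<^sub>v row Ck i)) + row Ck i \<bullet> (V *\<^sub>v row Ck i))"
proof -
  let ?E = "err_out G (Ak, B, Ck)"
  have E: "?E \<in> carrier_mat p (2 * n)" using G Ck by (auto simp: mult_2)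
  have row: "row ?E i = row G i @\<^sub>v (- row Ck i)" if "i < p" for i
    using that G Ck by (intro eq_vecI) auto
  have "L_OE A C G W1 W2 (Ak, B, Ck) = (\<Sum>i<p. row ?E i \<bullet> (blk X U V *\<^sub>v row ?E i))"
    unfolding L_OE_def S by (rule tr_congruence[OF E]) (use X V in simp)
  also have "\<dots> = (\<Sum>i<p. row G i \<bullet> (X *\<^sub>v row G i) - 2 * (row G i \<bullet> (U *\<^sub>v row Ck i)) + row Ck i \<bullet> (V *\<^sub>v row Ck i))"
  proof (rule sum.cong[OF refl])
    fix i assume "i \<in> {..<p}"
    then have i: "i < p" by simp
    have r: "row G i \<in> carrier_vec n" "row Ck i \<in> carrier_vec n" "- row Ck i \<in> carrier_vec n" using G Ck by auto
    show "row ?E i \<bullet> (blk X U V *\<^sub>v row ?E i) = row G i \<bullet> (X *\<^sub>v row G i) - 2 * (row G i \<bullet> (U *\<^sub>v row Ck i)) + row Ck i \<bullet> (V *\<^sub>v row Ck i)"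
      unfolding row[OF i] blk_form[OF X U V r(1,3)]
      using r(1,2) U V Ck G by (simp add: mvec_uminus[of "row Ck i"])
  qed
  finally show ?thesis .
qed

abbreviation Kinfo :: "filt set" where "Kinfo \<equiv> K_info n m p A C W1 W2"

lemma Kinfo_iff:
  assumes Ak: "Ak \<in> carrier_mat n n" and B: "B \<in> carrier_mat n m" and Ck: "Ck \<in> carrier_mat p n" and H: "hurwitz Ak"
    and S: "SigK (Ak, B, Ck) = blk X U V" and U: "U \<in> carrier_mat n n" and V: "V \<in> carrier_mat n n"
  shows "(Ak, B, Ck) \<in> Kinfo \<longleftrightarrow> Determinant.det U \<noteq> 0"
  using assms mat_rank_n_iff[OF U] X
  by (auto simp: K_info_def K_stab_def filters_def S)

lemma KinfoE:
  assumes K: "(Ak, B, Ck) \<in> Kinfo"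
  obtains U V where "Ak \<in> carrier_mat n n" "B \<in> carrier_mat n m" "Ck \<in> carrier_mat p n" "hurwitz Ak"
    "SigK (Ak, B, Ck) = blk X U V" "U \<in> carrier_mat n n" "sym_mat n V" "Determinant.det U \<noteq> 0"
    "res12 U Ak B = 0\<^sub>m n n" "\<And>u. u \<in> carrier_vec n \<Longrightarrow> res22 U V Ak B u = 0" "pos_def (2 * n) (blk X U V)" "pos_def n (schur U V)"
proof -
  have c: "Ak \<in> carrier_mat n n" "B \<in> carrier_mat n m" "Ck \<in> carrier_mat p n" "hurwitz Ak"
    using K by (auto simp: K_info_def K_stab_def filters_def)
  obtain U V where UV: "SigK (Ak, B, Ck) = blk X U V" "U \<in> carrier_mat n n" "sym_mat n V"
    "res12 U Ak B = 0\<^sub>m n n" "\<And>u. u \<in> carrier_vec n \<Longrightarrow> res22 U V Ak B u = 0"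
    using SigK_blk[OF c(1,2,4)] by blast
  have det: "Determinant.det U \<noteq> 0"
    using Kinfo_iff[OF c UV(1,2)] UV(3) K by (simp add: sym_mat_def)
  note pd = pos_def_SigK[OF c(1,2,4) UV(1-3) det]
  show ?thesis
    by (rule that[OF c UV(1-3) det UV(4,5) pd pos_def_schur[OF UV(2,3) pd]])
qed

lemma pos_def_V:
  assumes U: "U \<in> carrier_mat n n" and V: "sym_mat n V" and D: "pos_def n (schur U V)"
  shows "pos_def n V"
  unfolding pos_def_def
proof (intro conjI ballI impI V)
  have Vc: "V \<in> carrier_mat n n" using V by (simp add: sym_mat_def)
  fix v :: "real vec" assume v: "v \<in> carrier_vec n" "v \<noteq> 0\<^sub>v n"
  have Uv: "U *\<^sub>v v \<in> carrier_vec n" using U v by simp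
  have "v \<bullet> (V *\<^sub>v v) = v \<bullet> (schur U V *\<^sub>v v) + (U *\<^sub>v v) \<bullet> (Xi *\<^sub>v (U *\<^sub>v v))"
    using schur_mvec[OF U Vc v(1)] schur_carrier[OF U Vc] U Xi v sp_mvec_left[of v U "Xi *\<^sub>v (U *\<^sub>v v)"]
    by (simp add: sp_simps)
  then show "0 < v \<bullet> (V *\<^sub>v v)" using pos_defD(5)[OF D v] pos_def_ge_0[OF pos_def_Xi Uv] by simp
qed

lemma Z_K_eq:
  assumes S: "SigK K = blk X U V" and U: "U \<in> carrier_mat n n" "Determinant.det U \<noteq> 0" and V: "pos_def n V"
  shows "Z_K A C W1 W2 K = U * minv V * U\<^sup>T" "minv (Z_K A C W1 W2 K) = Tm U V"
proof -
  note Vc = pos_defD(1)[OF V]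
  show "Z_K A C W1 W2 K = U * minv V * U\<^sup>T"
    unfolding Z_K_def Let_def S using A X U Vc by simp
  then show "minv (Z_K A C W1 W2 K) = Tm U V"
    using minv_congruence[OF U Vc pos_defD(4)[OF V]] by (simp add: Tm_def)
qed

definition fc :: "real mat \<Rightarrow> real mat \<Rightarrow> real mat \<Rightarrow> real mat \<Rightarrow> ereal" where
  "fc T Q H E = (if feas T Q E then ereal (cost (Xi + minv T) H) else \<infinity>)"

lemma L_reg_Kinfo:
  assumes K: "(Ak, B, Ck) \<in> Kinfo" and S: "SigK (Ak, B, Ck) = blk X U V" and U: "U \<in> carrier_mat n n" "Determinant.det U \<noteq> 0"
    and V: "sym_mat n V" and D: "pos_def n (schur U V)"
  shows "L_reg n m p A C G W1 W2 reg (Ak, B, Ck) = ereal (cost (Tm U V) (Ck * U\<^sup>T))"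
proof -
  have Ck: "Ck \<in> carrier_mat p n" using K by (auto simp: K_info_def K_stab_def filters_def)
  note Vpd = pos_def_V[OF U(1) V D]
  show ?thesis
    unfolding L_reg_def cost_Tm[OF U pos_defD(1)[OF Vpd] Ck]
    using K L_OE_eq[OF S U(1) pos_defD(1)[OF Vpd] Ck] Z_K_eq(2)[OF S U Vpd] by simp
qed

text \<open>The blocks are determined by \<open>SigK (Ak, B, Ck)\<close>, for which the residuals
  vanish; the true covariance is therefore feasible, and its cost is the objective itself.\<close>

lemma fc_SigK:
  assumes K: "(Ak, B, Ck) \<in> Kinfo" and S: "SigK (Ak, B, Ck) = blk X U V" and U: "U \<in> carrier_mat n n"
    and V: "V \<in> carrier_mat n n"
  shows "fc (Th U V) (Ps U V B) (Ck * U\<^sup>T) (res12 U Ak B) = L_reg n m p A C G W1 W2 reg (Ak, B, Ck)"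
proof -
  obtain U' V' where *: "Ak \<in> carrier_mat n n" "B \<in> carrier_mat n m" "Ck \<in> carrier_mat p n" "hurwitz Ak"
    "SigK (Ak, B, Ck) = blk X U' V'" "U' \<in> carrier_mat n n" "sym_mat n V'" "Determinant.det U' \<noteq> 0"
    "res12 U' Ak B = 0\<^sub>m n n" "\<And>u. u \<in> carrier_vec n \<Longrightarrow> res22 U' V' Ak B u = 0" "pos_def (2 * n) (blk X U' V')" "pos_def n (schur U' V')"
    by (rule KinfoE[OF K]) blast
  have Vc: "V' \<in> carrier_mat n n" using *(7) by (simp add: sym_mat_def)
  have eq: "U' = U" "V' = V"
    using block12_blk[OF X *(6) Vc] block12_blk[OF X U V] *(5) S by auto
  have f: "feas (Th U' V') (Ps U' V' B) (res12 U' Ak B)"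
    by (rule feasI[OF *(1,2,6,7,8,12,9)]) (simp add: *(10))
  show ?thesis
    using f Tm_eq[OF *(6,8) Vc pos_defD(4)[OF *(12)]] L_reg_Kinfo[OF K *(5,6,8,7,12)]
    by (simp add: fc_def eq)
qed

text \<open>\<open>T\<close> occurs in quadratic forms with nonnegative weights; for the trace term
  this is \<open>reg >= 0\<close>.\<close>

lemma cost_mono:
  assumes T: "T \<in> carrier_mat n n" and T': "T' \<in> carrier_mat n n" and H: "H \<in> carrier_mat p n"
    and le: "\<And>v. v \<in> carrier_vec n \<Longrightarrow> v \<bullet> (T *\<^sub>v v) \<le> v \<bullet> (T' *\<^sub>v v)"
  shows "cost T H \<le> cost T' H"
proof -
  have "tr T \<le> tr T'" unfolding tr_form[OF T] tr_form[OF T'] by (intro sum_mono le) simp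
  then show ?thesis
    unfolding cost_def using le H reg by (intro add_mono sum_mono mult_left_mono) auto
qed

text \<open>A feasible \<open>\<Sigma>\<close> makes the filter stable, shares its off-diagonal
  block with the true covariance and dominates its lower right block, so \<open>Tm\<close>, and with
  it the cost, can only be larger. An infeasible one costs \<open>\<infinity>\<close>.\<close>

lemma fc_ge_L_reg:
  assumes Ak: "Ak \<in> carrier_mat n n" and B: "B \<in> carrier_mat n m" and Ck: "Ck \<in> carrier_mat p n"
    and U: "U \<in> carrier_mat n n" and V: "sym_mat n V" and det: "Determinant.det (schur U V) \<noteq> 0"
  shows "L_reg n m p A C G W1 W2 reg (Ak, B, Ck) \<le> fc (Th U V) (Ps U V B) (Ck * U\<^sup>T) (res12 U Ak B)"
proof (cases "feas (Th U V) (Ps U V B) (res12 U Ak B)")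
  case True
  note f = feasD[OF Ak B U V det True]
  have H: "hurwitz Ak" by (rule feas_hurwitz[OF Ak B U V f])
  obtain U' V' where S: "SigK (Ak, B, Ck) = blk X U' V'" "U' \<in> carrier_mat n n" "sym_mat n V'"
    using SigK_blk[OF Ak B H] by blast
  have c: "U' = U" "\<And>v. v \<in> carrier_vec n \<Longrightarrow> v \<bullet> (V' *\<^sub>v v) \<le> v \<bullet> (V *\<^sub>v v)"
    by (rule feas_compare[OF Ak B H S U V f(3,4)]; assumption)+
  have Vc: "V \<in> carrier_mat n n" "V' \<in> carrier_mat n n" using V S(3) by (auto simp: sym_mat_def)
  have K: "(Ak, B, Ck) \<in> Kinfo" using Kinfo_iff[OF Ak B Ck H S(1,2) Vc(2)] f(1) c(1) by simp
  have S': "SigK (Ak, B, Ck) = blk X U V'" using S(1) c(1) by simp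
  have D': "pos_def n (schur U V')"
    by (rule pos_def_schur[OF U S(3) pos_def_SigK[OF Ak B H S' U S(3) f(1)]])
  have CU: "Ck * U\<^sup>T \<in> carrier_mat p n" by (rule carrier_intros Ck U)+
  have "cost (Tm U V') (Ck * U\<^sup>T) \<le> cost (Tm U V) (Ck * U\<^sup>T)"
  proof (rule cost_mono[OF Tm_carrier[OF U f(1) Vc(2)] Tm_carrier[OF U f(1) Vc(1)] CU])
    fix v :: "real vec" assume v: "v \<in> carrier_vec n"
    show "v \<bullet> (Tm U V' *\<^sub>v v) \<le> v \<bullet> (Tm U V *\<^sub>v v)"
      unfolding Tm_form[OF U f(1) Vc(1) v] Tm_form[OF U f(1) Vc(2) v]
      by (rule c(2)[OF mult_mat_vec_carrier[OF minv_carrier[OF U f(1)] v]])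
  qed
  then show ?thesis
    using L_reg_Kinfo[OF K S' U f(1) S(3) D'] True Tm_eq[OF U f(1) Vc(1) det] by (simp add: fc_def)
qed (simp add: fc_def)

subsection \<open>The Kalman filter\<close>

definition Lk :: "real mat" where "Lk = kalman_gain C W2 P"
text \<open>At the Kalman filter the estimate is uncorrelated with its error, so
  \<open>X - P\<close> is both the covariance of the estimate and its cross covariance with the
  state: \<open>U\<close> and \<open>V\<close> coincide.\<close>

definition Zs :: "real mat" where "Zs = X - P"

abbreviation "W2i \<equiv> minv W2"

lemma P: "P \<in> carrier_mat n n" and P_sym: "P\<^sup>T = P"
  using ric by (auto simp: is_riccati_sol_def pos_semidef_def sym_mat_def)

lemma pos_def_W2i: "pos_def m W2i" by (rule pos_def_minv[OF W2])
lemmas W2i = pos_defD(1)[OF pos_def_W2i]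
lemmas W2i_sym = pos_defD(2)[OF pos_def_W2i]

lemma Lk: "Lk \<in> carrier_mat n m"
  unfolding Lk_def kalman_gain_def by (rule carrier_intros P C W2i)+

lemma Zs: "Zs \<in> carrier_mat n n"
  unfolding Zs_def by (rule carrier_intros P)+

lemma sym_Zs: "sym_mat n Zs"
  using Zs X P X_sym P_sym by (simp add: sym_mat_def Zs_def mtrans)

lemma Lk_mvec:
  "v \<in> carrier_vec m \<Longrightarrow> Lk *\<^sub>v v = P *\<^sub>v (C\<^sup>T *\<^sub>v (W2i *\<^sub>v v))"
  "v \<in> carrier_vec n \<Longrightarrow> Lk\<^sup>T *\<^sub>v v = W2i *\<^sub>v (C *\<^sub>v (P *\<^sub>v v))"
  using P P_sym C W2i W2i_sym by (simp_all add: Lk_def kalman_gain_def mult_mvec mtrans)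

lemma Zs_mvec: "v \<in> carrier_vec n \<Longrightarrow> Zs *\<^sub>v v = X *\<^sub>v v - P *\<^sub>v v"
  using X P by (simp add: Zs_def minus_mvec)

text \<open>The Riccati equation of \<open>P\<close> subtracted from the Lyapunov equation of
  \<open>X\<close>; the noise intensity \<open>W1\<close> cancels.\<close>

lemma Zs_lyap:
  assumes v: "v \<in> carrier_vec n"
  shows "A *\<^sub>v (Zs *\<^sub>v v) + Zs *\<^sub>v (A\<^sup>T *\<^sub>v v) + P *\<^sub>v (C\<^sup>T *\<^sub>v (W2i *\<^sub>v (C *\<^sub>v (P *\<^sub>v v)))) = 0\<^sub>v n"
proof -
  have ric': "A * P + P * A\<^sup>T - P * C\<^sup>T * W2i * C * P + W1 = 0\<^sub>m n n"
    using ric by (simp add: is_riccati_sol_def)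
  have c: "A * P + P * A\<^sup>T \<in> carrier_mat n n" "P * C\<^sup>T * W2i * C * P \<in> carrier_mat n n"
     "A * P + P * A\<^sup>T - P * C\<^sup>T * W2i * C * P \<in> carrier_mat n n" by (rule carrier_intros A P C W2i)+
  have "(A * P + P * A\<^sup>T - P * C\<^sup>T * W2i * C * P + W1) *\<^sub>v v = 0\<^sub>v n"
    unfolding ric' using v by (simp add: zero_mvec)
  then have e: "A *\<^sub>v (P *\<^sub>v v) + P *\<^sub>v (A\<^sup>T *\<^sub>v v) - P *\<^sub>v (C\<^sup>T *\<^sub>v (W2i *\<^sub>v (C *\<^sub>v (P *\<^sub>v v)))) + W1 *\<^sub>v v = 0\<^sub>v n"
    using A P C W2i W1c v by (simp add: mvec_simps mmult_assoc)
  have ATv: "A\<^sup>T *\<^sub>v v \<in> carrier_vec n" using A v by simp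
  show ?thesis
    unfolding Zs_mvec[OF v] Zs_mvec[OF ATv]
  proof (rule eq_vecI)
    fix i assume "i < dim_vec (0\<^sub>v n :: real vec)"
    then show "(A *\<^sub>v (X *\<^sub>v v - P *\<^sub>v v) + (X *\<^sub>v (A\<^sup>T *\<^sub>v v) - P *\<^sub>v (A\<^sup>T *\<^sub>v v)) + P *\<^sub>v (C\<^sup>T *\<^sub>v (W2i *\<^sub>v (C *\<^sub>v (P *\<^sub>v v))))) $ i = 0\<^sub>v n $ i"
      using A X P W1c v arg_cong[OF e, of "\<lambda>w. w $ i"] arg_cong[OF X_mvec[OF v], of "\<lambda>w. w $ i"]
      by (simp add: mvec_minus del: index_mult_mat_vec)
  qed (use A P in simp)
qed

lemma Ak_opt: "A - Lk * C \<in> carrier_mat n n"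
  by (rule carrier_intros Lk C)+

lemma hurwitz_opt: "hurwitz (A - Lk * C)"
  using ric by (simp add: is_riccati_sol_def Lk_def)

text \<open>By uniqueness it suffices to check the candidate. Both nontrivial blocks reduce to
  \<open>Zs_lyap\<close>: the off-diagonal one through \<open>X - Zs = P\<close>, the lower right
  one through \<open>L W2 L^T = P C^T W2^{-1} C P\<close>.\<close>

lemma SigK_opt: "SigK (A - Lk * C, Lk, G) = blk X Zs Zs"
proof (rule SigK_lyap(3)[OF Ak_opt Lk hurwitz_opt, symmetric])
  show "blk X Zs Zs \<in> carrier_mat (2 * n) (2 * n)" using X Zs by simp
  let ?Ak = "A - Lk * C"
  let ?R12 = "A * Zs + X * C\<^sup>T * Lk\<^sup>T + Zs * ?Ak\<^sup>T"
  let ?R22 = "(Lk * C) * Zs + ?Ak * Zs + (Zs\<^sup>T * (Lk * C)\<^sup>T + Zs * ?Ak\<^sup>T) + Lk * W2 * Lk\<^sup>T"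
  note cs = A X Zs C Lk W2c P W2i
  have LC: "Lk * C \<in> carrier_mat n n" by (rule carrier_intros Lk C)+
  have ZT: "Zs\<^sup>T = Zs" using sym_Zs by (simp add: sym_mat_def)
  have "?R12 = 0\<^sub>m n n"
  proof (rule eq_mat_by_mvec)
    show "?R12 \<in> carrier_mat n n" by (rule carrier_intros cs)+
    fix v :: "real vec" assume v: "v \<in> carrier_vec n"
    let ?c = "C\<^sup>T *\<^sub>v (W2i *\<^sub>v (C *\<^sub>v (P *\<^sub>v v)))"
    have c: "?c \<in> carrier_vec n" using C W2i P v by simp
    have "?R12 *\<^sub>v v = A *\<^sub>v (Zs *\<^sub>v v) + X *\<^sub>v ?c + Zs *\<^sub>v (A\<^sup>T *\<^sub>v v - ?c)"
      using cs v LC by (simp add: mvec_simps mtrans Lk_mvec)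
    also have "\<dots> = A *\<^sub>v (Zs *\<^sub>v v) + X *\<^sub>v ?c + (Zs *\<^sub>v (A\<^sup>T *\<^sub>v v) - (X *\<^sub>v ?c - P *\<^sub>v ?c))"
      using cs v c by (simp add: mvec_minus Zs_mvec[OF c])
    also have "\<dots> = A *\<^sub>v (Zs *\<^sub>v v) + Zs *\<^sub>v (A\<^sup>T *\<^sub>v v) + P *\<^sub>v ?c"
      using cs by (intro eq_vecI) (simp_all del: index_mult_mat_vec)
    also have "\<dots> = 0\<^sub>m n n *\<^sub>v v" unfolding Zs_lyap[OF v] using v by (simp add: zero_mvec)
    finally show "?R12 *\<^sub>v v = 0\<^sub>m n n *\<^sub>v v" .
  qed simp
  moreover have "?R22 = 0\<^sub>m n n"
  proof (rule eq_mat_by_mvec)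
    show "?R22 \<in> carrier_mat n n" by (rule carrier_intros cs)+
    fix v :: "real vec" assume v: "v \<in> carrier_vec n"
    let ?c = "C\<^sup>T *\<^sub>v (W2i *\<^sub>v (C *\<^sub>v (P *\<^sub>v v)))"
    have c: "?c \<in> carrier_vec n" using C W2i P v by simp
    let ?d = "Lk *\<^sub>v (C *\<^sub>v (Zs *\<^sub>v v))"
    have "W2 *\<^sub>v (W2i *\<^sub>v (C *\<^sub>v (P *\<^sub>v v))) = C *\<^sub>v (P *\<^sub>v v)"
      by (rule minv_cancel(1)[OF W2c pos_defD(4)[OF W2]]) (use C P v in simp)
    then have LWL: "Lk *\<^sub>v (W2 *\<^sub>v (Lk\<^sup>T *\<^sub>v v)) = P *\<^sub>v ?c"
      using C P v by (simp add: Lk_mvec)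
    have "?R22 *\<^sub>v v = ?d + (A *\<^sub>v (Zs *\<^sub>v v) - ?d) + (Zs *\<^sub>v ?c + Zs *\<^sub>v (A\<^sup>T *\<^sub>v v - ?c)) + P *\<^sub>v ?c"
      using cs v LC ZT LWL by (simp add: mvec_simps mtrans Lk_mvec(2))
    also have "\<dots> = A *\<^sub>v (Zs *\<^sub>v v) + Zs *\<^sub>v (A\<^sup>T *\<^sub>v v) + P *\<^sub>v ?c"
      using cs c v by (intro eq_vecI) (simp_all add: mvec_minus del: index_mult_mat_vec)
    also have "\<dots> = 0\<^sub>m n n *\<^sub>v v" unfolding Zs_lyap[OF v] using v by (simp add: zero_mvec)
    finally show "?R22 *\<^sub>v v = 0\<^sub>m n n *\<^sub>v v" .
  qed simp
  ultimately show "acl ?Ak Lk * blk X Zs Zs + blk X Zs Zs * (acl ?Ak Lk)\<^sup>T + wcl Lk = 0\<^sub>m (2 * n) (2 * n)"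
    unfolding lyap_blk[OF Ak_opt Lk X Zs Zs X_sym] X_eq by (simp add: mult_2)
qed

end

text \<open>Such a \<open>v\<close> is orthogonal to every column of the Kalman matrix. Rank
  \<open>n\<close> provides \<open>n\<close> independent columns, and the square matrix formed by
  them has an invertible transpose.\<close>

lemma ctrb_kernel:
  assumes M: "M \<in> carrier_mat n n" and B: "B \<in> carrier_mat n m" and ct: "controllable M B"
    and v: "v \<in> carrier_vec n" and z: "\<And>k. B\<^sup>T *\<^sub>v (M\<^sup>T ^\<^sub>m k *\<^sub>v v) = 0\<^sub>v m"
  shows "v = 0\<^sub>v n"
proof -
  have MT: "M\<^sup>T \<in> carrier_mat n n" and BT: "B\<^sup>T \<in> carrier_mat m n" using M B by auto
  have pk: "M ^\<^sub>m k \<in> carrier_mat n n" "M\<^sup>T ^\<^sub>m k \<in> carrier_mat n n" for k by (rule carrier_intros M MT)+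
  have tp: "(M ^\<^sub>m k)\<^sup>T = M\<^sup>T ^\<^sub>m k" for k
  proof (induction k)
    case (Suc k)
    have "(M ^\<^sub>m Suc k)\<^sup>T = M\<^sup>T * M\<^sup>T ^\<^sub>m k"
      using transpose_mult[OF pk(1)[of k] M] by (simp add: Suc)
    also have "\<dots> = M\<^sup>T ^\<^sub>m Suc k"
    proof (rule eq_mat_by_mvec)
      show "M\<^sup>T * M\<^sup>T ^\<^sub>m k \<in> carrier_mat n n" by (rule carrier_intros MT pk)+
      show "M\<^sup>T ^\<^sub>m Suc k \<in> carrier_mat n n" by (rule pk(2))
      fix u :: "real vec" assume u: "u \<in> carrier_vec n"
      show "M\<^sup>T * M\<^sup>T ^\<^sub>m k *\<^sub>v u = M\<^sup>T ^\<^sub>m Suc k *\<^sub>v u"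
        unfolding pow_mvec_Suc[OF MT u] by (rule assoc_mult_mat_vec[OF MT pk(2) u])
    qed
    finally show ?case .
  qed (use M in simp)
  have zk: "(M ^\<^sub>m k * B)\<^sup>T *\<^sub>v v = 0\<^sub>v m" for k
    unfolding transpose_mult[OF pk(1) B] tp using assoc_mult_mat_vec[OF BT pk(2) v] z by simp
  define cs where "cs = concat (map (\<lambda>k. cols (M ^\<^sub>m k * B)) [0..<n])"
  have MB: "M ^\<^sub>m k * B \<in> carrier_mat n m" for k by (rule carrier_intros M B)+
  have csc: "set cs \<subseteq> carrier_vec n" 
  proof
    fix x assume "x \<in> set cs"
    then obtain k where "x \<in> set (cols (M ^\<^sub>m k * B))" by (auto simp: cs_def)
    then show "x \<in> carrier_vec n" using cols_dim[of "M ^\<^sub>m k * B"] MB[of k] M by auto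
  qed
  have ctr: "ctrb_mat M B = mat_of_cols n cs" using M by (simp add: ctrb_mat_def cs_def)
  have rk: "vec_space.rank n (mat_of_cols n cs) = n" using ct M ctr by (simp add: controllable_def)
  have Mc: "mat_of_cols n cs \<in> carrier_mat n (length cs)" by simp
  have cols: "cols (mat_of_cols n cs) = cs" by (rule cols_mat_of_cols[OF csc])
  interpret vec_space "TYPE(real)" n .
  have "lin_indpt {}" by (rule finite_lin_indpt2) auto
  \<comment> \<open>Extending the empty set to a maximal independent set of columns; its cardinality
    is the rank.\<close>
  then have "{} \<subseteq> set cs \<and> lin_indpt {}" by (rule conjI[OF empty_subsetI])
  from maximal_exists_superset[of "set cs" "\<lambda>T. T \<subseteq> set cs \<and> lin_indpt T", OF List.finite_set conjunct1 this]
  obtain S where S: "maximal S (\<lambda>T. T \<subseteq> set cs \<and> lin_indpt T)" by blast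
  have S1: "S \<subseteq> set cs" "lin_indpt S" using S unfolding maximal_def by blast+
  have fS: "finite S" by (rule finite_subset[OF S1(1) List.finite_set])
  have cS: "card S = n" using rank_card_indpt[OF Mc, unfolded cols, OF S] rk by (simp only:)
  obtain l where l: "set l = S" "distinct l" using finite_distinct_list[OF fS] by blast
  then have len: "length l = n" using cS distinct_card by fastforce
  let ?Q = "mat_of_cols n l"
  have Q: "?Q \<in> carrier_mat n n" using len by (simp add: mat_of_cols_def)
  have colsQ: "cols ?Q = l" by (rule cols_mat_of_cols) (use S1(1) csc l(1) in blast)
  have "rank ?Q = n"
  proof (rule lin_indpt_full_rank[OF Q])
    show "distinct (cols ?Q)" unfolding colsQ by (rule l(2))
    show "lin_indpt (set (cols ?Q))" unfolding colsQ l(1) by (rule S1(2))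
  qed
  then have "Determinant.det ?Q \<noteq> 0" by (rule iffD1[OF mat_rank_n_iff[OF Q]])
  then have "Determinant.det ?Q\<^sup>T \<noteq> 0" by (rule det_trans_nz[OF Q])
  moreover have "?Q\<^sup>T *\<^sub>v v = 0\<^sub>v n"
  proof (rule eq_vecI)
    fix i assume "i < dim_vec (0\<^sub>v n :: real vec)"
    then have i: "i < n" by simp
    then have "l ! i \<in> set l" using len by simp
    then have lcs: "l ! i \<in> set cs" using S1(1) l(1) by blast
    then have lc: "l ! i \<in> carrier_vec n" using csc by blast
    obtain k where k: "l ! i \<in> set (cols (M ^\<^sub>m k * B))" using lcs unfolding cs_def by auto
    have "dim_col (M ^\<^sub>m k * B) = m" using B by simp
    then obtain j where j: "j < m" "l ! i = col (M ^\<^sub>m k * B) j"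
      using k unfolding cols_def by auto
    have "row (M ^\<^sub>m k * B)\<^sup>T j = col (M ^\<^sub>m k * B) j"
      by (rule row_transpose) (use j(1) B in simp)
    moreover have "((M ^\<^sub>m k * B)\<^sup>T *\<^sub>v v) $ j = row (M ^\<^sub>m k * B)\<^sup>T j \<bullet> v"
      by (rule index_mult_mat_vec) (use j(1) B in simp)
    ultimately have "col (M ^\<^sub>m k * B) j \<bullet> v = 0" using zk[of k] j(1) by simp
    then have "l ! i \<bullet> v = 0" using j by simp
    moreover have "col ?Q i = l ! i" using i len lc by (intro col_mat_of_cols) auto
    ultimately show "(?Q\<^sup>T *\<^sub>v v) $ i = 0\<^sub>v n $ i" using i len by simp
  qed (use len in simp)
  moreover have "?Q\<^sup>T \<in> carrier_mat n n" using Q by simp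
  ultimately show ?thesis using det_nz_iff_kernel v by blast
qed

section \<open>Convexity of quadratic and matrix fractional functions\<close>

lemma psd_quad_convex:
  assumes Q: "pos_def n Q" and a: "a \<in> carrier_vec n" and b: "b \<in> carrier_vec n" and t: "0 \<le> t" "t \<le> 1"
  shows "(t \<cdot>\<^sub>v a + (1 - t) \<cdot>\<^sub>v b) \<bullet> (Q *\<^sub>v (t \<cdot>\<^sub>v a + (1 - t) \<cdot>\<^sub>v b)) \<le> t * (a \<bullet> (Q *\<^sub>v a)) + (1 - t) * (b \<bullet> (Q *\<^sub>v b))"
proof -
  note D = pos_defD[OF Q]
  have ab: "a - b \<in> carrier_vec n" using a b by simp
  have sw: "b \<bullet> (Q *\<^sub>v a) = a \<bullet> (Q *\<^sub>v b)" by (rule sym_mat_swap[OF D(3) b a])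
  have "t * (a \<bullet> (Q *\<^sub>v a)) + (1 - t) * (b \<bullet> (Q *\<^sub>v b)) - (t \<cdot>\<^sub>v a + (1 - t) \<cdot>\<^sub>v b) \<bullet> (Q *\<^sub>v (t \<cdot>\<^sub>v a + (1 - t) \<cdot>\<^sub>v b))
      = t * (1 - t) * ((a - b) \<bullet> (Q *\<^sub>v (a - b)))"
    using D(1) a b sw by (simp add: mvec_simps sp_simps algebra_simps power2_eq_square)
  then show ?thesis using pos_def_ge_0[OF Q ab] t by (smt (verit) mult_nonneg_nonneg)
qed

text \<open>\<open>h . Q^{-1} h\<close> is the maximum over \<open>y\<close> of the left side,
  attained at \<open>y = Q^{-1} h\<close>. This Young inequality yields convexity of the fractional
  function, optimality of the Kalman filter, and the coercivity constant of a definite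
  matrix.\<close>

lemma frac_lower:
  assumes Q: "pos_def n Q" and h: "h \<in> carrier_vec n" and y: "y \<in> carrier_vec n"
  shows "2 * (h \<bullet> y) - y \<bullet> (Q *\<^sub>v y) \<le> h \<bullet> (minv Q *\<^sub>v h)"
proof -
  note D = pos_defD[OF Q]
  define z where "z = minv Q *\<^sub>v h"
  have z: "z \<in> carrier_vec n" using minv_carrier[OF D(1,4)] h by (simp add: z_def)
  have Qz: "Q *\<^sub>v z = h" unfolding z_def by (rule minv_cancel(1)[OF D(1,4) h])
  have yz: "y - z \<in> carrier_vec n" using z y by simp
  have "(y - z) \<bullet> (Q *\<^sub>v (y - z)) = y \<bullet> (Q *\<^sub>v y) - 2 * (h \<bullet> y) + h \<bullet> z"
    using D(1) y z h Qz sym_mat_swap[OF D(3) z y] comm_scalar_prod[OF y h] comm_scalar_prod[OF z h]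
    by (simp add: mvec_minus sp_simps)
  then show ?thesis using pos_def_ge_0[OF Q yz] unfolding z_def by simp
qed

text \<open>A supremum of functions affine in \<open>(h, Q)\<close> is convex: \<open>y\<close> is
  the maximizer for the combination and is merely admissible at the two end points.\<close>

lemma frac_convex:
  assumes Q: "pos_def n Q" "pos_def n R" and a: "a \<in> carrier_vec n" and b: "b \<in> carrier_vec n" and t: "0 \<le> t" "t \<le> 1"
    and S: "pos_def n (t \<cdot>\<^sub>m Q + (1 - t) \<cdot>\<^sub>m R)"
  shows "(t \<cdot>\<^sub>v a + (1 - t) \<cdot>\<^sub>v b) \<bullet> (minv (t \<cdot>\<^sub>m Q + (1 - t) \<cdot>\<^sub>m R) *\<^sub>v (t \<cdot>\<^sub>v a + (1 - t) \<cdot>\<^sub>v b)) \<le>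
    t * (a \<bullet> (minv Q *\<^sub>v a)) + (1 - t) * (b \<bullet> (minv R *\<^sub>v b))"
proof -
  let ?S = "t \<cdot>\<^sub>m Q + (1 - t) \<cdot>\<^sub>m R" and ?h = "t \<cdot>\<^sub>v a + (1 - t) \<cdot>\<^sub>v b"
  note D = pos_defD[OF S]
  define y where "y = minv ?S *\<^sub>v ?h"
  have h: "?h \<in> carrier_vec n" using a b by simp
  have y: "y \<in> carrier_vec n" using minv_carrier[OF D(1,4)] h by (simp add: y_def)
  have Sy: "?S *\<^sub>v y = ?h" unfolding y_def by (rule minv_cancel(1)[OF D(1,4) h])
  have yh: "y \<bullet> ?h = ?h \<bullet> y" by (rule comm_scalar_prod[OF y h])
  have "?h \<bullet> y = 2 * (?h \<bullet> y) - y \<bullet> (?S *\<^sub>v y)" unfolding Sy yh by simp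
  also have "\<dots> = t * (2 * (a \<bullet> y) - y \<bullet> (Q *\<^sub>v y)) + (1 - t) * (2 * (b \<bullet> y) - y \<bullet> (R *\<^sub>v y))"
    using pos_defD(1)[OF Q(1)] pos_defD(1)[OF Q(2)] a b y by (simp add: mvec_simps sp_simps algebra_simps)
  also have "\<dots> \<le> t * (a \<bullet> (minv Q *\<^sub>v a)) + (1 - t) * (b \<bullet> (minv R *\<^sub>v b))"
    using t mult_left_mono[OF frac_lower[OF Q(1) a y], of t] mult_left_mono[OF frac_lower[OF Q(2) b y], of "1 - t"]
    by simp
  finally show ?thesis unfolding y_def .
qed

lemma pos_def_convex:
  assumes Q: "pos_def n Q" "pos_def n R" and t: "0 < t" "t < 1"
  shows "pos_def n (t \<cdot>\<^sub>m Q + (1 - t) \<cdot>\<^sub>m R)"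
  unfolding pos_def_def
proof (intro conjI ballI impI)
  note D = pos_defD[OF Q(1)] and E = pos_defD[OF Q(2)]
  have "(t \<cdot>\<^sub>m Q + (1 - t) \<cdot>\<^sub>m R)\<^sup>T = t \<cdot>\<^sub>m Q\<^sup>T + (1 - t) \<cdot>\<^sub>m R\<^sup>T" using D(1) E(1) by (auto intro!: eq_matI)
  then show "sym_mat n (t \<cdot>\<^sub>m Q + (1 - t) \<cdot>\<^sub>m R)" using D(1,2) E(1,2) by (simp add: sym_mat_def)
  fix v :: "real vec" assume v: "v \<in> carrier_vec n" "v \<noteq> 0\<^sub>v n"
  have "v \<bullet> ((t \<cdot>\<^sub>m Q + (1 - t) \<cdot>\<^sub>m R) *\<^sub>v v) = t * (v \<bullet> (Q *\<^sub>v v)) + (1 - t) * (v \<bullet> (R *\<^sub>v v))"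
    using D(1) E(1) v(1) by (simp add: mvec_simps sp_simps)
  also have "\<dots> > 0" using D(5)[OF v] E(5)[OF v] t by (simp add: add_pos_pos)
  finally show "0 < v \<bullet> ((t \<cdot>\<^sub>m Q + (1 - t) \<cdot>\<^sub>m R) *\<^sub>v v)" .
qed

lemma convex_combination_add:
  fixes t :: real
  assumes "a \<le> t * b + (1 - t) * c" "r * d \<le> r * (t * e + (1 - t) * f)"
  shows "a + r * d \<le> t * (b + r * e) + (1 - t) * (c + r * f)"
  using assms by (simp add: algebra_simps)

lemma ereal_convex_combination_infty:
  assumes "x = \<infinity> \<or> y = \<infinity>" "x \<noteq> - \<infinity>" "y \<noteq> - \<infinity>" "0 < s" "0 < t"
  shows "ereal s * x + ereal t * y = \<infinity>"
  using assms by (cases x; cases y) simp_all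

context oe begin

text \<open>Semidefinite as a block of a covariance. By \<open>ker\<close> the kernel of
  \<open>Zs\<close> lies in that of \<open>L^T\<close> and is invariant under
  \<open>(A - L C)^T\<close>, so controllability of the Kalman filter, granted by (S4), leaves only
  0.\<close>

lemma pos_def_Zs: "pos_def n Zs"
proof -
  note S = SigK_opt
  have nn: "0 \<le> v \<bullet> (Zs *\<^sub>v v)" if v: "v \<in> carrier_vec n" for v
  proof -
    have "0\<^sub>v n @\<^sub>v v \<in> carrier_vec (2 * n)" using v by (simp add: mult_2)
    from SigK_form_ge_0[OF Ak_opt Lk hurwitz_opt this, of G]
    show ?thesis unfolding S using blk_form[OF X Zs Zs, of "0\<^sub>v n" v] v X Zs by (simp add: mvec_zero)
  qed
  have psd: "pos_semidef n Zs" using sym_Zs nn by (simp add: pos_semidef_def)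
  have one: "minv (1\<^sub>m n) = 1\<^sub>m n" by (rule minv_unique) auto
  \<comment> \<open>(S4) speaks of all similar realizations; \<open>S = 1\<close> picks the Kalman
    filter itself.\<close>
  have "(1\<^sub>m n * (A - Lk * C) * minv (1\<^sub>m n), 1\<^sub>m n * Lk, G * minv (1\<^sub>m n)) \<in> K_opt n A C G W2 P"
    unfolding K_opt_def Let_def Lk_def[symmetric]
    by (rule CollectI, rule exI[of _ "1\<^sub>m n"]) (auto simp: invertible_mat_def inverts_mat_def intro!: exI[of _ "1\<^sub>m n"])
  then have "(A - Lk * C, Lk, G) \<in> K_opt n A C G W2 P"
    unfolding one using Ak_opt Lk G by (simp only: left_mult_one_mat[OF Ak_opt] left_mult_one_mat[OF Lk]
       right_mult_one_mat[OF Ak_opt] right_mult_one_mat[OF G])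
  then have ct: "controllable (A - Lk * C) Lk" using std by (auto simp: standing_assumptions_def)
  define Ao where "Ao = A - Lk * C"
  have Ao: "Ao \<in> carrier_mat n n" unfolding Ao_def by (rule Ak_opt)
  \<comment> \<open>Tested at \<open>v\<close>, the equation of \<open>Zs\<close> gives
    \<open>C P v = 0\<close>, as \<open>W2^{-1}\<close> is definite. The equation itself then gives
    \<open>Zs A^T v = 0\<close>, and on such \<open>v\<close> the maps \<open>A^T\<close> and
    \<open>(A - L C)^T\<close> agree.\<close>
  have ker: "Lk\<^sup>T *\<^sub>v v = 0\<^sub>v m \<and> Zs *\<^sub>v (Ao\<^sup>T *\<^sub>v v) = 0\<^sub>v n" if v: "v \<in> carrier_vec n" and z: "Zs *\<^sub>v v = 0\<^sub>v n" for v
  proof -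
    let ?c = "C *\<^sub>v (P *\<^sub>v v)"
    have c: "?c \<in> carrier_vec m" using C P v by simp
    have lz: "P *\<^sub>v (C\<^sup>T *\<^sub>v (W2i *\<^sub>v ?c)) + Zs *\<^sub>v (A\<^sup>T *\<^sub>v v) = 0\<^sub>v n"
      using Zs_lyap[OF v] Zs A P C W2i v unfolding z
      by (simp add: mvec_zero comm_add_vec[of "Zs *\<^sub>v (A\<^sup>T *\<^sub>v v)" n])
    then have "v \<bullet> (P *\<^sub>v (C\<^sup>T *\<^sub>v (W2i *\<^sub>v ?c)) + Zs *\<^sub>v (A\<^sup>T *\<^sub>v v)) = 0" using v by simp
    then have "v \<bullet> (P *\<^sub>v (C\<^sup>T *\<^sub>v (W2i *\<^sub>v ?c))) + v \<bullet> (Zs *\<^sub>v (A\<^sup>T *\<^sub>v v)) = 0"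
      using v P Zs by (simp add: sp_simps)
    moreover have "v \<bullet> (Zs *\<^sub>v (A\<^sup>T *\<^sub>v v)) = 0"
      using sym_mat_swap[OF sym_Zs v, of "A\<^sup>T *\<^sub>v v"] A v z by simp
    moreover have "v \<bullet> (P *\<^sub>v (C\<^sup>T *\<^sub>v (W2i *\<^sub>v ?c))) = ?c \<bullet> (W2i *\<^sub>v ?c)"
      using sp_mvec_left[of v P "C\<^sup>T *\<^sub>v (W2i *\<^sub>v ?c)"] sp_mvec_left[of "P *\<^sub>v v" C "W2i *\<^sub>v ?c"] P P_sym C W2i v c by simp
    ultimately have "?c \<bullet> (W2i *\<^sub>v ?c) = 0" by simp
    then have c0: "?c = 0\<^sub>v m" using pos_defD(5)[OF pos_def_W2i c] by fastforce
    have L0: "Lk\<^sup>T *\<^sub>v v = 0\<^sub>v m" unfolding Lk_mvec(2)[OF v] c0 using W2i by (simp add: mvec_zero)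
    have "Ao\<^sup>T *\<^sub>v v = A\<^sup>T *\<^sub>v v - C\<^sup>T *\<^sub>v (Lk\<^sup>T *\<^sub>v v)"
      using A Lk C v by (simp add: Ao_def mtrans mvec_simps)
    also have "\<dots> = A\<^sup>T *\<^sub>v v" unfolding L0 using A C v by (simp add: mvec_zero)
    finally have "Ao\<^sup>T *\<^sub>v v = A\<^sup>T *\<^sub>v v" .
    moreover have "Zs *\<^sub>v (A\<^sup>T *\<^sub>v v) = 0\<^sub>v n"
      using lz unfolding c0 using A Zs P C W2i v by (simp add: mvec_zero)
    ultimately show ?thesis using L0 by simp
  qed
  have AkT: "Ao\<^sup>T \<in> carrier_mat n n" using Ao by simp
  show ?thesis
    unfolding pos_def_def
  proof (intro conjI ballI impI sym_Zs)
    fix v :: "real vec" assume v: "v \<in> carrier_vec n" "v \<noteq> 0\<^sub>v n"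
    have "v \<bullet> (Zs *\<^sub>v v) \<noteq> 0"
    proof
      assume "v \<bullet> (Zs *\<^sub>v v) = 0"
      then have z: "Zs *\<^sub>v v = 0\<^sub>v n" by (rule pos_semidef_kernel[OF psd v(1)])
      have pc: "Ao\<^sup>T ^\<^sub>m k *\<^sub>v v \<in> carrier_vec n" for k by (rule carrier_intros AkT v)+
      have it: "Zs *\<^sub>v (Ao\<^sup>T ^\<^sub>m k *\<^sub>v v) = 0\<^sub>v n" for k
      proof (induction k)
        case 0
        have "Ao\<^sup>T ^\<^sub>m 0 *\<^sub>v v = v" using v(1) Ao by simp
        then show ?case using z by (simp only:)
      next
        case (Suc k)
        show ?case unfolding pow_mvec_Suc[OF AkT v(1)] using ker[OF pc Suc] by (rule conjunct2)
      qed
      have ct': "controllable Ao Lk" using ct by (simp only: Ao_def)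
      have "Lk\<^sup>T *\<^sub>v (Ao\<^sup>T ^\<^sub>m k *\<^sub>v v) = 0\<^sub>v m" for k using ker[OF pc it] by (rule conjunct1)
      then have "v = 0\<^sub>v n" by (rule ctrb_kernel[OF Ao Lk ct' v(1)])
      then show False using v(2) by contradiction
    qed
    then show "0 < v \<bullet> (Zs *\<^sub>v v)" using nn[OF v(1)] by simp
  qed
qed

lemma Kopt_Kinfo: "(A - Lk * C, Lk, G) \<in> Kinfo"
  by (rule iffD2[OF Kinfo_iff[OF Ak_opt Lk G hurwitz_opt SigK_opt Zs Zs] pos_defD(4)[OF pos_def_Zs]])

text \<open>For a feasible pair \<open>(T, Q)\<close> the inverse of \<open>T\<close> satisfies the Lyapunov inequality of an observer
  for the time-reversed system \<open>(- A\<^sup>T, C X)\<close> with gain \<open>- minv T * Q\<close>; the Kalman filter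
  corresponds to the solution \<open>minv Zs - Xi\<close> of the associated Riccati equation.\<close>

lemma feas_lower:
  assumes f: "feas T Q E" and Q: "Q \<in> carrier_mat n m" and w: "w \<in> carrier_vec n"
  shows "w \<bullet> (minv Zs *\<^sub>v w) \<le> w \<bullet> ((Xi + minv T) *\<^sub>v w)"
proof -
  have T: "pos_def n T" and lm: "\<And>v. v \<in> carrier_vec n \<Longrightarrow> lmi T Q v \<le> 0" using f by (auto simp: feas_def)
  note D = pos_defD[OF T]
  define Y where "Y = minv T"
  have pY: "pos_def n Y" unfolding Y_def by (rule pos_def_minv[OF T])
  note Y = pos_defD[OF pY]
  have pTs: "pos_def n (minv Zs)" by (rule pos_def_minv[OF pos_def_Zs])
  note Ts = pos_defD[OF pTs] and Zd = pos_defD(4)[OF pos_def_Zs]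
  \<comment> \<open>The value of \<open>\<Theta>^{-1}\<close> at the Kalman filter, where
    \<open>X^{-1} + \<Theta>^{-1} = Zs^{-1}\<close>.\<close>
  define Ys where "Ys = minv Zs - Xi"
  have Ys: "Ys \<in> carrier_mat n n" unfolding Ys_def by (rule carrier_intros Xi)+
  have symYs: "sym_mat n Ys" using Ys Ts(1,2) Xi Xi_sym by (simp add: sym_mat_def Ys_def mtrans)
  define g where "g = Y * Q"
  have g: "g \<in> carrier_mat n m" unfolding g_def by (rule carrier_intros Y(1) Q)+
  define N where "N = - (A\<^sup>T + g * (C * X))"
  have N0: "A\<^sup>T + g * (C * X) \<in> carrier_mat n n" by (rule carrier_intros A g C X)+
  have N: "N \<in> carrier_mat n n" using N0 by (simp add: N_def)
  let ?q = "\<lambda>u. (Xi *\<^sub>v u) \<bullet> (W1 *\<^sub>v (Xi *\<^sub>v u))"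
  have Nform: "u \<bullet> ((N * R + R * N\<^sup>T) *\<^sub>v u) = - 2 * (u \<bullet> (A\<^sup>T *\<^sub>v (R *\<^sub>v u))) - 2 * ((g\<^sup>T *\<^sub>v u) \<bullet> (C *\<^sub>v (X *\<^sub>v (R *\<^sub>v u))))"
    if R: "sym_mat n R" and u: "u \<in> carrier_vec n" for R u
  proof -
    have Rc: "R \<in> carrier_mat n n" "R\<^sup>T = R" using R by (auto simp: sym_mat_def)
    have c: "N * R \<in> carrier_mat n n" "R * N\<^sup>T \<in> carrier_mat n n" by (rule carrier_intros N Rc)+
    have t: "u \<bullet> ((R * N\<^sup>T) *\<^sub>v u) = u \<bullet> ((N * R) *\<^sub>v u)"
      using sp_mvec_swap[of u "N * R" u] c N Rc u by (simp add: mtrans)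
    have "(N * R) *\<^sub>v u = - (A\<^sup>T *\<^sub>v (R *\<^sub>v u) + g *\<^sub>v (C *\<^sub>v (X *\<^sub>v (R *\<^sub>v u))))"
      using N Rc(1) u A g C X by (simp add: N_def mult_mvec add_mvec)
    then have "u \<bullet> ((N * R) *\<^sub>v u) = - (u \<bullet> (A\<^sup>T *\<^sub>v (R *\<^sub>v u))) - u \<bullet> (g *\<^sub>v (C *\<^sub>v (X *\<^sub>v (R *\<^sub>v u))))"
      using u A g C X Rc(1) by (simp add: sp_simps)
    moreover have "u \<bullet> (g *\<^sub>v (C *\<^sub>v (X *\<^sub>v (R *\<^sub>v u)))) = (g\<^sup>T *\<^sub>v u) \<bullet> (C *\<^sub>v (X *\<^sub>v (R *\<^sub>v u)))"
      using sp_mvec_left[of u "g\<^sup>T" "C *\<^sub>v (X *\<^sub>v (R *\<^sub>v u))"] g C X u by simp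
    ultimately show ?thesis unfolding form_add(1)[OF c u] t by simp
  qed
  \<comment> \<open>The substitution \<open>v = Y u\<close> with \<open>Y = T^{-1}\<close> removes
    \<open>T\<close> from the quadratic inequality, which becomes a Lyapunov inequality for
    \<open>Y\<close> with a noise term depending on the gain \<open>g = Y Q\<close>.\<close>
  have lmY: "u \<bullet> ((N * Y + Y * N\<^sup>T) *\<^sub>v u) + ?q u + (g\<^sup>T *\<^sub>v u) \<bullet> (W2 *\<^sub>v (g\<^sup>T *\<^sub>v u)) \<le> 0" if u: "u \<in> carrier_vec n" for u
  proof -
    have v: "Y *\<^sub>v u \<in> carrier_vec n" using Y(1) u by simp
    have Tv: "T *\<^sub>v (Y *\<^sub>v u) = u" unfolding Y_def by (rule minv_cancel(1)[OF D(1,4) u])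
    have gu: "Q\<^sup>T *\<^sub>v (Y *\<^sub>v u) = g\<^sup>T *\<^sub>v u" using Q Y(1,2) u by (simp add: g_def mtrans mult_mvec)
    have "(Y *\<^sub>v u) \<bullet> (T *\<^sub>v (A\<^sup>T *\<^sub>v (Y *\<^sub>v u))) = (A\<^sup>T *\<^sub>v (Y *\<^sub>v u)) \<bullet> u"
      using sym_mat_swap[OF D(3) v, of "A\<^sup>T *\<^sub>v (Y *\<^sub>v u)"] A v Tv by simp
    also have "\<dots> = u \<bullet> (A\<^sup>T *\<^sub>v (Y *\<^sub>v u))" by (rule comm_scalar_prod[of _ n]) (use A v u in auto)
    finally have 1: "(Y *\<^sub>v u) \<bullet> (T *\<^sub>v (A\<^sup>T *\<^sub>v (Y *\<^sub>v u))) = u \<bullet> (A\<^sup>T *\<^sub>v (Y *\<^sub>v u))" .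
    have 2: "(Y *\<^sub>v u) \<bullet> (Q *\<^sub>v (C *\<^sub>v (X *\<^sub>v (Y *\<^sub>v u)))) = (g\<^sup>T *\<^sub>v u) \<bullet> (C *\<^sub>v (X *\<^sub>v (Y *\<^sub>v u)))"
      using sp_mvec_left[of "Y *\<^sub>v u" "Q\<^sup>T" "C *\<^sub>v (X *\<^sub>v (Y *\<^sub>v u))"] Q C X Y(1) v gu by simp
    show ?thesis using lm[OF v] unfolding lmi_def Tv gu 1 2 Nform[OF Y(3) u] by simp
  qed
  \<comment> \<open>With \<open>z = Zs^{-1} u\<close> one finds \<open>X Ys u = P z\<close>; the
    claim is then \<open>Zs_lyap\<close> tested at \<open>z\<close>, combined with
    \<open>W1_form\<close> at \<open>X^{-1} u\<close>.\<close>
  have ricY: "- 2 * (u \<bullet> (A\<^sup>T *\<^sub>v (Ys *\<^sub>v u))) - (C *\<^sub>v (X *\<^sub>v (Ys *\<^sub>v u))) \<bullet> (W2i *\<^sub>v (C *\<^sub>v (X *\<^sub>v (Ys *\<^sub>v u)))) + ?q u = 0"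
    if u: "u \<in> carrier_vec n" for u
  proof -
    define z where "z = minv Zs *\<^sub>v u"
    define r where "r = Xi *\<^sub>v u"
    have z: "z \<in> carrier_vec n" using Ts(1) u by (simp add: z_def)
    have r: "r \<in> carrier_vec n" using Xi u by (simp add: r_def)
    have Zz: "Zs *\<^sub>v z = u" unfolding z_def by (rule minv_cancel(1)[OF Zs Zd u])
    have Yu: "Ys *\<^sub>v u = z - r" using Ts(1) Xi u by (simp add: Ys_def minus_mvec z_def r_def)
    have Xr: "X *\<^sub>v r = u" using Xi_mvec(1)[OF u] by (simp add: r_def)
    have XY: "X *\<^sub>v (Ys *\<^sub>v u) = P *\<^sub>v z"
    proof -
      have "X *\<^sub>v (Ys *\<^sub>v u) = X *\<^sub>v z - u" using X z r by (simp add: Yu mvec_minus Xr)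
      also have "\<dots> = X *\<^sub>v z - (X *\<^sub>v z - P *\<^sub>v z)" using Zs_mvec[OF z] Zz by simp
      also have "\<dots> = P *\<^sub>v z" using X P by (intro eq_vecI) (simp_all del: index_mult_mat_vec)
      finally show ?thesis .
    qed
    let ?c = "C *\<^sub>v (P *\<^sub>v z)"
    have c: "?c \<in> carrier_vec m" using C P z by simp
    have "z \<bullet> (A *\<^sub>v (Zs *\<^sub>v z) + Zs *\<^sub>v (A\<^sup>T *\<^sub>v z) + P *\<^sub>v (C\<^sup>T *\<^sub>v (W2i *\<^sub>v ?c))) = 0"
      unfolding Zs_lyap[OF z] using z by simp
    then have "z \<bullet> (A *\<^sub>v u) + z \<bullet> (Zs *\<^sub>v (A\<^sup>T *\<^sub>v z)) + z \<bullet> (P *\<^sub>v (C\<^sup>T *\<^sub>v (W2i *\<^sub>v ?c))) = 0"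
      unfolding Zz using z u A Zs P by (simp add: sp_simps)
    moreover have "z \<bullet> (Zs *\<^sub>v (A\<^sup>T *\<^sub>v z)) = (A\<^sup>T *\<^sub>v z) \<bullet> u"
      using sym_mat_swap[OF sym_Zs z, of "A\<^sup>T *\<^sub>v z"] A z Zz by simp
    moreover have "(A\<^sup>T *\<^sub>v z) \<bullet> u = z \<bullet> (A *\<^sub>v u)" using sp_mvec_left[of z "A\<^sup>T" u] A z u by simp
    moreover have "z \<bullet> (P *\<^sub>v (C\<^sup>T *\<^sub>v (W2i *\<^sub>v ?c))) = ?c \<bullet> (W2i *\<^sub>v ?c)"
      using sp_mvec_left[of z P "C\<^sup>T *\<^sub>v (W2i *\<^sub>v ?c)"] sp_mvec_left[of "P *\<^sub>v z" C "W2i *\<^sub>v ?c"] P P_sym C W2i z c by simp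
    ultimately have e: "2 * (z \<bullet> (A *\<^sub>v u)) + ?c \<bullet> (W2i *\<^sub>v ?c) = 0" by simp
    have "u \<bullet> (A\<^sup>T *\<^sub>v (z - r)) = u \<bullet> (A\<^sup>T *\<^sub>v z) - u \<bullet> (A\<^sup>T *\<^sub>v r)" using A u z r by (simp add: mvec_minus sp_simps)
    also have "u \<bullet> (A\<^sup>T *\<^sub>v z) = z \<bullet> (A *\<^sub>v u)" using sp_mvec_swap[of u "A\<^sup>T" z] A z u by simp
    finally have "u \<bullet> (A\<^sup>T *\<^sub>v (z - r)) = z \<bullet> (A *\<^sub>v u) - u \<bullet> (A\<^sup>T *\<^sub>v r)" .
    moreover have "r \<bullet> (W1 *\<^sub>v r) = - 2 * (u \<bullet> (A\<^sup>T *\<^sub>v r))" using W1_form[OF r] unfolding Xr .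
    ultimately show ?thesis using e unfolding XY unfolding Yu r_def[symmetric] by simp
  qed
  \<comment> \<open>Strictness of the Lyapunov inequality comes from \<open>W1\<close>, since
    \<open>X^{-1} u \<noteq> 0\<close>.\<close>
  have hN: "hurwitz N"
  proof (rule hurwitzI_lyapunov[OF pY N])
    fix u :: "real vec" assume u: "u \<in> carrier_vec n" "u \<noteq> 0\<^sub>v n"
    have Xu: "Xi *\<^sub>v u \<in> carrier_vec n" using Xi u by simp
    have "Xi *\<^sub>v u \<noteq> 0\<^sub>v n" using pos_defD(4)[OF pos_def_Xi] u unfolding det_nz_iff_kernel[OF Xi] by blast
    then have "?q u > 0" by (rule pos_defD(5)[OF W1 Xu])
    moreover have "(g\<^sup>T *\<^sub>v u) \<bullet> (W2 *\<^sub>v (g\<^sup>T *\<^sub>v u)) \<ge> 0" by (rule pos_def_ge_0[OF W2]) (use g u in simp)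
    ultimately show "u \<bullet> ((N * Y + Y * N\<^sup>T) *\<^sub>v u) < 0" using lmY[OF u(1)] by linarith
  qed
  have YYs: "Y - Ys \<in> carrier_mat n n" by (rule carrier_intros Ys)+
  have "0 \<le> w \<bullet> ((Y - Ys) *\<^sub>v w)"
  proof (rule lyapunov_nonneg[OF N hN YYs _ w])
    fix u :: "real vec" assume u: "u \<in> carrier_vec n"
    have sD: "sym_mat n (Y - Ys)" using Y(1,2) Ys symYs YYs by (simp add: sym_mat_def mtrans)
    let ?c = "C *\<^sub>v (X *\<^sub>v (Ys *\<^sub>v u))" and ?g = "g\<^sup>T *\<^sub>v u"
    have c: "?c \<in> carrier_vec m" "?g \<in> carrier_vec m" using C X Ys g u by auto
    have split: "u \<bullet> ((N * (Y - Ys) + (Y - Ys) * N\<^sup>T) *\<^sub>v u) = u \<bullet> ((N * Y + Y * N\<^sup>T) *\<^sub>v u) - u \<bullet> ((N * Ys + Ys * N\<^sup>T) *\<^sub>v u)"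
      unfolding Nform[OF sD u] Nform[OF Y(3) u] Nform[OF symYs u]
      using A g C X Y(1) Ys u by (simp add: minus_mvec mvec_minus sp_simps)
    \<comment> \<open>The gain of the Riccati equation is the minimizing one; what another gain
      loses is a completed square, here in the form of the Young inequality.\<close>
    have "2 * (?g \<bullet> ?c) \<le> ?g \<bullet> (W2 *\<^sub>v ?g) + ?c \<bullet> (W2i *\<^sub>v ?c)"
      using frac_lower[OF W2 c] comm_scalar_prod[OF c] by simp
    then show "u \<bullet> ((N * (Y - Ys) + (Y - Ys) * N\<^sup>T) *\<^sub>v u) \<le> 0"
      unfolding split Nform[OF symYs u] using lmY[OF u] ricY[OF u] by linarith
  qed
  then have "w \<bullet> (Ys *\<^sub>v w) \<le> w \<bullet> (Y *\<^sub>v w)" unfolding form_add(2)[OF Y(1) Ys w] by simp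
  then show ?thesis
    unfolding form_add(1)[OF Xi Y(1) w, unfolded Y_def] using form_add(2)[OF Ts(1) Xi w] by (simp add: Ys_def Y_def)
qed

text \<open>Two separate comparisons: with \<open>X^{-1} + T^{-1}\<close> replaced by its lower
  bound \<open>Zs^{-1}\<close>, completing the square shows that \<open>H = G Zs\<close> is best;
  going back to the actual value only adds cost.\<close>

lemma fc_minimum:
  assumes H: "H \<in> carrier_mat p n" and Q: "Q \<in> carrier_mat n m"
  shows "fc (Th Zs Zs) (Ps Zs Zs Lk) (G * Zs\<^sup>T) (res12 Zs (A - Lk * C) Lk) \<le> fc T Q H E"
    "\<bar>fc (Th Zs Zs) (Ps Zs Zs Lk) (G * Zs\<^sup>T) (res12 Zs (A - Lk * C) Lk)\<bar> \<noteq> \<infinity>"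
proof -
  note Zd = pos_defD(4)[OF pos_def_Zs]
  note ZZ = pos_defD[OF pos_def_minv[OF pos_def_Zs]]
  have ZT: "Zs\<^sup>T = Zs" using sym_Zs by (simp add: sym_mat_def)
  have D: "pos_def n (schur Zs Zs)"
    by (rule pos_def_schur[OF Zs sym_Zs pos_def_SigK[OF Ak_opt Lk hurwitz_opt SigK_opt Zs sym_Zs Zd]])
  have Tz: "Tm Zs Zs = minv Zs"
    unfolding Tm_def using ZZ(1,2) by (simp add: minv_left[OF Zs Zd] mmult_one)
  have eq: "fc (Th Zs Zs) (Ps Zs Zs Lk) (G * Zs\<^sup>T) (res12 Zs (A - Lk * C) Lk) = ereal (cost (minv Zs) (G * Zs\<^sup>T))"
    unfolding fc_SigK[OF Kopt_Kinfo SigK_opt Zs Zs] L_reg_Kinfo[OF Kopt_Kinfo SigK_opt Zs Zd sym_Zs D] Tz ..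
  show "\<bar>fc (Th Zs Zs) (Ps Zs Zs Lk) (G * Zs\<^sup>T) (res12 Zs (A - Lk * C) Lk)\<bar> \<noteq> \<infinity>" unfolding eq by simp
  show "fc (Th Zs Zs) (Ps Zs Zs Lk) (G * Zs\<^sup>T) (res12 Zs (A - Lk * C) Lk) \<le> fc T Q H E"
  proof (cases "feas T Q E")
    case True
    then have T: "pos_def n T" by (simp add: feas_def)
    have XT: "Xi + minv T \<in> carrier_mat n n" by (rule carrier_intros Xi pos_defD(1)[OF pos_def_minv[OF T]])+
    have row: "- 2 * (g \<bullet> (Zs *\<^sub>v g)) + (Zs *\<^sub>v g) \<bullet> (minv Zs *\<^sub>v (Zs *\<^sub>v g)) \<le> - 2 * (g \<bullet> h) + h \<bullet> (minv Zs *\<^sub>v h)"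
      if g: "g \<in> carrier_vec n" and h: "h \<in> carrier_vec n" for g h
      using frac_lower[OF pos_def_Zs h g] minv_cancel(2)[OF Zs Zd g] comm_scalar_prod[OF g h]
        comm_scalar_prod[of "Zs *\<^sub>v g" n g] Zs g by simp
    have "cost (minv Zs) (G * Zs\<^sup>T) \<le> cost (minv Zs) H"
      unfolding cost_def
    proof (intro add_right_mono sum_mono)
      fix i assume "i \<in> {..<p}"
      then have i: "i < p" by simp
      have r: "row G i \<in> carrier_vec n" "row H i \<in> carrier_vec n" using G H by auto
      show "row G i \<bullet> (X *\<^sub>v row G i) - 2 * (row G i \<bullet> row (G * Zs\<^sup>T) i) + row (G * Zs\<^sup>T) i \<bullet> (minv Zs *\<^sub>v row (G * Zs\<^sup>T) i)
        \<le> row G i \<bullet> (X *\<^sub>v row G i) - 2 * (row G i \<bullet> row H i) + row H i \<bullet> (minv Zs *\<^sub>v row H i)"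
        unfolding row_mult_transpose[OF G Zs i] using row[OF r] by simp
    qed
    also have "\<dots> \<le> cost (Xi + minv T) H"
      by (rule cost_mono[OF ZZ(1) XT H feas_lower[OF True Q]])
    finally show ?thesis unfolding eq using True by (simp add: fc_def)
  qed (simp add: fc_def)
qed

text \<open>Affine in the pair apart from two quadratic forms, whose weights \<open>W1\<close> and
  \<open>W2\<close> are definite.\<close>

lemma lmi_convex:
  assumes T: "T1 \<in> carrier_mat n n" "T2 \<in> carrier_mat n n" and Q: "Q1 \<in> carrier_mat n m" "Q2 \<in> carrier_mat n m"
    and t: "0 \<le> t" "t \<le> 1" and v: "v \<in> carrier_vec n"
  shows "lmi (t \<cdot>\<^sub>m T1 + (1 - t) \<cdot>\<^sub>m T2) (t \<cdot>\<^sub>m Q1 + (1 - t) \<cdot>\<^sub>m Q2) v \<le> t * lmi T1 Q1 v + (1 - t) * lmi T2 Q2 v"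
proof -
  have QT: "(t \<cdot>\<^sub>m Q1 + (1 - t) \<cdot>\<^sub>m Q2)\<^sup>T = t \<cdot>\<^sub>m Q1\<^sup>T + (1 - t) \<cdot>\<^sub>m Q2\<^sup>T" using Q by (auto intro!: eq_matI)
  have 1: "Xi *\<^sub>v ((t \<cdot>\<^sub>m T1 + (1 - t) \<cdot>\<^sub>m T2) *\<^sub>v v) = t \<cdot>\<^sub>v (Xi *\<^sub>v (T1 *\<^sub>v v)) + (1 - t) \<cdot>\<^sub>v (Xi *\<^sub>v (T2 *\<^sub>v v))"
    using T Xi v by (simp add: mvec_simps)
  have 2: "(t \<cdot>\<^sub>m Q1 + (1 - t) \<cdot>\<^sub>m Q2)\<^sup>T *\<^sub>v v = t \<cdot>\<^sub>v (Q1\<^sup>T *\<^sub>v v) + (1 - t) \<cdot>\<^sub>v (Q2\<^sup>T *\<^sub>v v)"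
    unfolding QT using Q v by (simp add: mvec_simps)
  have c: "Xi *\<^sub>v (T1 *\<^sub>v v) \<in> carrier_vec n" "Xi *\<^sub>v (T2 *\<^sub>v v) \<in> carrier_vec n"
    "Q1\<^sup>T *\<^sub>v v \<in> carrier_vec m" "Q2\<^sup>T *\<^sub>v v \<in> carrier_vec m" using Xi T Q v by auto
  have 3: "v \<bullet> ((t \<cdot>\<^sub>m T1 + (1 - t) \<cdot>\<^sub>m T2) *\<^sub>v (A\<^sup>T *\<^sub>v v)) = t * (v \<bullet> (T1 *\<^sub>v (A\<^sup>T *\<^sub>v v))) + (1 - t) * (v \<bullet> (T2 *\<^sub>v (A\<^sup>T *\<^sub>v v)))"
    using T A v by (simp add: mvec_simps sp_simps)
  have 4: "v \<bullet> ((t \<cdot>\<^sub>m Q1 + (1 - t) \<cdot>\<^sub>m Q2) *\<^sub>v (C *\<^sub>v (X *\<^sub>v v))) = t * (v \<bullet> (Q1 *\<^sub>v (C *\<^sub>v (X *\<^sub>v v)))) + (1 - t) * (v \<bullet> (Q2 *\<^sub>v (C *\<^sub>v (X *\<^sub>v v))))"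
    using Q C X v by (simp add: mvec_simps sp_simps)
  show ?thesis
    unfolding lmi_def 1 2 3 4
    using psd_quad_convex[OF W1 c(1,2) t] psd_quad_convex[OF W2 c(3,4) t] by (simp add: algebra_simps)
qed

lemma cost_convex:
  assumes T: "pos_def n T1" "pos_def n T2" and H: "H1 \<in> carrier_mat p n" "H2 \<in> carrier_mat p n" and t: "0 < t" "t < 1"
  shows "cost (Xi + minv (t \<cdot>\<^sub>m T1 + (1 - t) \<cdot>\<^sub>m T2)) (t \<cdot>\<^sub>m H1 + (1 - t) \<cdot>\<^sub>m H2) \<le>
    t * cost (Xi + minv T1) H1 + (1 - t) * cost (Xi + minv T2) H2"
proof -
  let ?T = "t \<cdot>\<^sub>m T1 + (1 - t) \<cdot>\<^sub>m T2" and ?H = "t \<cdot>\<^sub>m H1 + (1 - t) \<cdot>\<^sub>m H2"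
  have pT: "pos_def n ?T" by (rule pos_def_convex[OF T t])
  have t': "0 \<le> t" "t \<le> 1" using t by auto
  note I = pos_defD(1)[OF pos_def_minv[OF pT]] pos_defD(1)[OF pos_def_minv[OF T(1)]] pos_defD(1)[OF pos_def_minv[OF T(2)]]
  have XI: "Xi + minv ?T \<in> carrier_mat n n" "Xi + minv T1 \<in> carrier_mat n n" "Xi + minv T2 \<in> carrier_mat n n"
    by (rule carrier_intros Xi I)+
  have f: "(t \<cdot>\<^sub>v a + (1 - t) \<cdot>\<^sub>v b) \<bullet> ((Xi + minv ?T) *\<^sub>v (t \<cdot>\<^sub>v a + (1 - t) \<cdot>\<^sub>v b)) \<le>
    t * (a \<bullet> ((Xi + minv T1) *\<^sub>v a)) + (1 - t) * (b \<bullet> ((Xi + minv T2) *\<^sub>v b))"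
    if a: "a \<in> carrier_vec n" and b: "b \<in> carrier_vec n" for a b
  proof -
    have ab: "t \<cdot>\<^sub>v a + (1 - t) \<cdot>\<^sub>v b \<in> carrier_vec n" using a b by simp
    show ?thesis
      unfolding form_add(1)[OF Xi I(1) ab] form_add(1)[OF Xi I(2) a] form_add(1)[OF Xi I(3) b]
      using psd_quad_convex[OF pos_def_Xi a b t'] frac_convex[OF T a b t' pT] by (simp add: algebra_simps)
  qed
  \<comment> \<open>The estimate \<open>f\<close> with the same unit vector at both ends, so that
    the combination is that vector again.\<close>
  have tr: "tr (Xi + minv ?T) \<le> t * tr (Xi + minv T1) + (1 - t) * tr (Xi + minv T2)"
    unfolding tr_form[OF XI(1)] tr_form[OF XI(2)] tr_form[OF XI(3)] sum_distrib_left sum.distrib[symmetric]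
  proof (rule sum_mono)
    fix i
    have "t \<cdot>\<^sub>v unit_vec n i + (1 - t) \<cdot>\<^sub>v unit_vec n i = (unit_vec n i :: real vec)"
      by (intro eq_vecI) (auto simp: algebra_simps)
    then show "unit_vec n i \<bullet> ((Xi + minv ?T) *\<^sub>v unit_vec n i) \<le> t * (unit_vec n i \<bullet> ((Xi + minv T1) *\<^sub>v unit_vec n i))
        + (1 - t) * (unit_vec n i \<bullet> ((Xi + minv T2) *\<^sub>v unit_vec n i))"
      using f[of "unit_vec n i" "unit_vec n i"] by simp
  qed
  have "(\<Sum>i<p. row G i \<bullet> (X *\<^sub>v row G i) - 2 * (row G i \<bullet> row ?H i) + row ?H i \<bullet> ((Xi + minv ?T) *\<^sub>v row ?H i)) \<le>
    (\<Sum>i<p. t * (row G i \<bullet> (X *\<^sub>v row G i) - 2 * (row G i \<bullet> row H1 i) + row H1 i \<bullet> ((Xi + minv T1) *\<^sub>v row H1 i))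
     + (1 - t) * (row G i \<bullet> (X *\<^sub>v row G i) - 2 * (row G i \<bullet> row H2 i) + row H2 i \<bullet> ((Xi + minv T2) *\<^sub>v row H2 i)))"
  proof (rule sum_mono)
    fix i assume "i \<in> {..<p}"
    then have i: "i < p" by simp
    have r: "row G i \<in> carrier_vec n" "row H1 i \<in> carrier_vec n" "row H2 i \<in> carrier_vec n" using G H by auto
    have rH: "row ?H i = t \<cdot>\<^sub>v row H1 i + (1 - t) \<cdot>\<^sub>v row H2 i" using H i by (intro eq_vecI) auto
    have "row G i \<bullet> row ?H i = t * (row G i \<bullet> row H1 i) + (1 - t) * (row G i \<bullet> row H2 i)"
      unfolding rH using r G H by (simp add: sp_simps)
    then show "row G i \<bullet> (X *\<^sub>v row G i) - 2 * (row G i \<bullet> row ?H i) + row ?H i \<bullet> ((Xi + minv ?T) *\<^sub>v row ?H i) \<le>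
      t * (row G i \<bullet> (X *\<^sub>v row G i) - 2 * (row G i \<bullet> row H1 i) + row H1 i \<bullet> ((Xi + minv T1) *\<^sub>v row H1 i))
     + (1 - t) * (row G i \<bullet> (X *\<^sub>v row G i) - 2 * (row G i \<bullet> row H2 i) + row H2 i \<bullet> ((Xi + minv T2) *\<^sub>v row H2 i))"
      using f[OF r(2,3)] unfolding rH by (simp add: algebra_simps)
  qed
  moreover have "reg * tr (Xi + minv ?T) \<le> reg * (t * tr (Xi + minv T1) + (1 - t) * tr (Xi + minv T2))"
    by (rule mult_left_mono[OF tr reg])
  ultimately show ?thesis
    unfolding cost_def sum.distrib sum_distrib_left[symmetric] by (rule convex_combination_add)
qed

text \<open>If one end point is infeasible, the strictly positive weights make the right side
  infinite; otherwise feasibility is inherited and \<open>cost_convex\<close> applies.\<close>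

lemma fc_convex:
  assumes T: "T1 \<in> carrier_mat n n" "T2 \<in> carrier_mat n n" and Q: "Q1 \<in> carrier_mat n m" "Q2 \<in> carrier_mat n m"
    and H: "H1 \<in> carrier_mat p n" "H2 \<in> carrier_mat p n" and E: "E1 \<in> carrier_mat n n" "E2 \<in> carrier_mat n n"
    and t: "0 < t" "t < 1"
  shows "fc (t \<cdot>\<^sub>m T1 + (1 - t) \<cdot>\<^sub>m T2) (t \<cdot>\<^sub>m Q1 + (1 - t) \<cdot>\<^sub>m Q2) (t \<cdot>\<^sub>m H1 + (1 - t) \<cdot>\<^sub>m H2) (t \<cdot>\<^sub>m E1 + (1 - t) \<cdot>\<^sub>m E2)
    \<le> ereal t * fc T1 Q1 H1 E1 + ereal (1 - t) * fc T2 Q2 H2 E2"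
proof (cases "feas T1 Q1 E1 \<and> feas T2 Q2 E2")
  case True
  then have f: "pos_def n T1" "pos_def n T2" "E1 = 0\<^sub>m n n" "E2 = 0\<^sub>m n n" by (auto simp: feas_def)
  have "feas (t \<cdot>\<^sub>m T1 + (1 - t) \<cdot>\<^sub>m T2) (t \<cdot>\<^sub>m Q1 + (1 - t) \<cdot>\<^sub>m Q2) (t \<cdot>\<^sub>m E1 + (1 - t) \<cdot>\<^sub>m E2)"
    unfolding feas_def
  proof (intro conjI ballI)
    show "pos_def n (t \<cdot>\<^sub>m T1 + (1 - t) \<cdot>\<^sub>m T2)" by (rule pos_def_convex[OF f(1,2) t])
    show "t \<cdot>\<^sub>m E1 + (1 - t) \<cdot>\<^sub>m E2 = 0\<^sub>m n n" unfolding f by (auto intro!: eq_matI)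
    fix v :: "real vec" assume v: "v \<in> carrier_vec n"
    have "lmi (t \<cdot>\<^sub>m T1 + (1 - t) \<cdot>\<^sub>m T2) (t \<cdot>\<^sub>m Q1 + (1 - t) \<cdot>\<^sub>m Q2) v \<le> t * lmi T1 Q1 v + (1 - t) * lmi T2 Q2 v"
      by (rule lmi_convex[OF T Q _ _ v]) (use t in auto)
    also have "\<dots> \<le> 0" using True v t by (intro add_nonpos_nonpos mult_nonneg_nonpos) (auto simp: feas_def)
    finally show "lmi (t \<cdot>\<^sub>m T1 + (1 - t) \<cdot>\<^sub>m T2) (t \<cdot>\<^sub>m Q1 + (1 - t) \<cdot>\<^sub>m Q2) v \<le> 0" .
  qed
  then show ?thesis using True cost_convex[OF f(1,2) H t] by (simp add: fc_def)
next
  case False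
  then have "fc T1 Q1 H1 E1 = \<infinity> \<or> fc T2 Q2 H2 E2 = \<infinity>" by (auto simp: fc_def)
  moreover have "fc T1 Q1 H1 E1 \<noteq> - \<infinity>" "fc T2 Q2 H2 E2 \<noteq> - \<infinity>" by (auto simp: fc_def)
  ultimately have "ereal t * fc T1 Q1 H1 E1 + ereal (1 - t) * fc T2 Q2 H2 E2 = \<infinity>"
    using t by (intro ereal_convex_combination_infty) auto
  then show ?thesis by (simp only: ereal_less_eq)
qed

end

section \<open>Coordinates of symmetric matrices\<close>

text \<open>Enumerated in the order of the comprehension in \<open>svec\<close>, so that entry
  \<open>k\<close> of \<open>svec S\<close> belongs to index pair \<open>k\<close>.\<close>

definition upper_indices :: "nat \<Rightarrow> (nat \<times> nat) list" where
  "upper_indices N = concat (map (\<lambda>i. map (\<lambda>j. (i, j)) [i..<N]) [0..<N])"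

lemma set_upper_indices: "set (upper_indices N) = {(i, j). i \<le> j \<and> j < N}"
  by (force simp: upper_indices_def)

lemma distinct_upper_indices: "distinct (upper_indices N)"
proof -
  have "distinct (concat (map (\<lambda>i. map (\<lambda>j. (i, j)) [i..<N]) xs))" if "distinct xs" for xs
    using that by (induction xs) (auto simp: distinct_map inj_on_def)
  then show ?thesis by (simp add: upper_indices_def)
qed

text \<open>The sum is doubled before the induction, so that the division in \<open>dim_sym\<close>
  is exact.\<close>

lemma length_upper_indices: "length (upper_indices N) = dim_sym N"
proof -
  have "2 * (\<Sum>i<N. N - i) = N * (N + 1)"
  proof (induction N)
    case (Suc N)
    have "(\<Sum>i<Suc N. Suc N - i) = (\<Sum>i<N. Suc (N - i)) + 1"
      by (simp add: Suc_diff_le)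
    also have "\<dots> = (\<Sum>i<N. N - i) + N + 1" by (simp add: sum_Suc)
    finally show ?case using Suc by simp
  qed simp
  moreover have "length (upper_indices N) = (\<Sum>i<N. N - i)"
    by (simp add: upper_indices_def length_concat comp_def interv_sum_list_conv_sum_set_nat atLeast0LessThan)
  ultimately show ?thesis by (simp add: dim_sym_def)
qed

text \<open>The inverse of \<open>upper_indices\<close>, extended symmetrically. Since the list is
  distinct, the choice is unique, and a closed formula for the position is avoided.\<close>

definition sym_pos :: "nat \<Rightarrow> nat \<Rightarrow> nat \<Rightarrow> nat" where
  "sym_pos N i j = (SOME k. k < dim_sym N \<and> upper_indices N ! k = (min i j, max i j))"

lemma sym_pos:
  assumes "i < N" "j < N"
  shows "sym_pos N i j < dim_sym N" "upper_indices N ! sym_pos N i j = (min i j, max i j)"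
proof -
  have "(min i j, max i j) \<in> set (upper_indices N)" using assms by (auto simp: set_upper_indices)
  then have "\<exists>k. k < dim_sym N \<and> upper_indices N ! k = (min i j, max i j)"
    by (metis in_set_conv_nth length_upper_indices)
  from someI_ex[OF this] show "sym_pos N i j < dim_sym N" "upper_indices N ! sym_pos N i j = (min i j, max i j)"
    by (auto simp: sym_pos_def)
qed

lemma sym_pos_upper_indices:
  assumes "k < dim_sym N" "upper_indices N ! k = (i, j)"
  shows "i \<le> j" "j < N" "sym_pos N i j = k"
proof -
  have "(i, j) \<in> set (upper_indices N)" using assms by (metis length_upper_indices nth_mem)
  then show ij: "i \<le> j" "j < N" by (auto simp: set_upper_indices)
  have "upper_indices N ! sym_pos N i j = upper_indices N ! k" "sym_pos N i j < dim_sym N"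
    using sym_pos[of i N j] ij assms by auto
  then show "sym_pos N i j = k"
    using distinct_upper_indices[of N] assms(1) by (simp add: nth_eq_iff_index_eq length_upper_indices)
qed

definition smat :: "nat \<Rightarrow> real vec \<Rightarrow> real mat" where
  "smat N v = mat N N (\<lambda>(i,j). (if i = j then 1 else 1 / sqrt 2) * v $ sym_pos N i j)"

lemma svec_eq:
  assumes "S \<in> carrier_mat N N"
  shows "svec S = vec (dim_sym N) (\<lambda>k. let (i, j) = upper_indices N ! k in (if i = j then 1 else sqrt 2) * S $$ (i,j))"
proof -
  let ?f = "\<lambda>(i,j). if i = j then S $$ (i,j) else sqrt 2 * S $$ (i,j)"
  have "svec S = vec_of_list (map ?f (upper_indices N))"
    using assms by (simp add: svec_def upper_indices_def map_concat comp_def)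
  also have "\<dots> = vec (dim_sym N) (\<lambda>k. ?f (upper_indices N ! k))"
    by (intro eq_vecI) (simp_all add: length_upper_indices vec_of_list_index)
  also have "\<dots> = vec (dim_sym N) (\<lambda>k. let (i, j) = upper_indices N ! k in (if i = j then 1 else sqrt 2) * S $$ (i,j))"
    by (intro eq_vecI) (auto split: prod.split)
  finally show ?thesis .
qed

lemma svec_carrier [simp]: "S \<in> carrier_mat N N \<Longrightarrow> svec S \<in> carrier_vec (dim_sym N)"
  by (simp add: svec_eq)

lemma smat_carrier [simp]: "smat N v \<in> carrier_mat N N"
  by (simp add: smat_def)

lemma smat_index: "i < N \<Longrightarrow> j < N \<Longrightarrow> smat N v $$ (i,j) = (if i = j then 1 else 1 / sqrt 2) * v $ sym_pos N i j"
  by (simp add: smat_def)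

lemma sym_smat: "sym_mat N (smat N v)"
  by (auto simp: sym_mat_def smat_def sym_pos_def min.commute max.commute intro!: eq_matI)

lemma smat_svec:
  assumes "sym_mat N S"
  shows "smat N (svec S) = S"
proof (rule eq_matI)
  have S: "S \<in> carrier_mat N N" "S\<^sup>T = S" using assms by (auto simp: sym_mat_def)
  fix i j assume "i < dim_row S" "j < dim_col S"
  then have ij: "i < N" "j < N" using S by auto
  have "S $$ (j,i) = S $$ (i,j)" using arg_cong[OF S(2), of "\<lambda>M. M $$ (i,j)"] ij S(1) by simp
  then have "S $$ (min i j, max i j) = S $$ (i,j)" by (auto simp: min_def max_def)
  then show "smat N (svec S) $$ (i,j) = S $$ (i,j)"
    using sym_pos[OF ij] by (simp add: smat_index[OF ij] svec_eq[OF S(1)])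
      (auto simp: min_def max_def split: if_splits)
qed (use assms in \<open>auto simp: sym_mat_def smat_def\<close>)

lemma svec_smat:
  assumes v: "v \<in> carrier_vec (dim_sym N)"
  shows "svec (smat N v) = v"
proof (rule eq_vecI)
  fix k assume "k < dim_vec v"
  then have k: "k < dim_sym N" using v by simp
  obtain i j where ij: "upper_indices N ! k = (i, j)" by (metis surj_pair)
  note p = sym_pos_upper_indices[OF k ij]
  then have "i < N" "j < N" by auto
  then show "svec (smat N v) $ k = v $ k"
    using k p by (simp add: svec_eq[OF smat_carrier] ij smat_index)
qed (use v in simp)

lemma smat_linear:
  assumes "v \<in> carrier_vec (dim_sym N)" "w \<in> carrier_vec (dim_sym N)"
  shows "smat N (v + w) = smat N v + smat N w" "smat N (k \<cdot>\<^sub>v v) = k \<cdot>\<^sub>m smat N v"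
  using assms sym_pos(1)[of _ N] by (auto simp: smat_def distrib_left intro!: eq_matI)

text \<open>The square of indices splits into the triangles \<open>L\<close>, \<open>Q\<close> and
  the diagonal \<open>D\<close>; the factor \<open>sqrt 2\<close> counts \<open>L\<close> twice,
  which accounts for \<open>Q\<close>.\<close>

lemma vnorm_svec:
  assumes "sym_mat N S"
  shows "vnorm (svec S) = frob_norm S"
proof -
  have S: "S \<in> carrier_mat N N" "S\<^sup>T = S" using assms by (auto simp: sym_mat_def)
  have sw: "S $$ (j,i) = S $$ (i,j)" if "i < N" "j < N" for i j
    using arg_cong[OF S(2), of "\<lambda>M. M $$ (i,j)"] that S(1) by simp
  let ?g = "\<lambda>q. (S $$ q)\<^sup>2"
  let ?f = "\<lambda>(i,j). (if i = j then 1 else 2) * (S $$ (i,j))\<^sup>2"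
  have "svec S \<bullet> svec S = (\<Sum>k<dim_sym N. ?f (upper_indices N ! k))"
    unfolding sp_self using S(1)
    by (simp add: svec_eq) (auto intro!: sum.cong simp: split_beta power_mult_distrib)
  also have "\<dots> = sum_list (map ?f (upper_indices N))"
    by (simp add: sum_list_sum_nth length_upper_indices atLeast0LessThan)
  also have "\<dots> = sum ?f {(i, j). i \<le> j \<and> j < N}"
    by (simp only: sum_list_distinct_conv_sum_set[OF distinct_upper_indices] set_upper_indices)
  finally have 1: "svec S \<bullet> svec S = sum ?f {(i, j). i \<le> j \<and> j < N}" .
  define L where "L = {(i, j). i < j \<and> j < N}"
  define Q where "Q = {(i, j). j < i \<and> i < N}"
  define D where "D = {(i, j). i = j \<and> j < N}"
  have fin: "finite L" "finite Q" "finite D"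
    by (rule finite_subset[of _ "{..<N} \<times> {..<N}"]; force simp: L_def Q_def D_def)+
  have s1: "{(i, j). i \<le> j \<and> j < N} = L \<union> D" "L \<inter> D = {}" by (auto simp: L_def D_def)
  have s2: "{..<N} \<times> {..<N} = (L \<union> D) \<union> Q" "(L \<union> D) \<inter> Q = {}" by (auto simp: L_def D_def Q_def)
  have "sum ?f L = sum (\<lambda>p. 2 * ?g p) L" by (intro sum.cong) (auto simp: L_def)
  then have fL: "sum ?f L = 2 * sum ?g L" by (simp add: sum_distrib_left)
  have fD: "sum ?f D = sum ?g D" by (intro sum.cong) (auto simp: D_def)
  have gQ: "sum ?g Q = sum ?g L"
    by (rule sum.reindex_bij_witness[where i = "\<lambda>(i,j). (j,i)" and j = "\<lambda>(i,j). (j,i)"])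
      (auto simp: L_def Q_def sw)
  have "(frob_norm S)\<^sup>2 = sum ?g ({..<N} \<times> {..<N})"
    using S(1) by (simp add: frob_norm_sq sum.cartesian_product)
  also have "\<dots> = sum ?g L + sum ?g D + sum ?g Q"
    unfolding s2 using fin s1 s2 by (simp add: sum.union_disjoint)
  also have "\<dots> = svec S \<bullet> svec S"
    unfolding 1 s1 using fin s1 by (subst sum.union_disjoint) (simp_all add: fL fD gQ)
  finally show ?thesis unfolding vnorm_def by (simp add: real_sqrt_unique)
qed

section \<open>Coordinates of filters\<close>

lemma vec_first_append [simp]: "v \<in> carrier_vec a \<Longrightarrow> vec_first (v @\<^sub>v w) a = v"
  by (auto simp: vec_first_def intro!: eq_vecI)

lemma vec_last_append [simp]: "w \<in> carrier_vec b \<Longrightarrow> vec_last (v @\<^sub>v w) b = w"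
  by (auto simp: vec_last_def intro!: eq_vecI)

lemma filt_of_vec_append:
  assumes "a \<in> carrier_vec (n * n)" "b \<in> carrier_vec (n * m)" "c \<in> carrier_vec (p * n)"
  shows "filt_of_vec n m p (a @\<^sub>v (b @\<^sub>v c)) = (mat_of_vec n n a, mat_of_vec n m b, mat_of_vec p n c)"
proof -
  have "vec_last (a @\<^sub>v (b @\<^sub>v c)) (p * n) = c"
    using assms by (auto simp: vec_last_def intro!: eq_vecI)
  then show ?thesis using assms by (simp add: filt_of_vec_def)
qed

lemma filt_of_vec_of_filt:
  assumes "Ak \<in> carrier_mat n n" "B \<in> carrier_mat n m" "Ck \<in> carrier_mat p n"
  shows "vec_of_filt (Ak, B, Ck) \<in> carrier_vec (dim_filt n m p)"
    "filt_of_vec n m p (vec_of_filt (Ak, B, Ck)) = (Ak, B, Ck)"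
  using assms by (auto simp: dim_filt_def filt_of_vec_append mat_of_vec_of_mat)

lemma vec_of_filt_of_vec:
  assumes x: "x \<in> carrier_vec (dim_filt n m p)"
  shows "vec_of_filt (filt_of_vec n m p x) = x"
proof -
  define a where "a = vec_first x (n * n)"
  define b where "b = vec_first (vec_last x (n * m + p * n)) (n * m)"
  define c where "c = vec_last (vec_last x (n * m + p * n)) (p * n)"
  have d: "a \<in> carrier_vec (n * n)" "b \<in> carrier_vec (n * m)" "c \<in> carrier_vec (p * n)" by (auto simp: a_def b_def c_def)
  have "x = a @\<^sub>v (b @\<^sub>v c)" using x by (simp add: a_def b_def c_def dim_filt_def)
  then show ?thesis using d by (simp add: filt_of_vec_append vec_of_mat_of_vec)
qed

section \<open>Differential calculus on carriers\<close>

text \<open>Neighbourhoods of \<open>x\<close> relative to \<open>Y\<close>, with \<open>x\<close>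
  itself included. A limit of \<open>f\<close> at \<open>f x\<close> along this filter is thus
  continuity on \<open>Y\<close>, and the difference quotients below take the harmless value 0 at
  \<open>y = x\<close>, as division by zero gives 0.\<close>

definition vnear :: "real vec set \<Rightarrow> real vec \<Rightarrow> real vec filter" where
  "vnear Y x = (INF e\<in>{0<..}. principal {y \<in> Y. vnorm (y - x) < e})"

lemma eventually_vnear: "eventually Q (vnear Y x) \<longleftrightarrow> (\<exists>e>0. \<forall>y\<in>Y. vnorm (y - x) < e \<longrightarrow> Q y)"
proof -
  have "eventually Q (vnear Y x) \<longleftrightarrow> (\<exists>e\<in>{0<..}. eventually Q (principal {y \<in> Y. vnorm (y - x) < e}))"
    unfolding vnear_def
  proof (rule eventually_INF_base)
    fix a b :: real assume "a \<in> {0<..}" "b \<in> {0<..}"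
    then show "\<exists>c\<in>{0<..}. principal {y \<in> Y. vnorm (y - x) < c} \<le>
        inf (principal {y \<in> Y. vnorm (y - x) < a}) (principal {y \<in> Y. vnorm (y - x) < b})"
      by (intro bexI[of _ "min a b"]) auto
  qed auto
  then show ?thesis by (auto simp: eventually_principal)
qed

lemma vnear_mono: "Y \<subseteq> Z \<Longrightarrow> vnear Y x \<le> vnear Z x"
  unfolding le_filter_def eventually_vnear by blast

lemma tendsto_vnear:
  fixes f :: "real vec \<Rightarrow> real"
  shows "(f \<longlongrightarrow> l) (vnear Y x) \<longleftrightarrow> (\<forall>e>0. \<exists>\<delta>>0. \<forall>y\<in>Y. vnorm (y - x) < \<delta> \<longrightarrow> \<bar>f y - l\<bar> < e)"
  by (simp add: tendsto_iff eventually_vnear dist_real_def)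

lemma tendsto_vnear_eq:
  fixes f :: "real vec \<Rightarrow> real"
  assumes "(f \<longlongrightarrow> l) (vnear Y x)" "\<And>y. y \<in> Y \<Longrightarrow> f y = g y"
  shows "(g \<longlongrightarrow> l) (vnear Y x)"
  using assms unfolding tendsto_vnear by simp

lemma vnorm_vnear: "((\<lambda>y. vnorm (y - x)) \<longlongrightarrow> 0) (vnear Y x)"
  unfolding tendsto_vnear by force

definition has_grad :: "nat \<Rightarrow> (real vec \<Rightarrow> real) \<Rightarrow> real vec \<Rightarrow> real vec \<Rightarrow> bool" where
  "has_grad d g x D \<longleftrightarrow> x \<in> carrier_vec d \<and> D \<in> carrier_vec d \<and>
    ((\<lambda>y. (g y - g x - D \<bullet> (y - x)) / vnorm (y - x)) \<longlongrightarrow> 0) (vnear (carrier_vec d) x)"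

lemma eventually_carrier: "eventually (\<lambda>y. y \<in> carrier_vec d) (vnear (carrier_vec d) x)"
  unfolding eventually_vnear by (auto intro: exI[of _ 1])

lemma abs_sp_le:
  assumes "D \<in> carrier_vec d" "x \<in> carrier_vec d" "y \<in> carrier_vec d"
  shows "\<bar>D \<bullet> (y - x)\<bar> \<le> vnorm D * vnorm (y - x)" "\<bar>D \<bullet> (y - x) / vnorm (y - x)\<bar> \<le> vnorm D"
proof -
  show 1: "\<bar>D \<bullet> (y - x)\<bar> \<le> vnorm D * vnorm (y - x)" by (rule vec_Cauchy_Schwarz) (use assms in simp)
  show "\<bar>D \<bullet> (y - x) / vnorm (y - x)\<bar> \<le> vnorm D"
    using 1 by (cases "vnorm (y - x) = 0") (auto simp: abs_divide divide_le_eq less_le)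
qed

lemma vec_eq_of_vnorm_minus:
  assumes "x \<in> carrier_vec d" "y \<in> carrier_vec d" "vnorm (y - x) = 0"
  shows "y = x"
proof (rule eq_vecI)
  have z: "y - x = 0\<^sub>v d" using assms vnorm_eq_0[of "y - x" d] by simp
  fix i assume "i < dim_vec x"
  then show "y $ i = x $ i" using arg_cong[OF z, of "\<lambda>w. w $ i"] assms by simp
qed (use assms in simp)

text \<open>\<open>g y\<close> is the error quotient times the distance, plus the linear part, plus
  \<open>g x\<close>; the first two tend to 0.\<close>

lemma has_grad_tendsto:
  assumes "has_grad d g x D"
  shows "(g \<longlongrightarrow> g x) (vnear (carrier_vec d) x)"
proof -
  have c: "x \<in> carrier_vec d" "D \<in> carrier_vec d" and
    r: "((\<lambda>y. (g y - g x - D \<bullet> (y - x)) / vnorm (y - x)) \<longlongrightarrow> 0) (vnear (carrier_vec d) x)" (is "(?r \<longlongrightarrow> 0) _")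
    using assms by (auto simp: has_grad_def)
  have "((\<lambda>y. D \<bullet> (y - x)) \<longlongrightarrow> 0) (vnear (carrier_vec d) x)"
  proof (rule Lim_null_comparison)
    show "\<forall>\<^sub>F y in vnear (carrier_vec d) x. norm (D \<bullet> (y - x)) \<le> vnorm D * vnorm (y - x)"
      using eventually_carrier[of d x] by eventually_elim (use abs_sp_le(1)[OF c(2,1)] in simp)
    show "((\<lambda>y. vnorm D * vnorm (y - x)) \<longlongrightarrow> 0) (vnear (carrier_vec d) x)"
      using tendsto_mult_right_zero[OF vnorm_vnear] by simp
  qed
  from tendsto_add[OF tendsto_add[OF tendsto_mult[OF r vnorm_vnear] this] tendsto_const[of "g x"]]
  have "((\<lambda>y. ?r y * vnorm (y - x) + D \<bullet> (y - x) + g x) \<longlongrightarrow> g x) (vnear (carrier_vec d) x)" by simp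
  then show ?thesis
  proof (rule Lim_transform_eventually)
    show "\<forall>\<^sub>F y in vnear (carrier_vec d) x. ?r y * vnorm (y - x) + D \<bullet> (y - x) + g x = g y"
      using eventually_carrier[of d x]
    proof eventually_elim
      case (elim y)
      show ?case
      proof (cases "vnorm (y - x) = 0")
        case True
        then have "y = x" by (rule vec_eq_of_vnorm_minus[OF c(1) elim])
        then show ?thesis using c by (simp add: minus_cancel_vec)
      qed simp
    qed
  qed
qed

lemma has_grad_const: "x \<in> carrier_vec d \<Longrightarrow> has_grad d (\<lambda>_. c) x (0\<^sub>v d)"
  unfolding has_grad_def tendsto_vnear by (auto intro!: exI[of _ 1])

lemma has_grad_coord:
  assumes "x \<in> carrier_vec d" "k < d"
  shows "has_grad d (\<lambda>y. y $ k) x (unit_vec d k)"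
  unfolding has_grad_def tendsto_vnear using assms by (auto intro!: exI[of _ 1])

lemma has_grad_add:
  assumes "has_grad d f x D" "has_grad d g x E"
  shows "has_grad d (\<lambda>y. f y + g y) x (D + E)"
proof -
  have c: "x \<in> carrier_vec d" "D \<in> carrier_vec d" "E \<in> carrier_vec d" using assms by (auto simp: has_grad_def)
  have "((\<lambda>y. (f y - f x - D \<bullet> (y - x)) / vnorm (y - x) + (g y - g x - E \<bullet> (y - x)) / vnorm (y - x)) \<longlongrightarrow> 0) (vnear (carrier_vec d) x)"
    using assms by (intro tendsto_add_zero) (auto simp: has_grad_def)
  then have "((\<lambda>y. (f y + g y - (f x + g x) - (D + E) \<bullet> (y - x)) / vnorm (y - x)) \<longlongrightarrow> 0) (vnear (carrier_vec d) x)"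
  proof (rule tendsto_vnear_eq)
    fix y :: "real vec" assume y: "y \<in> carrier_vec d"
    have "(D + E) \<bullet> (y - x) = D \<bullet> (y - x) + E \<bullet> (y - x)" using c y by (simp add: sp_add)
    then show "(f y - f x - D \<bullet> (y - x)) / vnorm (y - x) + (g y - g x - E \<bullet> (y - x)) / vnorm (y - x) =
      (f y + g y - (f x + g x) - (D + E) \<bullet> (y - x)) / vnorm (y - x)"
      by (simp add: add_divide_distrib[symmetric])
  qed
  then show ?thesis using c by (simp add: has_grad_def)
qed

lemma has_grad_mult:
  assumes f: "has_grad d f x D" and g: "has_grad d g x E"
  shows "has_grad d (\<lambda>y. f y * g y) x (f x \<cdot>\<^sub>v E + g x \<cdot>\<^sub>v D)"
proof -
  have c: "x \<in> carrier_vec d" "D \<in> carrier_vec d" "E \<in> carrier_vec d" using assms by (auto simp: has_grad_def)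
  let ?F = "vnear (carrier_vec d) x"
  let ?rf = "\<lambda>y. (f y - f x - D \<bullet> (y - x)) / vnorm (y - x)" and ?rg = "\<lambda>y. (g y - g x - E \<bullet> (y - x)) / vnorm (y - x)"
  have r: "(?rf \<longlongrightarrow> 0) ?F" "(?rg \<longlongrightarrow> 0) ?F" using f g by (auto simp: has_grad_def)
  have m: "((\<lambda>y. (f y - f x) * (E \<bullet> (y - x) / vnorm (y - x))) \<longlongrightarrow> 0) ?F"
  proof (rule Lim_null_comparison)
    show "\<forall>\<^sub>F y in ?F. norm ((f y - f x) * (E \<bullet> (y - x) / vnorm (y - x))) \<le> \<bar>f y - f x\<bar> * vnorm E"
      using eventually_carrier[of d x]
    proof eventually_elim
      case (elim y)
      show ?case unfolding real_norm_def abs_mult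
        by (rule mult_left_mono[OF abs_sp_le(2)[OF c(3,1) elim]]) simp
    qed
    have "((\<lambda>y. \<bar>f y - f x\<bar> * vnorm E) \<longlongrightarrow> \<bar>f x - f x\<bar> * vnorm E) ?F"
      by (intro tendsto_intros has_grad_tendsto[OF f])
    then show "((\<lambda>y. \<bar>f y - f x\<bar> * vnorm E) \<longlongrightarrow> 0) ?F" by simp
  qed
  \<comment> \<open>The error of a product: \<open>f y\<close> times the error of \<open>g\<close>,
    \<open>g x\<close> times the error of \<open>f\<close>, and the mixed term bounded in
    \<open>m\<close>.\<close>
  have "((\<lambda>y. f y * ?rg y + g x * ?rf y + (f y - f x) * (E \<bullet> (y - x) / vnorm (y - x))) \<longlongrightarrow> f x * 0 + g x * 0 + 0) ?F"
    by (intro tendsto_add tendsto_mult has_grad_tendsto[OF f] r m tendsto_const)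
  then have "((\<lambda>y. f y * ?rg y + g x * ?rf y + (f y - f x) * (E \<bullet> (y - x) / vnorm (y - x))) \<longlongrightarrow> 0) ?F" by simp
  then have "((\<lambda>y. (f y * g y - f x * g x - (f x \<cdot>\<^sub>v E + g x \<cdot>\<^sub>v D) \<bullet> (y - x)) / vnorm (y - x)) \<longlongrightarrow> 0) ?F"
  proof (rule tendsto_vnear_eq)
    fix y :: "real vec" assume y: "y \<in> carrier_vec d"
    have e: "(f x \<cdot>\<^sub>v E + g x \<cdot>\<^sub>v D) \<bullet> (y - x) = f x * (E \<bullet> (y - x)) + g x * (D \<bullet> (y - x))" using c y by (simp add: sp_add)
    show "f y * ?rg y + g x * ?rf y + (f y - f x) * (E \<bullet> (y - x) / vnorm (y - x)) =
      (f y * g y - f x * g x - (f x \<cdot>\<^sub>v E + g x \<cdot>\<^sub>v D) \<bullet> (y - x)) / vnorm (y - x)"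
      unfolding e times_divide_eq_right add_divide_distrib[symmetric] by (rule arg_cong[where f = "\<lambda>z. z / _"]) (simp add: algebra_simps)
  qed
  then show ?thesis using c by (simp add: has_grad_def)
qed

lemma has_grad_inverse:
  assumes f: "has_grad d f x D" and nz: "f x \<noteq> 0"
  shows "has_grad d (\<lambda>y. inverse (f y)) x ((- inverse ((f x)\<^sup>2)) \<cdot>\<^sub>v D)"
proof -
  have c: "x \<in> carrier_vec d" "D \<in> carrier_vec d" using assms by (auto simp: has_grad_def)
  let ?F = "vnear (carrier_vec d) x"
  let ?rf = "\<lambda>y. (f y - f x - D \<bullet> (y - x)) / vnorm (y - x)"
  have r: "(?rf \<longlongrightarrow> 0) ?F" using f by (auto simp: has_grad_def)
  note ft = has_grad_tendsto[OF f]
  have enz: "\<forall>\<^sub>F y in ?F. f y \<noteq> 0" using tendsto_imp_eventually_ne[OF ft nz] .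
  have m: "((\<lambda>y. (f y - f x) * (D \<bullet> (y - x) / vnorm (y - x))) \<longlongrightarrow> 0) ?F"
  proof (rule Lim_null_comparison)
    show "\<forall>\<^sub>F y in ?F. norm ((f y - f x) * (D \<bullet> (y - x) / vnorm (y - x))) \<le> \<bar>f y - f x\<bar> * vnorm D"
      using eventually_carrier[of d x]
    proof eventually_elim
      case (elim y)
      show ?case unfolding real_norm_def abs_mult
        by (rule mult_left_mono[OF abs_sp_le(2)[OF c(2,1) elim]]) simp
    qed
    have "((\<lambda>y. \<bar>f y - f x\<bar> * vnorm D) \<longlongrightarrow> \<bar>f x - f x\<bar> * vnorm D) ?F"
      by (intro tendsto_intros ft)
    then show "((\<lambda>y. \<bar>f y - f x\<bar> * vnorm D) \<longlongrightarrow> 0) ?F" by simp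
  qed
  \<comment> \<open>An exact decomposition of the error quotient of \<open>1 / f\<close>, valid
    where \<open>f y \<noteq> 0\<close>, that is, eventually.\<close>
  have "((\<lambda>y. ((f y - f x) * (D \<bullet> (y - x) / vnorm (y - x))) / ((f x)\<^sup>2 * f y) - ?rf y / (f x * f y)) \<longlongrightarrow> 0 / ((f x)\<^sup>2 * f x) - 0 / (f x * f x)) ?F"
    by (intro tendsto_intros m r ft) (use nz in auto)
  then have "((\<lambda>y. ((f y - f x) * (D \<bullet> (y - x) / vnorm (y - x))) / ((f x)\<^sup>2 * f y) - ?rf y / (f x * f y)) \<longlongrightarrow> 0) ?F"
    by simp
  then have "((\<lambda>y. (inverse (f y) - inverse (f x) - ((- inverse ((f x)\<^sup>2)) \<cdot>\<^sub>v D) \<bullet> (y - x)) / vnorm (y - x)) \<longlongrightarrow> 0) ?F"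
  proof (rule Lim_transform_eventually)
    show "\<forall>\<^sub>F y in ?F. ((f y - f x) * (D \<bullet> (y - x) / vnorm (y - x))) / ((f x)\<^sup>2 * f y) - ?rf y / (f x * f y) =
      (inverse (f y) - inverse (f x) - ((- inverse ((f x)\<^sup>2)) \<cdot>\<^sub>v D) \<bullet> (y - x)) / vnorm (y - x)"
      using eventually_carrier[of d x] enz
    proof eventually_elim
      case (elim y)
      have e: "((- inverse ((f x)\<^sup>2)) \<cdot>\<^sub>v D) \<bullet> (y - x) = - (D \<bullet> (y - x)) / (f x)\<^sup>2" using c elim by (simp add: divide_inverse)
      show ?case
      proof (cases "vnorm (y - x) = 0")
        case False
        then show ?thesis unfolding e using nz elim(2) by (simp add: field_simps power2_eq_square)
      qed simp
    qed
  qed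
  then show ?thesis using c by (simp add: has_grad_def)
qed

definition C1s :: "nat \<Rightarrow> real vec set \<Rightarrow> (real vec \<Rightarrow> real) \<Rightarrow> bool" where
  "C1s d Y g \<longleftrightarrow> (\<exists>D. \<forall>x\<in>Y. has_grad d g x (D x) \<and> (\<forall>j<d. ((\<lambda>y. D y $ j) \<longlongrightarrow> D x $ j) (vnear Y x)))"

lemma C1s_I:
  assumes "\<And>x. x \<in> Y \<Longrightarrow> has_grad d g x (D x)"
    and "\<And>x j. x \<in> Y \<Longrightarrow> j < d \<Longrightarrow> ((\<lambda>y. D y $ j) \<longlongrightarrow> D x $ j) (vnear Y x)"
  shows "C1s d Y g"
  using assms unfolding C1s_def by blast

lemma C1s_subset:
  assumes "C1s d Z g" "Y \<subseteq> Z"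
  shows "C1s d Y g"
proof -
  obtain D where D: "\<forall>x\<in>Z. has_grad d g x (D x) \<and> (\<forall>j<d. ((\<lambda>y. D y $ j) \<longlongrightarrow> D x $ j) (vnear Z x))"
    using assms(1) by (auto simp: C1s_def)
  show ?thesis
    by (rule C1s_I[of _ _ _ D]) (use D assms(2) tendsto_mono[OF vnear_mono[OF assms(2)]] in blast)+
qed

lemma C1s_const: "Y \<subseteq> carrier_vec d \<Longrightarrow> C1s d Y (\<lambda>_. c)"
  by (rule C1s_I[of _ _ _ "\<lambda>_. 0\<^sub>v d"]) (auto intro: has_grad_const)

lemma C1s_coord: "Y \<subseteq> carrier_vec d \<Longrightarrow> k < d \<Longrightarrow> C1s d Y (\<lambda>y. y $ k)"
  by (rule C1s_I[of _ _ _ "\<lambda>_. unit_vec d k"]) (auto intro: has_grad_coord)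

lemma tendsto_vnear_cong:
  fixes f :: "real vec \<Rightarrow> real"
  assumes "\<And>y. y \<in> Y \<Longrightarrow> f y = g y" "x \<in> Y" "(f \<longlongrightarrow> f x) (vnear Y x)"
  shows "(g \<longlongrightarrow> g x) (vnear Y x)"
  using tendsto_vnear_eq[OF assms(3,1)] assms(1)[OF assms(2)] by simp

lemma C1s_add:
  assumes "C1s d Y f" "C1s d Y g"
  shows "C1s d Y (\<lambda>y. f y + g y)"
proof -
  obtain D where D: "\<And>x. x \<in> Y \<Longrightarrow> has_grad d f x (D x)" "\<And>x j. x \<in> Y \<Longrightarrow> j < d \<Longrightarrow> ((\<lambda>y. D y $ j) \<longlongrightarrow> D x $ j) (vnear Y x)"
    using assms(1) by (auto simp: C1s_def)
  obtain E where E: "\<And>x. x \<in> Y \<Longrightarrow> has_grad d g x (E x)" "\<And>x j. x \<in> Y \<Longrightarrow> j < d \<Longrightarrow> ((\<lambda>y. E y $ j) \<longlongrightarrow> E x $ j) (vnear Y x)"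
    using assms(2) by (auto simp: C1s_def)
  show ?thesis
  proof (rule C1s_I[of _ _ _ "\<lambda>y. D y + E y"])
    fix x assume x: "x \<in> Y"
    show "has_grad d (\<lambda>y. f y + g y) x (D x + E x)" by (rule has_grad_add[OF D(1)[OF x] E(1)[OF x]])
    fix j assume j: "j < d"
    have c: "D y \<in> carrier_vec d" "E y \<in> carrier_vec d" if "y \<in> Y" for y using D(1)[OF that] E(1)[OF that] by (auto simp: has_grad_def)
    show "((\<lambda>y. (D y + E y) $ j) \<longlongrightarrow> (D x + E x) $ j) (vnear Y x)"
      by (rule tendsto_vnear_cong[of _ "\<lambda>y. D y $ j + E y $ j", OF _ x tendsto_add[OF D(2)[OF x j] E(2)[OF x j]]])
        (use c j in force)
  qed
qed

lemma C1s_tendsto: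
  assumes "Y \<subseteq> carrier_vec d" "C1s d Y f" "x \<in> Y"
  shows "(f \<longlongrightarrow> f x) (vnear Y x)"
  using assms has_grad_tendsto tendsto_mono[OF vnear_mono[OF assms(1)]] unfolding C1s_def by blast

lemma C1s_mult:
  assumes Y: "Y \<subseteq> carrier_vec d" and f: "C1s d Y f" and g: "C1s d Y g"
  shows "C1s d Y (\<lambda>y. f y * g y)"
proof -
  obtain D where D: "\<And>x. x \<in> Y \<Longrightarrow> has_grad d f x (D x)" "\<And>x j. x \<in> Y \<Longrightarrow> j < d \<Longrightarrow> ((\<lambda>y. D y $ j) \<longlongrightarrow> D x $ j) (vnear Y x)"
    using f by (auto simp: C1s_def)
  obtain E where E: "\<And>x. x \<in> Y \<Longrightarrow> has_grad d g x (E x)" "\<And>x j. x \<in> Y \<Longrightarrow> j < d \<Longrightarrow> ((\<lambda>y. E y $ j) \<longlongrightarrow> E x $ j) (vnear Y x)"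
    using g by (auto simp: C1s_def)
  show ?thesis
  proof (rule C1s_I[of _ _ _ "\<lambda>y. f y \<cdot>\<^sub>v E y + g y \<cdot>\<^sub>v D y"])
    fix x assume x: "x \<in> Y"
    show "has_grad d (\<lambda>y. f y * g y) x (f x \<cdot>\<^sub>v E x + g x \<cdot>\<^sub>v D x)" by (rule has_grad_mult[OF D(1)[OF x] E(1)[OF x]])
    fix j assume j: "j < d"
    have c: "D y \<in> carrier_vec d" "E y \<in> carrier_vec d" if "y \<in> Y" for y using D(1)[OF that] E(1)[OF that] by (auto simp: has_grad_def)
    have "((\<lambda>y. f y * E y $ j + g y * D y $ j) \<longlongrightarrow> f x * E x $ j + g x * D x $ j) (vnear Y x)"
      by (intro tendsto_intros C1s_tendsto[OF Y f x] C1s_tendsto[OF Y g x] D(2)[OF x j] E(2)[OF x j])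
    then show "((\<lambda>y. (f y \<cdot>\<^sub>v E y + g y \<cdot>\<^sub>v D y) $ j) \<longlongrightarrow> (f x \<cdot>\<^sub>v E x + g x \<cdot>\<^sub>v D x) $ j) (vnear Y x)"
      by (rule tendsto_vnear_cong[rotated 2]) (use c j x in force)+
  qed
qed

lemma C1s_inverse:
  assumes Y: "Y \<subseteq> carrier_vec d" and f: "C1s d Y f" and nz: "\<And>x. x \<in> Y \<Longrightarrow> f x \<noteq> 0"
  shows "C1s d Y (\<lambda>y. inverse (f y))"
proof -
  obtain D where D: "\<And>x. x \<in> Y \<Longrightarrow> has_grad d f x (D x)" "\<And>x j. x \<in> Y \<Longrightarrow> j < d \<Longrightarrow> ((\<lambda>y. D y $ j) \<longlongrightarrow> D x $ j) (vnear Y x)"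
    using f by (auto simp: C1s_def)
  show ?thesis
  proof (rule C1s_I[of _ _ _ "\<lambda>y. (- inverse ((f y)\<^sup>2)) \<cdot>\<^sub>v D y"])
    fix x assume x: "x \<in> Y"
    show "has_grad d (\<lambda>y. inverse (f y)) x ((- inverse ((f x)\<^sup>2)) \<cdot>\<^sub>v D x)" by (rule has_grad_inverse[OF D(1)[OF x] nz[OF x]])
    fix j assume j: "j < d"
    have c: "D y \<in> carrier_vec d" if "y \<in> Y" for y using D(1)[OF that] by (auto simp: has_grad_def)
    have "((\<lambda>y. (- inverse ((f y)\<^sup>2)) * D y $ j) \<longlongrightarrow> (- inverse ((f x)\<^sup>2)) * D x $ j) (vnear Y x)"
      by (intro tendsto_intros C1s_tendsto[OF Y f x] D(2)[OF x j]) (use nz[OF x] in simp)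
    then show "((\<lambda>y. ((- inverse ((f y)\<^sup>2)) \<cdot>\<^sub>v D y) $ j) \<longlongrightarrow> ((- inverse ((f x)\<^sup>2)) \<cdot>\<^sub>v D x) $ j) (vnear Y x)"
      by (rule tendsto_vnear_cong[rotated 2]) (use c j x in force)+
  qed
qed

lemma C1s_sum:
  assumes Y: "Y \<subseteq> carrier_vec d" and "finite I" "\<And>i. i \<in> I \<Longrightarrow> C1s d Y (f i)"
  shows "C1s d Y (\<lambda>y. \<Sum>i\<in>I. f i y)"
  using assms(2,3) by (induction I rule: finite_induct) (auto intro: C1s_add C1s_const[OF Y])

lemma C1s_prod:
  assumes Y: "Y \<subseteq> carrier_vec d" and "finite I" "\<And>i. i \<in> I \<Longrightarrow> C1s d Y (f i)"
  shows "C1s d Y (\<lambda>y. \<Prod>i\<in>I. f i y)"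
  using assms(2,3) by (induction I rule: finite_induct) (auto intro: C1s_mult[OF Y] C1s_const[OF Y])

text \<open>Openness matters: \<open>has_grad\<close> looks at a full neighbourhood, while the two
  functions agree on \<open>Y\<close> only.\<close>

lemma C1s_cong:
  assumes Y: "vopen d Y" and f: "C1s d Y f" and eq: "\<And>y. y \<in> Y \<Longrightarrow> f y = g y"
  shows "C1s d Y g"
proof -
  obtain D where D: "\<And>x. x \<in> Y \<Longrightarrow> has_grad d f x (D x)" "\<And>x j. x \<in> Y \<Longrightarrow> j < d \<Longrightarrow> ((\<lambda>y. D y $ j) \<longlongrightarrow> D x $ j) (vnear Y x)"
    using f by (auto simp: C1s_def)
  show ?thesis
  proof (rule C1s_I[of _ _ _ D])
    fix x assume x: "x \<in> Y"
    have ev: "\<forall>\<^sub>F y in vnear (carrier_vec d) x. y \<in> Y"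
      using Y x unfolding vopen_def eventually_vnear by blast
    have "((\<lambda>y. (g y - g x - D x \<bullet> (y - x)) / vnorm (y - x)) \<longlongrightarrow> 0) (vnear (carrier_vec d) x)"
    proof (rule Lim_transform_eventually)
      show "((\<lambda>y. (f y - f x - D x \<bullet> (y - x)) / vnorm (y - x)) \<longlongrightarrow> 0) (vnear (carrier_vec d) x)"
        using D(1)[OF x] by (simp add: has_grad_def)
      show "\<forall>\<^sub>F y in vnear (carrier_vec d) x. (f y - f x - D x \<bullet> (y - x)) / vnorm (y - x) = (g y - g x - D x \<bullet> (y - x)) / vnorm (y - x)"
        using ev by eventually_elim (simp add: eq x)
    qed
    then show "has_grad d g x (D x)" using D(1)[OF x] by (simp add: has_grad_def)
  qed (rule D(2))
qed

subsection \<open>Matrix-valued functions\<close>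

text \<open>The dimensions are demanded at every argument, also outside \<open>Y\<close>, so that
  entries of sums and products can be rewritten under the binder without membership
  conditions.\<close>

definition C1m :: "nat \<Rightarrow> real vec set \<Rightarrow> nat \<Rightarrow> nat \<Rightarrow> (real vec \<Rightarrow> real mat) \<Rightarrow> bool" where
  "C1m d Y r c M \<longleftrightarrow> (\<forall>x. M x \<in> carrier_mat r c) \<and> (\<forall>i<r. \<forall>j<c. C1s d Y (\<lambda>x. M x $$ (i,j)))"

lemma C1m_const: "Y \<subseteq> carrier_vec d \<Longrightarrow> M \<in> carrier_mat r c \<Longrightarrow> C1m d Y r c (\<lambda>_. M)"
  by (simp add: C1m_def C1s_const)

lemma C1m_add:
  assumes "C1m d Y r c M" "C1m d Y r c N"
  shows "C1m d Y r c (\<lambda>x. M x + N x)"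
proof -
  have c: "M x \<in> carrier_mat r c" "N x \<in> carrier_mat r c" for x using assms by (auto simp: C1m_def)
  have "(M x + N x) $$ (i,j) = M x $$ (i,j) + N x $$ (i,j)" if "i < r" "j < c" for x i j
    using c[of x] that by simp
  then show ?thesis using assms by (auto simp: C1m_def intro: C1s_add)
qed

lemma C1m_transpose:
  assumes "C1m d Y r c M"
  shows "C1m d Y c r (\<lambda>x. (M x)\<^sup>T)"
proof -
  have "M x \<in> carrier_mat r c" for x using assms by (auto simp: C1m_def)
  from carrier_matD[OF this] have "(M x)\<^sup>T $$ (i,j) = M x $$ (j,i)" if "i < c" "j < r" for x i j
    using that by simp
  then show ?thesis using assms by (auto simp: C1m_def)
qed

lemma C1m_mult:
  assumes Y: "Y \<subseteq> carrier_vec d" and M: "C1m d Y r c M" and N: "C1m d Y c q N"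
  shows "C1m d Y r q (\<lambda>x. M x * N x)"
proof -
  have c: "M x \<in> carrier_mat r c" "N x \<in> carrier_mat c q" for x using M N by (auto simp: C1m_def)
  have "(M x * N x) $$ (i,j) = (\<Sum>k<c. M x $$ (i,k) * N x $$ (k,j))" if "i < r" "j < q" for x i j
    using c[of x] that by (simp add: scalar_prod_def atLeast0LessThan)
  moreover have "C1s d Y (\<lambda>x. \<Sum>k<c. M x $$ (i,k) * N x $$ (k,j))" if "i < r" "j < q" for i j
    by (intro C1s_sum[OF Y] C1s_mult[OF Y]) (use M N that in \<open>auto simp: C1m_def\<close>)
  moreover have "M x * N x \<in> carrier_mat r q" for x by (rule mult_carrier_mat[OF c])
  ultimately show ?thesis by (auto simp: C1m_def)
qed

lemma C1m_uminus:
  assumes Y: "Y \<subseteq> carrier_vec d" and "C1m d Y r c M"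
  shows "C1m d Y r c (\<lambda>x. - M x)"
proof -
  have "M x \<in> carrier_mat r c" for x using assms by (auto simp: C1m_def)
  from carrier_matD[OF this] have "(- M x) $$ (i,j) = (-1) * M x $$ (i,j)" if "i < r" "j < c" for x i j
    using that by simp
  moreover have "C1s d Y (\<lambda>x. (-1) * M x $$ (i,j))" if "i < r" "j < c" for i j
    by (intro C1s_mult[OF Y] C1s_const[OF Y]) (use assms that in \<open>auto simp: C1m_def\<close>)
  ultimately show ?thesis using assms by (auto simp: C1m_def)
qed

lemma C1m_minus:
  assumes Y: "Y \<subseteq> carrier_vec d" and M: "C1m d Y r c M" and N: "C1m d Y r c N"
  shows "C1m d Y r c (\<lambda>x. M x - N x)"
proof -
  have "M x - N x = M x + - N x" for x using M N by (intro eq_matI) (auto simp: C1m_def)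
  then show ?thesis using C1m_add[OF M C1m_uminus[OF Y N]] by simp
qed

text \<open>By the Leibniz formula the determinant is a polynomial in the entries.\<close>

lemma C1s_det:
  assumes Y: "Y \<subseteq> carrier_vec d" and M: "C1m d Y n n M"
  shows "C1s d Y (\<lambda>x. Determinant.det (M x))"
proof -
  have c: "M x \<in> carrier_mat n n" for x using M by (auto simp: C1m_def)
  have "Determinant.det (M x) = (\<Sum>q\<in>{q. q permutes {0..<n}}. signof q * (\<Prod>i=0..<n. M x $$ (i, q i)))" for x
    by (rule det_def'[OF c])
  moreover have "C1s d Y (\<lambda>x. \<Sum>q\<in>{q. q permutes {0..<n}}. signof q * (\<Prod>i=0..<n. M x $$ (i, q i)))"
  proof (intro C1s_sum[OF Y] C1s_mult[OF Y] C1s_const[OF Y] C1s_prod[OF Y])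
    fix q i assume "q \<in> {q. q permutes {0..<n}}" "i \<in> {0..<n}"
    then have "i < n" "q i < n" by (auto dest: permutes_in_image)
    then show "C1s d Y (\<lambda>x. M x $$ (i, q i))" using M by (auto simp: C1m_def)
  qed (auto intro: finite_permutations)
  ultimately show ?thesis by simp
qed

lemma vopen_det:
  assumes M: "C1m d (carrier_vec d) n n M"
  shows "vopen d {x \<in> carrier_vec d. Determinant.det (M x) \<noteq> 0}"
  unfolding vopen_def
proof (intro conjI ballI)
  fix x assume "x \<in> {x \<in> carrier_vec d. Determinant.det (M x) \<noteq> 0}"
  then have x: "x \<in> carrier_vec d" "Determinant.det (M x) \<noteq> 0" by auto
  have "((\<lambda>x. Determinant.det (M x)) \<longlongrightarrow> Determinant.det (M x)) (vnear (carrier_vec d) x)"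
    by (rule C1s_tendsto[OF subset_refl C1s_det[OF subset_refl M] x(1)])
  from tendsto_imp_eventually_ne[OF this x(2)]
  show "\<exists>e>0. \<forall>y\<in>carrier_vec d. vnorm (y - x) < e \<longrightarrow> y \<in> {x \<in> carrier_vec d. Determinant.det (M x) \<noteq> 0}"
    unfolding eventually_vnear by auto
qed auto

lemma minv_adj:
  assumes M: "M \<in> carrier_mat n n" and det: "Determinant.det M \<noteq> 0"
  shows "minv M = inverse (Determinant.det M) \<cdot>\<^sub>m adj_mat M"
proof (rule minv_unique[OF M])
  note a = adj_mat[OF M]
  show "inverse (Determinant.det M) \<cdot>\<^sub>m adj_mat M \<in> carrier_mat n n" using a by simp
  show "M * (inverse (Determinant.det M) \<cdot>\<^sub>m adj_mat M) = 1\<^sub>m n"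
    unfolding mult_smult_distrib[OF M a(1)] a(2) using det by (auto intro!: eq_matI)
qed

text \<open>Cramer's rule: each entry of the inverse is a signed minor divided by the determinant.
  The claim is entrywise because off \<open>Y\<close> the value \<open>minv (M x)\<close> is
  unspecified, even in its dimensions.\<close>

lemma C1m_minv:
  assumes M: "C1m d (carrier_vec d) n n M" and Y: "Y = {x \<in> carrier_vec d. Determinant.det (M x) \<noteq> 0}"
    and i: "i < n" and j: "j < n"
  shows "C1s d Y (\<lambda>x. minv (M x) $$ (i,j))"
proof -
  have c: "M x \<in> carrier_mat n n" for x using M by (auto simp: C1m_def)
  have Yc: "Y \<subseteq> carrier_vec d" by (auto simp: Y)
  have MY: "C1m d Y n n M" using M C1s_subset[OF _ Yc] by (auto simp: C1m_def)
  have del: "C1m d Y (n - 1) (n - 1) (\<lambda>x. mat_delete (M x) j i)"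
    unfolding C1m_def
  proof (intro conjI allI impI)
    show "mat_delete (M x) j i \<in> carrier_mat (n - 1) (n - 1)" for x
      using c[of x] by (rule mat_delete_carrier)
    fix k l assume kl: "k < n - 1" "l < n - 1"
    have "mat_delete (M x) j i $$ (k,l) = M x $$ (if k < j then k else Suc k, if l < i then l else Suc l)" for x
      using c[of x] kl by (auto simp: mat_delete_def)
    then show "C1s d Y (\<lambda>x. mat_delete (M x) j i $$ (k,l))" using MY kl by (auto simp: C1m_def)
  qed
  have "C1s d Y (\<lambda>x. inverse (Determinant.det (M x)) * ((-1)^(j + i) * Determinant.det (mat_delete (M x) j i)))"
    by (intro C1s_mult[OF Yc] C1s_inverse[OF Yc] C1s_const[OF Yc] C1s_det[OF Yc MY] C1s_det[OF Yc del]) (auto simp: Y)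
  then show ?thesis
  proof (rule C1s_cong[rotated])
    show "vopen d Y" unfolding Y by (rule vopen_det[OF M])
    fix x assume "x \<in> Y"
    then have "minv (M x) = inverse (Determinant.det (M x)) \<cdot>\<^sub>m adj_mat (M x)"
      using minv_adj[OF c] by (simp add: Y)
    then show "inverse (Determinant.det (M x)) * ((-1)^(j + i) * Determinant.det (mat_delete (M x) j i)) = minv (M x) $$ (i,j)"
      using i j c[of x] adj_mat(1)[OF c[of x]] by (simp add: adj_mat_def cofactor_def)
  qed
qed

subsection \<open>Jacobians\<close>

lemma has_grad_line:
  assumes g: "has_grad d g x D" and h: "h \<in> carrier_vec d"
  shows "((\<lambda>t. g (x + t \<cdot>\<^sub>v h)) has_real_derivative (D \<bullet> h)) (at 0)"
proof -
  have c: "x \<in> carrier_vec d" "D \<in> carrier_vec d" and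
    r: "((\<lambda>y. (g y - g x - D \<bullet> (y - x)) / vnorm (y - x)) \<longlongrightarrow> 0) (vnear (carrier_vec d) x)" (is "(?r \<longlongrightarrow> 0) _")
    using g by (auto simp: has_grad_def)
  have d: "x + t \<cdot>\<^sub>v h - x = t \<cdot>\<^sub>v h" for t using c h by (intro eq_vecI) auto
  have x0: "x + 0 \<cdot>\<^sub>v h = x" using c h by (intro eq_vecI) auto
  have lim: "filterlim (\<lambda>t. x + t \<cdot>\<^sub>v h) (vnear (carrier_vec d) x) (at 0)"
    unfolding filterlim_iff
  proof (intro allI impI)
    fix Q assume "eventually Q (vnear (carrier_vec d) x)"
    then obtain e where e: "e > 0" "\<And>y. y \<in> carrier_vec d \<Longrightarrow> vnorm (y - x) < e \<Longrightarrow> Q y" by (auto simp: eventually_vnear)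
    show "\<forall>\<^sub>F t in at 0. Q (x + t \<cdot>\<^sub>v h)"
      unfolding eventually_at
    proof (intro exI[of _ "e / (vnorm h + 1)"] conjI ballI impI)
      have p: "vnorm h + 1 > 0" using vnorm_ge_0[of h] by linarith
      show "0 < e / (vnorm h + 1)" using e(1) p by simp
      fix t :: real assume "t \<noteq> 0 \<and> dist t 0 < e / (vnorm h + 1)"
      then have "\<bar>t\<bar> * (vnorm h + 1) < e" using p by (simp add: dist_real_def pos_less_divide_eq)
      moreover have "\<bar>t\<bar> * vnorm h \<le> \<bar>t\<bar> * (vnorm h + 1)" by (rule mult_left_mono) auto
      ultimately have "vnorm (x + t \<cdot>\<^sub>v h - x) < e" unfolding d vnorm_smult by simp
      then show "Q (x + t \<cdot>\<^sub>v h)" using e(2) c h by simp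
    qed
  qed
  have "((\<lambda>t. \<bar>?r (x + t \<cdot>\<^sub>v h)\<bar> * vnorm h) \<longlongrightarrow> \<bar>0\<bar> * vnorm h) (at 0)"
    by (intro tendsto_intros filterlim_compose[OF r lim])
  then have z: "((\<lambda>t. \<bar>?r (x + t \<cdot>\<^sub>v h)\<bar> * vnorm h) \<longlongrightarrow> 0) (at 0)" by simp
  have "((\<lambda>t. (g (x + t \<cdot>\<^sub>v h) - g x) / t - D \<bullet> h) \<longlongrightarrow> 0) (at 0)"
  proof (rule Lim_null_comparison[OF _ z])
    show "\<forall>\<^sub>F t in at 0. norm ((g (x + t \<cdot>\<^sub>v h) - g x) / t - D \<bullet> h) \<le> \<bar>?r (x + t \<cdot>\<^sub>v h)\<bar> * vnorm h"
      unfolding eventually_at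
    proof (intro exI[of _ 1] conjI ballI impI)
      fix t :: real assume "t \<noteq> 0 \<and> dist t 0 < 1"
      then have t: "t \<noteq> 0" by simp
      have e: "D \<bullet> (t \<cdot>\<^sub>v h) = t * (D \<bullet> h)" using c h by simp
      show "norm ((g (x + t \<cdot>\<^sub>v h) - g x) / t - D \<bullet> h) \<le> \<bar>?r (x + t \<cdot>\<^sub>v h)\<bar> * vnorm h"
      proof (cases "vnorm h = 0")
        case True
        then have "h = 0\<^sub>v d" using h vnorm_eq_0 by blast
        then have "x + t \<cdot>\<^sub>v h = x" "D \<bullet> h = 0" using c by auto
        then show ?thesis by simp
      next
        case False
        then show ?thesis unfolding d e vnorm_smult using t
          by (simp add: abs_divide abs_mult diff_divide_distrib[symmetric] field_simps)
      qed
    qed simp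
  qed
  then show ?thesis
    unfolding has_field_derivative_iff using LIM_zero_iff[of "\<lambda>t. (g (x + t \<cdot>\<^sub>v h) - g x) / t" "D \<bullet> h" "at 0"]
    by (simp add: x0)
qed

lemma has_jacobian_of_grads:
  assumes F: "\<And>y. y \<in> carrier_vec d \<Longrightarrow> vnorm (y - x) < r \<Longrightarrow> F y \<in> carrier_vec k" and r: "r > 0"
    and x: "x \<in> carrier_vec d"
    and g: "\<And>i. i < k \<Longrightarrow> has_grad d (\<lambda>y. F y $ i) x (D i)"
  shows "has_jacobian d k F x (mat k d (\<lambda>(i,j). D i $ j))"
  unfolding has_jacobian_def
proof (intro conjI allI impI)
  let ?J = "mat k d (\<lambda>(i,j). D i $ j)"
  fix e :: real assume e: "e > 0"
  \<comment> \<open>The Euclidean norm is bounded by the sum of \<open>k\<close> components, each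
    controlled by \<open>c\<close>; the added 1 covers \<open>k = 0\<close>.\<close>
  define c where "c = e / (real k + 1)"
  have c: "c > 0" using e by (simp add: c_def add_nonneg_pos)
  have "\<forall>\<^sub>F y in vnear (carrier_vec d) x. \<bar>F y $ i - F x $ i - D i \<bullet> (y - x)\<bar> \<le> c * vnorm (y - x)" if i: "i < k" for i
  proof -
    have Di: "D i \<in> carrier_vec d" using g[OF i] by (simp add: has_grad_def)
    have "((\<lambda>y. (F y $ i - F x $ i - D i \<bullet> (y - x)) / vnorm (y - x)) \<longlongrightarrow> 0) (vnear (carrier_vec d) x)"
      using g[OF i] by (simp add: has_grad_def)
    then have "\<forall>\<^sub>F y in vnear (carrier_vec d) x. \<bar>(F y $ i - F x $ i - D i \<bullet> (y - x)) / vnorm (y - x)\<bar> < c"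
      using c unfolding tendsto_iff dist_real_def by simp
    then show ?thesis using eventually_carrier[of d x]
    proof eventually_elim
      case (elim y)
      show ?case
      proof (cases "vnorm (y - x) = 0")
        case True
        then have "y = x" by (rule vec_eq_of_vnorm_minus[OF x elim(2)])
        then show ?thesis using x Di by (simp add: minus_cancel_vec)
      next
        case False
        then have "vnorm (y - x) > 0" by (simp add: less_le)
        then show ?thesis using elim(1) by (simp add: abs_divide pos_divide_less_eq)
      qed
    qed
  qed
  then have "\<forall>\<^sub>F y in vnear (carrier_vec d) x. \<forall>i\<in>{..<k}. \<bar>F y $ i - F x $ i - D i \<bullet> (y - x)\<bar> \<le> c * vnorm (y - x)"
    by (intro eventually_ball_finite) auto
  then obtain \<delta> where \<delta>: "\<delta> > 0" "\<And>y i. y \<in> carrier_vec d \<Longrightarrow> vnorm (y - x) < \<delta> \<Longrightarrow> i < k \<Longrightarrow>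
      \<bar>F y $ i - F x $ i - D i \<bullet> (y - x)\<bar> \<le> c * vnorm (y - x)"
    unfolding eventually_vnear by auto
  show "\<exists>\<delta>>0. \<forall>h\<in>carrier_vec d. vnorm h < \<delta> \<longrightarrow> vnorm (F (x + h) - F x - ?J *\<^sub>v h) \<le> e * vnorm h"
  proof (intro exI[of _ "min \<delta> r"] conjI ballI impI)
    show "min \<delta> r > 0" using \<delta>(1) r by simp
    fix h :: "real vec" assume h: "h \<in> carrier_vec d" "vnorm h < min \<delta> r"
    have xh: "x + h \<in> carrier_vec d" "x + h - x = h" using x h by (auto intro!: eq_vecI)
    have Fc: "F (x + h) \<in> carrier_vec k" by (rule F) (use xh h in auto)
    have Fx: "F x \<in> carrier_vec k" by (rule F) (use x r in \<open>auto simp: minus_cancel_vec\<close>)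
    let ?v = "F (x + h) - F x - ?J *\<^sub>v h"
    have v: "dim_vec ?v = k" by simp
    have "\<bar>?v $ i\<bar> \<le> c * vnorm h" if i: "i < k" for i
    proof -
      have "D i \<in> carrier_vec d" using g[OF i] by (simp add: has_grad_def)
      then have "row ?J i = D i" using i by (intro eq_vecI) auto
      then have "?v $ i = F (x + h) $ i - F x $ i - D i \<bullet> h" using i Fc Fx by simp
      then show ?thesis using \<delta>(2)[OF xh(1) _ i] xh(2) h(2) by simp
    qed
    then have "(\<Sum>i<k. \<bar>?v $ i\<bar>) \<le> (\<Sum>i<k. c * vnorm h)" by (intro sum_mono) auto
    then have "vnorm ?v \<le> real k * (c * vnorm h)" using vnorm_le_sum[of ?v] unfolding v by simp
    also have "\<dots> \<le> (real k + 1) * (c * vnorm h)" using c by (intro mult_right_mono) auto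
    also have "\<dots> = e * vnorm h" by (simp add: c_def add_nonneg_eq_0_iff)
    finally show "vnorm ?v \<le> e * vnorm h" .
  qed
qed simp

lemma C1_on_components:
  assumes Y: "vopen d Y" and F: "\<And>y. y \<in> Y \<Longrightarrow> F y \<in> carrier_vec k"
    and g: "\<And>i. i < k \<Longrightarrow> C1s d Y (\<lambda>y. F y $ i)"
  shows "C1_on d k Y F"
proof -
  have "\<forall>i. \<exists>D. i < k \<longrightarrow> (\<forall>x\<in>Y. has_grad d (\<lambda>y. F y $ i) x (D x) \<and> (\<forall>j<d. ((\<lambda>y. D y $ j) \<longlongrightarrow> D x $ j) (vnear Y x)))"
    using g by (auto simp: C1s_def)
  from choice[OF this] obtain D where
    DD: "\<forall>i. i < k \<longrightarrow> (\<forall>x\<in>Y. has_grad d (\<lambda>y. F y $ i) x (D i x) \<and> (\<forall>j<d. ((\<lambda>y. D i y $ j) \<longlongrightarrow> D i x $ j) (vnear Y x)))"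
    by blast
  then have D: "\<And>i x. i < k \<Longrightarrow> x \<in> Y \<Longrightarrow> has_grad d (\<lambda>y. F y $ i) x (D i x)"
    "\<And>i x j. i < k \<Longrightarrow> x \<in> Y \<Longrightarrow> j < d \<Longrightarrow> ((\<lambda>y. D i y $ j) \<longlongrightarrow> D i x $ j) (vnear Y x)"
    by simp_all
  let ?J = "\<lambda>x. mat k d (\<lambda>(i,j). D i x $ j)"
  have "has_jacobian d k F x (?J x)" if x: "x \<in> Y" for x
  proof -
    obtain r where r: "r > 0" "\<And>y. y \<in> carrier_vec d \<Longrightarrow> vnorm (y - x) < r \<Longrightarrow> y \<in> Y"
      using Y x by (auto simp: vopen_def)
    show ?thesis
      by (rule has_jacobian_of_grads[OF F[OF r(2)] r(1)]) (use Y x D in \<open>auto simp: vopen_def\<close>)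
  qed
  moreover have "\<exists>\<delta>>0. \<forall>y\<in>Y. vnorm (y - x) < \<delta> \<longrightarrow> \<bar>?J y $$ (i,j) - ?J x $$ (i,j)\<bar> < e"
    if "i < k" "j < d" "x \<in> Y" "e > 0" for i j x and e :: real
    using D(2)[OF that(1,3,2)] that unfolding tendsto_vnear by simp
  ultimately show ?thesis unfolding C1_on_def using F by (intro conjI exI[of _ ?J]) blast+
qed

lemma has_jacobian_line:
  assumes J: "has_jacobian d k F x J" and x: "x \<in> carrier_vec d" and h: "h \<in> carrier_vec d" and i: "i < k"
    and F: "dim_vec (F x) = k"
  shows "((\<lambda>t. F (x + t \<cdot>\<^sub>v h) $ i) has_real_derivative ((J *\<^sub>v h) $ i)) (at 0)"
proof -
  have Jc: "J \<in> carrier_mat k d" using J by (simp add: has_jacobian_def)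
  have x0: "x + 0 \<cdot>\<^sub>v h = x" using x h by (intro eq_vecI) auto
  have "((\<lambda>t. (F (x + t \<cdot>\<^sub>v h) $ i - F x $ i) / t) \<longlongrightarrow> (J *\<^sub>v h) $ i) (at 0)"
    unfolding tendsto_iff eventually_at
  proof (intro allI impI)
    fix e :: real assume e: "e > 0"
    \<comment> \<open>The factor 2 keeps the final inequality strict; the added 1 covers
      \<open>h = 0\<close>.\<close>
    define c where "c = e / (2 * (vnorm h + 1))"
    have p: "vnorm h + 1 > 0" using vnorm_ge_0[of h] by linarith
    have c: "c > 0" using e p by (simp add: c_def)
    obtain \<delta> where \<delta>: "\<delta> > 0" "\<And>h. h \<in> carrier_vec d \<Longrightarrow> vnorm h < \<delta> \<Longrightarrow> vnorm (F (x + h) - F x - J *\<^sub>v h) \<le> c * vnorm h"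
      using J c unfolding has_jacobian_def by blast
    show "\<exists>r>0. \<forall>t\<in>UNIV. t \<noteq> 0 \<and> dist t 0 < r \<longrightarrow> dist ((F (x + t \<cdot>\<^sub>v h) $ i - F x $ i) / t) ((J *\<^sub>v h) $ i) < e"
    proof (intro exI[of _ "\<delta> / (vnorm h + 1)"] conjI ballI impI)
      show "0 < \<delta> / (vnorm h + 1)" using \<delta>(1) p by simp
      fix t :: real assume t: "t \<noteq> 0 \<and> dist t 0 < \<delta> / (vnorm h + 1)"
      then have "\<bar>t\<bar> * (vnorm h + 1) < \<delta>" using p by (simp add: dist_real_def pos_less_divide_eq)
      moreover have "\<bar>t\<bar> * vnorm h \<le> \<bar>t\<bar> * (vnorm h + 1)" by (rule mult_left_mono) auto
      ultimately have "vnorm (t \<cdot>\<^sub>v h) < \<delta>" unfolding vnorm_smult by simp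
      then have b: "vnorm (F (x + t \<cdot>\<^sub>v h) - F x - J *\<^sub>v (t \<cdot>\<^sub>v h)) \<le> c * (\<bar>t\<bar> * vnorm h)"
        using \<delta>(2)[of "t \<cdot>\<^sub>v h"] h by (simp add: vnorm_smult)
      have Jh: "J *\<^sub>v (t \<cdot>\<^sub>v h) = t \<cdot>\<^sub>v (J *\<^sub>v h)" using Jc h by (simp add: mvec_smult)
      have "\<bar>(F (x + t \<cdot>\<^sub>v h) - F x - J *\<^sub>v (t \<cdot>\<^sub>v h)) $ i\<bar> \<le> c * (\<bar>t\<bar> * vnorm h)"
        by (rule order_trans[OF abs_index_le_vnorm b]) (use i Jc in simp)
      moreover have "(F (x + t \<cdot>\<^sub>v h) - F x - J *\<^sub>v (t \<cdot>\<^sub>v h)) $ i = F (x + t \<cdot>\<^sub>v h) $ i - F x $ i - t * (J *\<^sub>v h) $ i"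
        unfolding Jh using i Jc F by (simp del: index_mult_mat_vec)
      ultimately have "\<bar>F (x + t \<cdot>\<^sub>v h) $ i - F x $ i - t * (J *\<^sub>v h) $ i\<bar> \<le> \<bar>t\<bar> * (c * vnorm h)" by (simp add: ac_simps)
      then have "\<bar>(F (x + t \<cdot>\<^sub>v h) $ i - F x $ i) / t - (J *\<^sub>v h) $ i\<bar> \<le> c * vnorm h"
      proof -
        assume a: "\<bar>F (x + t \<cdot>\<^sub>v h) $ i - F x $ i - t * (J *\<^sub>v h) $ i\<bar> \<le> \<bar>t\<bar> * (c * vnorm h)"
        have "\<bar>(F (x + t \<cdot>\<^sub>v h) $ i - F x $ i) / t - (J *\<^sub>v h) $ i\<bar> = \<bar>F (x + t \<cdot>\<^sub>v h) $ i - F x $ i - t * (J *\<^sub>v h) $ i\<bar> / \<bar>t\<bar>"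
          using t by (simp add: abs_divide[symmetric] diff_divide_distrib del: index_mult_mat_vec)
        then show ?thesis using a t by (simp add: divide_le_eq mult.commute del: index_mult_mat_vec)
      qed
      also have "c * vnorm h \<le> c * (vnorm h + 1)" using c by simp
      also have "\<dots> = e / 2" using p by (simp add: c_def field_simps)
      also have "\<dots> < e" using e by simp
      finally show "dist ((F (x + t \<cdot>\<^sub>v h) $ i - F x $ i) / t) ((J *\<^sub>v h) $ i) < e" by (simp add: dist_real_def)
    qed
  qed
  then show ?thesis unfolding has_field_derivative_iff by (simp add: x0)
qed

text \<open>Directional derivatives determine the action of any Jacobian on every \<open>h\<close>,
  so the description operator in \<open>jacobian_mat\<close> has a unique witness.\<close>

lemma jacobian_mat_line:
  assumes J: "has_jacobian d k F x J" and x: "x \<in> carrier_vec d" and F: "dim_vec (F x) = k"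
  shows "jacobian_mat d k F x = J"
  unfolding jacobian_mat_def
proof (rule the_equality[of "has_jacobian d k F x", OF J])
  fix J' assume J': "has_jacobian d k F x J'"
  have c: "J \<in> carrier_mat k d" "J' \<in> carrier_mat k d" using J J' by (auto simp: has_jacobian_def)
  show "J' = J"
  proof (rule eq_mat_by_mvec[OF c(2,1)])
    fix h :: "real vec" assume h: "h \<in> carrier_vec d"
    show "J' *\<^sub>v h = J *\<^sub>v h"
    proof (rule eq_vecI)
      fix i assume "i < dim_vec (J *\<^sub>v h)"
      then have i: "i < k" using c by simp
      show "(J' *\<^sub>v h) $ i = (J *\<^sub>v h) $ i"
        by (rule DERIV_unique[OF has_jacobian_line[OF J' x h i F] has_jacobian_line[OF J x h i F]])
    qed (use c in simp)
  qed
qed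

section \<open>Singular values\<close>

text \<open>Symmetry equates \<open>b . S a\<close> and \<open>a . S b\<close>; with the eigenvector
  equations this says \<open>Im \<mu> (|a|^2 + |b|^2) = 0\<close>.\<close>

lemma sym_real_eigenvalue:
  assumes S: "sym_mat n S" and ev: "eigenvalue (map_mat complex_of_real S) \<mu>"
  shows "Im \<mu> = 0"
proof -
  have Sc: "S \<in> carrier_mat n n" using S by (simp add: sym_mat_def)
  obtain a b where ab: "real_eigenpair n S (Re \<mu>) (Im \<mu>) a b"
    using ev eigenvalue_iff_real_eigenpair[OF Sc] by blast
  have c: "a \<in> carrier_vec n" "b \<in> carrier_vec n" and nz: "a \<noteq> 0\<^sub>v n \<or> b \<noteq> 0\<^sub>v n"
    and e: "S *\<^sub>v a = Re \<mu> \<cdot>\<^sub>v a - Im \<mu> \<cdot>\<^sub>v b" "S *\<^sub>v b = Im \<mu> \<cdot>\<^sub>v a + Re \<mu> \<cdot>\<^sub>v b"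
    using ab by (auto simp: real_eigenpair_def)
  have "b \<bullet> (Re \<mu> \<cdot>\<^sub>v a - Im \<mu> \<cdot>\<^sub>v b) = a \<bullet> (Im \<mu> \<cdot>\<^sub>v a + Re \<mu> \<cdot>\<^sub>v b)"
    using sym_mat_swap[OF S c(2,1)] unfolding e .
  then have "Im \<mu> * (a \<bullet> a + b \<bullet> b) = 0"
    using c comm_scalar_prod[OF c] by (simp add: sp_simps algebra_simps)
  moreover have "a \<bullet> a + b \<bullet> b \<noteq> 0"
    using nz sp_self_eq_0[OF c(1)] sp_self_eq_0[OF c(2)] sp_self_ge_0[of a] sp_self_ge_0[of b] by linarith
  ultimately show ?thesis by simp
qed

lemma proots_linear_factors: "proots (\<Prod>a\<leftarrow>as. [:- a, 1:]) = mset (as :: real list)"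
proof (induction as)
  case (Cons a as)
  have nz: "(\<Prod>a\<leftarrow>as. [:- a, 1:]) \<noteq> 0" for as :: "real list" by (auto simp: prod_list_zero_iff)
  have "proots ([:- a, 1:] * (\<Prod>a\<leftarrow>as. [:- a, 1:])) = proots [:- a, 1:] + proots (\<Prod>a\<leftarrow>as. [:- a, 1:])"
    by (rule proots_mult) (use nz in auto)
  then show ?case using Cons by simp
qed simp

lemma map_poly_of_real_linear_mult:
  "map_poly complex_of_real (pCons 0 q - Polynomial.smult c q) =
    pCons 0 (map_poly complex_of_real q) - Polynomial.smult (complex_of_real c) (map_poly complex_of_real q)"
  by (simp add: poly_eq_iff coeff_map_poly coeff_pCons split: nat.split)

lemma of_real_poly_eq_iff: "map_poly complex_of_real p = map_poly complex_of_real q \<longleftrightarrow> p = q"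
  by (auto simp: poly_eq_iff coeff_map_poly)

text \<open>The characteristic polynomial splits over the complex numbers and its roots are real.
  The length \<open>n\<close> ensures that the list in \<open>sing_val\<close> has as many entries
  as \<open>J\<close> has rows.\<close>

lemma sym_char_poly_splits:
  assumes S: "sym_mat n S"
  obtains as :: "real list" where "char_poly S = (\<Prod>a\<leftarrow>as. [:- a, 1:])" "length as = n"
proof -
  have Sc: "S \<in> carrier_mat n n" using S by (simp add: sym_mat_def)
  then have cS: "map_mat complex_of_real S \<in> carrier_mat n n" by simp
  obtain bs where bs: "char_poly (map_mat complex_of_real S) = (\<Prod>a\<leftarrow>bs. [:- a, 1:])" "length bs = n"
    using char_poly_factorized[OF cS] by blast
  have "Im b = 0" if "b \<in> set bs" for b
  proof -
    have "poly (char_poly (map_mat complex_of_real S)) b = 0"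
      unfolding bs(1) using that by (auto simp: poly_prod_list prod_list_zero_iff)
    then show ?thesis using sym_real_eigenvalue[OF S] eigenvalue_root_char_poly[OF cS] by blast
  qed
  then have re: "map complex_of_real (map Re bs) = bs"
    by (auto intro!: map_idI simp: complex_eq_iff)
  have "map_poly complex_of_real (char_poly S) = (\<Prod>a\<leftarrow>map complex_of_real (map Re bs). [:- a, 1:])"
    unfolding re bs(1)[symmetric] by (rule of_real_hom.char_poly_hom[OF Sc, symmetric])
  also have "\<dots> = map_poly complex_of_real (\<Prod>a\<leftarrow>map Re bs. [:- a, 1:])"
    by (induction bs) (simp_all add: map_poly_of_real_linear_mult)
  finally have "char_poly S = (\<Prod>a\<leftarrow>map Re bs. [:- a, 1:])"
    by (simp add: of_real_poly_eq_iff)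
  then show ?thesis using that[of "map Re bs"] bs(2) by simp
qed

text \<open>A right inverse of norm \<open>q\<close> bounds every eigenvalue \<open>a\<close> of
  \<open>J J^T\<close> from below: for an eigenvector \<open>v\<close> and a preimage
  \<open>h\<close> of it, \<open>|v|^2 = h . J^T v <= q |v| |J^T v|\<close>, while
  \<open>|J^T v|^2 = a |v|^2\<close>.\<close>

lemma sing_val_ge:
  assumes J: "J \<in> carrier_mat k d" and k: "1 \<le> k" "k \<le> d" and q: "q > 0"
    and inv: "\<And>w. w \<in> carrier_vec k \<Longrightarrow> \<exists>h\<in>carrier_vec d. J *\<^sub>v h = w \<and> vnorm h \<le> q * vnorm w"
  shows "sing_val k J \<ge> 1 / q"
proof -
  let ?S = "J * J\<^sup>T"
  have Sc: "?S \<in> carrier_mat k k" using J by simp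
  have S: "sym_mat k ?S" unfolding sym_mat_def using J by (simp add: mtrans)
  obtain as where as: "char_poly ?S = (\<Prod>a\<leftarrow>as. [:- a, 1:])" "length as = k"
    using sym_char_poly_splits[OF S] by blast
  have ge: "sqrt a \<ge> 1 / q" if a: "a \<in> set as" for a
  proof -
    have "poly (char_poly ?S) a = 0" unfolding as(1) using a by (auto simp: poly_prod_list prod_list_zero_iff)
    then obtain v where v: "v \<in> carrier_vec k" "v \<noteq> 0\<^sub>v k" "?S *\<^sub>v v = a \<cdot>\<^sub>v v"
      using eigenvalue_root_char_poly[OF Sc, of a] carrier_matD(1)[OF Sc] unfolding eigenvalue_def eigenvector_def by auto
    let ?u = "J\<^sup>T *\<^sub>v v"
    obtain h where h: "h \<in> carrier_vec d" "J *\<^sub>v h = v" "vnorm h \<le> q * vnorm v" using inv[OF v(1)] by blast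
    have vp: "vnorm v > 0" by (rule vnorm_pos[OF v(1,2)])
    have "(vnorm v)\<^sup>2 = h \<bullet> ?u" unfolding vnorm_sq using sp_mvec_left[of h J v] J h v by simp
    also have "\<dots> \<le> vnorm h * vnorm ?u" by (rule vec_Cauchy_Schwarz') (use J h in simp)
    also have "\<dots> \<le> (q * vnorm v) * vnorm ?u" by (rule mult_right_mono[OF h(3)]) simp
    finally have "vnorm v * vnorm v \<le> vnorm v * (q * vnorm ?u)" by (simp add: power2_eq_square ac_simps)
    then have le: "vnorm v \<le> q * vnorm ?u" using vp by simp
    have "a * (vnorm v)\<^sup>2 = (?S *\<^sub>v v) \<bullet> v" unfolding v(3) vnorm_sq by simp
    also have "\<dots> = (J *\<^sub>v ?u) \<bullet> v" using J v by (simp add: mult_mvec)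
    also have "\<dots> = (vnorm ?u)\<^sup>2" unfolding vnorm_sq using sp_mvec_left[of ?u J v] J v by simp
    finally have e: "a * (vnorm v)\<^sup>2 = (vnorm ?u)\<^sup>2" .
    have "(vnorm v)\<^sup>2 \<le> (q * vnorm ?u)\<^sup>2" by (rule power_mono[OF le]) simp
    also have "\<dots> = q\<^sup>2 * a * (vnorm v)\<^sup>2" by (simp add: power_mult_distrib e[symmetric])
    finally have "1 \<le> q\<^sup>2 * a" using vp by simp
    then have "(1 / q)\<^sup>2 \<le> a" using q by (simp add: power_divide divide_le_eq mult.commute)
    then show ?thesis by (rule real_le_rsqrt)
  qed
  let ?M = "image_mset sqrt (proots (char_poly ?S))"
  have M: "?M = mset (map sqrt as)" unfolding as(1) proots_linear_factors by simp
  let ?l = "rev (sorted_list_of_multiset ?M)"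
  have "mset ?l = mset (map sqrt as)" by (simp add: M)
  then have "set ?l = set (map sqrt as)" "length ?l = k" using as(2) by (metis set_mset_mset, metis length_map size_mset)
  \<comment> \<open>Index \<open>k - 1\<close> holds the \<open>k\<close>-th largest value. The
    bound holds for every listed value, so membership in the list is enough.\<close>
  then have "?l ! (k - 1) \<in> sqrt ` set as" using k(1) nth_mem[of "k - 1" ?l] by simp
  then have "?l ! (k - 1) \<ge> 1 / q" using ge by auto
  then show ?thesis using J k by (simp add: sing_val_def)
qed

section \<open>Derivatives of matrices along lines\<close>

text \<open>Dimensions are required only near 0, because \<open>minv\<close> has guaranteed
  dimensions only where the determinant is nonzero.\<close>

definition mder :: "nat \<Rightarrow> nat \<Rightarrow> (real \<Rightarrow> real mat) \<Rightarrow> real mat \<Rightarrow> bool" where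
  "mder r c M M' \<longleftrightarrow> (\<forall>\<^sub>F t in nhds 0. M t \<in> carrier_mat r c) \<and> M' \<in> carrier_mat r c \<and>
     (\<forall>i<r. \<forall>j<c. ((\<lambda>t. M t $$ (i,j)) has_real_derivative M' $$ (i,j)) (at 0))"

lemma deriv_cong_nhds:
  fixes f :: "real \<Rightarrow> real"
  assumes "(f has_real_derivative D) (at 0)" "D = E" "\<forall>\<^sub>F t in nhds 0. f t = g t"
  shows "(g has_real_derivative E) (at 0)"
  using DERIV_cong_ev[OF refl assms(3) assms(2)] assms(1) by simp

lemma mder_cong:
  assumes "mder r c M M'" "\<forall>\<^sub>F t in nhds 0. M t = N t"
  shows "mder r c N M'"
proof -
  have "\<forall>\<^sub>F t in nhds 0. N t \<in> carrier_mat r c"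
    using assms(2) conjunct1[OF assms(1)[unfolded mder_def]] by eventually_elim simp
  moreover have "((\<lambda>t. N t $$ (i,j)) has_real_derivative M' $$ (i,j)) (at 0)" if "i < r" "j < c" for i j
  proof (rule DERIV_cong_ev[THEN iffD1, OF refl _ refl])
    show "\<forall>\<^sub>F t in nhds 0. M t $$ (i,j) = N t $$ (i,j)" using assms(2) by eventually_elim simp
    show "((\<lambda>t. M t $$ (i,j)) has_real_derivative M' $$ (i,j)) (at 0)" using assms(1) that by (simp add: mder_def)
  qed
  ultimately show ?thesis using assms(1) by (simp add: mder_def)
qed

lemma mder_unique:
  assumes "mder r c M M'" "mder r c M M''"
  shows "M' = M''"
proof (rule eq_matI)
  fix i j assume "i < dim_row M''" "j < dim_col M''"
  then have "((\<lambda>t. M t $$ (i,j)) has_real_derivative M' $$ (i,j)) (at 0)" "((\<lambda>t. M t $$ (i,j)) has_real_derivative M'' $$ (i,j)) (at 0)"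
    using assms by (auto simp: mder_def)
  then show "M' $$ (i,j) = M'' $$ (i,j)" by (rule DERIV_unique)
qed (use assms in \<open>auto simp: mder_def\<close>)

lemma mder_const: "M \<in> carrier_mat r c \<Longrightarrow> mder r c (\<lambda>_. M) (0\<^sub>m r c)"
  by (auto simp: mder_def)

lemma mder_line:
  assumes "M \<in> carrier_mat r c" "N \<in> carrier_mat r c"
  shows "mder r c (\<lambda>t. M + t \<cdot>\<^sub>m N) N"
  using assms by (auto simp: mder_def intro!: derivative_eq_intros)

lemma mder_mult:
  assumes M: "mder r c M M'" and N: "mder c q N N'" and c: "M 0 \<in> carrier_mat r c" "N 0 \<in> carrier_mat c q"
  shows "mder r q (\<lambda>t. M t * N t) (M' * N 0 + M 0 * N')"
  unfolding mder_def
proof (intro conjI allI impI)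
  have ev: "\<forall>\<^sub>F t in nhds 0. M t \<in> carrier_mat r c \<and> N t \<in> carrier_mat c q"
    using M N by (auto simp: mder_def eventually_conj)
  have c': "M' \<in> carrier_mat r c" "N' \<in> carrier_mat c q" using M N by (auto simp: mder_def)
  show "\<forall>\<^sub>F t in nhds 0. M t * N t \<in> carrier_mat r q" using ev by eventually_elim auto
  show "M' * N 0 + M 0 * N' \<in> carrier_mat r q" by (rule carrier_intros c c')+
  fix i j assume i: "i < r" and j: "j < q"
  have "((\<lambda>t. \<Sum>k<c. M t $$ (i,k) * N t $$ (k,j)) has_real_derivative
     (\<Sum>k<c. M 0 $$ (i,k) * N' $$ (k,j) + M' $$ (i,k) * N 0 $$ (k,j))) (at 0)"
    by (intro DERIV_sum DERIV_mult') (use M N i j in \<open>auto simp: mder_def\<close>)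
  moreover have "(\<Sum>k<c. M 0 $$ (i,k) * N' $$ (k,j) + M' $$ (i,k) * N 0 $$ (k,j)) = (M' * N 0 + M 0 * N') $$ (i,j)"
    using c c' i j by (simp add: scalar_prod_def atLeast0LessThan sum.distrib)
  moreover have "\<forall>\<^sub>F t in nhds 0. (\<Sum>k<c. M t $$ (i,k) * N t $$ (k,j)) = (M t * N t) $$ (i,j)"
    using ev by eventually_elim (use i j in \<open>auto simp: scalar_prod_def atLeast0LessThan\<close>)
  ultimately show "((\<lambda>t. (M t * N t) $$ (i,j)) has_real_derivative (M' * N 0 + M 0 * N') $$ (i,j)) (at 0)"
    by (rule deriv_cong_nhds)
qed

lemma mder_add:
  assumes M: "mder r c M M'" and N: "mder r c N N'"
  shows "mder r c (\<lambda>t. M t + N t) (M' + N')"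
  unfolding mder_def
proof (intro conjI allI impI)
  have ev: "\<forall>\<^sub>F t in nhds 0. M t \<in> carrier_mat r c \<and> N t \<in> carrier_mat r c"
    using M N by (auto simp: mder_def eventually_conj)
  have c': "M' \<in> carrier_mat r c" "N' \<in> carrier_mat r c" using M N by (auto simp: mder_def)
  show "\<forall>\<^sub>F t in nhds 0. M t + N t \<in> carrier_mat r c" using ev by eventually_elim auto
  show "M' + N' \<in> carrier_mat r c" using c' by simp
  fix i j assume i: "i < r" and j: "j < c"
  have "((\<lambda>t. M t $$ (i,j) + N t $$ (i,j)) has_real_derivative (M' $$ (i,j) + N' $$ (i,j))) (at 0)"
    by (intro DERIV_add) (use M N i j in \<open>auto simp: mder_def\<close>)
  moreover have "M' $$ (i,j) + N' $$ (i,j) = (M' + N') $$ (i,j)" using c' i j by simp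
  moreover have "\<forall>\<^sub>F t in nhds 0. M t $$ (i,j) + N t $$ (i,j) = (M t + N t) $$ (i,j)"
    using ev by eventually_elim (use i j in auto)
  ultimately show "((\<lambda>t. (M t + N t) $$ (i,j)) has_real_derivative (M' + N') $$ (i,j)) (at 0)"
    by (rule deriv_cong_nhds)
qed

lemma mder_transpose:
  assumes M: "mder r c M M'"
  shows "mder c r (\<lambda>t. (M t)\<^sup>T) M'\<^sup>T"
  unfolding mder_def
proof (intro conjI allI impI)
  have ev: "\<forall>\<^sub>F t in nhds 0. M t \<in> carrier_mat r c" using M by (auto simp: mder_def)
  have c': "M' \<in> carrier_mat r c" using M by (auto simp: mder_def)
  show "\<forall>\<^sub>F t in nhds 0. (M t)\<^sup>T \<in> carrier_mat c r" using ev by eventually_elim auto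
  show "M'\<^sup>T \<in> carrier_mat c r" using c' by simp
  fix i j assume i: "i < c" and j: "j < r"
  have "((\<lambda>t. M t $$ (j,i)) has_real_derivative M' $$ (j,i)) (at 0)" using M i j by (auto simp: mder_def)
  moreover have "M' $$ (j,i) = M'\<^sup>T $$ (i,j)" using c' i j by simp
  moreover have "\<forall>\<^sub>F t in nhds 0. M t $$ (j,i) = (M t)\<^sup>T $$ (i,j)" using ev by eventually_elim (use i j in simp)
  ultimately show "((\<lambda>t. (M t)\<^sup>T $$ (i,j)) has_real_derivative M'\<^sup>T $$ (i,j)) (at 0)"
    by (rule deriv_cong_nhds)
qed

text \<open>Differentiability of the entries is a premise, to be supplied by Cramer's rule; the
  value of the derivative then follows by differentiating \<open>M M^{-1} = 1\<close>.\<close>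

lemma mder_minv:
  assumes M: "mder n n M M'" and ev: "\<forall>\<^sub>F t in nhds 0. M t \<in> carrier_mat n n \<and> Determinant.det (M t) \<noteq> 0"
    and diff: "\<And>i j. i < n \<Longrightarrow> j < n \<Longrightarrow> \<exists>D. ((\<lambda>t. minv (M t) $$ (i,j)) has_real_derivative D) (at 0)"
  shows "mder n n (\<lambda>t. minv (M t)) (- (minv (M 0) * M' * minv (M 0)))"
proof -
  have M0: "M 0 \<in> carrier_mat n n" "Determinant.det (M 0) \<noteq> 0" using eventually_nhds_x_imp_x[OF ev] by auto
  note N = minv_carrier[OF M0]
  have M': "M' \<in> carrier_mat n n" using M by (simp add: mder_def)
  define D where "D = mat n n (\<lambda>(i,j). SOME d. ((\<lambda>t. minv (M t) $$ (i,j)) has_real_derivative d) (at 0))"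
  have D: "D \<in> carrier_mat n n" by (simp add: D_def)
  have "\<forall>\<^sub>F t in nhds 0. minv (M t) \<in> carrier_mat n n" using ev by eventually_elim (auto intro: minv_carrier)
  then have mD: "mder n n (\<lambda>t. minv (M t)) D"
    using D diff by (auto simp: mder_def D_def intro: someI_ex)
  have "mder n n (\<lambda>t. M t * minv (M t)) (M' * minv (M 0) + M 0 * D)" by (rule mder_mult[OF M mD M0(1) N])
  moreover have "mder n n (\<lambda>t. M t * minv (M t)) (0\<^sub>m n n)"
    by (rule mder_cong[OF mder_const[OF one_carrier_mat] eventually_mono[OF ev]]) (rule minv_right[symmetric], auto)
  ultimately have e: "M' * minv (M 0) + M 0 * D = 0\<^sub>m n n" by (rule mder_unique)
  have c: "minv (M 0) * (M' * minv (M 0)) \<in> carrier_mat n n" by (rule carrier_intros N M')+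
  have "minv (M 0) * (M' * minv (M 0) + M 0 * D) = minv (M 0) * (M' * minv (M 0)) + minv (M 0) * (M 0 * D)"
    using N M' M0(1) D by (simp add: mmult_add del: assoc_mult_mat)
  also have "minv (M 0) * (M 0 * D) = (minv (M 0) * M 0) * D" using N M0(1) D by (simp add: mmult_assoc)
  also have "\<dots> = D" using D by (simp add: minv_left[OF M0] mmult_one)
  finally have "minv (M 0) * (M' * minv (M 0)) + D = 0\<^sub>m n n" unfolding e using N by simp
  then have s: "minv (M 0) * (M' * minv (M 0)) + D = 0\<^sub>m n n" .
  have "D = - (minv (M 0) * M' * minv (M 0))"
  proof (rule eq_matI)
    have a: "minv (M 0) * M' * minv (M 0) = minv (M 0) * (M' * minv (M 0))" using N M' by (simp add: mmult_assoc)
    fix i j assume "i < dim_row (- (minv (M 0) * M' * minv (M 0)))" "j < dim_col (- (minv (M 0) * M' * minv (M 0)))"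
    then have ij: "i < n" "j < n" using N by auto
    define Q where "Q = minv (M 0) * (M' * minv (M 0))"
    have Q: "Q \<in> carrier_mat n n" using c by (simp add: Q_def)
    have "Q $$ (i,j) + D $$ (i,j) = 0"
      using arg_cong[OF s, of "\<lambda>R. R $$ (i,j)"] ij Q D unfolding Q_def[symmetric] by simp
    then show "D $$ (i,j) = (- (minv (M 0) * M' * minv (M 0))) $$ (i,j)"
      unfolding a Q_def[symmetric] using ij Q by simp
  qed (use D N in auto)
  then show ?thesis using mD by simp
qed

section \<open>The lifting in coordinates\<close>

definition sub :: "nat \<Rightarrow> nat \<Rightarrow> real vec \<Rightarrow> real vec" where
  "sub a k y = vec k (\<lambda>i. y $ (a + i))"

lemma sub_carrier [simp]: "sub a k y \<in> carrier_vec k"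
  by (simp add: sub_def)

lemma sub_linear:
  assumes "v \<in> carrier_vec d" "w \<in> carrier_vec d" "a + k \<le> d"
  shows "sub a k (v + w) = sub a k v + sub a k w" "sub a k (t \<cdot>\<^sub>v v) = t \<cdot>\<^sub>v sub a k v"
  using assms by (auto simp: sub_def intro!: eq_vecI)

definition C1v :: "nat \<Rightarrow> real vec set \<Rightarrow> nat \<Rightarrow> (real vec \<Rightarrow> real vec) \<Rightarrow> bool" where
  "C1v d Y k F \<longleftrightarrow> (\<forall>y. F y \<in> carrier_vec k) \<and> (\<forall>i<k. C1s d Y (\<lambda>y. F y $ i))"

lemma C1v_append:
  assumes "C1v d Y k F" "C1v d Y l H"
  shows "C1v d Y (k + l) (\<lambda>y. F y @\<^sub>v H y)"
  unfolding C1v_def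
proof (intro conjI allI impI)
  have c: "F y \<in> carrier_vec k" "H y \<in> carrier_vec l" for y using assms by (auto simp: C1v_def)
  show "F y @\<^sub>v H y \<in> carrier_vec (k + l)" for y using c by simp
  fix i assume i: "i < k + l"
  have "(F y @\<^sub>v H y) $ i = (if i < k then F y $ i else H y $ (i - k))" for y
    using i carrier_vecD[OF c(1)[of y]] carrier_vecD[OF c(2)[of y]] by simp
  then show "C1s d Y (\<lambda>y. (F y @\<^sub>v H y) $ i)" using assms i by (cases "i < k") (auto simp: C1v_def)
qed

lemma C1v_vec_of_mat:
  assumes "C1m d Y r c M"
  shows "C1v d Y (r * c) (\<lambda>y. vec_of_mat (M y))"
  unfolding C1v_def
proof (intro conjI allI impI)
  have c: "M y \<in> carrier_mat r c" for y using assms by (auto simp: C1m_def)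
  show "vec_of_mat (M y) \<in> carrier_vec (r * c)" for y using c by simp
  fix i assume i: "i < r * c"
  then have "c > 0" by (intro Nat.gr0I) simp
  then have b: "i div c < r" "i mod c < c" using i by (auto simp: less_mult_imp_div_less)
  have "vec_of_mat (M y) $ i = M y $$ (i div c, i mod c)" for y using c[of y] i by (simp add: vec_of_mat_def)
  then show "C1s d Y (\<lambda>y. vec_of_mat (M y) $ i)" using assms b by (auto simp: C1m_def)
qed

lemma C1v_svec:
  assumes Y: "Y \<subseteq> carrier_vec d" and M: "C1m d Y n n M"
  shows "C1v d Y (dim_sym n) (\<lambda>y. svec (M y))"
  unfolding C1v_def
proof (intro conjI allI impI)
  have c: "M y \<in> carrier_mat n n" for y using M by (auto simp: C1m_def)
  show "svec (M y) \<in> carrier_vec (dim_sym n)" for y using c by simp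
  fix k assume k: "k < dim_sym n"
  obtain i j where ij: "upper_indices n ! k = (i, j)" by (metis surj_pair)
  have b: "i < n" "j < n" using sym_pos_upper_indices(1,2)[OF k ij] by auto
  have "svec (M y) $ k = (if i = j then 1 else sqrt 2) * M y $$ (i,j)" for y
    using k by (simp add: svec_eq[OF c] ij)
  then show "C1s d Y (\<lambda>y. svec (M y) $ k)"
    using M b by (auto simp: C1m_def intro!: C1s_mult[OF Y] C1s_const[OF Y])
qed

lemma C1m_mat_of_vec_sub:
  assumes Y: "Y \<subseteq> carrier_vec d" and "a + r * c \<le> d"
  shows "C1m d Y r c (\<lambda>y. mat_of_vec r c (sub a (r * c) y))"
proof -
  have "mat_of_vec r c (sub a (r * c) y) $$ (i,j) = y $ (a + (i * c + j))" if "i < r" "j < c" for i j y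
    using that by (simp add: mat_of_vec_def sub_def index_lt_mult)
  moreover have "C1s d Y (\<lambda>y. y $ (a + (i * c + j)))" if "i < r" "j < c" for i j
    using index_lt_mult[OF that] assms by (intro C1s_coord) auto
  ultimately show ?thesis by (simp add: C1m_def)
qed

lemma C1m_smat_sub:
  assumes Y: "Y \<subseteq> carrier_vec d" and "a + dim_sym N \<le> d"
  shows "C1m d Y N N (\<lambda>y. smat N (sub a (dim_sym N) y))"
proof -
  have "smat N (sub a (dim_sym N) y) $$ (i,j) = (if i = j then 1 else 1 / sqrt 2) * y $ (a + sym_pos N i j)" if "i < N" "j < N" for i j y
    using that sym_pos(1)[OF that] by (simp add: smat_index sub_def)
  moreover have "C1s d Y (\<lambda>y. (if i = j then 1 else 1 / sqrt 2) * y $ (a + sym_pos N i j))" if "i < N" "j < N" for i j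
    using sym_pos(1)[OF that] assms by (intro C1s_mult[OF Y] C1s_const[OF Y] C1s_coord[OF Y]) auto
  ultimately show ?thesis by (simp add: C1m_def)
qed

lemma C1m_block:
  assumes "C1m d Y (2 * n) (2 * n) M"
  shows "C1m d Y n n (\<lambda>y. block12 n (M y))" "C1m d Y n n (\<lambda>y. block22 n (M y))"
  using assms by (auto simp: C1m_def block12_def block22_def)

lemma sym_block22: "sym_mat (2 * n) S \<Longrightarrow> sym_mat n (block22 n S)"
proof -
  assume S: "sym_mat (2 * n) S"
  have "S $$ (n + j, n + i) = S $$ (n + i, n + j)" if "i < n" "j < n" for i j
  proof -
    have "S \<in> carrier_mat (2 * n) (2 * n)" using S by (simp add: sym_mat_def)
    then have "S\<^sup>T $$ (n + i, n + j) = S $$ (n + j, n + i)" using that by auto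
    then show ?thesis using S by (simp add: sym_mat_def)
  qed
  then show ?thesis by (auto simp: sym_mat_def block22_def intro!: eq_matI)
qed

lemma block_carrier [simp]: "block12 n S \<in> carrier_mat n n" "block22 n S \<in> carrier_mat n n"
  by (auto simp: block12_def block22_def)

lemma block_linear:
  assumes "S \<in> carrier_mat (2 * n) (2 * n)" "R \<in> carrier_mat (2 * n) (2 * n)"
  shows "block12 n (S + t \<cdot>\<^sub>m R) = block12 n S + t \<cdot>\<^sub>m block12 n R"
    "block22 n (S + t \<cdot>\<^sub>m R) = block22 n S + t \<cdot>\<^sub>m block22 n R"
  using assms by (auto simp: block12_def block22_def intro!: eq_matI)

context oe begin

abbreviation "df \<equiv> dim_filt n m p"
abbreviation "ds \<equiv> dim_sym (2 * n)"
abbreviation "dz \<equiv> dim_sym n + (n * m + (p * n + n * n))"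

definition yA :: "real vec \<Rightarrow> real mat" where "yA y = mat_of_vec n n (sub 0 (n * n) y)"
definition yB :: "real vec \<Rightarrow> real mat" where "yB y = mat_of_vec n m (sub (n * n) (n * m) y)"
definition yC :: "real vec \<Rightarrow> real mat" where "yC y = mat_of_vec p n (sub (n * n + n * m) (p * n) y)"
definition yS :: "real vec \<Rightarrow> real mat" where "yS y = smat (2 * n) (sub df ds y)"
definition yU :: "real vec \<Rightarrow> real mat" where "yU y = block12 n (yS y)"
definition yV :: "real vec \<Rightarrow> real mat" where "yV y = block22 n (yS y)"

definition Phi :: "real vec \<Rightarrow> real vec" where
  "Phi y = svec (Th (yU y) (yV y)) @\<^sub>v (vec_of_mat (Ps (yU y) (yV y) (yB y)) @\<^sub>v
     (vec_of_mat (yC y * (yU y)\<^sup>T) @\<^sub>v vec_of_mat (res12 (yU y) (yA y) (yB y))))"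

definition zT :: "real vec \<Rightarrow> real mat" where "zT z = smat n (sub 0 (dim_sym n) z)"
definition zQ :: "real vec \<Rightarrow> real mat" where "zQ z = mat_of_vec n m (sub (dim_sym n) (n * m) z)"
definition zH :: "real vec \<Rightarrow> real mat" where "zH z = mat_of_vec p n (sub (dim_sym n + n * m) (p * n) z)"
definition zE :: "real vec \<Rightarrow> real mat" where "zE z = mat_of_vec n n (sub (dim_sym n + n * m + p * n) (n * n) z)"

definition fcvx :: "real vec \<Rightarrow> ereal" where "fcvx z = fc (zT z) (zQ z) (zH z) (zE z)"

text \<open>The only inverse that \<open>Phi\<close> takes of a variable matrix is that of the Schur
  complement, so this open set is its natural domain. Invertibility of \<open>U\<close> and
  definiteness of \<open>\<Theta>\<close> are left to \<open>feas\<close>.\<close>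

definition Y :: "real vec set" where
  "Y = {y \<in> carrier_vec (df + ds). Determinant.det (schur (yU y) (yV y)) \<noteq> 0}"

text \<open>The upper left block of \<open>yS y\<close> is ignored: it is replaced by \<open>X\<close>.\<close>

definition flft :: "real vec \<Rightarrow> ereal" where
  "flft y = (if y \<in> Y then fcvx (Phi y) else \<infinity>)"

lemma y_carriers [simp]:
  "yA y \<in> carrier_mat n n" "yB y \<in> carrier_mat n m" "yC y \<in> carrier_mat p n"
  "yU y \<in> carrier_mat n n" "yV y \<in> carrier_mat n n" "yS y \<in> carrier_mat (2 * n) (2 * n)"
  by (auto simp: yA_def yB_def yC_def yU_def yV_def yS_def)

lemma z_carriers [simp]:
  "zT z \<in> carrier_mat n n" "zQ z \<in> carrier_mat n m" "zH z \<in> carrier_mat p n" "zE z \<in> carrier_mat n n"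
  by (auto simp: zT_def zQ_def zH_def zE_def)

lemma sym_yV: "sym_mat n (yV y)"
  unfolding yV_def yS_def by (rule sym_block22[OF sym_smat])

lemma df_eq: "df = n * n + (n * m + p * n)" by (simp add: dim_filt_def)

lemma decode_append:
  assumes x: "x \<in> carrier_vec df" and xi: "\<xi> \<in> carrier_vec ds"
  shows "filt_of_vec n m p x = (yA (x @\<^sub>v \<xi>), yB (x @\<^sub>v \<xi>), yC (x @\<^sub>v \<xi>))" "yS (x @\<^sub>v \<xi>) = smat (2 * n) \<xi>"
proof -
  define a where "a = vec_first x (n * n)"
  define b where "b = vec_first (vec_last x (n * m + p * n)) (n * m)"
  define c where "c = vec_last (vec_last x (n * m + p * n)) (p * n)"
  have d: "a \<in> carrier_vec (n * n)" "b \<in> carrier_vec (n * m)" "c \<in> carrier_vec (p * n)" by (auto simp: a_def b_def c_def)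
  have e: "x = a @\<^sub>v (b @\<^sub>v c)" using x by (simp add: a_def b_def c_def dim_filt_def)
  have "sub 0 (n * n) (x @\<^sub>v \<xi>) = a" "sub (n * n) (n * m) (x @\<^sub>v \<xi>) = b" "sub (n * n + n * m) (p * n) (x @\<^sub>v \<xi>) = c"
    unfolding e using d by (auto simp: sub_def intro!: eq_vecI)
  then show "filt_of_vec n m p x = (yA (x @\<^sub>v \<xi>), yB (x @\<^sub>v \<xi>), yC (x @\<^sub>v \<xi>))"
    unfolding yA_def yB_def yC_def e filt_of_vec_append[OF d] by simp
  have "sub df ds (x @\<^sub>v \<xi>) = \<xi>" using x xi by (auto simp: sub_def intro!: eq_vecI)
  then show "yS (x @\<^sub>v \<xi>) = smat (2 * n) \<xi>" unfolding yS_def by simp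
qed

lemma decode_lift:
  assumes K: "Ak \<in> carrier_mat n n" "B \<in> carrier_mat n m" "Ck \<in> carrier_mat p n" and S: "sym_mat (2 * n) S"
  shows "lift_param (Ak, B, Ck) S \<in> carrier_vec (df + ds)"
    "yA (lift_param (Ak, B, Ck) S) = Ak" "yB (lift_param (Ak, B, Ck) S) = B" "yC (lift_param (Ak, B, Ck) S) = Ck"
    "yS (lift_param (Ak, B, Ck) S) = S" "yU (lift_param (Ak, B, Ck) S) = block12 n S" "yV (lift_param (Ak, B, Ck) S) = block22 n S"
proof -
  note f = filt_of_vec_of_filt[OF K]
  have s: "svec S \<in> carrier_vec ds" using S by (simp add: sym_mat_def)
  show "lift_param (Ak, B, Ck) S \<in> carrier_vec (df + ds)"
    unfolding lift_param_def by (rule append_carrier_vec[OF f(1) s])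
  note d = decode_append[OF f(1) s, folded lift_param_def]
  show "yA (lift_param (Ak, B, Ck) S) = Ak" "yB (lift_param (Ak, B, Ck) S) = B" "yC (lift_param (Ak, B, Ck) S) = Ck"
    using d(1) unfolding f(2) by auto
  show e: "yS (lift_param (Ak, B, Ck) S) = S" using d(2) smat_svec[OF S] by simp
  show "yU (lift_param (Ak, B, Ck) S) = block12 n S" "yV (lift_param (Ak, B, Ck) S) = block22 n S"
    by (simp_all add: yU_def yV_def e)
qed

lemma decode_line:
  assumes y: "y \<in> carrier_vec (df + ds)" and h: "h \<in> carrier_vec (df + ds)"
  shows "yA (y + t \<cdot>\<^sub>v h) = yA y + t \<cdot>\<^sub>m yA h" "yB (y + t \<cdot>\<^sub>v h) = yB y + t \<cdot>\<^sub>m yB h" "yC (y + t \<cdot>\<^sub>v h) = yC y + t \<cdot>\<^sub>m yC h"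
    "yU (y + t \<cdot>\<^sub>v h) = yU y + t \<cdot>\<^sub>m yU h" "yV (y + t \<cdot>\<^sub>v h) = yV y + t \<cdot>\<^sub>m yV h"
proof -
  have th: "t \<cdot>\<^sub>v h \<in> carrier_vec (df + ds)" using h by simp
  have s: "sub a k (y + t \<cdot>\<^sub>v h) = sub a k y + t \<cdot>\<^sub>v sub a k h" if "a + k \<le> df + ds" for a k
    using sub_linear(1)[OF y th that] sub_linear(2)[OF h h that] by simp
  have m: "mat_of_vec r c (sub a (r * c) (y + t \<cdot>\<^sub>v h)) = mat_of_vec r c (sub a (r * c) y) + t \<cdot>\<^sub>m mat_of_vec r c (sub a (r * c) h)"
    if "a + r * c \<le> df + ds" for a r c
    unfolding s[OF that] using mat_of_vec_linear(1)[of "sub a (r * c) y" r c "t \<cdot>\<^sub>v sub a (r * c) h"]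
      mat_of_vec_linear(2)[of "sub a (r * c) h" r c "sub a (r * c) h" t] by simp
  show "yA (y + t \<cdot>\<^sub>v h) = yA y + t \<cdot>\<^sub>m yA h" "yB (y + t \<cdot>\<^sub>v h) = yB y + t \<cdot>\<^sub>m yB h" "yC (y + t \<cdot>\<^sub>v h) = yC y + t \<cdot>\<^sub>m yC h"
    unfolding yA_def yB_def yC_def by (rule m, simp add: df_eq)+
  have "yS (y + t \<cdot>\<^sub>v h) = yS y + t \<cdot>\<^sub>m yS h"
    unfolding yS_def s[OF order_refl] using smat_linear(1)[of "sub df ds y" "2 * n" "t \<cdot>\<^sub>v sub df ds h"]
      smat_linear(2)[of "sub df ds h" "2 * n" "sub df ds h" t] by simp
  then show "yU (y + t \<cdot>\<^sub>v h) = yU y + t \<cdot>\<^sub>m yU h" "yV (y + t \<cdot>\<^sub>v h) = yV y + t \<cdot>\<^sub>m yV h"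
    by (simp_all add: yU_def yV_def block_linear)
qed

lemma z_decode:
  assumes T: "sym_mat n T" and Q: "Q \<in> carrier_mat n m" and H: "H \<in> carrier_mat p n" and E: "E \<in> carrier_mat n n"
  defines "z \<equiv> svec T @\<^sub>v (vec_of_mat Q @\<^sub>v (vec_of_mat H @\<^sub>v vec_of_mat E))"
  shows "z \<in> carrier_vec dz" "zT z = T" "zQ z = Q" "zH z = H" "zE z = E"
proof -
  have c: "svec T \<in> carrier_vec (dim_sym n)" "vec_of_mat Q \<in> carrier_vec (n * m)" "vec_of_mat H \<in> carrier_vec (p * n)" "vec_of_mat E \<in> carrier_vec (n * n)"
    using T Q H E by (auto simp: sym_mat_def)
  show "z \<in> carrier_vec dz" unfolding z_def using c by (intro append_carrier_vec)
  have "sub 0 (dim_sym n) z = svec T" "sub (dim_sym n) (n * m) z = vec_of_mat Q"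
    "sub (dim_sym n + n * m) (p * n) z = vec_of_mat H" "sub (dim_sym n + n * m + p * n) (n * n) z = vec_of_mat E"
    unfolding z_def using carrier_vecD[OF c(1)] carrier_vecD[OF c(2)] carrier_vecD[OF c(3)] carrier_vecD[OF c(4)]
    by (auto simp: sub_def intro!: eq_vecI)
  then show "zT z = T" "zQ z = Q" "zH z = H" "zE z = E"
    using smat_svec[OF T] mat_of_vec_of_mat[OF Q] mat_of_vec_of_mat[OF H] mat_of_vec_of_mat[OF E]
    by (simp_all add: zT_def zQ_def zH_def zE_def)
qed

lemma z_encode:
  assumes w: "w \<in> carrier_vec dz"
  shows "svec (zT w) @\<^sub>v (vec_of_mat (zQ w) @\<^sub>v (vec_of_mat (zH w) @\<^sub>v vec_of_mat (zE w))) = w"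
proof -
  have "svec (zT w) = sub 0 (dim_sym n) w" "vec_of_mat (zQ w) = sub (dim_sym n) (n * m) w"
    "vec_of_mat (zH w) = sub (dim_sym n + n * m) (p * n) w" "vec_of_mat (zE w) = sub (dim_sym n + n * m + p * n) (n * n) w"
    unfolding zT_def zQ_def zH_def zE_def by (simp_all add: svec_smat vec_of_mat_of_vec)
  then show ?thesis using w by (auto simp: sub_def add.assoc intro!: eq_vecI arg_cong[of _ _ "\<lambda>i. w $ i"])
qed

lemma z_convex:
  assumes z: "z \<in> carrier_vec dz" "z' \<in> carrier_vec dz"
  shows "zT (s \<cdot>\<^sub>v z + t \<cdot>\<^sub>v z') = s \<cdot>\<^sub>m zT z + t \<cdot>\<^sub>m zT z'" "zQ (s \<cdot>\<^sub>v z + t \<cdot>\<^sub>v z') = s \<cdot>\<^sub>m zQ z + t \<cdot>\<^sub>m zQ z'"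
    "zH (s \<cdot>\<^sub>v z + t \<cdot>\<^sub>v z') = s \<cdot>\<^sub>m zH z + t \<cdot>\<^sub>m zH z'" "zE (s \<cdot>\<^sub>v z + t \<cdot>\<^sub>v z') = s \<cdot>\<^sub>m zE z + t \<cdot>\<^sub>m zE z'"
proof -
  have c: "s \<cdot>\<^sub>v z \<in> carrier_vec dz" "t \<cdot>\<^sub>v z' \<in> carrier_vec dz" using z by auto
  have sb: "sub a k (s \<cdot>\<^sub>v z + t \<cdot>\<^sub>v z') = s \<cdot>\<^sub>v sub a k z + t \<cdot>\<^sub>v sub a k z'" if "a + k \<le> dz" for a k
    using sub_linear(1)[OF c that] sub_linear(2)[OF z(1) z(1) that] sub_linear(2)[OF z(2) z(2) that] by simp
  have m: "mat_of_vec q c (sub a (q * c) (s \<cdot>\<^sub>v z + t \<cdot>\<^sub>v z')) = s \<cdot>\<^sub>m mat_of_vec q c (sub a (q * c) z) + t \<cdot>\<^sub>m mat_of_vec q c (sub a (q * c) z')"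
    if "a + q * c \<le> dz" for a q c
    unfolding sb[OF that] using mat_of_vec_linear(1)[of "s \<cdot>\<^sub>v sub a (q * c) z" q c "t \<cdot>\<^sub>v sub a (q * c) z'"]
      mat_of_vec_linear(2)[of "sub a (q * c) z" q c "sub a (q * c) z" s]
      mat_of_vec_linear(2)[of "sub a (q * c) z'" q c "sub a (q * c) z'" t] by simp
  show "zQ (s \<cdot>\<^sub>v z + t \<cdot>\<^sub>v z') = s \<cdot>\<^sub>m zQ z + t \<cdot>\<^sub>m zQ z'"
    "zH (s \<cdot>\<^sub>v z + t \<cdot>\<^sub>v z') = s \<cdot>\<^sub>m zH z + t \<cdot>\<^sub>m zH z'" "zE (s \<cdot>\<^sub>v z + t \<cdot>\<^sub>v z') = s \<cdot>\<^sub>m zE z + t \<cdot>\<^sub>m zE z'"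
    unfolding zQ_def zH_def zE_def by (rule m, simp)+
  have "sub 0 (dim_sym n) (s \<cdot>\<^sub>v z + t \<cdot>\<^sub>v z') = s \<cdot>\<^sub>v sub 0 (dim_sym n) z + t \<cdot>\<^sub>v sub 0 (dim_sym n) z'"
    by (rule sb) simp
  then show "zT (s \<cdot>\<^sub>v z + t \<cdot>\<^sub>v z') = s \<cdot>\<^sub>m zT z + t \<cdot>\<^sub>m zT z'"
    using smat_linear(1)[of "s \<cdot>\<^sub>v sub 0 (dim_sym n) z" n "t \<cdot>\<^sub>v sub 0 (dim_sym n) z'"]
      smat_linear(2)[of "sub 0 (dim_sym n) z" n "sub 0 (dim_sym n) z" s]
      smat_linear(2)[of "sub 0 (dim_sym n) z'" n "sub 0 (dim_sym n) z'" t] by (simp add: zT_def)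
qed

lemma Y_D:
  assumes "y \<in> Y"
  shows "y \<in> carrier_vec (df + ds)" "Determinant.det (schur (yU y) (yV y)) \<noteq> 0"
  using assms by (auto simp: Y_def)

lemma sym_Th:
  assumes U: "U \<in> carrier_mat n n" and V: "sym_mat n V" and det: "Determinant.det (schur U V) \<noteq> 0"
  shows "sym_mat n (Th U V)"
proof -
  have N: "minv (schur U V) \<in> carrier_mat n n" "(minv (schur U V))\<^sup>T = minv (schur U V)"
    using sym_mat_minv[OF schur_sym[OF U V] det] by (auto simp: sym_mat_def)
  have "Th U V \<in> carrier_mat n n" unfolding Th_def by (rule carrier_intros U N)+
  moreover have "(Th U V)\<^sup>T = Th U V" unfolding Th_def using U N by (simp add: mtrans mmult_assoc)
  ultimately show ?thesis by (simp add: sym_mat_def)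
qed

lemma Phi_decode:
  assumes y: "y \<in> Y"
  shows "Phi y \<in> carrier_vec dz" "fcvx (Phi y) = fc (Th (yU y) (yV y)) (Ps (yU y) (yV y) (yB y)) (yC y * (yU y)\<^sup>T) (res12 (yU y) (yA y) (yB y))"
proof -
  note det = Y_D(2)[OF y]
  have c: "Ps (yU y) (yV y) (yB y) \<in> carrier_mat n m" "yC y * (yU y)\<^sup>T \<in> carrier_mat p n"
    using Th_carrier(2)[OF _ _ det] by (auto intro!: mult_carrier_mat[of _ p n])
  note z = z_decode[OF sym_Th[OF y_carriers(4) sym_yV det] c res12_carrier[OF y_carriers(4,1,2)], of y y y, folded Phi_def]
  show "Phi y \<in> carrier_vec dz" by (rule z(1))
  show "fcvx (Phi y) = fc (Th (yU y) (yV y)) (Ps (yU y) (yV y) (yB y)) (yC y * (yU y)\<^sup>T) (res12 (yU y) (yA y) (yB y))"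
    unfolding fcvx_def z(2-5) ..
qed

lemma flft_ge:
  assumes x: "x \<in> carrier_vec df" and xi: "\<xi> \<in> carrier_vec ds"
  shows "L_reg n m p A C G W1 W2 reg (filt_of_vec n m p x) \<le> flft (x @\<^sub>v \<xi>)"
proof (cases "x @\<^sub>v \<xi> \<in> Y")
  case True
  show ?thesis
    unfolding decode_append(1)[OF x xi] flft_def if_P[OF True] Phi_decode(2)[OF True]
    by (rule fc_ge_L_reg[OF y_carriers(1-4) sym_yV Y_D(2)[OF True]])
qed (simp add: flft_def)

lemma flft_Sigma:
  assumes K: "(Ak, B, Ck) \<in> Kinfo"
  shows "lift_param (Ak, B, Ck) (SigK (Ak, B, Ck)) \<in> Y"
    "flft (lift_param (Ak, B, Ck) (SigK (Ak, B, Ck))) = L_reg n m p A C G W1 W2 reg (Ak, B, Ck)"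
proof -
  obtain U V where *: "Ak \<in> carrier_mat n n" "B \<in> carrier_mat n m" "Ck \<in> carrier_mat p n" "hurwitz Ak"
    "SigK (Ak, B, Ck) = blk X U V" "U \<in> carrier_mat n n" "sym_mat n V" "Determinant.det U \<noteq> 0"
    "res12 U Ak B = 0\<^sub>m n n" "\<And>u. u \<in> carrier_vec n \<Longrightarrow> res22 U V Ak B u = 0" "pos_def (2 * n) (blk X U V)" "pos_def n (schur U V)"
    by (rule KinfoE[OF K]) blast
  have Vc: "V \<in> carrier_mat n n" using *(7) by (simp add: sym_mat_def)
  note d = decode_lift[OF *(1-3) pos_defD(3)[OF *(11)], unfolded block12_blk[OF X *(6) Vc]]
  show Yy: "lift_param (Ak, B, Ck) (SigK (Ak, B, Ck)) \<in> Y"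
    unfolding Y_def *(5) using d pos_defD(4)[OF *(12)] by simp
  show "flft (lift_param (Ak, B, Ck) (SigK (Ak, B, Ck))) = L_reg n m p A C G W1 W2 reg (Ak, B, Ck)"
    unfolding flft_def if_P[OF Yy] Phi_decode(2)[OF Yy] unfolding *(5) d(2-4,6,7)
    by (rule fc_SigK[OF K *(5,6) Vc])
qed

lemma C1m_decode:
  assumes S: "S \<subseteq> carrier_vec (df + ds)"
  shows "C1m (df + ds) S n n yA" "C1m (df + ds) S n m yB" "C1m (df + ds) S p n yC"
    "C1m (df + ds) S n n yU" "C1m (df + ds) S n n yV" "C1m (df + ds) S n n (\<lambda>y. schur (yU y) (yV y))"
proof -
  show "C1m (df + ds) S n n yA" "C1m (df + ds) S n m yB" "C1m (df + ds) S p n yC"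
    unfolding yA_def yB_def yC_def by (rule C1m_mat_of_vec_sub[OF S], simp add: df_eq)+
  have "C1m (df + ds) S (2 * n) (2 * n) yS" unfolding yS_def by (rule C1m_smat_sub[OF S]) simp
  then show U: "C1m (df + ds) S n n yU" and V: "C1m (df + ds) S n n yV"
    unfolding yU_def yV_def by (rule C1m_block)+
  show "C1m (df + ds) S n n (\<lambda>y. schur (yU y) (yV y))"
    unfolding schur_def by (rule C1m_minus[OF S V C1m_mult[OF S C1m_mult[OF S C1m_transpose[OF U] C1m_const[OF S Xi]] U]])
qed

lemma Y_open: "vopen (df + ds) Y"
  unfolding Y_def by (rule vopen_det[OF C1m_decode(6)[OF subset_refl]])

lemma Y_sub: "Y \<subseteq> carrier_vec (df + ds)" by (auto simp: Y_def)

lemma C1s_minv_schur: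
  assumes "i < n" "j < n"
  shows "C1s (df + ds) Y (\<lambda>y. minv (schur (yU y) (yV y)) $$ (i,j))"
  by (rule C1m_minv[OF C1m_decode(6)[OF subset_refl] Y_def assms])

lemma C1_Phi: "C1_on (df + ds) dz Y Phi"
proof (rule C1_on_components[OF Y_open Phi_decode(1)])
  fix i assume i: "i < dz"
  \<comment> \<open>Agrees with the inverse on \<open>Y\<close> and has the right dimensions
    everywhere, as \<open>C1m\<close> demands.\<close>
  define N where "N y = mat n n (\<lambda>ij. minv (schur (yU y) (yV y)) $$ ij)" for y
  have N: "C1m (df + ds) Y n n N" unfolding C1m_def N_def using C1s_minv_schur by auto
  have Neq: "N y = minv (schur (yU y) (yV y))" if y: "y \<in> Y" for y
    using minv_carrier[OF schur_carrier[OF y_carriers(4,5)] Y_D(2)[OF y]] by (auto simp: N_def intro!: eq_matI)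
  note c = C1m_decode(1-5)[OF Y_sub]
  let ?F = "\<lambda>y. svec (yU y * N y * (yU y)\<^sup>T) @\<^sub>v (vec_of_mat (yU y * N y * yB y) @\<^sub>v
     (vec_of_mat (yC y * (yU y)\<^sup>T) @\<^sub>v vec_of_mat (res12 (yU y) (yA y) (yB y))))"
  have "C1v (df + ds) Y dz ?F"
    unfolding res12_def
    by (rule C1v_append C1v_svec[OF Y_sub] C1v_vec_of_mat C1m_add C1m_mult[OF Y_sub] C1m_transpose c N C1m_const[OF Y_sub] A X C transpose_carrier_mat)+
  then have "C1s (df + ds) Y (\<lambda>y. ?F y $ i)" using i by (simp add: C1v_def)
  then show "C1s (df + ds) Y (\<lambda>y. Phi y $ i)"
    by (rule C1s_cong[OF Y_open]) (simp add: Phi_def Th_def Ps_def Neq)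
qed

lemma fcvx_convex: "ext_convex dz fcvx"
  unfolding ext_convex_def
proof (intro ballI allI impI)
  fix z z' :: "real vec" and t :: real assume z: "z \<in> carrier_vec dz" "z' \<in> carrier_vec dz" and t: "0 < t \<and> t < 1"
  show "fcvx (t \<cdot>\<^sub>v z + (1 - t) \<cdot>\<^sub>v z') \<le> ereal t * fcvx z + ereal (1 - t) * fcvx z'"
    unfolding fcvx_def z_convex[OF z] by (rule fc_convex) (use t in auto)
qed

lemma L_reg_not_minf: "L_reg n m p A C G W1 W2 reg K \<noteq> - \<infinity>"
  by (simp add: L_reg_def)

lemma fcvx_not_minf: "fcvx z \<noteq> - \<infinity>"
  by (simp add: fcvx_def fc_def)

text \<open>The Kalman filter serves twice: it shows that the objective is proper, and its image
  under \<open>Phi\<close> minimizes the convex function.\<close>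

lemma DCL: "is_DCL df ds dz (\<lambda>x. L_reg n m p A C G W1 W2 reg (filt_of_vec n m p x)) fcvx flft Phi"
proof -
  let ?f = "\<lambda>x. L_reg n m p A C G W1 W2 reg (filt_of_vec n m p x)"
  let ?Ko = "(A - Lk * C, Lk, G)"
  define y where "y = lift_param ?Ko (SigK ?Ko)"
  note o = filt_of_vec_of_filt[OF Ak_opt Lk G]
  have y: "y \<in> Y" unfolding y_def by (rule flft_Sigma(1)[OF Kopt_Kinfo])
  have bS: "sym_mat (2 * n) (blk X Zs Zs)"
    using pos_defD(3)[OF pos_def_SigK[OF Ak_opt Lk hurwitz_opt SigK_opt Zs sym_Zs pos_defD(4)[OF pos_def_Zs]]] .
  note d = decode_lift[OF Ak_opt Lk G bS, unfolded block12_blk[OF X Zs Zs], folded SigK_opt, folded y_def]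
  have zy: "fcvx (Phi y) = fc (Th Zs Zs) (Ps Zs Zs Lk) (G * Zs\<^sup>T) (res12 Zs (A - Lk * C) Lk)"
    unfolding Phi_decode(2)[OF y] d ..
  have zmin: "\<bar>fcvx (Phi y)\<bar> \<noteq> \<infinity>" "\<And>z. fcvx (Phi y) \<le> fcvx z"
    unfolding zy using fc_minimum[OF z_carriers(3,2)] by (auto simp: fcvx_def)
  have "ext_proper df ?f"
    unfolding ext_proper_def ext_valued_def ext_dom_def using L_reg_not_minf o Kopt_Kinfo
    by (auto simp: L_reg_def intro!: exI[of _ "vec_of_filt ?Ko"])
  moreover have "ext_proper dz fcvx"
    unfolding ext_proper_def ext_valued_def ext_dom_def using fcvx_not_minf zmin(1) Phi_decode(1)[OF y] by auto
  moreover have "\<exists>z\<in>carrier_vec dz. \<bar>fcvx z\<bar> \<noteq> \<infinity> \<and> (\<forall>z'\<in>carrier_vec dz. fcvx z \<le> fcvx z')"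
    by (intro bexI[OF _ Phi_decode(1)[OF y]] conjI ballI zmin)
  moreover have "ext_valued (df + ds) flft"
    unfolding ext_valued_def flft_def using fcvx_not_minf by auto
  moreover have "\<exists>\<xi>\<in>carrier_vec ds. ?f x = flft (x @\<^sub>v \<xi>) \<and> (\<forall>\<xi>'\<in>carrier_vec ds. flft (x @\<^sub>v \<xi>) \<le> flft (x @\<^sub>v \<xi>'))"
    if x: "x \<in> carrier_vec df" for x
  proof -
    have "\<exists>\<xi>\<in>carrier_vec ds. ?f x = flft (x @\<^sub>v \<xi>)"
    proof (cases "filt_of_vec n m p x \<in> Kinfo")
      case True
      obtain Ak B Ck where K: "filt_of_vec n m p x = (Ak, B, Ck)" by (metis prod_cases3)
      then have K': "(Ak, B, Ck) \<in> Kinfo" using True by simp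
      have Kc: "Ak \<in> carrier_mat n n" "B \<in> carrier_mat n m" "Ck \<in> carrier_mat p n" "hurwitz Ak"
        using K' by (auto simp: K_info_def K_stab_def filters_def)
      have "vec_of_filt (Ak, B, Ck) = x" using vec_of_filt_of_vec[OF x] K by simp
      then have "flft (x @\<^sub>v svec (SigK (Ak, B, Ck))) = ?f x"
        using flft_Sigma(2)[OF K'] K by (simp add: lift_param_def)
      moreover have "svec (SigK (Ak, B, Ck)) \<in> carrier_vec ds"
        using SigK_lyap(1)[OF Kc(1,2,4)] by simp
      ultimately show ?thesis by metis
    next
      case False
      \<comment> \<open>Outside the informative set the lower bound \<open>flft_ge\<close> makes
        every lifting variable a minimizer with value \<open>\<infinity>\<close>; 0 is
        picked.\<close>
      then have "?f x = \<infinity>" by (simp add: L_reg_def)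
      then have "flft (x @\<^sub>v 0\<^sub>v ds) = ?f x" using flft_ge[OF x, of "0\<^sub>v ds"] by simp
      then show ?thesis by (intro bexI[of _ "0\<^sub>v ds"]) auto
    qed
    then show ?thesis using flft_ge[OF x] by metis
  qed
  moreover have "\<exists>Y. vopen (df + ds) Y \<and> ext_dom (df + ds) flft \<subseteq> Y \<and> C1_on (df + ds) dz Y Phi \<and> (\<forall>y\<in>Y. flft y = fcvx (Phi y))"
    by (rule exI[of _ Y]) (auto simp: Y_open C1_Phi ext_dom_def flft_def)
  ultimately show ?thesis unfolding is_DCL_def using fcvx_convex by blast
qed

end

section \<open>A right inverse of the Jacobian\<close>

definition vder :: "nat \<Rightarrow> (real \<Rightarrow> real vec) \<Rightarrow> real vec \<Rightarrow> bool" where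
  "vder k F F' \<longleftrightarrow> (\<forall>\<^sub>F t in nhds 0. F t \<in> carrier_vec k) \<and> F' \<in> carrier_vec k \<and>
     (\<forall>i<k. ((\<lambda>t. F t $ i) has_real_derivative F' $ i) (at 0))"

lemma vder_append:
  assumes F: "vder k F F'" and H: "vder l H H'"
  shows "vder (k + l) (\<lambda>t. F t @\<^sub>v H t) (F' @\<^sub>v H')"
  unfolding vder_def
proof (intro conjI allI impI)
  have ev: "\<forall>\<^sub>F t in nhds 0. F t \<in> carrier_vec k \<and> H t \<in> carrier_vec l"
    using F H by (auto simp: vder_def eventually_conj)
  have c: "F' \<in> carrier_vec k" "H' \<in> carrier_vec l" using F H by (auto simp: vder_def)
  show "\<forall>\<^sub>F t in nhds 0. F t @\<^sub>v H t \<in> carrier_vec (k + l)"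
    by (rule eventually_mono[OF ev]) auto
  show "F' @\<^sub>v H' \<in> carrier_vec (k + l)" using c by simp
  fix i assume i: "i < k + l"
  show "((\<lambda>t. (F t @\<^sub>v H t) $ i) has_real_derivative (F' @\<^sub>v H') $ i) (at 0)"
  proof (cases "i < k")
    case True
    then have d: "((\<lambda>t. F t $ i) has_real_derivative F' $ i) (at 0)" using F by (auto simp: vder_def)
    show ?thesis by (rule deriv_cong_nhds[OF d _ eventually_mono[OF ev]]) (use True i c in auto)
  next
    case False
    then have d: "((\<lambda>t. H t $ (i - k)) has_real_derivative H' $ (i - k)) (at 0)" using H i by (auto simp: vder_def)
    show ?thesis by (rule deriv_cong_nhds[OF d _ eventually_mono[OF ev]]) (use False i c in auto)
  qed
qed

lemma vder_vec_of_mat: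
  assumes M: "mder r c M M'"
  shows "vder (r * c) (\<lambda>t. vec_of_mat (M t)) (vec_of_mat M')"
  unfolding vder_def
proof (intro conjI allI impI)
  have ev: "\<forall>\<^sub>F t in nhds 0. M t \<in> carrier_mat r c" and c: "M' \<in> carrier_mat r c" using M by (auto simp: mder_def)
  show "\<forall>\<^sub>F t in nhds 0. vec_of_mat (M t) \<in> carrier_vec (r * c)" by (rule eventually_mono[OF ev]) simp
  show "vec_of_mat M' \<in> carrier_vec (r * c)" using c by simp
  fix i assume i: "i < r * c"
  then have "c > 0" by (intro Nat.gr0I) simp
  then have b: "i div c < r" "i mod c < c" using i by (auto simp: less_mult_imp_div_less)
  then have d: "((\<lambda>t. M t $$ (i div c, i mod c)) has_real_derivative M' $$ (i div c, i mod c)) (at 0)" using M by (auto simp: mder_def)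
  show "((\<lambda>t. vec_of_mat (M t) $ i) has_real_derivative vec_of_mat M' $ i) (at 0)"
    by (rule deriv_cong_nhds[OF d _ eventually_mono[OF ev]]) (use i c in \<open>auto simp: vec_of_mat_def\<close>)
qed

lemma vder_svec:
  assumes M: "mder N N M M'"
  shows "vder (dim_sym N) (\<lambda>t. svec (M t)) (svec M')"
  unfolding vder_def
proof (intro conjI allI impI)
  have ev: "\<forall>\<^sub>F t in nhds 0. M t \<in> carrier_mat N N" and c: "M' \<in> carrier_mat N N" using M by (auto simp: mder_def)
  show "\<forall>\<^sub>F t in nhds 0. svec (M t) \<in> carrier_vec (dim_sym N)" by (rule eventually_mono[OF ev]) simp
  show "svec M' \<in> carrier_vec (dim_sym N)" using c by simp
  fix k assume k: "k < dim_sym N"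
  obtain i j where ij: "upper_indices N ! k = (i, j)" by (metis surj_pair)
  have b: "i < N" "j < N" using sym_pos_upper_indices(1,2)[OF k ij] by auto
  define s :: real where "s = (if i = j then 1 else sqrt 2)"
  have e: "svec S $ k = s * S $$ (i,j)" if "S \<in> carrier_mat N N" for S
    using k by (simp add: svec_eq[OF that] ij s_def)
  have d: "((\<lambda>t. s * M t $$ (i,j)) has_real_derivative s * M' $$ (i,j)) (at 0)"
    using M b by (auto simp: mder_def intro!: DERIV_cmult)
  show "((\<lambda>t. svec (M t) $ k) has_real_derivative svec M' $ k) (at 0)"
    by (rule deriv_cong_nhds[OF d _ eventually_mono[OF ev]]) (auto simp: e c)
qed

lemma jacobian_vder:
  assumes J: "has_jacobian d k F x J" and x: "x \<in> carrier_vec d" and h: "h \<in> carrier_vec d" and F: "dim_vec (F x) = k"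
    and w: "vder k (\<lambda>t. F (x + t \<cdot>\<^sub>v h)) w"
  shows "J *\<^sub>v h = w"
proof (rule eq_vecI)
  have c: "J \<in> carrier_mat k d" "w \<in> carrier_vec k" using J w by (auto simp: has_jacobian_def vder_def)
  then show "dim_vec (J *\<^sub>v h) = dim_vec w" by simp
  fix i assume "i < dim_vec w"
  then have i: "i < k" using c by simp
  show "(J *\<^sub>v h) $ i = w $ i"
    by (rule DERIV_unique[OF has_jacobian_line[OF J x h i F]]) (use w i in \<open>auto simp: vder_def\<close>)
qed

lemma mder_at_0: "mder r c M M' \<Longrightarrow> M 0 \<in> carrier_mat r c"
  by (auto simp: mder_def dest: eventually_nhds_x_imp_x)

lemma mder_mult_const:
  assumes M: "mder r c M M'" and L: "L \<in> carrier_mat q r" and R: "R \<in> carrier_mat c q'"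
  shows "mder q c (\<lambda>t. L * M t) (L * M')" "mder r q' (\<lambda>t. M t * R) (M' * R)"
proof -
  have c: "M 0 \<in> carrier_mat r c" "M' \<in> carrier_mat r c" using mder_at_0[OF M] M by (auto simp: mder_def)
  have "0\<^sub>m q r * M 0 + L * M' = L * M'" "M' * R + M 0 * 0\<^sub>m c q' = M' * R" using c L R by auto
  then show "mder q c (\<lambda>t. L * M t) (L * M')" "mder r q' (\<lambda>t. M t * R) (M' * R)"
    using mder_mult[OF mder_const[OF L] M L c(1)] mder_mult[OF M mder_const[OF R] c(1) R] by simp_all
qed

lemma vopen_line:
  assumes Y: "vopen d Y" and y: "y \<in> Y" and h: "h \<in> carrier_vec d"
  shows "\<forall>\<^sub>F t in nhds 0. y + t \<cdot>\<^sub>v h \<in> Y"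
proof -
  have yc: "y \<in> carrier_vec d" using Y y by (auto simp: vopen_def)
  obtain e where e: "e > 0" "\<And>y'. y' \<in> carrier_vec d \<Longrightarrow> vnorm (y' - y) < e \<Longrightarrow> y' \<in> Y"
    using Y y unfolding vopen_def by blast
  have "\<forall>\<^sub>F t in nhds (0::real). \<bar>t\<bar> * vnorm h < e"
  proof -
    have "((\<lambda>t::real. \<bar>t\<bar> * vnorm h) \<longlongrightarrow> \<bar>0\<bar> * vnorm h) (nhds 0)"
      by (intro tendsto_intros filterlim_ident)
    then show ?thesis using e(1) by (auto dest: order_tendstoD)
  qed
  then show ?thesis
  proof (rule eventually_mono)
    fix t :: real assume t: "\<bar>t\<bar> * vnorm h < e"
    have "(y + t \<cdot>\<^sub>v h) - y = t \<cdot>\<^sub>v h" using yc h by (intro eq_vecI) auto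
    then show "y + t \<cdot>\<^sub>v h \<in> Y" using e(2)[of "y + t \<cdot>\<^sub>v h"] t yc h by (simp add: vnorm_smult)
  qed
qed

lemma frob_norm_blk_22:
  assumes "V \<in> carrier_mat n n"
  shows "frob_norm (blk (0\<^sub>m n n) (0\<^sub>m n n) V) = frob_norm V"
proof -
  have r: "(\<Sum>i<n + n. f i) = (\<Sum>i<n. f i) + (\<Sum>i<n. f (n + i))" for f :: "nat \<Rightarrow> real"
    using sum.nat_group[of f n 2] by (simp add: numeral_2_eq_2 lessThan_Suc sum.atLeastLessThan_shift_0[of f n] lessThan_atLeast0 sum.atLeastLessThan_concat[of 0 n "n + n" f, symmetric] add.commute)
  show ?thesis using assms by (simp add: frob_norm_def blk_def r)
qed

lemma sym_blk_22:
  assumes "sym_mat n V"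
  shows "sym_mat (2 * n) (blk (0\<^sub>m n n) (0\<^sub>m n n) V)"
proof -
  have c: "V \<in> carrier_mat n n" and s: "V\<^sup>T = V" using assms by (auto simp: sym_mat_def)
  have "V $$ (j, i) = V $$ (i, j)" if "i < n" "j < n" for i j
    using arg_cong[OF s, of "\<lambda>M. M $$ (i, j)"] index_transpose_mat(1)[of i V j] c that by auto
  then show ?thesis using c by (auto simp: sym_mat_def blk_def intro!: eq_matI)
qed

context oe begin

text \<open>The direction varies \<open>V\<close>, \<open>B\<close>, \<open>C\<close>,
  \<open>A\<close> and keeps \<open>U\<close> fixed. Along it the Schur complement is affine with
  slope \<open>dV\<close>, so its inverse is the only ingredient that is not affine, and the
  derivative is triangular in \<open>dV\<close>, \<open>dB\<close>, \<open>dC\<close>,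
  \<open>dA\<close>.\<close>

lemma Phi_line:
  assumes y: "y \<in> Y" and d: "dA \<in> carrier_mat n n" "dB \<in> carrier_mat n m" "dC \<in> carrier_mat p n" and dV: "sym_mat n dV"
  defines "h \<equiv> lift_param (dA, dB, dC) (blk (0\<^sub>m n n) (0\<^sub>m n n) dV)" and "U \<equiv> yU y" and "N \<equiv> minv (schur (yU y) (yV y))"
  shows "h \<in> carrier_vec (df + ds)"
    "vder dz (\<lambda>t. Phi (y + t \<cdot>\<^sub>v h)) (svec (U * - (N * dV * N) * U\<^sup>T) @\<^sub>v (vec_of_mat (U * - (N * dV * N) * yB y + U * N * dB)
       @\<^sub>v (vec_of_mat (dC * U\<^sup>T) @\<^sub>v vec_of_mat (X * C\<^sup>T * dB\<^sup>T + U * dA\<^sup>T))))"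
proof -
  define D where "D = schur U (yV y)"
  have V: "dV \<in> carrier_mat n n" "dV\<^sup>T = dV" using dV by (auto simp: sym_mat_def)
  have U: "U \<in> carrier_mat n n" by (simp add: U_def)
  have D: "D \<in> carrier_mat n n" unfolding D_def by (rule schur_carrier[OF U y_carriers(5)])
  have detD: "Determinant.det D \<noteq> 0" using Y_D(2)[OF y] by (simp add: D_def U_def)
  have bs: "sym_mat (2 * n) (blk (0\<^sub>m n n) (0\<^sub>m n n) dV)"
    by (rule sym_blk_22[OF dV])
  note dec = decode_lift[OF d bs, unfolded block12_blk[OF zero_carrier_mat zero_carrier_mat V(1)], folded h_def]
  show h: "h \<in> carrier_vec (df + ds)" by (rule dec(1))
  note yc = Y_D(1)[OF y]
  note line = decode_line[OF yc h, unfolded dec]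
  have lU: "yU (y + t \<cdot>\<^sub>v h) = U" for t using line(4) U by (auto simp: U_def intro!: eq_matI)
  have lS: "schur (yU (y + t \<cdot>\<^sub>v h)) (yV (y + t \<cdot>\<^sub>v h)) = D + t \<cdot>\<^sub>m dV" for t
  proof -
    have "U\<^sup>T * Xi * U \<in> carrier_mat n n" using U Xi by simp
    then show ?thesis unfolding lU line(5) D_def schur_def using V(1) y_carriers(5)[of y] by (intro eq_matI) auto
  qed
  have S: "mder n n (\<lambda>t. D + t \<cdot>\<^sub>m dV) dV" by (rule mder_line[OF D V(1)])
  have S0: "D + 0 \<cdot>\<^sub>m dV = D" using D V(1) by (intro eq_matI) auto
  have ev: "\<forall>\<^sub>F t in nhds 0. y + t \<cdot>\<^sub>v h \<in> Y" by (rule vopen_line[OF Y_open y h])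
  have Nder: "mder n n (\<lambda>t. minv (D + t \<cdot>\<^sub>m dV)) (- (N * dV * N))"
  proof -
    have "mder n n (\<lambda>t. minv (D + t \<cdot>\<^sub>m dV)) (- (minv (D + 0 \<cdot>\<^sub>m dV) * dV * minv (D + 0 \<cdot>\<^sub>m dV)))"
    proof (rule mder_minv[OF S])
      show "\<forall>\<^sub>F t in nhds 0. D + t \<cdot>\<^sub>m dV \<in> carrier_mat n n \<and> Determinant.det (D + t \<cdot>\<^sub>m dV) \<noteq> 0"
      proof (rule eventually_mono[OF ev], intro conjI)
        fix t assume t: "y + t \<cdot>\<^sub>v h \<in> Y"
        show "D + t \<cdot>\<^sub>m dV \<in> carrier_mat n n" using D V(1) by simp
        show "Determinant.det (D + t \<cdot>\<^sub>m dV) \<noteq> 0" using Y_D(2)[OF t] unfolding lS .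
      qed
      fix i j assume ij: "i < n" "j < n"
      obtain E where "has_grad (df + ds) (\<lambda>y. minv (schur (yU y) (yV y)) $$ (i,j)) y E"
        using C1s_minv_schur[OF ij] y unfolding C1s_def by blast
      from has_grad_line[OF this h]
      show "\<exists>D'. ((\<lambda>t. minv (D + t \<cdot>\<^sub>m dV) $$ (i,j)) has_real_derivative D') (at 0)" unfolding lS by blast
    qed
    then show ?thesis unfolding S0 by (simp add: N_def D_def U_def)
  qed
  have N: "N \<in> carrier_mat n n" using minv_carrier[OF D detD] by (simp add: N_def D_def U_def)
  have B0: "yB y + 0 \<cdot>\<^sub>m dB = yB y" using d(2) carrier_matD[OF y_carriers(2)[of y]] by (intro eq_matI) auto
  have N0: "minv (D + 0 \<cdot>\<^sub>m dV) = N" unfolding S0 by (simp add: N_def D_def U_def)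
  note UN = mder_mult_const(1)[OF Nder U one_carrier_mat]
  have T: "mder n n (\<lambda>t. Th (yU (y + t \<cdot>\<^sub>v h)) (yV (y + t \<cdot>\<^sub>v h))) (U * - (N * dV * N) * U\<^sup>T)"
    unfolding Th_def lS unfolding lU
    by (rule mder_mult_const(2)[OF UN one_carrier_mat]) (use U in simp)
  have Bl: "mder n m (\<lambda>t. yB y + t \<cdot>\<^sub>m dB) dB" by (rule mder_line[OF y_carriers(2) d(2)])
  have Q: "mder n m (\<lambda>t. Ps (yU (y + t \<cdot>\<^sub>v h)) (yV (y + t \<cdot>\<^sub>v h)) (yB (y + t \<cdot>\<^sub>v h))) (U * - (N * dV * N) * yB y + U * N * dB)"
    unfolding Ps_def lS unfolding lU line(2)
    using mder_mult[OF UN Bl mder_at_0[OF UN] mder_at_0[OF Bl]] unfolding N0 B0 .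
  have H: "mder p n (\<lambda>t. yC (y + t \<cdot>\<^sub>v h) * (yU (y + t \<cdot>\<^sub>v h))\<^sup>T) (dC * U\<^sup>T)"
    unfolding lU line(3)
    by (rule mder_mult_const(2)[OF mder_line[OF y_carriers(3) d(3)] one_carrier_mat]) (use U in simp)
  have XC: "X * C\<^sup>T \<in> carrier_mat n m" using X C by simp
  have AU: "A * U \<in> carrier_mat n n" using A U by simp
  have z: "0\<^sub>m n n + X * C\<^sup>T * dB\<^sup>T = X * C\<^sup>T * dB\<^sup>T" using XC d(2) by (intro left_add_zero_mat[of _ n n]) auto
  have E: "mder n n (\<lambda>t. res12 (yU (y + t \<cdot>\<^sub>v h)) (yA (y + t \<cdot>\<^sub>v h)) (yB (y + t \<cdot>\<^sub>v h))) (X * C\<^sup>T * dB\<^sup>T + U * dA\<^sup>T)"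
    unfolding res12_def lU line(1,2)
    using mder_add[OF mder_add[OF mder_const[OF AU] mder_mult_const(1)[OF mder_transpose[OF Bl] XC one_carrier_mat]]
      mder_mult_const(1)[OF mder_transpose[OF mder_line[OF y_carriers(1) d(1)]] U one_carrier_mat]]
    unfolding z .
  show "vder dz (\<lambda>t. Phi (y + t \<cdot>\<^sub>v h)) (svec (U * - (N * dV * N) * U\<^sup>T) @\<^sub>v (vec_of_mat (U * - (N * dV * N) * yB y + U * N * dB)
       @\<^sub>v (vec_of_mat (dC * U\<^sup>T) @\<^sub>v vec_of_mat (X * C\<^sup>T * dB\<^sup>T + U * dA\<^sup>T))))"
    unfolding Phi_def by (intro vder_append vder_svec vder_vec_of_mat T Q H E)
qed

text \<open>\<open>M = \<Delta> U^{-1}\<close> is the inverse of \<open>U N\<close>. The component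
  of \<open>\<Theta>\<close> asks for \<open>- (U N) dV (U N)^T\<close> to equal
  \<open>zT w\<close>, which gives \<open>dV\<close>; the components of \<open>\<Psi>\<close>,
  \<open>H\<close> and the residual then give \<open>dB\<close>, \<open>dC\<close> and
  \<open>dA\<close>. The norm estimate uses that the coordinates preserve Frobenius norms.\<close>

lemma Phi_right_inverse:
  assumes y: "y \<in> Y" and det: "Determinant.det (yU y) \<noteq> 0" and w: "w \<in> carrier_vec dz"
  defines "N \<equiv> minv (schur (yU y) (yV y))" and "Ui \<equiv> minv (yU y)" and "M \<equiv> schur (yU y) (yV y) * minv (yU y)"
  defines "dV \<equiv> - (M * zT w * M\<^sup>T)"
  defines "dB \<equiv> M * zQ w + dV * N * yB y"
  defines "dC \<equiv> zH w * Ui\<^sup>T" and "dA \<equiv> (Ui * (zE w - X * C\<^sup>T * dB\<^sup>T))\<^sup>T"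
  shows "\<exists>h\<in>carrier_vec (df + ds). jacobian_mat (df + ds) dz Phi y *\<^sub>v h = w \<and>
    vnorm h \<le> frob_norm dA + frob_norm dB + frob_norm dC + frob_norm dV"
proof -
  define U where "U = yU y"
  define D where "D = schur U (yV y)"
  have U: "U \<in> carrier_mat n n" by (simp add: U_def)
  have D: "D \<in> carrier_mat n n" unfolding D_def by (rule schur_carrier[OF U y_carriers(5)])
  have detD: "Determinant.det D \<noteq> 0" using Y_D(2)[OF y] by (simp add: D_def U_def)
  have N: "N \<in> carrier_mat n n" "N\<^sup>T = N"
    using sym_mat_minv[OF schur_sym[OF y_carriers(4) sym_yV] Y_D(2)[OF y]] by (auto simp: N_def sym_mat_def)
  have ND: "N * D = 1\<^sub>m n" using minv_left[OF D detD] by (simp add: N_def D_def U_def)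
  have Ui: "Ui \<in> carrier_mat n n" "U * Ui = 1\<^sub>m n"
    using minv_carrier[OF y_carriers(4) det] minv_right[OF y_carriers(4) det] by (auto simp: Ui_def U_def)
  have M_eq: "M = D * Ui" by (simp add: M_def D_def Ui_def U_def)
  have M: "M \<in> carrier_mat n n" unfolding M_eq using D Ui by simp
  note z = z_carriers[of w]
  have zTs: "(zT w)\<^sup>T = zT w" using sym_smat[of n "sub 0 (dim_sym n) w"] by (simp add: zT_def sym_mat_def)
  have V: "dV \<in> carrier_mat n n" unfolding dV_def by (intro uminus_carrier_mat) (rule carrier_intros M z)+
  have Vs: "dV\<^sup>T = dV" unfolding dV_def using carrier_matD[OF M] carrier_matD[OF z(1)] by (simp add: mtrans mmult_assoc zTs transpose_uminus)
  have B: "dB \<in> carrier_mat n m" unfolding dB_def by (rule carrier_intros M z V N y_carriers)+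
  have dC: "dC \<in> carrier_mat p n" unfolding dC_def by (rule carrier_intros z Ui)+
  have XCB: "X * C\<^sup>T * dB\<^sup>T \<in> carrier_mat n n" using X C B by simp
  have Ac: "Ui * (zE w - X * C\<^sup>T * dB\<^sup>T) \<in> carrier_mat n n" by (rule mult_carrier_mat[OF Ui(1) minus_carrier_mat[OF XCB]])
  have dA: "dA \<in> carrier_mat n n" unfolding dA_def using Ac by simp
  have V': "sym_mat n dV" using V Vs by (simp add: sym_mat_def)
  note cd = carrier_matD[OF U] carrier_matD[OF N(1)] carrier_matD[OF M] carrier_matD[OF V] carrier_matD[OF B] carrier_matD[OF D] carrier_matD[OF Ui(1)]
    carrier_matD[OF z(1)] carrier_matD[OF z(2)] carrier_matD[OF z(3)] carrier_matD[OF z(4)] carrier_matD[OF y_carriers(2)[of y]]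
  have UNM: "U * (N * M) = 1\<^sub>m n"
  proof -
    have "N * (D * Ui) = Ui" using cd by (simp flip: mmult_assoc add: ND mmult_one)
    then show ?thesis by (simp add: M_eq Ui)
  qed
  have MNU: "M\<^sup>T * (N * U\<^sup>T) = 1\<^sub>m n"
    using arg_cong[OF UNM, of transpose_mat] cd by (simp add: mtrans mmult_assoc N(2))
  have UNM': "U * (N * (M * Z)) = Z" if "dim_row Z = n" for Z
  proof -
    have "U * (N * (M * Z)) = U * (N * M) * Z" using cd that by (simp add: mmult_assoc)
    then show ?thesis using that by (simp add: UNM mmult_one)
  qed
  have UUi: "U * (Ui * Z) = Z" if "dim_row Z = n" for Z
    using cd that mmult_assoc[of U Ui Z] by (simp add: Ui(2) mmult_one)
  have e1: "U * - (N * dV * N) * U\<^sup>T = zT w"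
    unfolding dV_def using cd by (simp add: mmult_uminus mmult_assoc UNM' MNU mmult_one)
  have e2: "U * - (N * dV * N) * yB y + U * N * dB = zQ w"
  proof -
    have a: "U * N * dB = zQ w + U * (N * (dV * (N * yB y)))"
      unfolding dB_def using cd by (simp add: mmult_assoc mmult_add UNM')
    have b: "U * - (N * dV * N) * yB y = - (U * (N * (dV * (N * yB y))))"
      using cd by (simp add: mmult_uminus mmult_assoc)
    have "- (U * (N * (dV * (N * yB y)))) + (zQ w + U * (N * (dV * (N * yB y)))) = zQ w"
      using cd by (intro eq_matI) auto
    then show ?thesis unfolding a b .
  qed
  have e3: "dC * U\<^sup>T = zH w"
    unfolding dC_def using cd arg_cong[OF Ui(2), of transpose_mat] by (simp add: mmult_assoc mtrans mmult_one)
  have e4: "X * C\<^sup>T * dB\<^sup>T + U * dA\<^sup>T = zE w"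
  proof -
    have "U * dA\<^sup>T = zE w - X * C\<^sup>T * dB\<^sup>T"
      unfolding dA_def transpose_transpose by (rule UUi) (use carrier_matD[OF minus_carrier_mat[OF XCB]] in simp)
    moreover have "R + (E - R) = E" if "R \<in> carrier_mat n n" "E \<in> carrier_mat n n" for R E :: "real mat"
      using that by (auto intro!: eq_matI)
    ultimately show ?thesis using XCB z(4) by simp
  qed
  define h where "h = lift_param (dA, dB, dC) (blk (0\<^sub>m n n) (0\<^sub>m n n) dV)"
  note L = Phi_line[OF y dA B dC V', folded h_def N_def U_def, unfolded e1 e2 e3 e4 z_encode[OF w]]
  obtain J where J: "has_jacobian (df + ds) dz Phi y J" using C1_Phi y unfolding C1_on_def by blast
  note dP = carrier_vecD[OF Phi_decode(1)[OF y]]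
  have "jacobian_mat (df + ds) dz Phi y *\<^sub>v h = w"
    unfolding jacobian_mat_line[OF J Y_D(1)[OF y] dP] by (rule jacobian_vder[OF J Y_D(1)[OF y] L(1) dP L(2)])
  moreover have "vnorm h \<le> frob_norm dA + frob_norm dB + frob_norm dC + frob_norm dV"
  proof -
    have bs: "sym_mat (2 * n) (blk (0\<^sub>m n n) (0\<^sub>m n n) dV)"
      by (rule sym_blk_22[OF V'])
    have s: "vnorm (svec (blk (0\<^sub>m n n) (0\<^sub>m n n) dV)) = frob_norm dV"
      unfolding vnorm_svec[OF bs] by (rule frob_norm_blk_22[OF V])
    have "vnorm h \<le> (vnorm (vec_of_mat dA) + (vnorm (vec_of_mat dB) + vnorm (vec_of_mat dC))) + frob_norm dV"
      unfolding h_def lift_param_def vec_of_filt.simps s[symmetric]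
      by (rule order_trans[OF vnorm_append_le] add_right_mono add_left_mono vnorm_append_le)+
    then show ?thesis by (simp add: vnorm_vec_of_mat)
  qed
  ultimately show ?thesis using L(1) by blast
qed

end

section \<open>Bounds for informative filters\<close>

text \<open>The reciprocal of the norm of \<open>S^{-1}\<close> acts as the least eigenvalue of
  \<open>S\<close>. The estimate is \<open>frac_lower\<close> for \<open>S^{-1}\<close>, tested at
  the multiple \<open>v / k\<close> that balances the two terms.\<close>

lemma pos_def_vnorm:
  assumes S: "pos_def n S" and v: "v \<in> carrier_vec n"
  shows "v \<bullet> v \<le> op_norm (minv S) * (v \<bullet> (S *\<^sub>v v))"
proof -
  define k where "k = op_norm (minv S)"
  note I = pos_def_minv[OF S]
  note Ic = pos_defD(1)[OF I]
  have vI: "vnorm (minv S *\<^sub>v v) \<le> k * vnorm v" unfolding k_def by (rule vnorm_mvec_le_op) (use Ic v in simp)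
  have k0: "k \<ge> 0" by (simp add: k_def)
  show ?thesis
  proof (cases "k = 0")
    case True
    have "vnorm (minv S *\<^sub>v v) = 0" using vI True vnorm_ge_0[of "minv S *\<^sub>v v"] by simp
    then have "minv S *\<^sub>v v = 0\<^sub>v n" using vnorm_eq_0[OF mult_mat_vec_carrier[OF Ic v]] by simp
    then have "v = 0\<^sub>v n" using pos_defD(5)[OF I v] v by auto
    then show ?thesis using k0 pos_def_ge_0[OF S v] by (simp add: k_def)
  next
    case False
    then have k: "k > 0" using k0 by simp
    have "v \<bullet> (minv S *\<^sub>v v) \<le> vnorm v * vnorm (minv S *\<^sub>v v)"
      by (rule vec_Cauchy_Schwarz') (use Ic v in simp)
    also have "\<dots> \<le> vnorm v * (k * vnorm v)" using vI by (simp add: mult_left_mono)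
    also have "\<dots> = k * (v \<bullet> v)" by (simp add: vnorm_sq[symmetric] power2_eq_square)
    finally have q: "v \<bullet> (minv S *\<^sub>v v) \<le> k * (v \<bullet> v)" .
    have "2 * (v \<bullet> ((1/k) \<cdot>\<^sub>v v)) - ((1/k) \<cdot>\<^sub>v v) \<bullet> (minv S *\<^sub>v ((1/k) \<cdot>\<^sub>v v)) \<le> v \<bullet> (minv (minv S) *\<^sub>v v)"
      by (rule frac_lower[OF I v]) (use v in simp)
    then have "2 * (1/k) * (v \<bullet> v) - (1/k) * (1/k) * (v \<bullet> (minv S *\<^sub>v v)) \<le> v \<bullet> (S *\<^sub>v v)"
      using v Ic by (simp add: minv_minv[OF pos_defD(1,4)[OF S]] mvec_smult)
    moreover have "(1/k) * (1/k) * (v \<bullet> (minv S *\<^sub>v v)) \<le> (1/k) * (1/k) * (k * (v \<bullet> v))"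
      by (rule mult_left_mono[OF q]) simp
    moreover have "(1/k) * (1/k) * (k * (v \<bullet> v)) = (1/k) * (v \<bullet> v)" using k by simp
    ultimately have "(1/k) * (v \<bullet> v) \<le> v \<bullet> (S *\<^sub>v v)" by simp
    then show ?thesis using k by (simp add: k_def[symmetric] field_simps)
  qed
qed

text \<open>Converse of \<open>pos_def_vnorm\<close>: the coercivity estimate at
  \<open>x = D^{-1} u\<close>, Cauchy-Schwarz, and cancellation of \<open>|x|\<close>.\<close>

lemma op_norm_minv_le:
  assumes D: "D \<in> carrier_mat n n" "Determinant.det D \<noteq> 0" and c: "c \<ge> 0"
    and le: "\<And>v. v \<in> carrier_vec n \<Longrightarrow> v \<bullet> v \<le> c * (v \<bullet> (D *\<^sub>v v))"
  shows "op_norm (minv D) \<le> c"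
proof (rule op_norm_le[OF _ c])
  fix u :: "real vec" assume "u \<in> carrier_vec (dim_col (minv D))"
  then have u: "u \<in> carrier_vec n" using minv_carrier[OF D] by simp
  define x where "x = minv D *\<^sub>v u"
  have x: "x \<in> carrier_vec n" unfolding x_def using minv_carrier[OF D] u by simp
  have "D *\<^sub>v x = u" unfolding x_def by (rule minv_cancel(1)[OF D u])
  then have "x \<bullet> x \<le> c * (x \<bullet> u)" using le[OF x] by simp
  also have "\<dots> \<le> c * (vnorm x * vnorm u)" by (intro mult_left_mono[OF _ c] vec_Cauchy_Schwarz') (use x u in simp)
  finally have "vnorm x * vnorm x \<le> vnorm x * (c * vnorm u)"
    by (simp add: vnorm_sq[symmetric] power2_eq_square mult_ac)
  then have "vnorm x \<le> c * vnorm u"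
    using c vnorm_ge_0[of x] by (cases "vnorm x = 0") (auto simp: mult_le_cancel_left)
  then show "vnorm (minv D *\<^sub>v u) \<le> c * vnorm u" by (simp add: x_def)
qed

lemma op_norm_blk:
  assumes c: "X \<in> carrier_mat n n" "U \<in> carrier_mat n n" "V \<in> carrier_mat n n"
  shows "op_norm X \<le> op_norm (blk X U V)" "op_norm U \<le> op_norm (blk X U V)" "op_norm V \<le> op_norm (blk X U V)"
proof -
  let ?s = "op_norm (blk X U V)"
  have b: "vnorm (blk X U V *\<^sub>v z) \<le> ?s * vnorm z" if "z \<in> carrier_vec (n + n)" for z
    by (rule vnorm_mvec_le_op) (use that c in \<open>simp add: blk_def\<close>)
  have a: "vnorm (v @\<^sub>v 0\<^sub>v n) = vnorm v" "vnorm (0\<^sub>v n @\<^sub>v v) = vnorm v" for v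
    using vnorm_append_sq[of v "0\<^sub>v n"] vnorm_append_sq[of "0\<^sub>v n" v] by simp_all
  have l: "vnorm (X *\<^sub>v v) \<le> ?s * vnorm v" "vnorm (U\<^sup>T *\<^sub>v v) \<le> ?s * vnorm v" "vnorm (V *\<^sub>v v) \<le> ?s * vnorm v"
    if v: "v \<in> carrier_vec n" for v
  proof -
    have m1: "blk X U V *\<^sub>v (v @\<^sub>v 0\<^sub>v n) = (X *\<^sub>v v) @\<^sub>v (U\<^sup>T *\<^sub>v v)"
      unfolding blk_mvec[OF c v zero_carrier_vec] using c v by (simp add: mvec_zero)
    have m2: "blk X U V *\<^sub>v (0\<^sub>v n @\<^sub>v v) = (U *\<^sub>v v) @\<^sub>v (V *\<^sub>v v)"
      unfolding blk_mvec[OF c zero_carrier_vec v] using c v by (simp add: mvec_zero)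
    show "vnorm (X *\<^sub>v v) \<le> ?s * vnorm v" "vnorm (U\<^sup>T *\<^sub>v v) \<le> ?s * vnorm v"
      using b[of "v @\<^sub>v 0\<^sub>v n"] v vnorm_le_append[of "X *\<^sub>v v" "U\<^sup>T *\<^sub>v v"] vnorm_le_append[of "U\<^sup>T *\<^sub>v v" "X *\<^sub>v v"] unfolding m1 a by auto
    show "vnorm (V *\<^sub>v v) \<le> ?s * vnorm v"
      using b[of "0\<^sub>v n @\<^sub>v v"] v vnorm_le_append(2)[of "V *\<^sub>v v" "U *\<^sub>v v"] unfolding m2 a by auto
  qed
  show "op_norm X \<le> ?s" "op_norm V \<le> ?s" by (rule op_norm_le; use l c in simp)+
  have "op_norm U\<^sup>T \<le> ?s" by (rule op_norm_le; use l c in simp)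
  then show "op_norm U \<le> ?s" by (simp add: op_norm_transpose)
qed

lemma op_norm_mult_le:
  assumes "dim_col A = dim_row B" "op_norm A \<le> a" "op_norm B \<le> b"
  shows "op_norm (A * B) \<le> a * b"
proof -
  have "op_norm (A * B) \<le> op_norm A * op_norm B" by (rule op_norm_mult[OF assms(1)])
  also have "\<dots> \<le> a * b" using assms(2,3) op_norm_ge_0[of A] op_norm_ge_0[of B] by (intro mult_mono) linarith+
  finally show ?thesis .
qed

text \<open>If the claim failed, then \<open>x < r\<close> and the first term could be absorbed into
  the second; dividing by \<open>r\<close> gives a contradiction. Bounding the root of the quadratic
  linearly in the coefficients keeps the final constants polynomial.\<close>

lemma quadratic_bound:
  fixes r x \<alpha> \<beta> :: real
  assumes "r * r \<le> \<alpha> * (x * x) + \<beta> * (r * x)" "0 \<le> \<alpha>" "0 \<le> \<beta>" "0 \<le> r" "0 \<le> x"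
  shows "r \<le> (1 + \<alpha> + \<beta>) * x"
proof (rule ccontr)
  assume g: "\<not> r \<le> (1 + \<alpha> + \<beta>) * x"
  have "x \<le> (1 + \<alpha> + \<beta>) * x" using assms by (simp add: algebra_simps)
  then have rx: "x < r" and r: "r > 0" using g assms(5) by auto
  have "\<alpha> * (x * x) \<le> \<alpha> * (r * x)" using rx assms by (intro mult_left_mono mult_right_mono) auto
  then have "r * r \<le> r * ((\<alpha> + \<beta>) * x)" using assms(1) by (simp add: algebra_simps)
  then have "r \<le> (\<alpha> + \<beta>) * x" using r by simp
  then show False using g assms(5) by (simp add: algebra_simps)
qed

text \<open>
  Bounds for the operator norms of \<open>U\<^sup>-\<^sup>1\<close>, \<open>\<Delta>\<close>, \<open>\<Delta> U\<^sup>-\<^sup>1\<close>, \<open>\<Theta>\<close>, \<open>\<Psi>\<close>, \<open>B\<^sub>K\<close> and \<open>A\<^sub>K\<close>; the arguments \<open>a\<close>, \<open>c\<close>, \<open>w\<close>, \<open>s\<close>,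
  \<open>k\<close>, \<open>z\<close> stand for the norms of \<open>A\<close>, \<open>C\<close>, \<open>W\<^sub>2\<^sup>-\<^sup>1\<close>, \<open>\<Sigma>\<close>, \<open>\<Sigma>\<^sup>-\<^sup>1\<close>, \<open>Z\<^sup>-\<^sup>1\<close>.
\<close>

definition bU :: "real \<Rightarrow> real \<Rightarrow> real \<Rightarrow> real" where "bU s k z = k * s * z"
definition bD :: "real \<Rightarrow> real \<Rightarrow> real" where "bD s k = s + s * k * s"
definition bM :: "real \<Rightarrow> real \<Rightarrow> real \<Rightarrow> real" where "bM s k z = bD s k * bU s k z"
definition bT :: "real \<Rightarrow> real \<Rightarrow> real" where "bT s k = s * k * s"
definition bQ :: "real \<Rightarrow> real \<Rightarrow> real \<Rightarrow> real \<Rightarrow> real \<Rightarrow> real" where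
  "bQ a c w s k = 1 + w * (2 * (bT s k * a)) + w * (2 * (c * s))"
definition bB :: "real \<Rightarrow> real \<Rightarrow> real \<Rightarrow> real \<Rightarrow> real \<Rightarrow> real \<Rightarrow> real" where
  "bB a c w s k z = bM s k z * bQ a c w s k"
definition bA :: "real \<Rightarrow> real \<Rightarrow> real \<Rightarrow> real \<Rightarrow> real \<Rightarrow> real \<Rightarrow> real" where
  "bA a c w s k z = bU s k z * (a * s + s * c * bB a c w s k z)"

lemmas bound_defs = bU_def bD_def bM_def bT_def bQ_def bB_def bA_def

locale oe_info = oe +
  fixes Ak B Ck U V
  assumes K: "(Ak, B, Ck) \<in> Kinfo" and Ak: "Ak \<in> carrier_mat n n" and B: "B \<in> carrier_mat n m"
    and Ck: "Ck \<in> carrier_mat p n" and S: "SigK (Ak, B, Ck) = blk X U V" and U: "U \<in> carrier_mat n n"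
    and sym_V: "sym_mat n V" and detU: "Determinant.det U \<noteq> 0" and r12: "res12 U Ak B = 0\<^sub>m n n"
    and r22: "\<And>u. u \<in> carrier_vec n \<Longrightarrow> res22 U V Ak B u = 0" and pos_S: "pos_def (2 * n) (blk X U V)"
    and pos_D: "pos_def n (schur U V)"
begin

abbreviation "sg \<equiv> op_norm (blk X U V)"
abbreviation "kp \<equiv> op_norm (minv (blk X U V))"
abbreviation "zt \<equiv> op_norm (Tm U V)"
abbreviation "al \<equiv> op_norm A"
abbreviation "ga \<equiv> op_norm C"
abbreviation "om \<equiv> op_norm W2i"
abbreviation "N \<equiv> minv (schur U V)"
abbreviation "M \<equiv> schur U V * minv U"

lemma V: "V \<in> carrier_mat n n" and V_sym: "V\<^sup>T = V" using sym_V by (auto simp: sym_mat_def)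

lemmas D = pos_defD(1,4)[OF pos_D]

lemma N: "N \<in> carrier_mat n n" by (rule minv_carrier[OF D])

lemma Ui: "minv U \<in> carrier_mat n n" by (rule minv_carrier[OF U detU])

lemma detV: "Determinant.det V \<noteq> 0" by (rule pos_defD(4)[OF pos_def_V[OF U sym_V pos_D]])

lemmas Q = Th_carrier(2)[OF U V D(2) B]

lemmas U_dims [simp] = carrier_matD[OF U] carrier_matD[OF V] carrier_matD[OF D(1)] carrier_matD[OF N] carrier_matD[OF Ui]
  carrier_matD[OF Ak] carrier_matD[OF B] carrier_matD[OF Ck] carrier_matD[OF X] carrier_matD[OF Xi] carrier_matD[OF A]
  carrier_matD[OF C] carrier_matD[OF G] carrier_matD[OF Q] carrier_matD[OF W2i] carrier_matD[OF Th_carrier(1)[OF U V D(2)]]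

lemma form_lower:
  assumes y: "y \<in> carrier_vec n" and v: "v \<in> carrier_vec n"
  shows "v \<bullet> v \<le> kp * ((y @\<^sub>v v) \<bullet> (blk X U V *\<^sub>v (y @\<^sub>v v)))" "y \<bullet> y \<le> kp * ((y @\<^sub>v v) \<bullet> (blk X U V *\<^sub>v (y @\<^sub>v v)))"
proof -
  have "y @\<^sub>v v \<in> carrier_vec (2 * n)" using y v by (simp add: mult_2)
  note le = pos_def_vnorm[OF pos_S this]
  have "(y @\<^sub>v v) \<bullet> (y @\<^sub>v v) = y \<bullet> y + v \<bullet> v" using vnorm_append_sq[of y v] by (simp add: vnorm_sq)
  then show "v \<bullet> v \<le> kp * ((y @\<^sub>v v) \<bullet> (blk X U V *\<^sub>v (y @\<^sub>v v)))" "y \<bullet> y \<le> kp * ((y @\<^sub>v v) \<bullet> (blk X U V *\<^sub>v (y @\<^sub>v v)))"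
    using le sp_self_ge_0[of y] sp_self_ge_0[of v] by linarith+
qed

lemma op_blocks: "op_norm X \<le> sg" "op_norm U \<le> sg" "op_norm V \<le> sg"
  by (rule op_norm_blk[OF X U V])+

text \<open>The form of \<open>\<Delta>\<close> at \<open>v\<close> is the form of
  \<open>\<Sigma>\<close> at \<open>(- X^{-1} U v, v)\<close>, so coercivity of
  \<open>\<Sigma>\<close> passes to the Schur complement.\<close>

lemma op_N: "op_norm N \<le> kp"
proof (rule op_norm_minv_le[OF D op_norm_ge_0])
  fix v :: "real vec" assume v: "v \<in> carrier_vec n"
  define y where "y = - (Xi *\<^sub>v (U *\<^sub>v v))"
  have y: "y \<in> carrier_vec n" unfolding y_def using Xi U v by simp
  have "y + Xi *\<^sub>v (U *\<^sub>v v) = 0\<^sub>v n" unfolding y_def using v by (intro eq_vecI) auto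
  then have "(y @\<^sub>v v) \<bullet> (blk X U V *\<^sub>v (y @\<^sub>v v)) = v \<bullet> (schur U V *\<^sub>v v)"
    unfolding blk_form_schur[OF U V y v] using X by (simp add: mvec_zero)
  then show "v \<bullet> v \<le> kp * (v \<bullet> (schur U V *\<^sub>v v))" using form_lower(1)[OF y v] by simp
qed

lemma op_Xi: "op_norm Xi \<le> kp"
  unfolding Xi_def
proof (rule op_norm_minv_le[OF X detX op_norm_ge_0])
  fix v :: "real vec" assume v: "v \<in> carrier_vec n"
  show "v \<bullet> v \<le> kp * (v \<bullet> (X *\<^sub>v v))"
    using form_lower(2)[OF v zero_carrier_vec] unfolding blk_form[OF X U V v zero_carrier_vec]
    using v by (simp add: mvec_zero)
qed

lemma op_Vi: "op_norm (minv V) \<le> kp"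
proof (rule op_norm_minv_le[OF V detV op_norm_ge_0])
  fix v :: "real vec" assume v: "v \<in> carrier_vec n"
  show "v \<bullet> v \<le> kp * (v \<bullet> (V *\<^sub>v v))"
    using form_lower(1)[OF zero_carrier_vec v] unfolding blk_form[OF X U V zero_carrier_vec v]
    using v mult_mat_vec_carrier[OF U v] by (simp add: mvec_zero)
qed

lemma Z_eq: "minv (Z_K A C W1 W2 (Ak, B, Ck)) = Tm U V"
  by (rule Z_K_eq(2)[OF S U detU pos_def_V[OF U sym_V pos_D]])

text \<open>\<open>U^{-1} = V^{-1} U^T Z^{-1}\<close>: invertibility of \<open>U\<close> is
  quantified by \<open>Z^{-1}\<close>, which is the origin of \<open>bU\<close>.\<close>

lemma op_Ui: "op_norm (minv U) \<le> bU sg kp zt"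
proof -
  have Vi: "minv V \<in> carrier_mat n n" by (rule minv_carrier[OF V detV])
  have T: "Tm U V \<in> carrier_mat n n" by (rule Tm_carrier[OF U detU V])
  have c: "minv V * U\<^sup>T * Tm U V \<in> carrier_mat n n" by (rule carrier_intros Vi U T)+
  have "minv U = minv V * U\<^sup>T * Tm U V"
  proof (rule minv_unique[OF U c])
    have UT: "(minv U * U)\<^sup>T = 1\<^sub>m n" using minv_left[OF U detU] by simp
    have "U\<^sup>T * (minv U)\<^sup>T = 1\<^sub>m n" using UT by (simp add: mtrans)
    then have a: "U\<^sup>T * ((minv U)\<^sup>T * (V * minv U)) = V * minv U"
      using mmult_assoc[of "U\<^sup>T" "(minv U)\<^sup>T" "V * minv U"] by (simp add: mmult_one)
    have b: "minv V * (V * minv U) = minv U"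
      using mmult_assoc[of "minv V" V "minv U"] carrier_matD[OF Vi] by (simp add: minv_left[OF V detV] mmult_one)
    show "U * (minv V * U\<^sup>T * Tm U V) = 1\<^sub>m n"
      unfolding Tm_def using carrier_matD[OF Vi] by (simp add: mmult_assoc a b minv_right[OF U detU])
  qed
  moreover have "op_norm (minv V * U\<^sup>T * Tm U V) \<le> kp * sg * zt"
    using carrier_matD[OF Vi] carrier_matD[OF T]
    by (intro op_norm_mult_le op_Vi order_refl) (simp_all add: op_norm_transpose op_blocks)
  ultimately show ?thesis by (simp add: bU_def)
qed

lemma op_D: "op_norm (schur U V) \<le> bD sg kp"
proof -
  have "op_norm (schur U V) \<le> op_norm V + op_norm (U\<^sup>T * Xi * U)"
    unfolding schur_def by (rule op_norm_minus) simp_all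
  also have "\<dots> \<le> sg + sg * kp * sg"
    by (intro add_mono op_norm_mult_le op_blocks op_Xi) (simp_all add: op_norm_transpose op_blocks)
  finally show ?thesis by (simp add: bD_def)
qed

lemma op_M: "op_norm M \<le> bM sg kp zt"
  unfolding bM_def by (rule op_norm_mult_le[OF _ op_D op_Ui]) simp

lemma op_Th: "op_norm (Th U V) \<le> bT sg kp"
  unfolding bT_def Th_def by (intro op_norm_mult_le op_blocks op_N) (simp_all add: op_norm_transpose op_blocks)

lemma bounds_ge_0: "0 \<le> bU sg kp zt" "0 \<le> bM sg kp zt" "0 \<le> bT sg kp" "0 \<le> bQ al ga om sg kp" "0 \<le> bB al ga om sg kp zt"
  by (simp_all add: bound_defs)

text \<open>At the true covariance \<open>lmi\<close> vanishes. Solved for the form of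
  \<open>W2\<close> at \<open>r = \<Psi>^T v\<close>, the contribution of \<open>W1\<close> has a
  negative sign and is dropped, which keeps \<open>W1\<close> out of the bound. Coercivity of
  \<open>W2\<close> turns the rest into a quadratic inequality for \<open>|r|\<close>.\<close>

lemma op_Q: "op_norm (Ps U V B)\<^sup>T \<le> bQ al ga om sg kp"
proof (rule op_norm_le[OF _ bounds_ge_0(4)])
  fix v :: "real vec" assume "v \<in> carrier_vec (dim_col (Ps U V B)\<^sup>T)"
  then have v: "v \<in> carrier_vec n" by simp
  have vd: "dim_vec v = n" using v by simp
  define r where "r = (Ps U V B)\<^sup>T *\<^sub>v v"
  define z where "z = Xi *\<^sub>v (Th U V *\<^sub>v v)"
  have r: "r \<in> carrier_vec m" unfolding r_def using Q v by simp
  have z: "z \<in> carrier_vec n" unfolding z_def using Th_carrier(1)[OF U V D(2)] Xi v by simp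
  have Cx: "C *\<^sub>v (X *\<^sub>v v) \<in> carrier_vec m" using C X v by simp
  have "lmi (Th U V) (Ps U V B) v = 0"
    unfolding lmi_eq_res22[OF U sym_V Ak B D(2) r12 v] by (rule r22) (use N U v in simp)
  then have "r \<bullet> (W2 *\<^sub>v r) = 2 * (v \<bullet> (Th U V *\<^sub>v (A\<^sup>T *\<^sub>v v))) + 2 * (v \<bullet> (Ps U V B *\<^sub>v (C *\<^sub>v (X *\<^sub>v v)))) - z \<bullet> (W1 *\<^sub>v z)"
    unfolding lmi_def r_def[symmetric] z_def[symmetric] by linarith
  also have "\<dots> \<le> 2 * (bT sg kp * al * (vnorm v * vnorm v)) + 2 * (ga * sg * (vnorm r * vnorm v))"
  proof -
    have "0 \<le> z \<bullet> (W1 *\<^sub>v z)" by (rule pos_def_ge_0[OF W1 z])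
    moreover have "v \<bullet> (Th U V *\<^sub>v (A\<^sup>T *\<^sub>v v)) \<le> bT sg kp * al * (vnorm v * vnorm v)"
    proof -
      have "vnorm (Th U V *\<^sub>v (A\<^sup>T *\<^sub>v v)) = vnorm (Th U V * A\<^sup>T *\<^sub>v v)" by (simp add: mult_mvec vd)
      also have "\<dots> \<le> op_norm (Th U V * A\<^sup>T) * vnorm v" by (rule vnorm_mvec_le_op) (simp add: vd)
      also have "\<dots> \<le> (bT sg kp * al) * vnorm v"
        by (intro mult_right_mono op_norm_mult_le op_Th) (simp_all add: op_norm_transpose)
      finally have "vnorm (Th U V *\<^sub>v (A\<^sup>T *\<^sub>v v)) \<le> (bT sg kp * al) * vnorm v" .
      then have "vnorm v * vnorm (Th U V *\<^sub>v (A\<^sup>T *\<^sub>v v)) \<le> vnorm v * ((bT sg kp * al) * vnorm v)"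
        by (intro mult_left_mono) simp_all
      then show ?thesis using vec_Cauchy_Schwarz'[of v "Th U V *\<^sub>v (A\<^sup>T *\<^sub>v v)"] by (simp add: vd mult_ac)
    qed
    moreover have "v \<bullet> (Ps U V B *\<^sub>v (C *\<^sub>v (X *\<^sub>v v))) \<le> ga * sg * (vnorm r * vnorm v)"
    proof -
      have "v \<bullet> (Ps U V B *\<^sub>v (C *\<^sub>v (X *\<^sub>v v))) = (C *\<^sub>v (X *\<^sub>v v)) \<bullet> r"
        unfolding r_def by (rule sp_mvec_swap) (simp_all add: vd)
      also have "\<dots> \<le> vnorm (C *\<^sub>v (X *\<^sub>v v)) * vnorm r" by (rule vec_Cauchy_Schwarz') (use r in simp)
      also have "\<dots> \<le> (ga * sg * vnorm v) * vnorm r"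
      proof (rule mult_right_mono)
        have "vnorm (C *\<^sub>v (X *\<^sub>v v)) = vnorm (C * X *\<^sub>v v)" by (simp add: mult_mvec vd)
        also have "\<dots> \<le> op_norm (C * X) * vnorm v" by (rule vnorm_mvec_le_op) (simp add: vd)
        also have "\<dots> \<le> (ga * sg) * vnorm v" by (intro mult_right_mono op_norm_mult_le op_blocks) simp_all
        finally show "vnorm (C *\<^sub>v (X *\<^sub>v v)) \<le> ga * sg * vnorm v" .
      qed simp
      finally show ?thesis by (simp add: mult_ac)
    qed
    ultimately show ?thesis by linarith
  qed
  finally have le: "r \<bullet> (W2 *\<^sub>v r) \<le> 2 * (bT sg kp * al * (vnorm v * vnorm v)) + 2 * (ga * sg * (vnorm r * vnorm v))" .
  have "r \<bullet> r \<le> om * (r \<bullet> (W2 *\<^sub>v r))" by (rule pos_def_vnorm[OF W2 r])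
  also have "\<dots> \<le> om * (2 * (bT sg kp * al * (vnorm v * vnorm v)) + 2 * (ga * sg * (vnorm r * vnorm v)))"
    by (rule mult_left_mono[OF le]) simp
  finally have "vnorm r * vnorm r \<le> (om * (2 * (bT sg kp * al))) * (vnorm v * vnorm v) + (om * (2 * (ga * sg))) * (vnorm r * vnorm v)"
    by (simp add: vnorm_sq[symmetric] power2_eq_square algebra_simps)
  from quadratic_bound[OF this]
  show "vnorm ((Ps U V B)\<^sup>T *\<^sub>v v) \<le> bQ al ga om sg kp * vnorm v"
    using bounds_ge_0(3) by (simp add: r_def bQ_def)
qed

text \<open>Inverts the definition of \<open>\<Psi>\<close>:
  \<open>B = \<Delta> U^{-1} \<Psi>\<close>.\<close>

lemma op_B: "op_norm B \<le> bB al ga om sg kp zt"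
proof -
  have a: "minv U * (U * (N * B)) = N * B"
    using mmult_assoc[of "minv U" U "N * B"] by (simp add: minv_left[OF U detU] mmult_one)
  have b: "schur U V * (N * B) = B"
    using mmult_assoc[of "schur U V" N B] by (simp add: minv_right[OF D] mmult_one)
  have "B = M * Ps U V B" unfolding Ps_def by (simp add: mmult_assoc a b)
  also have "op_norm \<dots> \<le> bM sg kp zt * bQ al ga om sg kp"
    by (rule op_norm_mult_le[OF _ op_M]) (use op_Q in \<open>simp_all add: op_norm_transpose\<close>)
  finally show ?thesis by (simp add: bB_def)
qed

text \<open>The vanishing residual solved for \<open>Ak^T\<close>.\<close>

lemma op_Ak: "op_norm Ak \<le> bA al ga om sg kp zt"
proof -
  define R where "R = A * U + X * C\<^sup>T * B\<^sup>T"
  have R: "R \<in> carrier_mat n n" unfolding R_def by (rule carrier_intros A U X C B)+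
  have UA: "U * Ak\<^sup>T \<in> carrier_mat n n" by (rule carrier_intros U Ak)+
  have "R + U * Ak\<^sup>T = 0\<^sub>m n n" using r12 unfolding res12_def R_def .
  then have e: "U * Ak\<^sup>T = - R"
  proof -
    assume 0: "R + U * Ak\<^sup>T = 0\<^sub>m n n"
    have "(U * Ak\<^sup>T) $$ (i,j) = (- R) $$ (i,j)" if "i < n" "j < n" for i j
      using arg_cong[OF 0, of "\<lambda>M. M $$ (i,j)"] that R UA by (simp del: index_mult_mat(1))
    then show ?thesis using R UA by (intro eq_matI) (simp_all del: index_mult_mat(1))
  qed
  have "Ak\<^sup>T = minv U * (U * Ak\<^sup>T)"
    using mmult_assoc[of "minv U" U "Ak\<^sup>T"] by (simp add: minv_left[OF U detU] mmult_one)
  then have "op_norm Ak = op_norm (minv U * - R)" unfolding e by (metis op_norm_transpose)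
  also have "\<dots> \<le> bU sg kp zt * (al * sg + sg * ga * bB al ga om sg kp zt)"
  proof (rule op_norm_mult_le[OF _ op_Ui])
    have "op_norm R \<le> op_norm (A * U) + op_norm (X * C\<^sup>T * B\<^sup>T)" unfolding R_def by (rule op_norm_add) simp_all
    also have "\<dots> \<le> al * sg + sg * ga * bB al ga om sg kp zt"
      by (intro add_mono op_norm_mult_le op_blocks) (simp_all add: op_norm_transpose op_B)
    finally show "op_norm (- R) \<le> al * sg + sg * ga * bB al ga om sg kp zt" by (simp add: op_norm_uminus)
  qed (use R in simp)
  finally show ?thesis by (simp add: bA_def)
qed

abbreviation "Lo \<equiv> L_OE A C G W1 W2 (Ak, B, Ck)"

text \<open>\<open>Lo\<close> is the sum of the forms of \<open>\<Sigma>\<close> at the vectors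
  \<open>(g, - c)\<close> made of corresponding rows of \<open>G\<close> and \<open>Ck\<close>;
  coercivity of \<open>\<Sigma>\<close> bounds each \<open>|c|^2\<close> by \<open>kp\<close> times
  its summand.\<close>

lemma frob_Ck: "frob_norm Ck \<le> sqrt (Lo * kp)" and Lo_ge_0: "0 \<le> Lo"
proof -
  define t where "t i = row G i \<bullet> (X *\<^sub>v row G i) - 2 * (row G i \<bullet> (U *\<^sub>v row Ck i)) + row Ck i \<bullet> (V *\<^sub>v row Ck i)" for i
  have t: "t i = (row G i @\<^sub>v (- row Ck i)) \<bullet> (blk X U V *\<^sub>v (row G i @\<^sub>v (- row Ck i)))" if "i < p" for i
  proof -
    have c: "row G i \<in> carrier_vec n" "- row Ck i \<in> carrier_vec n" using G Ck that by auto
    show ?thesis unfolding blk_form[OF X U V c] t_def by (simp add: mvec_uminus)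
  qed
  have c: "row G i \<in> carrier_vec n" "- row Ck i \<in> carrier_vec n" if "i < p" for i using G Ck that by auto
  have L: "Lo = (\<Sum>i<p. t i)" unfolding t_def by (rule L_OE_eq[OF S U V Ck])
  have t0: "0 \<le> t i" if "i < p" for i
    unfolding t[OF that] by (rule pos_def_ge_0[OF pos_S]) (use c[OF that] in \<open>simp add: mult_2\<close>)
  show "0 \<le> Lo" unfolding L by (intro sum_nonneg t0) simp
  have "(frob_norm Ck)\<^sup>2 = (\<Sum>i<p. (vnorm (row Ck i))\<^sup>2)" by (simp add: frob_norm_sq_rows)
  also have "\<dots> \<le> (\<Sum>i<p. kp * t i)"
  proof (rule sum_mono)
    fix i assume "i \<in> {..<p}"
    then have i: "i < p" by simp
    have "(vnorm (row Ck i))\<^sup>2 = (- row Ck i) \<bullet> (- row Ck i)" using vnorm_sq[of "- row Ck i"] by (simp add: vnorm_uminus)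
    then show "(vnorm (row Ck i))\<^sup>2 \<le> kp * t i" using form_lower(1)[OF c[OF i]] t[OF i] by simp
  qed
  also have "\<dots> = Lo * kp" by (simp add: L sum_distrib_right mult.commute)
  finally show "frob_norm Ck \<le> sqrt (Lo * kp)" by (rule real_le_rsqrt)
qed

end

section \<open>The estimates\<close>

text \<open>Bound for \<open>dB\<close> per unit of \<open>|w|\<close>: the first term comes from
  \<open>M * zQ w\<close>, the second from \<open>dV N B\<close> with
  \<open>dV = - M * zT w * M^T\<close>.\<close>

definition bJ :: "real \<Rightarrow> real \<Rightarrow> real \<Rightarrow> real \<Rightarrow> real \<Rightarrow> real \<Rightarrow> real" where
  "bJ a c w s k z = bM s k z + bM s k z * bM s k z * k * bB a c w s k z"

text \<open>The summands after the 1 bound \<open>dA\<close>, \<open>dB\<close>, \<open>dC\<close>,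
  \<open>dV\<close> in this order; the 1 makes the value positive, so that its reciprocal is
  meaningful.\<close>

definition q1 :: "real \<times> real \<times> real \<times> real \<times> real \<times> real \<times> real \<Rightarrow> real" where
  "q1 = (\<lambda>(a, c, w, s, k, z, l). 1 + bU s k z * (1 + s * c * bJ a c w s k z) + bJ a c w s k z + bU s k z + bM s k z * bM s k z)"

text \<open>The summands belong to \<open>\<Theta>\<close>, \<open>\<Psi>\<close> and
  \<open>H\<close>. In the last one \<open>1 + k\<close> replaces \<open>sqrt k\<close>, which is
  not a polynomial.\<close>

definition q2 :: "real \<times> real \<times> real \<times> real \<times> real \<times> real \<Rightarrow> real" where
  "q2 = (\<lambda>(a, c, w, s, k, z). bT s k + bQ a c w s k + (1 + k) * s)"

text \<open>A sum dominates the maximum. The arguments come in another order than for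
  \<open>q1\<close> and \<open>q2\<close>: the norm of \<open>Z^{-1}\<close> precedes those of
  \<open>\<Sigma>\<close> and its inverse.\<close>

definition q3 :: "real \<times> real \<times> real \<times> real \<times> real \<times> real \<Rightarrow> real" where
  "q3 = (\<lambda>(a, c, w, z, s, k). bA a c w s k z + bB a c w s k z)"

text \<open>Each bound is assembled by sums and products from constants and coordinate projections,
  which are bounded linear.\<close>

lemma polynomial_q: "real_polynomial_function q1" "real_polynomial_function q2" "real_polynomial_function q3"
proof -
  have bl: "bounded_linear g \<Longrightarrow> bounded_linear (\<lambda>x. fst (g x))" "bounded_linear g \<Longrightarrow> bounded_linear (\<lambda>x. snd (g x))"
    for g :: "'a::real_normed_vector \<Rightarrow> 'b::real_normed_vector \<times> 'c::real_normed_vector"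
    by (auto intro: bounded_linear_fst_comp bounded_linear_snd_comp)
  note i = real_polynomial_function.intros(3,4) real_polynomial_function.intros(2) real_polynomial_function.intros(1) bl bounded_linear_ident
  show "real_polynomial_function q1" unfolding q1_def bJ_def bound_defs case_prod_unfold
    by (intro i)
  show "real_polynomial_function q2" unfolding q2_def bound_defs case_prod_unfold
    by (intro i)
  show "real_polynomial_function q3" unfolding q3_def bound_defs case_prod_unfold
    by (intro i)
qed

lemma frob_norm_mult_le:
  assumes "dim_col A = dim_row B"
  shows "op_norm A \<le> a \<Longrightarrow> frob_norm B \<le> b \<Longrightarrow> frob_norm (A * B) \<le> a * b"
    "frob_norm A \<le> a \<Longrightarrow> op_norm B \<le> b \<Longrightarrow> frob_norm (A * B) \<le> a * b"
proof -
  show "frob_norm (A * B) \<le> a * b" if "op_norm A \<le> a" "frob_norm B \<le> b"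
  proof -
    have "frob_norm (A * B) \<le> op_norm A * frob_norm B" by (rule frob_norm_mult_left[OF assms])
    also have "\<dots> \<le> a * b" using that op_norm_ge_0[of A] by (intro mult_mono) (auto intro: order_trans[of 0 "op_norm A"])
    finally show ?thesis .
  qed
  show "frob_norm (A * B) \<le> a * b" if "frob_norm A \<le> a" "op_norm B \<le> b"
  proof -
    have "frob_norm (A * B) \<le> frob_norm A * op_norm B" by (rule frob_norm_mult_right[OF assms])
    also have "\<dots> \<le> a * b" using that op_norm_ge_0[of B] by (intro mult_mono) (auto intro: order_trans[of 0 "frob_norm A"])
    finally show ?thesis .
  qed
qed

context oe_info begin

definition y0 :: "real vec" where "y0 = lift_param (Ak, B, Ck) (blk X U V)"

lemma y0: "y0 \<in> Y" "yA y0 = Ak" "yB y0 = B" "yC y0 = Ck" "yU y0 = U" "yV y0 = V"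
  using flft_Sigma(1)[OF K] decode_lift[OF Ak B Ck pos_defD(3)[OF pos_S], unfolded block12_blk[OF X U V]]
  unfolding S y0_def by auto

text \<open>In every product exactly one factor, a block of \<open>w\<close> or one of
  \<open>dV\<close> and \<open>dB\<close>, is measured in the Frobenius norm; the others contribute
  operator norms, so the constant is free of dimensions.\<close>

lemma right_inverse_bound:
  assumes w: "w \<in> carrier_vec dz"
  shows "\<exists>h\<in>carrier_vec (df + ds). jacobian_mat (df + ds) dz Phi y0 *\<^sub>v h = w \<and>
    vnorm h \<le> q1 (al, ga, om, sg, kp, zt, l) * vnorm w"
proof -
  define r where "r = vnorm w"
  define \<mu> where "\<mu> = bM sg kp zt"
  define b where "b = bB al ga om sg kp zt"
  define u where "u = bU sg kp zt"
  define j where "j = bJ al ga om sg kp zt"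
  define dV where "dV = - (M * zT w * M\<^sup>T)"
  define dB where "dB = M * zQ w + dV * N * B"
  define dC where "dC = zH w * (minv U)\<^sup>T"
  define dA where "dA = (minv U * (zE w - X * C\<^sup>T * dB\<^sup>T))\<^sup>T"
  have r0: "0 \<le> r" by (simp add: r_def)
  have pos: "0 \<le> \<mu>" "0 \<le> b" "0 \<le> u" using bounds_ge_0 by (simp_all add: \<mu>_def b_def u_def)
  have opM: "op_norm M \<le> \<mu>" "op_norm M\<^sup>T \<le> \<mu>" using op_M by (simp_all add: \<mu>_def op_norm_transpose)
  have opB: "op_norm B \<le> b" using op_B by (simp add: b_def)
  have opU: "op_norm (minv U) \<le> u" "op_norm (minv U)\<^sup>T \<le> u" using op_Ui by (simp_all add: u_def op_norm_transpose)
  note z = z_carriers[of w]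
  note dims = carrier_matD[OF z(1)] carrier_matD[OF z(2)] carrier_matD[OF z(3)] carrier_matD[OF z(4)]
  have sT: "sym_mat n (zT w)" by (simp add: zT_def sym_smat)
  \<comment> \<open>The coordinates are isometric, so every block of \<open>w\<close> is bounded by
    the whole vector.\<close>
  have fz: "frob_norm (zT w) \<le> r" "frob_norm (zQ w) \<le> r" "frob_norm (zH w) \<le> r" "frob_norm (zE w) \<le> r"
  proof -
    let ?t = "svec (zT w)" and ?q = "vec_of_mat (zQ w)" and ?h = "vec_of_mat (zH w)" and ?e = "vec_of_mat (zE w)"
    have e: "r = vnorm (?t @\<^sub>v (?q @\<^sub>v (?h @\<^sub>v ?e)))" unfolding r_def z_encode[OF w] ..
    have "vnorm ?t \<le> r" unfolding e by (rule vnorm_le_append(1))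
    moreover have "vnorm ?q \<le> r" unfolding e by (rule order_trans[OF vnorm_le_append(1) vnorm_le_append(2)])
    moreover have "vnorm ?h \<le> r" unfolding e
      by (rule order_trans[OF vnorm_le_append(1) order_trans[OF vnorm_le_append(2) vnorm_le_append(2)]])
    moreover have "vnorm ?e \<le> r" unfolding e
      by (rule order_trans[OF vnorm_le_append(2) order_trans[OF vnorm_le_append(2) vnorm_le_append(2)]])
    ultimately show "frob_norm (zT w) \<le> r" "frob_norm (zQ w) \<le> r" "frob_norm (zH w) \<le> r" "frob_norm (zE w) \<le> r"
      by (simp_all add: vnorm_vec_of_mat vnorm_svec[OF sT])
  qed
  have fV: "frob_norm dV \<le> \<mu> * r * \<mu>"
    unfolding dV_def frob_norm_uminus by (intro frob_norm_mult_le opM fz) (simp_all add: dims)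
  have Vd: "dim_row dV = n" "dim_col dV = n" by (simp_all add: dV_def)
  have fB: "frob_norm dB \<le> j * r"
  proof -
    have "frob_norm dB \<le> frob_norm (M * zQ w) + frob_norm (dV * N * B)"
      unfolding dB_def by (rule frob_norm_add) (simp_all add: dims Vd)
    also have "\<dots> \<le> \<mu> * r + \<mu> * r * \<mu> * kp * b"
      by (intro add_mono frob_norm_mult_le(1)[OF _ opM(1) fz(2)] frob_norm_mult_le(2)[OF _ frob_norm_mult_le(2)[OF _ fV op_N] opB])
        (simp_all add: dims Vd)
    finally show ?thesis by (simp add: j_def bJ_def \<mu>_def[symmetric] b_def[symmetric] algebra_simps)
  qed
  have Bd: "dim_row dB = n" "dim_col dB = m" by (simp_all add: dB_def Vd)
  have fC: "frob_norm dC \<le> r * u"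
    unfolding dC_def by (rule frob_norm_mult_le(2)[OF _ fz(3) opU(2)]) (simp add: dims)
  have fA: "frob_norm dA \<le> u * (r + sg * ga * (j * r))"
  proof -
    have "frob_norm (zE w - X * C\<^sup>T * dB\<^sup>T) \<le> frob_norm (zE w) + frob_norm (X * C\<^sup>T * dB\<^sup>T)"
      by (rule frob_norm_minus) (simp_all add: dims Bd)
    also have "\<dots> \<le> r + sg * ga * (j * r)"
      by (intro add_mono fz frob_norm_mult_le(1) op_norm_mult_le op_blocks)
        (simp_all add: op_norm_transpose frob_norm_transpose fB Bd)
    finally show ?thesis unfolding dA_def frob_norm_transpose
      by (intro frob_norm_mult_le(1)[OF _ opU(1)]) (simp_all add: dims Bd)
  qed
  have det': "Determinant.det (yU y0) \<noteq> 0" using detU by (simp add: y0)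
  obtain h where h: "h \<in> carrier_vec (df + ds)" "jacobian_mat (df + ds) dz Phi y0 *\<^sub>v h = w"
    "vnorm h \<le> frob_norm dA + frob_norm dB + frob_norm dC + frob_norm dV"
    using Phi_right_inverse[OF y0(1) det' w] unfolding y0(2-6) dV_def[symmetric] dB_def[symmetric] dC_def[symmetric] dA_def[symmetric]
    by blast
  have "vnorm h \<le> u * (r + sg * ga * (j * r)) + j * r + r * u + \<mu> * r * \<mu>"
    using h(3) fA fB fC fV by linarith
  also have "\<dots> \<le> (1 + u * (1 + sg * ga * j) + j + u + \<mu> * \<mu>) * r"
    using r0 by (simp add: algebra_simps)
  also have "\<dots> = q1 (al, ga, om, sg, kp, zt, l) * vnorm w"
    by (simp add: q1_def u_def j_def \<mu>_def r_def)
  finally show ?thesis using h by blast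
qed

lemma q1_pos: "q1 (al, ga, om, sg, kp, zt, l) > 0"
proof -
  have "0 \<le> bJ al ga om sg kp zt" using bounds_ge_0 by (simp add: bJ_def)
  then show ?thesis using bounds_ge_0 by (simp add: q1_def add_pos_nonneg)
qed

text \<open>\<open>sing_val\<close> is 0 by convention for inadmissible indices, so
  \<open>dz\<close> has to lie between 1 and both dimensions of the Jacobian.\<close>

lemma dim_le: "1 \<le> dz" "dz \<le> df + ds"
proof -
  have "n * n \<ge> 1" using n_pos by simp
  then show "1 \<le> dz" by linarith
  have "dim_sym n \<le> ds" unfolding dim_sym_def by (intro div_le_mono mult_le_mono) simp_all
  then show "dz \<le> df + ds" by (simp add: df_eq)
qed

lemma sing_val_bound:
  "sing_val dz (jacobian_mat (df + ds) dz Phi y0) \<ge> 1 / q1 (al, ga, om, sg, kp, zt, l)"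
proof (rule sing_val_ge[OF _ dim_le q1_pos])
  obtain J where J: "has_jacobian (df + ds) dz Phi y0 J" using C1_Phi y0(1) unfolding C1_on_def by blast
  show "jacobian_mat (df + ds) dz Phi y0 \<in> carrier_mat dz (df + ds)"
    using J unfolding jacobian_mat_line[OF J Y_D(1)[OF y0(1)] carrier_vecD[OF Phi_decode(1)[OF y0(1)]]]
    by (simp add: has_jacobian_def)
qed (rule right_inverse_bound)

text \<open>The residual component vanishes at the true covariance. \<open>\<Theta>\<close> and
  \<open>\<Psi>\<close> pass from operator to Frobenius norm at the cost of \<open>sqrt n\<close>,
  whereas \<open>H\<close> inherits the Frobenius bound on \<open>Ck\<close>.\<close>

lemma Phi_bound:
  "vnorm (Phi y0) \<le> (max (real n) (sqrt (real (m * n))) + sqrt Lo) * q2 (al, ga, om, sg, kp, zt)"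
proof -
  let ?t = "Th U V" and ?q = "Ps U V B" and ?H = "Ck * U\<^sup>T" and ?s = "sqrt (real n)"
  have sT: "sym_mat n ?t" by (rule sym_Th[OF U sym_V D(2)])
  have "vnorm (Phi y0) \<le> vnorm (svec ?t) + (vnorm (vec_of_mat ?q) + (vnorm (vec_of_mat ?H) + vnorm (vec_of_mat (res12 U Ak B))))"
    unfolding Phi_def y0(2-6)
    by (rule order_trans[OF vnorm_append_le] add_left_mono vnorm_append_le)+
  then have "vnorm (Phi y0) \<le> frob_norm ?t + frob_norm ?q + frob_norm ?H"
    unfolding r12 vec_of_mat_zero by (simp add: vnorm_vec_of_mat vnorm_svec[OF sT])
  moreover have "frob_norm ?t \<le> ?s * bT sg kp"
    using frob_norm_le_op[of ?t] mult_left_mono[OF op_Th, of ?s] by simp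
  \<comment> \<open>Through the transpose, which has \<open>n\<close> columns, the factor is
    \<open>sqrt n\<close> instead of \<open>sqrt m\<close>.\<close>
  moreover have "frob_norm ?q \<le> ?s * bQ al ga om sg kp"
    using frob_norm_le_op[of "?q\<^sup>T"] mult_left_mono[OF op_Q, of ?s] by (simp add: frob_norm_transpose)
  moreover have "frob_norm ?H \<le> sqrt Lo * ((1 + kp) * sg)"
  proof -
    have "frob_norm ?H \<le> sqrt (Lo * kp) * sg"
      by (rule frob_norm_mult_le(2)[OF _ frob_Ck]) (simp_all add: op_norm_transpose op_blocks)
    also have "\<dots> \<le> sqrt Lo * ((1 + kp) * sg)"
    proof -
      have "sqrt kp \<le> 1 + kp" by (rule real_le_lsqrt) (simp_all add: power2_eq_square algebra_simps)
      then show ?thesis by (simp add: real_sqrt_mult mult.assoc mult_left_mono mult_right_mono Lo_ge_0)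
    qed
    finally show ?thesis .
  qed
  ultimately have le: "vnorm (Phi y0) \<le> ?s * (bT sg kp + bQ al ga om sg kp) + sqrt Lo * ((1 + kp) * sg)"
    by (simp add: distrib_left)
  define x where "x = max (real n) (sqrt (real (m * n)))"
  define c where "c = bT sg kp + bQ al ga om sg kp"
  define d where "d = (1 + kp) * sg"
  have cd: "0 \<le> c" "0 \<le> d" using bounds_ge_0 by (simp_all add: c_def d_def)
  have "real n \<le> real n * real n" using n_pos by simp
  \<comment> \<open>\<open>n >= 1\<close> makes \<open>sqrt n\<close> at most \<open>n\<close>, the
    first entry of the maximum.\<close>
  then have "?s \<le> real n" by (intro real_le_lsqrt) (simp_all add: power2_eq_square)
  then have x: "?s \<le> x" "0 \<le> x" by (simp_all add: x_def le_max_iff_disj)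
  have "?s * c + sqrt Lo * d \<le> x * c + sqrt Lo * d" using x cd by (simp add: mult_right_mono)
  also have "\<dots> \<le> (x + sqrt Lo) * (c + d)" using x cd Lo_ge_0 by (simp add: algebra_simps)
  finally show ?thesis using le by (simp add: x_def c_def d_def q2_def)
qed

lemma filter_bound: "max (op_norm Ak) (op_norm B) \<le> q3 (al, ga, om, zt, sg, kp)"
proof -
  have "0 \<le> bA al ga om sg kp zt" by (rule order_trans[OF op_norm_ge_0 op_Ak])
  then show ?thesis using op_Ak op_B bounds_ge_0(5) by (simp add: q3_def)
qed

text \<open>\<open>flft_ge\<close> bounds the lifted function below by the objective, and
  \<open>flft_Sigma\<close> says that the true covariance attains it.\<close>

lemma flft_min:
  assumes "pos_semidef (2 * n) R"
  shows "flft y0 \<le> flft (lift_param (Ak, B, Ck) R)"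
proof -
  note f = filt_of_vec_of_filt[OF Ak B Ck]
  have "svec R \<in> carrier_vec ds" using assms by (simp add: pos_semidef_def sym_mat_def)
  from flft_ge[OF f(1) this] show ?thesis
    using flft_Sigma(2)[OF K] unfolding S f(2) y0_def lift_param_def by simp
qed

end

lemma (in oe) KinfoE_info:
  assumes "(Ak, B, Ck) \<in> Kinfo"
  obtains U V where "oe_info n m p A C G W1 W2 P reg Ak B Ck U V"
proof -
  obtain U V where *: "Ak \<in> carrier_mat n n" "B \<in> carrier_mat n m" "Ck \<in> carrier_mat p n" "hurwitz Ak"
    "SigK (Ak, B, Ck) = blk X U V" "U \<in> carrier_mat n n" "sym_mat n V" "Determinant.det U \<noteq> 0"
    "res12 U Ak B = 0\<^sub>m n n" "\<And>u. u \<in> carrier_vec n \<Longrightarrow> res22 U V Ak B u = 0" "pos_def (2 * n) (blk X U V)" "pos_def n (schur U V)"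
    by (rule KinfoE[OF assms]) blast
  have "oe_info n m p A C G W1 W2 P reg Ak B Ck U V"
    by unfold_locales (use assms * in simp_all)
  then show ?thesis by (rule that)
qed

theorem proposition6p1:
  shows "\<exists>(q\<^sub>1 :: real \<times> real \<times> real \<times> real \<times> real \<times> real \<times> real \<Rightarrow> real)
          (q\<^sub>2 :: real \<times> real \<times> real \<times> real \<times> real \<times> real \<Rightarrow> real)
          (q\<^sub>3 :: real \<times> real \<times> real \<times> real \<times> real \<times> real \<Rightarrow> real).
    real_polynomial_function q\<^sub>1 \<and> real_polynomial_function q\<^sub>2 \<and> real_polynomial_function q\<^sub>3 \<and>
    (\<forall>n m p A C G W\<^sub>1 W\<^sub>2 P. standing_assumptions n m p A C G W\<^sub>1 W\<^sub>2 P \<longrightarrow>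
      (\<forall>reg\<ge>0. \<exists>dz fcvx flft \<Phi>.
        is_DCL (dim_filt n m p) (dim_sym (2 * n)) dz
          (\<lambda>x. L_reg n m p A C G W\<^sub>1 W\<^sub>2 reg (filt_of_vec n m p x)) fcvx flft \<Phi> \<and>
        (\<forall>K\<in>K_info n m p A C W\<^sub>1 W\<^sub>2.
          let \<Sigma> = Sigma_K A C W\<^sub>1 W\<^sub>2 K; Z = Z_K A C W\<^sub>1 W\<^sub>2 K; \<L> = L_OE A C G W\<^sub>1 W\<^sub>2 K in
          pos_def (2 * n) \<Sigma> \<and>
          L_reg n m p A C G W\<^sub>1 W\<^sub>2 reg K = flft (lift_param K \<Sigma>) \<and>
          (\<forall>S. pos_semidef (2 * n) S \<longrightarrow> flft (lift_param K \<Sigma>) \<le> flft (lift_param K S)) \<and>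
          q\<^sub>1 (op_norm A, op_norm C, op_norm (minv W\<^sub>2), op_norm \<Sigma>, op_norm (minv \<Sigma>),
              op_norm (minv Z), \<L>) > 0 \<and>
          sing_val dz (jacobian_mat (dim_filt n m p + dim_sym (2 * n)) dz \<Phi> (lift_param K \<Sigma>))
            \<ge> 1 / q\<^sub>1 (op_norm A, op_norm C, op_norm (minv W\<^sub>2), op_norm \<Sigma>, op_norm (minv \<Sigma>),
                       op_norm (minv Z), \<L>) \<and>
          vnorm (\<Phi> (lift_param K \<Sigma>))
            \<le> (max (real n) (sqrt (real (m * n))) + sqrt \<L>) *
               q\<^sub>2 (op_norm A, op_norm C, op_norm (minv W\<^sub>2), op_norm \<Sigma>, op_norm (minv \<Sigma>),
                   op_norm (minv Z)))) \<and>
      (\<forall>A\<^sub>K B\<^sub>K C\<^sub>K. (A\<^sub>K, B\<^sub>K, C\<^sub>K) \<in> K_info n m p A C W\<^sub>1 W\<^sub>2 \<longrightarrow>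
        (let K = (A\<^sub>K, B\<^sub>K, C\<^sub>K); \<Sigma> = Sigma_K A C W\<^sub>1 W\<^sub>2 K; Z = Z_K A C W\<^sub>1 W\<^sub>2 K in
          max (op_norm A\<^sub>K) (op_norm B\<^sub>K)
            \<le> q\<^sub>3 (op_norm A, op_norm C, op_norm (minv W\<^sub>2), op_norm (minv Z), op_norm \<Sigma>,
                   op_norm (minv \<Sigma>)) \<and>
          frob_norm C\<^sub>K \<le> sqrt (L_OE A C G W\<^sub>1 W\<^sub>2 K * op_norm (minv \<Sigma>)))))"
proof (rule exI[of _ q1], rule exI[of _ q2], rule exI[of _ q3], intro conjI polynomial_q allI impI)
  fix n m p A C G W1 W2 P
  assume std: "standing_assumptions n m p A C G W1 W2 P"
  {
    fix reg :: real assume "0 \<le> reg"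
    interpret oe n m p A C G W1 W2 P reg by (rule oe.intro[OF std \<open>0 \<le> reg\<close>])
    show "\<exists>dz fcvx flft \<Phi>.
        is_DCL (dim_filt n m p) (dim_sym (2 * n)) dz
          (\<lambda>x. L_reg n m p A C G W1 W2 reg (filt_of_vec n m p x)) fcvx flft \<Phi> \<and>
        (\<forall>K\<in>K_info n m p A C W1 W2.
          let \<Sigma> = Sigma_K A C W1 W2 K; Z = Z_K A C W1 W2 K; \<L> = L_OE A C G W1 W2 K in
          pos_def (2 * n) \<Sigma> \<and>
          L_reg n m p A C G W1 W2 reg K = flft (lift_param K \<Sigma>) \<and>
          (\<forall>S. pos_semidef (2 * n) S \<longrightarrow> flft (lift_param K \<Sigma>) \<le> flft (lift_param K S)) \<and>
          q1 (op_norm A, op_norm C, op_norm (minv W2), op_norm \<Sigma>, op_norm (minv \<Sigma>),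
              op_norm (minv Z), \<L>) > 0 \<and>
          sing_val dz (jacobian_mat (dim_filt n m p + dim_sym (2 * n)) dz \<Phi> (lift_param K \<Sigma>))
            \<ge> 1 / q1 (op_norm A, op_norm C, op_norm (minv W2), op_norm \<Sigma>, op_norm (minv \<Sigma>),
                       op_norm (minv Z), \<L>) \<and>
          vnorm (\<Phi> (lift_param K \<Sigma>))
            \<le> (max (real n) (sqrt (real (m * n))) + sqrt \<L>) *
               q2 (op_norm A, op_norm C, op_norm (minv W2), op_norm \<Sigma>, op_norm (minv \<Sigma>),
                   op_norm (minv Z)))"
    proof (intro exI conjI ballI, rule DCL)
      fix K assume "K \<in> Kinfo"
      moreover obtain Ak B Ck where K_eq: "K = (Ak, B, Ck)" by (metis prod_cases3)
      ultimately obtain U V where "oe_info n m p A C G W1 W2 P reg Ak B Ck U V" using KinfoE_info by blast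
      then interpret oe_info n m p A C G W1 W2 P reg Ak B Ck U V .
      show "let \<Sigma> = Sigma_K A C W1 W2 K; Z = Z_K A C W1 W2 K; \<L> = L_OE A C G W1 W2 K in
          pos_def (2 * n) \<Sigma> \<and>
          L_reg n m p A C G W1 W2 reg K = flft (lift_param K \<Sigma>) \<and>
          (\<forall>S. pos_semidef (2 * n) S \<longrightarrow> flft (lift_param K \<Sigma>) \<le> flft (lift_param K S)) \<and>
          q1 (op_norm A, op_norm C, op_norm (minv W2), op_norm \<Sigma>, op_norm (minv \<Sigma>),
              op_norm (minv Z), \<L>) > 0 \<and>
          sing_val dz (jacobian_mat (dim_filt n m p + dim_sym (2 * n)) dz Phi (lift_param K \<Sigma>))
            \<ge> 1 / q1 (op_norm A, op_norm C, op_norm (minv W2), op_norm \<Sigma>, op_norm (minv \<Sigma>),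
                       op_norm (minv Z), \<L>) \<and>
          vnorm (Phi (lift_param K \<Sigma>))
            \<le> (max (real n) (sqrt (real (m * n))) + sqrt \<L>) *
               q2 (op_norm A, op_norm C, op_norm (minv W2), op_norm \<Sigma>, op_norm (minv \<Sigma>),
                   op_norm (minv Z))"
        unfolding Let_def K_eq Z_eq S y0_def[symmetric]
        using pos_S q1_pos sing_val_bound Phi_bound flft_min flft_Sigma(2)[OF K, unfolded S, folded y0_def]
        by simp
    qed
  next
    fix Ak B Ck assume K: "(Ak, B, Ck) \<in> K_info n m p A C W1 W2"
    \<comment> \<open>The filter bounds stand outside the quantifier over the regularization weight,
      so an admissible value has to be supplied; 0 is one.\<close>
    interpret oe n m p A C G W1 W2 P 0 by (rule oe.intro[OF std order_refl])
    obtain U V where "oe_info n m p A C G W1 W2 P 0 Ak B Ck U V" using KinfoE_info[OF K] by blast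
    then interpret oe_info n m p A C G W1 W2 P 0 Ak B Ck U V .
    show "let K = (Ak, B, Ck); \<Sigma> = Sigma_K A C W1 W2 K; Z = Z_K A C W1 W2 K in
          max (op_norm Ak) (op_norm B)
            \<le> q3 (op_norm A, op_norm C, op_norm (minv W2), op_norm (minv Z), op_norm \<Sigma>,
                   op_norm (minv \<Sigma>)) \<and>
          frob_norm Ck \<le> sqrt (L_OE A C G W1 W2 K * op_norm (minv \<Sigma>))"
      unfolding Let_def Z_eq S using filter_bound frob_Ck by simp
  }
qed

end
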